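(* Let $n\ge2$. For type $D_n$ with the numeration of positive roots and the monomial order specified in the context, let $p_{i,j}^{\pm}\ge 0$ ($1\le i<j\le n$) denote the exponent of a signature corresponding to the root $\varepsilon_i\pm\varepsilon_j$, and let $\sum_i k_i\omega_i$ be its (dominant) highest weight. Then the semigroup $\Sigma_{D_n}$ of essential signatures is given by the following inequalities, i.e. a signature is essential if and only if all of them hold: 1. $p_{i,j}^{+}+\sum_{k=j+1}^{n}(p_{i,k}^{+}+p_{i,k}^{-}-p_{i+1,k}^{+}-p_{i+1,k}^{-})\le k_i$ for $i\in\{1,\dots,n-2\}$, $j\in\{i+2,\dots,n\}$; 2. $p_{i+1,j}^{-}+\sum_{k=j}^{n}(p_{i,k}^{+}+p_{i,k}^{-}-p_{i+1,k}^{+}-p_{i+1,k}^{-})\le k_i$ for $i\in\{1,\dots,n-2\}$, $j\in\{i+2,\dots,n\}$; 3. $p_{i,i+1}^{-}+\sum_{k=i+2}^{n}(p_{i,k}^{+}+p_{i,k}^{-}-p_{i+1,k}^{+}-p_{i+1,k}^{-})\le k_i$ for $i\in\{1,\dots,n-1\}$; 4. $p_{i,i+2}^{-}+p_{i,i+2}^{+}+p_{i+1,i+2}^{-}+\sum_{k=i+3}^{n}(p_{i,k}^{+}+p_{i,k}^{-}-p_{i+2,k}^{+}-p_{i+2,k}^{-})\le k_i+k_{i+1}$ for $i\in\{1,\dots,n-2\}$; 5. $p_{i,i+1}^{+}+\sum_{k=i+2}^{n}(p_{i,k}^{+}+p_{i,k}^{-}+p_{i+1,k}^{+}+p_{i+1,k}^{-})\le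 k_i+k_{n-1}+k_n+2\sum_{j=i+1}^{n-2}k_j$ for $i\in\{1,\dots,n-2\}$; 6. $p_{n-1,n}^{+}\le k_n$. (Empty sums are zero.)
   Context: General notions. Let $\mathfrak g$ be a complex semisimple Lie algebra with triangular decomposition $\mathfrak g=\mathfrak u^-\oplus\mathfrak t\oplus\mathfrak u$, positive roots $\Delta_+$, root vectors $e_{\pm\alpha}$ ($\alpha\in\Delta_+$), and fundamental weights $\omega_1,\dots,\omega_n$. $V(\lambda)$ is the irreducible module with highest weight $\lambda$ and $v_\lambda$ a highest weight vector. Fix a numeration $\Delta_+=\{\alpha_1,\dots,\alpha_N\}$ and a monomial order on $\mathbb Z_{\ge0}^N$ (a total order compatible with addition, with $0$ least). A signature is a tuple $\sigma=(\lambda;p_1,\dots,p_N)$ with $\lambda$ a dominant integral weight (the highest weight of $\sigma$) and $p_i\in\mathbb Z_{\ge 0}$ (the exponents of $\sigma$; $p_i$ is the exponent corresponding to $\alpha_i$). Put $v(\sigma)=\frac{e_{-\alpha_1}^{p_1}}{p_1!}\cdots\frac{e_{-\alpha_N}^{p_N}}{p_N!}v_\lambda\in V(\lambda)$. Signatures of the same highest weight are ordered by their exponent tuples via the monomial order. A signature $\sigma$ of highest weight $\lambda$ is essential if $v(\sigma)$ is not in the linear span of the $v(\tau)$ with $\tau<\sigma$ of highest weight $\lambda$. The essential signatures form a semigroup $\Sigma_{\mathfrak g}$ under componentwise addition. Type $D_n$ ($\mathfrak{so}_{2n}$; $D_2=A_1+A_1$). $\pm\varepsilon_1,\dots,\pm\varepsilon_n$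 are the weights of the standard representation. Positive roots: $\varepsilon_i\pm\varepsilon_j$, $i<j$. Fundamental weights: $\omega_i=\varepsilon_1+\dots+\varepsilon_i$ ($i\le n-2$), $\omega_{n-1}=\frac12(\varepsilon_1+\dots+\varepsilon_{n-1}-\varepsilon_n)$, $\omega_n=\frac12(\varepsilon_1+\dots+\varepsilon_n)$. Numeration of positive roots: for $m=2,\dots,n$ successively, the roots $\varepsilon_1-\varepsilon_m,\dots,\varepsilon_{m-1}-\varepsilon_m$ followed by $\varepsilon_1+\varepsilon_m,\dots,\varepsilon_{m-1}+\varepsilon_m$. Monomial order (degree lexicographic order compares the sums of entries first and then compares lexicographically). For two signatures of the same highest weight: for $m=n,n-1,\dots,2$ successively, compare first the tuples of exponents corresponding to $\varepsilon_1+\varepsilon_m,\dots,\varepsilon_{m-1}+\varepsilon_m$ by the degree lexicographic order, then those corresponding to $\varepsilon_1-\varepsilon_m,\dots,\varepsilon_{m-1}-\varepsilon_m$ by the degree lexicographic order, moving to the next step only if all earlier tuples coincide. *)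

theory Defs
  imports "Jordan_Normal_Form.Matrix"
begin

(* The algebra so_2n in its split form: skew-symmetric matrices with respect to the symmetric
   form whose Gram matrix pairs the basis vectors i and n + i (0-based).  Its Cartan subalgebra
   then consists of the diagonal matrices diag(h_1, ..., h_n, -h_1, ..., -h_n). *)

definition so_form :: "nat \<Rightarrow> complex mat" where
  "so_form n = four_block_mat (0\<^sub>m n n) (1\<^sub>m n) (1\<^sub>m n) (0\<^sub>m n n)"

definition so_even :: "nat \<Rightarrow> complex mat set" where
  "so_even n = {X \<in> carrier_mat (2 * n) (2 * n).
     transpose_mat X * so_form n + so_form n * X = 0\<^sub>m (2 * n) (2 * n)}"

definition cartan :: "nat \<Rightarrow> complex mat set" where
  "cartan n = {H \<in> so_even n. diagonal_mat H}"

(* Weights are linear functionals on the Cartan subalgebra; only their values on it matter. *)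
type_synonym weight = "complex mat \<Rightarrow> complex"

(* 1-based: epsilon 1, ..., epsilon n *)
definition epsilon :: "nat \<Rightarrow> weight" where
  "epsilon i H = H $$ (i - 1, i - 1)"

definition fundamental_weight :: "nat \<Rightarrow> nat \<Rightarrow> weight" where
  "fundamental_weight n i H =
     (if i + 2 \<le> n then \<Sum>j = 1..i. epsilon j H
      else if i + 1 = n then ((\<Sum>j = 1..n - 1. epsilon j H) - epsilon n H) / 2
      else (\<Sum>j = 1..n. epsilon j H) / 2)"

definition dominant_weight :: "nat \<Rightarrow> (nat \<Rightarrow> nat) \<Rightarrow> weight" where
  "dominant_weight n k H = (\<Sum>i = 1..n. of_nat (k i) * fundamental_weight n i H)"

(* Minus i j stands for epsilon i - epsilon j, Plus i j for epsilon i + epsilon j. *)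
datatype root = Minus nat nat | Plus nat nat

fun root_weight :: "root \<Rightarrow> weight" where
  "root_weight (Minus i j) H = epsilon i H - epsilon j H"
| "root_weight (Plus i j) H = epsilon i H + epsilon j H"

definition positive_roots :: "nat \<Rightarrow> root list" where
  "positive_roots n =
     concat (map (\<lambda>m. map (\<lambda>i. Minus i m) [1..<m] @ map (\<lambda>i. Plus i m) [1..<m]) [2..<n + 1])"

definition root_vector :: "nat \<Rightarrow> weight \<Rightarrow> complex mat \<Rightarrow> bool" where
  "root_vector n \<alpha> X \<longleftrightarrow>
     X \<in> so_even n \<and> X \<noteq> 0\<^sub>m (2 * n) (2 * n) \<and> (\<forall>H \<in> cartan n. H * X - X * H = \<alpha> H \<cdot>\<^sub>m X)"

definition lie_representation ::
    "complex mat set \<Rightarrow> (complex \<Rightarrow> 'v \<Rightarrow> 'v) \<Rightarrow> (complex mat \<Rightarrow> 'v \<Rightarrow> 'v::ab_group_add) \<Rightarrow> bool" where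
  "lie_representation L scale \<rho> \<longleftrightarrow>
     vector_space scale \<and>
     (\<forall>X \<in> L. Vector_Spaces.linear scale scale (\<rho> X)) \<and>
     (\<forall>X \<in> L. \<forall>Y \<in> L. \<forall>w. \<rho> (X + Y) w = \<rho> X w + \<rho> Y w) \<and>
     (\<forall>c. \<forall>X \<in> L. \<forall>w. \<rho> (c \<cdot>\<^sub>m X) w = scale c (\<rho> X w)) \<and>
     (\<forall>X \<in> L. \<forall>Y \<in> L. \<forall>w. \<rho> (X * Y - Y * X) w = \<rho> X (\<rho> Y w) - \<rho> Y (\<rho> X w))"

definition irreducible_representation ::
    "complex mat set \<Rightarrow> (complex \<Rightarrow> 'v \<Rightarrow> 'v) \<Rightarrow> (complex mat \<Rightarrow> 'v \<Rightarrow> 'v::ab_group_add) \<Rightarrow> bool" where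
  "irreducible_representation L scale \<rho> \<longleftrightarrow>
     lie_representation L scale \<rho> \<and> (\<exists>w::'v. w \<noteq> 0) \<and>
     (\<forall>W. module.subspace scale W \<and> (\<forall>X \<in> L. \<rho> X ` W \<subseteq> W) \<longrightarrow> W = {0} \<or> W = UNIV)"

definition highest_weight_vector ::
    "nat \<Rightarrow> (complex \<Rightarrow> 'v \<Rightarrow> 'v) \<Rightarrow> (complex mat \<Rightarrow> 'v \<Rightarrow> 'v::ab_group_add) \<Rightarrow> weight \<Rightarrow> 'v \<Rightarrow> bool" where
  "highest_weight_vector n scale \<rho> \<mu> v \<longleftrightarrow>
     v \<noteq> 0 \<and> (\<forall>H \<in> cartan n. \<rho> H v = scale (\<mu> H) v) \<and>
     (\<forall>\<alpha> \<in> set (positive_roots n). \<forall>X. root_vector n (root_weight \<alpha>) X \<longrightarrow> \<rho> X v = 0)"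

(* The exponents of a signature form a function on root labels; only its values on
   positive_roots n are ever used. *)
type_synonym exponents = "root \<Rightarrow> nat"

(* f \<alpha> is the root vector e_{-\<alpha>}; the factor of the last positive root acts first. *)
definition signature_vector ::
    "nat \<Rightarrow> (complex \<Rightarrow> 'v \<Rightarrow> 'v) \<Rightarrow> (complex mat \<Rightarrow> 'v \<Rightarrow> 'v) \<Rightarrow> 'v \<Rightarrow> (root \<Rightarrow> complex mat)
      \<Rightarrow> exponents \<Rightarrow> 'v" where
  "signature_vector n scale \<rho> v f p =
     foldr (\<lambda>\<alpha> w. scale (1 / fact (p \<alpha>)) ((\<rho> (f \<alpha>) ^^ p \<alpha>) w)) (positive_roots n) v"

definition deglex :: "(nat list \<times> nat list) set" where
  "deglex = {(xs, ys). sum_list xs < sum_list ys \<or>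
     sum_list xs = sum_list ys \<and> (xs, ys) \<in> lex {(a, b). a < b}}"

(* The tuples of exponents in the order in which they are compared: m = n, n - 1, ..., 2. *)
definition exponent_blocks :: "nat \<Rightarrow> exponents \<Rightarrow> nat list list" where
  "exponent_blocks n p =
     concat (map (\<lambda>m. [map (\<lambda>i. p (Plus i m)) [1..<m], map (\<lambda>i. p (Minus i m)) [1..<m]])
       (rev [2..<n + 1]))"

definition exponents_less :: "nat \<Rightarrow> exponents \<Rightarrow> exponents \<Rightarrow> bool" where
  "exponents_less n q p \<longleftrightarrow> (exponent_blocks n q, exponent_blocks n p) \<in> lex deglex"

definition essential ::
    "nat \<Rightarrow> (complex \<Rightarrow> 'v \<Rightarrow> 'v) \<Rightarrow> (complex mat \<Rightarrow> 'v \<Rightarrow> 'v) \<Rightarrow> 'v::ab_group_add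
      \<Rightarrow> (root \<Rightarrow> complex mat) \<Rightarrow> exponents \<Rightarrow> bool" where
  "essential n scale \<rho> v f p \<longleftrightarrow>
     signature_vector n scale \<rho> v f p
       \<notin> module.span scale {signature_vector n scale \<rho> v f q | q. exponents_less n q p}"

end

theory Submission
  imports Defs "HOL-Library.Function_Algebras" "HOL-Library.Product_Plus" "HOL-Library.Nat_Bijection"
begin

text \<open>
Write \<open>L a b\<close> for the action of \<open>E\<^bsub>a,b\<^esub> - E\<^bsub>-b,-a\<^esub>\<close>, where the basis of the standard representation is
indexed by \<open>\<plusminus>1, \<dots>, \<plusminus>n\<close>. The monomial order compares the exponents of the roots \<open>\<epsilon>\<^sub>i \<plusminus> \<epsilon>\<^sub>n\<close> first, so
essential signatures can be detected level by level along \<open>so\<^sub>2 \<subset> so\<^sub>4 \<subset> \<dots> \<subset> so\<^bsub>2n\<^esub>\<close>. Let \<open>v\<close> be singular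
for level \<open>m + 1\<close> modulo an invariant subspace \<open>W\<close>, and for exponents \<open>b\<close> of the roots \<open>\<epsilon>\<^sub>i \<plusminus> \<epsilon>\<^bsub>m+1\<^esub>\<close> let
\<open>X b v\<close> be the corresponding monomial applied to \<open>v\<close>. The level \<open>m\<close> lowering operators applied to \<open>W\<close> and to all
\<open>X b' v\<close> with \<open>b' < b\<close> span an invariant subspace \<open>G b\<close> modulo which \<open>X b v\<close> is again singular. Hence a signature is essential
iff at every level \<open>X b v\<close> is not in \<open>G b\<close>, and this happens iff \<open>b\<close> satisfies the inequalities 1 to 4
and 6 with \<open>j = n = m + 1\<close> for the highest weight of \<open>v\<close>. For the highest weight of \<open>X b v\<close>, the inequalities of level
\<open>m\<close> become the remaining ones of level \<open>m + 1\<close>.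

If one of the inequalities fails, relations in the \<open>sl\<^sub>2\<close>-triples of the roots \<open>\<epsilon>\<^sub>i - \<epsilon>\<^bsub>i+1\<^esub>\<close> and
\<open>\<epsilon>\<^sub>m \<plusminus> \<epsilon>\<^bsub>m+1\<^esub>\<close> express \<open>X b v\<close> by smaller monomials.

If they hold, there are a unitary module with a highest weight vector \<open>u\<close> of the same weight and a vector \<open>g\<close>, killed by
the raising operators of level \<open>m\<close>, that is orthogonal to \<open>X b' u\<close> for \<open>b' < b\<close> but not to \<open>X b u\<close>. Tensor products
multiply such data, so it is enough to treat the generators of the cone of solutions, which live in exterior powers of the standard
representation and in the two spin representations. The submodule generated by \<open>(v, u)\<close> in the product of the two modules
transfers the conclusion from \<open>u\<close> to \<open>v\<close>, without using complete reducibility or characters.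
\<close>

text \<open>The representation is not assumed finite-dimensional, and no quotient module is ever
  formed. Everything is therefore stated modulo a subspace \<open>W\<close> invariant under one
  level, and highest weight vectors become vectors that are \<open>singular\<close> modulo
  \<open>W\<close>. The sl2 arguments of the upper bound need lowering operators that are locally
  nilpotent. On the highest weight vector this comes from the comparison with a unitary module of
  the same highest weight; it spreads to every vector because the vectors on which a root vector
  acts nilpotently form an invariant subspace. The comparison must not presuppose that a highest
  weight determines the module. Positivity replaces this: if \<open>(0, f)\<close> lies in the
  submodule generated by \<open>(v, u)\<close>, then \<open>f\<close> is orthogonal to itself.
  Tensor products of varying length have to live in one type for the induction over the cone of
  solutions; hence the function spaces on lists over a common type of finite sets of modes, with a
  Hermitian form on the functions supported on a finite set.\<close>

declare One_nat_def [simp del] of_nat_Suc [simp del] sum.op_ivl_Suc [simp del] of_nat_sum [simp del]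

section \<open>Modules over the even orthogonal Lie algebra\<close>

definition ix :: "nat \<Rightarrow> int \<Rightarrow> bool" where
  "ix n a \<longleftrightarrow> a \<noteq> 0 \<and> \<bar>a\<bar> \<le> int n"

lemma ix_of_nat [simp]: "ix n (int i) \<longleftrightarrow> 1 \<le> i \<and> i \<le> n"
  by (auto simp: ix_def)

lemma ix_uminus [simp]: "ix n (- a) \<longleftrightarrow> ix n a"
  by (auto simp: ix_def)

lemma ix_mono: "ix m a \<Longrightarrow> m \<le> n \<Longrightarrow> ix n a"
  by (auto simp: ix_def)

lemma ix_cases:
  assumes "ix n a"
  obtains i where "1 \<le> i" "i \<le> n" "a = int i" | i where "1 \<le> i" "i \<le> n" "a = - int i"
proof (cases "a > 0")
  case True
  then show ?thesis using assms that(1)[of "nat a"] by (auto simp: ix_def)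
next
  case False
  then show ?thesis using assms that(2)[of "nat (- a)"] by (auto simp: ix_def)
qed

text \<open>Adding one factor at a time replaces computations with ordered products of powers.
  Values outside \<open>{1..<M}\<close> never enter a monomial of level \<open>M\<close>, so the
  base case covers all \<open>e\<close> that vanish inside this range rather than the zero function
  alone.\<close>

lemma exponent_induct [case_names zero step]:
  fixes e :: "nat \<Rightarrow> nat"
  assumes "\<And>e. (\<And>i. i \<in> {1..<M} \<Longrightarrow> e i = 0) \<Longrightarrow> P e"
    and "\<And>e i. i \<in> {1..<M} \<Longrightarrow> P e \<Longrightarrow> P (e(i := Suc (e i)))"
  shows "P e"
proof (induction "sum e {1..<M}" arbitrary: e)
  case 0
  then show ?case using assms(1) by simp
next
  case (Suc x)
  then obtain i where i: "i \<in> {1..<M}" "e i \<noteq> 0"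
    by (metis sum.neutral nat.distinct(1))
  let ?e = "e(i := e i - 1)"
  have "sum e {1..<M} = Suc (sum ?e {1..<M})"
    using i sum.remove[of "{1..<M}" i e] sum.remove[of "{1..<M}" i ?e] by simp
  then have "P (?e(i := Suc (?e i)))" using assms(2)[OF i(1)] Suc by (metis Suc_inject)
  moreover have "?e(i := Suc (?e i)) = e" using i by auto
  ultimately show ?case by simp
qed

text \<open>One unit moves from \<open>a\<close> to \<open>b\<close>. The second update reads the
  already lowered value, so \<open>a = b\<close> gives back \<open>e\<close> when
  \<open>e a > 0\<close>. For \<open>e a = 0\<close> the truncated value is harmless, because the
  commutation formulas carry the coefficient \<open>e a\<close>.\<close>

definition shift_exp :: "nat \<Rightarrow> nat \<Rightarrow> (nat \<Rightarrow> nat) \<Rightarrow> nat \<Rightarrow> nat" where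
  "shift_exp a b e = (let e' = e(a := e a - 1) in e'(b := Suc (e' b)))"

text \<open>\<open>L a b\<close> is the action of \<open>E\<^bsub>a,b\<^esub> - E\<^bsub>-b,-a\<^esub>\<close>; for \<open>0 < i < j\<close> the roots \<open>\<epsilon>\<^sub>i - \<epsilon>\<^sub>j\<close> and \<open>\<epsilon>\<^sub>i + \<epsilon>\<^sub>j\<close>
  belong to \<open>L i j\<close> and \<open>L i (-j)\<close>, their negatives to \<open>L j i\<close> and \<open>L (-j) i\<close>.\<close>
locale so_module = vector_space scale
  for scale :: "complex \<Rightarrow> 'v::ab_group_add \<Rightarrow> 'v" (infixr "*s" 75) +
  fixes n :: nat and L :: "int \<Rightarrow> int \<Rightarrow> 'v \<Rightarrow> 'v"
  assumes L_linear: "\<And>a b. ix n a \<Longrightarrow> ix n b \<Longrightarrow> Vector_Spaces.linear scale scale (L a b)"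
    and L_skew: "\<And>a b u. ix n a \<Longrightarrow> ix n b \<Longrightarrow> L (- b) (- a) u = - L a b u"
    and L_bracket: "\<And>a b c d u. ix n a \<Longrightarrow> ix n b \<Longrightarrow> ix n c \<Longrightarrow> ix n d \<Longrightarrow>
      L a b (L c d u) = L c d (L a b u)
        + ((if b = c then L a d u else 0) - (if a = d then L c b u else 0)
        - (if b = - d then L a (- c) u else 0) + (if a = - c then L (- d) b u else 0))"
begin

lemma L_add: "ix n a \<Longrightarrow> ix n b \<Longrightarrow> L a b (u + w) = L a b u + L a b w"
  and L_scale: "ix n a \<Longrightarrow> ix n b \<Longrightarrow> L a b (c *s u) = c *s L a b u"
  using L_linear[of a b] by (auto simp: Vector_Spaces.linear_iff)

lemma L_zero: "ix n a \<Longrightarrow> ix n b \<Longrightarrow> L a b 0 = 0"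
  using L_scale[of a b 0 0] by simp

lemma L_neg: "ix n a \<Longrightarrow> ix n b \<Longrightarrow> L a b (- u) = - L a b u"
  using L_scale[of a b "-1" u] by (simp add: scale_minus_left)

lemma L_diff: "ix n a \<Longrightarrow> ix n b \<Longrightarrow> L a b (u - w) = L a b u - L a b w"
  using L_add[of a b u "- w"] by (simp add: L_neg)

lemma L_anti: "ix n a \<Longrightarrow> L (- a) a u = 0" "ix n a \<Longrightarrow> L a (- a) u = 0"
proof -
  have *: "x = 0" if "x = - x" for x :: 'v
  proof -
    have "2 *s x = (1 + 1) *s x" by simp
    also have "\<dots> = x + x" unfolding scale_left_distrib by simp
    also have "\<dots> = x + - x" using that by metis
    finally show ?thesis by simp
  qed
  show "ix n a \<Longrightarrow> L (- a) a u = 0" "ix n a \<Longrightarrow> L a (- a) u = 0"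
    using L_skew[of "- a" a u] L_skew[of a "- a" u] * by auto
qed

lemmas L_lin = L_add L_scale L_zero L_neg L_diff

section \<open>Invariant subspaces and spans under lowering operators\<close>

definition stable :: "nat \<Rightarrow> 'v set \<Rightarrow> bool" where
  "stable m W \<longleftrightarrow> subspace W \<and> (\<forall>a b. ix m a \<longrightarrow> ix m b \<longrightarrow> (\<forall>w\<in>W. L a b w \<in> W))"

text \<open>The span of \<open>S\<close> under words in the negative root vectors of level
  \<open>m\<close>. Words in any order are allowed, which makes closure under these operators
  immediate; that ordered monomials suffice is \<open>low_eq_span_sv\<close>.\<close>

inductive_set low :: "nat \<Rightarrow> 'v set \<Rightarrow> 'v set" for m S where
  low_base: "s \<in> S \<Longrightarrow> s \<in> low m S"
| low_zero: "0 \<in> low m S"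
| low_add: "u \<in> low m S \<Longrightarrow> w \<in> low m S \<Longrightarrow> u + w \<in> low m S"
| low_scale: "u \<in> low m S \<Longrightarrow> c *s u \<in> low m S"
| low_minus: "u \<in> low m S \<Longrightarrow> 1 \<le> i \<Longrightarrow> i < j \<Longrightarrow> j \<le> m \<Longrightarrow> L (int j) (int i) u \<in> low m S"
| low_plus: "u \<in> low m S \<Longrightarrow> 1 \<le> i \<Longrightarrow> i < j \<Longrightarrow> j \<le> m \<Longrightarrow> L (- int j) (int i) u \<in> low m S"

lemma low_subspace: "subspace (low m S)"
  by (auto simp: subspace_def low_zero low_add low_scale)

lemma low_neg: "u \<in> low m S \<Longrightarrow> - u \<in> low m S"
  using subspace_neg[OF low_subspace] .

lemma low_diff: "u \<in> low m S \<Longrightarrow> w \<in> low m S \<Longrightarrow> u - w \<in> low m S"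
  using subspace_diff[OF low_subspace] .

lemma low_least:
  assumes "S \<subseteq> T" "subspace T"
    and "\<And>u i j. u \<in> T \<Longrightarrow> 1 \<le> i \<Longrightarrow> i < j \<Longrightarrow> j \<le> m \<Longrightarrow> L (int j) (int i) u \<in> T \<and> L (- int j) (int i) u \<in> T"
  shows "low m S \<subseteq> T"
proof
  fix u assume "u \<in> low m S"
  then show "u \<in> T"
    by (induction) (use assms in \<open>auto simp: subspace_def\<close>)
qed

lemma low_mono: "S \<subseteq> low m T \<Longrightarrow> low m S \<subseteq> low m T"
  by (rule low_least) (auto intro: low_subspace low_minus low_plus)

lemma low_skew:
  assumes "u \<in> low m S" "m \<le> n" "1 \<le> i" "1 \<le> j" "i \<le> m" "j \<le> m"
  shows "L (- int i) (int j) u \<in> low m S"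
proof -
  consider "i < j" | "i = j" | "j < i" by linarith
  then show ?thesis
  proof cases
    case 1
    then have "L (- int i) (int j) u = - L (- int j) (int i) u"
      using L_skew[of "- int j" "int i" u] assms by simp
    then show ?thesis using low_neg[OF low_plus[OF assms(1), of i j]] 1 assms by simp
  next
    case 2
    then show ?thesis using assms by (simp add: L_anti low_zero)
  next
    case 3
    then show ?thesis using assms by (simp add: low_plus)
  qed
qed

text \<open>By \<open>L_skew\<close> every operator is, up to sign, one with index pair
  \<open>(i, j)\<close>, \<open>(i, -j)\<close> or \<open>(-j, i)\<close> for positive
  \<open>i\<close> and \<open>j\<close>; the pairs \<open>(a, -a)\<close> give zero.\<close>

lemma all_ops_in:
  assumes "m \<le> n" "subspace T"
    and "\<And>i j. 1 \<le> i \<Longrightarrow> i < j \<Longrightarrow> j \<le> m \<Longrightarrow>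
      L (int i) (int j) u \<in> T \<and> L (int i) (- int j) u \<in> T \<and> L (int j) (int i) u \<in> T \<and> L (- int j) (int i) u \<in> T"
    and "\<And>i. 1 \<le> i \<Longrightarrow> i \<le> m \<Longrightarrow> L (int i) (int i) u \<in> T"
    and "ix m a" "ix m b"
  shows "L a b u \<in> T"
proof -
  have ixn: "ix n a" "ix n b" using assms(1,5,6) ix_mono by blast+
  have pp: "L (int i) (int j) u \<in> T" if "1 \<le> i" "i \<le> m" "1 \<le> j" "j \<le> m" for i j
    using assms(3)[of i j] assms(3)[of j i] assms(4)[of i] that by (cases i j rule: linorder_cases) auto
  have neg: "x \<in> T \<Longrightarrow> - x \<in> T" for x using assms(2) subspace_neg by blast
  have z: "0 \<in> T" using assms(2) subspace_0 by blast
  show ?thesis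
  proof (rule ix_cases[OF assms(5)]; rule ix_cases[OF assms(6)])
    fix i j assume ij: "1 \<le> i" "i \<le> m" "a = int i" "1 \<le> j" "j \<le> m" "b = int j"
    then show ?thesis using pp by simp
  next
    fix i j assume ij: "1 \<le> i" "i \<le> m" "a = - int i" "1 \<le> j" "j \<le> m" "b = - int j"
    then show ?thesis using pp[of j i] neg L_skew[of "int j" "int i" u] assms(1) by simp
  next
    fix i j assume ij: "1 \<le> i" "i \<le> m" "a = int i" "1 \<le> j" "j \<le> m" "b = - int j"
    then show ?thesis
      using assms(3)[of i j] neg assms(3)[of j i] L_skew[of "int j" "- int i" u] assms(1) z L_anti(2)[of "int i" u]
      by (cases i j rule: linorder_cases) auto
  next
    fix i j assume ij: "1 \<le> i" "i \<le> m" "a = - int i" "1 \<le> j" "j \<le> m" "b = int j"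
    then show ?thesis
      using assms(3)[of i j] neg assms(3)[of j i] L_skew[of "- int j" "int i" u] assms(1) z L_anti(1)[of "int i" u]
      by (cases i j rule: linorder_cases) auto
  qed
qed

lemma bracket_rest_in:
  assumes "subspace T" "\<And>x y. ix m x \<Longrightarrow> ix m y \<Longrightarrow> L x y u \<in> T"
    and "ix m a" "ix m b" "ix m c" "ix m d"
  shows "(if b = c then L a d u else 0) - (if a = d then L c b u else 0)
        - (if b = - d then L a (- c) u else 0) + (if a = - c then L (- d) b u else 0) \<in> T"
  using assms by (intro subspace_add subspace_diff) (simp_all add: subspace_0)

text \<open>Moving an operator of level \<open>m\<close> past a lowering operator of level
  \<open>m\<close> produces operators of level \<open>m\<close> on the shorter word. Induction on
  the word thus reduces invariance to the raising and Cartan operators on \<open>S\<close>.\<close>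

lemma low_inv:
  assumes "m \<le> n"
    and base: "\<And>s i j. s \<in> S \<Longrightarrow> 1 \<le> i \<Longrightarrow> i < j \<Longrightarrow> j \<le> m \<Longrightarrow> L (int i) (int j) s \<in> low m S \<and> L (int i) (- int j) s \<in> low m S"
    and base0: "\<And>s i. s \<in> S \<Longrightarrow> 1 \<le> i \<Longrightarrow> i \<le> m \<Longrightarrow> L (int i) (int i) s \<in> low m S"
  shows "stable m (low m S)"
proof -
  have "L a b u \<in> low m S" if "u \<in> low m S" "ix m a" "ix m b" for u a b
    using that
  proof (induction arbitrary: a b)
    case (low_base s)
    show ?case
      by (rule all_ops_in[OF assms(1) low_subspace _ _ low_base(2,3)])
         (use base base0 low_base low.intros in auto)
  next
    case low_zero
    then show ?case using ix_mono[OF _ assms(1)] by (simp add: L_lin low.low_zero)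
  next
    case (low_add u w)
    then show ?case using ix_mono[OF _ assms(1)] by (simp add: L_lin low.low_add)
  next
    case (low_scale u c)
    then show ?case using ix_mono[OF _ assms(1)] by (simp add: L_lin low.low_scale)
  next
    case (low_minus u i j)
    have "ix m (int i)" "ix m (int j)" using low_minus by auto
    have i: "ix n a" "ix n b" "ix n (int j)" "ix n (int i)" "ix m (int j)" "ix m (int i)"
      using low_minus ix_mono[OF _ assms(1)] assms(1) by auto
    show ?case
      unfolding L_bracket[OF i(1-4)]
      by (intro low_add low.low_minus bracket_rest_in[OF low_subspace, of m]) (use low_minus i in auto)
  next
    case (low_plus u i j)
    have "ix m (int i)" "ix m (int j)" using low_plus by auto
    have i: "ix n a" "ix n b" "ix n (- int j)" "ix n (int i)" "ix m (- int j)" "ix m (int i)"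
      using low_plus ix_mono[OF _ assms(1)] assms(1) by auto
    show ?case
      unfolding L_bracket[OF i(1-4)]
      by (intro low_add low.low_plus bracket_rest_in[OF low_subspace, of m]) (use low_plus i in auto)
  qed
  then show ?thesis by (auto simp: stable_def low_subspace)
qed

end

section \<open>Lowering monomials\<close>

lemma funpow_commute:
  assumes "\<And>u. g (h u) = h (g u)"
  shows "g ((h ^^ k) u) = (h ^^ k) (g u)"
  by (induction k) (simp_all add: assms)

lemma foldr_pow_commute:
  assumes "\<And>j u. j \<in> set xs \<Longrightarrow> g (y j u) = y j (g u)"
  shows "g (foldr (\<lambda>j. y j ^^ e j) xs u) = foldr (\<lambda>j. y j ^^ e j) xs (g u)"
  using assms by (induction xs) (simp_all add: funpow_commute)

lemma foldr_pow_Suc: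
  assumes "distinct xs" "i \<in> set xs" "\<And>j u. j \<in> set xs \<Longrightarrow> y i (y j u) = y j (y i u)"
  shows "foldr (\<lambda>j. y j ^^ (e(i := Suc (e i))) j) xs u = y i (foldr (\<lambda>j. y j ^^ e j) xs u)"
  using assms
proof (induction xs)
  case (Cons x xs)
  show ?case
  proof (cases "x = i")
    case True
    then have "foldr (\<lambda>j. y j ^^ (e(i := Suc (e i))) j) xs u = foldr (\<lambda>j. y j ^^ e j) xs u"
      using Cons.prems(1) by (intro foldr_cong) auto
    then show ?thesis using True by simp
  next
    case False
    then show ?thesis using Cons by (simp add: funpow_commute[of "y i" "y x"])
  qed
qed simp

context so_module
begin

text \<open>The cases \<open>s = M\<close> and \<open>s = -M\<close> are the monomials in the root vectors of \<open>-(\<epsilon>\<^sub>i - \<epsilon>\<^sub>M)\<close> and \<open>-(\<epsilon>\<^sub>i + \<epsilon>\<^sub>M)\<close>.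
  The factorials of a signature vector only rescale it and are left out.\<close>
definition yw :: "nat \<Rightarrow> int \<Rightarrow> (nat \<Rightarrow> nat) \<Rightarrow> 'v \<Rightarrow> 'v" where
  "yw M s e u = foldr (\<lambda>i. L s (int i) ^^ e i) [1..<M] u"

text \<open>In \<open>positive_roots\<close> the roots \<epsilon>_i - \<epsilon>_M stand before the
  roots \<epsilon>_i + \<epsilon>_M of the same level, and the last factor acts first; so the plus
  monomial is the inner one. The two monomials do not commute.\<close>

definition X :: "nat \<Rightarrow> (nat \<Rightarrow> nat) \<Rightarrow> (nat \<Rightarrow> nat) \<Rightarrow> 'v \<Rightarrow> 'v" where
  "X M pl mi u = yw M (int M) mi (yw M (- int M) pl u)"

definition lev :: "nat \<Rightarrow> int \<Rightarrow> bool" where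
  "lev M s \<longleftrightarrow> M \<le> n \<and> (s = int M \<or> s = - int M)"

text \<open>For equal signs the two roots do not add up to a root, so the factors of
  \<open>yw\<close> may be permuted freely.\<close>

lemma y_comm:
  assumes "lev M s" "i \<in> {1..<M}" "j \<in> {1..<M}"
  shows "L s (int i) (L s (int j) u) = L s (int j) (L s (int i) u)"
  using assms by (subst L_bracket) (auto simp: lev_def L_anti)

text \<open>For opposite signs the roots add up to -(\<epsilon>_i + \<epsilon>_j). The correction is
  a lowering operator of a smaller level and costs one plus factor; such error terms are controlled
  by the plus degree.\<close>

lemma y_comm_pm:
  assumes "M \<le> n" "i \<in> {1..<M}" "j \<in> {1..<M}"
  shows "L (- int M) (int i) (L (int M) (int j) u) = L (int M) (int j) (L (- int M) (int i) u) + L (- int j) (int i) u"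
  using assms by (subst L_bracket) auto

lemma y_low:
  assumes "lev M s" "c \<in> {1..<M}" "i \<in> {1..<M}" "j \<in> {1..<M}"
  shows "L s (int c) (L (int j) (int i) u) = L (int j) (int i) (L s (int c) u) + (if c = j then L s (int i) u else 0)"
    and "L s (int c) (L (- int j) (int i) u) = L (- int j) (int i) (L s (int c) u)"
  using assms by ((subst L_bracket); auto simp: lev_def)+

lemma gl_y:
  assumes "lev M s" "c \<in> {1..<M}" "i \<in> {1..<M}" "j \<in> {1..<M}"
  shows "L (int j) (int i) (L s (int c) u) = L s (int c) (L (int j) (int i) u) - (if c = j then L s (int i) u else 0)"
  using y_low(1)[OF assms, of u] by simp

text \<open>The correction \<open>L s (-j)\<close> has weight \<epsilon>_j + \<epsilon>_M or
  \<epsilon>_j - \<epsilon>_M according to the sign of \<open>s\<close>, and likewise for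
  \<open>i\<close>: both corrections are again raising operators, now of level
  \<open>M\<close>.\<close>

lemma raise_y:
  assumes "lev M s" "c \<in> {1..<M}" "i \<in> {1..<M}" "j \<in> {1..<M}"
  shows "L (int i) (- int j) (L s (int c) u) = L s (int c) (L (int i) (- int j) u)
    - (if i = c then L s (- int j) u else 0) + (if j = c then L s (- int i) u else 0)"
proof -
  have "L (int i) (- s) u = - L s (- int i) u"
    using L_skew[of "s" "- int i" u] assms by (auto simp: lev_def)
  then show ?thesis using assms by (subst L_bracket) (auto simp: lev_def)
qed

lemma raiseM_y:
  assumes "lev M s" "c \<in> {1..<M}" "b \<in> {1..<M}"
  shows "L s (- int b) (L s (int c) u) = L s (int c) (L s (- int b) u)"
    and "L s (- int b) (L (- s) (int c) u) = L (- s) (int c) (L s (- int b) u)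
           - (if b = c then L s s u else 0) - L (int b) (int c) u"
proof -
  show "L s (- int b) (L s (int c) u) = L s (int c) (L s (- int b) u)"
    using assms by (subst L_bracket) (auto simp: lev_def L_anti)
  have "L (- int c) (- int b) u = - L (int b) (int c) u"
    using L_skew[of "int b" "int c" u] assms by (auto simp: lev_def)
  then show "L s (- int b) (L (- s) (int c) u) = L (- s) (int c) (L s (- int b) u)
           - (if b = c then L s s u else 0) - L (int b) (int c) u"
    using assms by (subst L_bracket) (auto simp: lev_def)
qed

lemma cartanM_y:
  assumes "lev M s" "c \<in> {1..<M}"
  shows "L (int M) (int M) (L s (int c) u) = L s (int c) (L (int M) (int M) u) + (if s = int M then 1 else -1) *s L s (int c) u"
proof -
  have "L (- int c) (int M) u = - L (- int M) (int c) u"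
    using L_skew[of "- int M" "int c" u] assms by (auto simp: lev_def)
  then show ?thesis using assms
    by (subst L_bracket) (auto simp: lev_def scale_minus_left)
qed

lemma lev_simps [simp]: "lev M (int M) \<longleftrightarrow> M \<le> n" "lev M (- int M) \<longleftrightarrow> M \<le> n"
  by (auto simp: lev_def)

lemma lev_ix: "lev M s \<Longrightarrow> i \<in> {1..<M} \<Longrightarrow> ix n s \<and> ix n (int i)"
  by (auto simp: lev_def)

lemma y_lin:
  assumes "lev M s" "i \<in> {1..<M}"
  shows "L s (int i) (u + w) = L s (int i) u + L s (int i) w" "L s (int i) (u - w) = L s (int i) u - L s (int i) w"
    "L s (int i) (c *s u) = c *s L s (int i) u" "L s (int i) 0 = 0"
  using lev_ix[OF assms] by (simp_all add: L_lin)

lemma yw_Suc: 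
  assumes "lev M s" "i \<in> {1..<M}"
  shows "yw M s (e(i := Suc (e i))) u = L s (int i) (yw M s e u)"
  unfolding yw_def using assms by (intro foldr_pow_Suc) (auto intro!: y_comm[of M])

lemma yw_cong: "(\<And>i. i \<in> {1..<M} \<Longrightarrow> e i = e' i) \<Longrightarrow> yw M s e u = yw M s e' u"
  unfolding yw_def by (intro foldr_cong) auto

lemma yw_0: "(\<And>i. i \<in> {1..<M} \<Longrightarrow> e i = 0) \<Longrightarrow> yw M s e u = u"
proof -
  assume "\<And>i. i \<in> {1..<M} \<Longrightarrow> e i = 0"
  then have "foldr (\<lambda>i. L s (int i) ^^ e i) [1..<M] u = foldr (\<lambda>i. id) [1..<M] u"
    by (intro foldr_cong) (auto simp: funpow_0)
  also have "foldr (\<lambda>i. id) xs u = u" for xs :: "nat list" by (induction xs) auto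
  finally show ?thesis by (simp add: yw_def)
qed

lemma yw_commute:
  assumes "\<And>i u. i \<in> {1..<M} \<Longrightarrow> g (L s (int i) u) = L s (int i) (g u)"
  shows "g (yw M s e u) = yw M s e (g u)"
  unfolding yw_def using assms by (intro foldr_pow_commute) auto

lemma yw_in:
  assumes "\<And>i w. i \<in> {1..<M} \<Longrightarrow> w \<in> T \<Longrightarrow> L s (int i) w \<in> T" "u \<in> T" "lev M s"
  shows "yw M s e u \<in> T"
proof (induction e rule: exponent_induct[where M = M])
  case (zero e)
  then show ?case using assms(2) by (simp only: yw_0)
next
  case (step e i)
  then show ?case using assms by (simp only: yw_Suc)
qed

lemma yw_add:
  assumes "lev M s"
  shows "yw M s e (u + w) = yw M s e u + yw M s e w"
proof (induction e rule: exponent_induct[where M = M])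
  case (step e i)
  then show ?case using assms by (simp only: yw_Suc y_lin)
qed (simp only: yw_0)

lemma yw_scale:
  assumes "lev M s"
  shows "yw M s e (c *s u) = c *s yw M s e u"
proof (induction e rule: exponent_induct[where M = M])
  case (step e i)
  then show ?case using assms by (simp only: yw_Suc y_lin)
qed (simp only: yw_0)

lemma yw_diff:
  assumes "lev M s"
  shows "yw M s e (u - w) = yw M s e u - yw M s e w"
  using yw_add[OF assms, of e u "(-1) *s w"] yw_scale[OF assms, of e "-1" w] by simp

lemma yw_zero: "lev M s \<Longrightarrow> yw M s e 0 = 0"
  using yw_scale[of M s e 0 0] by simp

lemma yw_yw:
  assumes "lev M s"
  shows "yw M s e (yw M s e' u) = yw M s (\<lambda>i. e i + e' i) u"
proof (induction e rule: exponent_induct[where M = M])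
  case (zero e)
  then show ?case by (simp only: yw_0) (rule yw_cong, simp add: zero)
next
  case (step e i)
  have "(\<lambda>j. (e(i := Suc (e i))) j + e' j) = (\<lambda>j. e j + e' j)(i := Suc (e i + e' i))" by auto
  moreover have "yw M s ((\<lambda>j. e j + e' j)(i := Suc (e i + e' i))) u = L s (int i) (yw M s (\<lambda>j. e j + e' j) u)"
    using step assms by (intro yw_Suc)
  ultimately show ?case using step assms by (simp only: yw_Suc)
qed

text \<open>\<open>L a b\<close> acts as a derivation that replaces one factor with index
  \<open>a\<close> by one with index \<open>b\<close>; the coefficient \<open>e a\<close> counts the
  factors that can be replaced.\<close>

lemma gl_yw:
  assumes "lev M s" "a \<in> {1..<M}" "b \<in> {1..<M}"
  shows "L (int a) (int b) (yw M s e u) = yw M s e (L (int a) (int b) u) - of_nat (e a) *s yw M s (shift_exp a b e) u"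
proof (induction e rule: exponent_induct[where M = M])
  case (zero e)
  then have "e a = 0" using assms by blast
  then show ?case using zero by (simp only: yw_0) simp
next
  case (step e c)
  have "L (int a) (int b) (yw M s (e(c := Suc (e c))) u) =
      L s (int c) (L (int a) (int b) (yw M s e u)) - (if c = a then L s (int b) (yw M s e u) else 0)"
    using step assms by (simp add: yw_Suc gl_y)
  also have "\<dots> = yw M s (e(c := Suc (e c))) (L (int a) (int b) u)
     - (of_nat (e a) *s L s (int c) (yw M s (shift_exp a b e) u) + (if c = a then yw M s (e(b := Suc (e b))) u else 0))"
    using step assms by (simp add: yw_Suc y_lin)
  also have "of_nat (e a) *s L s (int c) (yw M s (shift_exp a b e) u) + (if c = a then yw M s (e(b := Suc (e b))) u else 0)
     = of_nat ((e(c := Suc (e c))) a) *s yw M s (shift_exp a b (e(c := Suc (e c)))) u"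
  proof (cases "c = a")
    case True
    have 1: "shift_exp a b (e(c := Suc (e c))) = e(b := Suc (e b))"
      using True by (auto simp: shift_exp_def Let_def)
    have "of_nat (e a) *s L s (int c) (yw M s (shift_exp a b e) u) = of_nat (e a) *s yw M s (e(b := Suc (e b))) u"
    proof (cases "e a = 0")
      case False
      have "(shift_exp a b e)(a := Suc (shift_exp a b e a)) = e(b := Suc (e b))"
        using False by (auto simp: shift_exp_def Let_def)
      then show ?thesis using yw_Suc[of M s a "shift_exp a b e" u] assms True by simp
    qed simp
    then show ?thesis using True 1 by (simp add: scale_left_distrib add.commute of_nat_Suc)
  next
    case False
    have "shift_exp a b (e(c := Suc (e c))) = (shift_exp a b e)(c := Suc (shift_exp a b e c))"
      using False by (auto simp: shift_exp_def Let_def)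
    then show ?thesis using False step assms by (simp add: yw_Suc)
  qed
  finally show ?case .
qed

lemma lowplus_yw:
  assumes "lev M s" "a \<in> {1..<M}" "b \<in> {1..<M}"
  shows "L (- int a) (int b) (yw M s e u) = yw M s e (L (- int a) (int b) u)"
  using assms by (intro yw_commute) (simp add: y_low)

lemma gl_X:
  assumes "M \<le> n" "a \<in> {1..<M}" "b \<in> {1..<M}"
  shows "L (int a) (int b) (X M pl mi u) = X M pl mi (L (int a) (int b) u)
    - of_nat (mi a) *s X M pl (shift_exp a b mi) u - of_nat (pl a) *s X M (shift_exp a b pl) mi u"
  using assms by (simp add: X_def gl_yw yw_diff yw_scale)

lemma X_minus: "M \<le> n \<Longrightarrow> c \<in> {1..<M} \<Longrightarrow> L (int M) (int c) (X M pl mi u) = X M pl (mi(c := Suc (mi c))) u"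
  by (simp add: X_def yw_Suc)

lemma X_linear:
  assumes "M \<le> n"
  shows "X M pl mi (u + w) = X M pl mi u + X M pl mi w" "X M pl mi (u - w) = X M pl mi u - X M pl mi w"
    "X M pl mi (c *s u) = c *s X M pl mi u" "X M pl mi 0 = 0"
  using assms by (simp_all add: X_def yw_add yw_diff yw_scale yw_zero)

lemma X_in:
  assumes "\<And>i w. i \<in> {1..<M} \<Longrightarrow> w \<in> T \<Longrightarrow> L (int M) (int i) w \<in> T \<and> L (- int M) (int i) w \<in> T" "u \<in> T" "M \<le> n"
  shows "X M pl mi u \<in> T"
  using assms unfolding X_def by (intro yw_in[where T = T]) auto

text \<open>With \<open>Q\<close> the exponents below a given block in \<open>block_lt\<close>, this
  is the space \<open>G b\<close> of the overview. Coarser choices of \<open>Q\<close> that ignore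
  the minus exponents are closed under more operators of level \<open>m + 1\<close> and serve for
  intermediate estimates.\<close>

definition gen :: "nat \<Rightarrow> 'v set \<Rightarrow> 'v set \<Rightarrow> ((nat \<Rightarrow> nat) \<Rightarrow> (nat \<Rightarrow> nat) \<Rightarrow> bool) \<Rightarrow> 'v set" where
  "gen m W S Q = low m (W \<union> {X (Suc m) pl mi s | pl mi s. s \<in> S \<and> Q pl mi})"

lemma gen_low [simp]:
  "0 \<in> gen m W S Q"
  "u \<in> gen m W S Q \<Longrightarrow> w \<in> gen m W S Q \<Longrightarrow> u + w \<in> gen m W S Q"
  "u \<in> gen m W S Q \<Longrightarrow> w \<in> gen m W S Q \<Longrightarrow> u - w \<in> gen m W S Q"
  "u \<in> gen m W S Q \<Longrightarrow> - u \<in> gen m W S Q"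
  "u \<in> gen m W S Q \<Longrightarrow> c *s u \<in> gen m W S Q"
  "u \<in> gen m W S Q \<Longrightarrow> 1 \<le> i \<Longrightarrow> i < j \<Longrightarrow> j \<le> m \<Longrightarrow> L (int j) (int i) u \<in> gen m W S Q"
  "u \<in> gen m W S Q \<Longrightarrow> 1 \<le> i \<Longrightarrow> i < j \<Longrightarrow> j \<le> m \<Longrightarrow> L (- int j) (int i) u \<in> gen m W S Q"
  "u \<in> gen m W S Q \<Longrightarrow> m \<le> n \<Longrightarrow> 1 \<le> i \<Longrightarrow> 1 \<le> j \<Longrightarrow> i \<le> m \<Longrightarrow> j \<le> m \<Longrightarrow> L (- int i) (int j) u \<in> gen m W S Q"
  "w \<in> W \<Longrightarrow> w \<in> gen m W S Q"
  "s \<in> S \<Longrightarrow> Q pl mi \<Longrightarrow> X (Suc m) pl mi s \<in> gen m W S Q"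
  unfolding gen_def
  by (auto simp: low_zero low_add low_diff low_neg low_scale low_minus low_plus low_skew intro!: low_base)

lemma gen_subspace: "subspace (gen m W S Q)"
  by (simp add: gen_def low_subspace)

lemma gen_mono: "(\<And>pl mi. Q pl mi \<Longrightarrow> Q' pl mi) \<Longrightarrow> gen m W S Q \<subseteq> gen m W S Q'"
  unfolding gen_def by (intro low_mono) (blast intro: low_base)

lemma gen_induct [consumes 1, case_names W X zero add scale minus plus]:
  assumes "u \<in> gen m W S Q"
    and "\<And>w. w \<in> W \<Longrightarrow> P w"
    and "\<And>pl mi s. s \<in> S \<Longrightarrow> Q pl mi \<Longrightarrow> P (X (Suc m) pl mi s)"
    and "P 0" and "\<And>u w. u \<in> gen m W S Q \<Longrightarrow> w \<in> gen m W S Q \<Longrightarrow> P u \<Longrightarrow> P w \<Longrightarrow> P (u + w)"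
    and "\<And>c u. u \<in> gen m W S Q \<Longrightarrow> P u \<Longrightarrow> P (c *s u)"
    and "\<And>u i j. u \<in> gen m W S Q \<Longrightarrow> P u \<Longrightarrow> 1 \<le> i \<Longrightarrow> i < j \<Longrightarrow> j \<le> m \<Longrightarrow> P (L (int j) (int i) u)"
    and "\<And>u i j. u \<in> gen m W S Q \<Longrightarrow> P u \<Longrightarrow> 1 \<le> i \<Longrightarrow> i < j \<Longrightarrow> j \<le> m \<Longrightarrow> P (L (- int j) (int i) u)"
  shows "P u"
  using assms(1) unfolding gen_def
  by (induction rule: low.induct) (use assms(2-) in \<open>auto simp: gen_def\<close>)

lemma gen_yminus:
  assumes "u \<in> gen m W S Q" "c \<in> {1..m}" "Suc m \<le> n"
    and W: "\<And>w i. w \<in> W \<Longrightarrow> i \<in> {1..m} \<Longrightarrow> L (int (Suc m)) (int i) w \<in> W"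
    and Q: "\<And>pl mi mi'. Q pl mi \<Longrightarrow> Q pl mi'"
  shows "L (int (Suc m)) (int c) u \<in> gen m W S Q"
  using assms(1,2)
proof (induction arbitrary: c rule: gen_induct)
  case (W w)
  then show ?case using assms(4) by simp
next
  case (X pl mi s)
  have "L (int (Suc m)) (int c) (X (Suc m) pl mi s) = X (Suc m) pl (mi(c := Suc (mi c))) s"
    using X assms by (intro X_minus) auto
  then show ?case using X Q by (metis gen_low(10))
qed (use assms in \<open>simp_all add: L_lin y_low[of "Suc m"] del: of_nat_Suc\<close>)

text \<open>Moving the new plus factor inside past the minus factors leaves corrections by lowering
  operators of level \<open>m\<close>, with the plus exponents unchanged. Hence \<open>Q'\<close>
  has to contain the exponents of \<open>Q\<close> as well as those with one more plus
  factor.\<close>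

lemma gen_yplus:
  assumes "u \<in> gen m W S Q" "c \<in> {1..m}" "Suc m \<le> n"
    and W: "\<And>w i. w \<in> W \<Longrightarrow> i \<in> {1..m} \<Longrightarrow> L (int (Suc m)) (int i) w \<in> W \<and> L (- int (Suc m)) (int i) w \<in> W"
    and Q: "\<And>pl mi mi'. Q pl mi \<Longrightarrow> Q' pl mi'" "\<And>pl mi mi' i. i \<in> {1..m} \<Longrightarrow> Q pl mi \<Longrightarrow> Q' (pl(i := Suc (pl i))) mi'"
    and Q': "\<And>pl mi mi'. Q' pl mi \<Longrightarrow> Q' pl mi'"
  shows "L (- int (Suc m)) (int c) u \<in> gen m W S Q'"
  using assms(1,2)
proof (induction arbitrary: c rule: gen_induct)
  case (W w)
  then show ?case using assms(4) by simp
next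
  case (X pl mi s)
  show ?case
  proof (induction mi rule: exponent_induct[where M = "Suc m"])
    case (zero mi)
    then have "L (- int (Suc m)) (int c) (X (Suc m) pl mi s) = X (Suc m) (pl(c := Suc (pl c))) mi s"
      unfolding X_def using X assms by (simp only: yw_0[OF zero] yw_Suc lev_simps) (simp add: yw_Suc[symmetric] yw_0[OF zero] del: of_nat_Suc)
    then show ?case using X Q by (metis gen_low(10))
  next
    case (step mi i)
    have "L (- int (Suc m)) (int c) (X (Suc m) pl (mi(i := Suc (mi i))) s) =
       L (int (Suc m)) (int i) (L (- int (Suc m)) (int c) (X (Suc m) pl mi s)) + L (- int i) (int c) (X (Suc m) pl mi s)"
      using X step assms by (simp add: X_minus[symmetric] y_comm_pm del: of_nat_Suc)
    moreover have "L (int (Suc m)) (int i) (L (- int (Suc m)) (int c) (X (Suc m) pl mi s)) \<in> gen m W S Q'"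
      using step assms by (intro gen_yminus) auto
    moreover have "X (Suc m) pl mi s \<in> gen m W S Q'" using X Q by simp
    moreover have "L (- int i) (int c) (X (Suc m) pl mi s) \<in> gen m W S Q'"
      using step X assms calculation(3) by simp
    ultimately show ?case by (simp only: gen_low)
  qed
next
  case (scale c u)
  then show ?case using assms by (simp_all add: L_lin y_low[of "Suc m"] del: of_nat_Suc)
qed (use assms in \<open>simp_all add: L_lin y_low[of "Suc m"] del: of_nat_Suc\<close>)

text \<open>The larger index comes first: \<open>pl j i\<close> and \<open>mi j i\<close> are the
  exponents of \<epsilon>_i + \<epsilon>_j and \<epsilon>_i - \<epsilon>_j, so that a whole block
  \<open>pl j\<close>, \<open>mi j\<close> is passed to \<open>X\<close>. The highest level acts
  first.\<close>

primrec sv :: "nat \<Rightarrow> (nat \<Rightarrow> nat \<Rightarrow> nat) \<Rightarrow> (nat \<Rightarrow> nat \<Rightarrow> nat) \<Rightarrow> 'v \<Rightarrow> 'v" where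
  "sv 0 pl mi u = u"
| "sv (Suc m) pl mi u = sv m pl mi (X (Suc m) (pl (Suc m)) (mi (Suc m)) u)"

lemma sv_in:
  assumes "\<And>i j w. w \<in> T \<Longrightarrow> 1 \<le> i \<Longrightarrow> i < j \<Longrightarrow> j \<le> m \<Longrightarrow> L (int j) (int i) w \<in> T \<and> L (- int j) (int i) w \<in> T"
    and "u \<in> T" "m \<le> n"
  shows "sv m pl mi u \<in> T"
  using assms
proof (induction m arbitrary: u)
  case (Suc m)
  have "X (Suc m) (pl (Suc m)) (mi (Suc m)) u \<in> T"
    using Suc.prems by (intro X_in) (auto simp del: of_nat_Suc)
  then show ?case using Suc by simp
qed simp

lemma sv_cong:
  "(\<And>j. j \<le> m \<Longrightarrow> pl j = pl' j \<and> mi j = mi' j) \<Longrightarrow> sv m pl mi u = sv m pl' mi' u"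
  by (induction m arbitrary: u) auto

text \<open>The spanning half of the Poincare-Birkhoff-Witt theorem. The monomials with level
  \<open>m + 1\<close> innermost span a space that is closed under the new lowering operators by
  \<open>gen_yminus\<close> and \<open>gen_yplus\<close>, taken without any condition on the
  exponents.\<close>

theorem low_eq_span_sv:
  "m \<le> n \<Longrightarrow> low m S = span {sv m pl mi s | pl mi s. s \<in> S}"
proof (induction m arbitrary: S)
  case 0
  have "low 0 S \<subseteq> span S" by (rule low_least) (auto intro: span_base)
  moreover have "span S \<subseteq> low 0 S" by (rule span_minimal) (auto intro: low_base low_subspace)
  ultimately show ?case by auto
next
  case (Suc m)
  let ?T = "gen m {} S (\<lambda>_ _. True)"
  have "?T = span {sv m pl mi s | pl mi s. s \<in> {X (Suc m) p q s | p q s. s \<in> S}}"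
    unfolding gen_def using Suc by simp
  also have "{sv m pl mi s | pl mi s. s \<in> {X (Suc m) p q s | p q s. s \<in> S}} = {sv (Suc m) pl mi s | pl mi s. s \<in> S}"
  proof (intro equalityI subsetI)
    fix x assume "x \<in> {sv m pl mi s | pl mi s. s \<in> {X (Suc m) p q s | p q s. s \<in> S}}"
    then obtain pl mi p q s where x: "x = sv m pl mi (X (Suc m) p q s)" "s \<in> S" by auto
    have "x = sv (Suc m) (pl(Suc m := p)) (mi(Suc m := q)) s"
      using x by (simp cong: sv_cong)
    then show "x \<in> {sv (Suc m) pl mi s | pl mi s. s \<in> S}" using x by blast
  next
    fix x assume "x \<in> {sv (Suc m) pl mi s | pl mi s. s \<in> S}"
    then obtain pl mi s where "x = sv m pl mi (X (Suc m) (pl (Suc m)) (mi (Suc m)) s)" "s \<in> S" by auto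
    then show "x \<in> {sv m pl mi s | pl mi s. s \<in> {X (Suc m) p q s | p q s. s \<in> S}}" by blast
  qed
  finally have T: "?T = span {sv (Suc m) pl mi s | pl mi s. s \<in> S}" .
  have "low (Suc m) S \<subseteq> ?T"
  proof (rule low_least)
    show "S \<subseteq> ?T"
    proof
      fix s assume "s \<in> S"
      then have "X (Suc m) (\<lambda>_. 0) (\<lambda>_. 0) s \<in> ?T" by simp
      then show "s \<in> ?T" by (simp add: X_def yw_0)
    qed
    show "subspace ?T" by (rule gen_subspace)
    fix u i j assume "u \<in> ?T" "1 \<le> i" "i < j" "j \<le> Suc m"
    then show "L (int j) (int i) u \<in> ?T \<and> L (- int j) (int i) u \<in> ?T"
      using gen_yminus[of u m "{}" S "\<lambda>_ _. True" i] gen_yplus[of u m "{}" S "\<lambda>_ _. True" i "\<lambda>_ _. True"] Suc.prems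
      by (cases "j = Suc m") auto
  qed
  moreover have "span {sv (Suc m) pl mi s | pl mi s. s \<in> S} \<subseteq> low (Suc m) S"
  proof (rule span_minimal)
    show "{sv (Suc m) pl mi s | pl mi s. s \<in> S} \<subseteq> low (Suc m) S"
    proof clarify
      fix pl mi s assume "s \<in> S"
      show "sv (Suc m) pl mi s \<in> low (Suc m) S"
        by (rule sv_in) (use \<open>s \<in> S\<close> Suc.prems in \<open>auto intro: low.intros\<close>)
    qed
  qed (rule low_subspace)
  ultimately show ?case using T by auto
qed

end

section \<open>The filtration by the monomial order\<close>

definition deglex_lt :: "nat \<Rightarrow> (nat \<Rightarrow> nat) \<Rightarrow> (nat \<Rightarrow> nat) \<Rightarrow> bool" where
  "deglex_lt M e' e \<longleftrightarrow> sum e' {1..<M} < sum e {1..<M} \<or>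
     sum e' {1..<M} = sum e {1..<M} \<and> (\<exists>i\<in>{1..<M}. e' i < e i \<and> (\<forall>j\<in>{1..<i}. e' j = e j))"

definition agree :: "nat \<Rightarrow> (nat \<Rightarrow> nat) \<Rightarrow> (nat \<Rightarrow> nat) \<Rightarrow> bool" where
  "agree M e' e \<longleftrightarrow> (\<forall>i\<in>{1..<M}. e' i = e i)"

definition block_lt :: "nat \<Rightarrow> (nat \<Rightarrow> nat) \<Rightarrow> (nat \<Rightarrow> nat) \<Rightarrow> (nat \<Rightarrow> nat) \<Rightarrow> (nat \<Rightarrow> nat) \<Rightarrow> bool" where
  "block_lt M pl' mi' pl mi \<longleftrightarrow> deglex_lt M pl' pl \<or> agree M pl' pl \<and> deglex_lt M mi' mi"

lemma agree_sum: "agree M e' e \<Longrightarrow> sum e' {1..<M} = sum e {1..<M}"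
  by (auto simp: agree_def intro: sum.cong)

lemma agree_dl: "agree M e2 e1 \<Longrightarrow> deglex_lt M e3 e2 \<Longrightarrow> deglex_lt M e3 e1"
  and deglex_lt_eqr: "agree M e3 e2 \<Longrightarrow> deglex_lt M e2 e1 \<Longrightarrow> deglex_lt M e3 e1"
  using agree_sum[of M e2 e1] agree_sum[of M e3 e2] by (fastforce simp: deglex_lt_def agree_def)+

lemma agree_trans: "agree M e3 e2 \<Longrightarrow> agree M e2 e1 \<Longrightarrow> agree M e3 e1"
  and agree_refl [simp]: "agree M e e"
  and agree_sym: "agree M e e' \<Longrightarrow> agree M e' e"
  by (auto simp: agree_def)

lemma deglex_lt_trans: "deglex_lt M e3 e2 \<Longrightarrow> deglex_lt M e2 e1 \<Longrightarrow> deglex_lt M e3 e1"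
proof -
  assume 1: "deglex_lt M e3 e2" and 2: "deglex_lt M e2 e1"
  show ?thesis
  proof (cases "sum e3 {1..<M} < sum e1 {1..<M}")
    case False
    then have s: "sum e3 {1..<M} = sum e2 {1..<M}" "sum e2 {1..<M} = sum e1 {1..<M}"
      using 1 2 by (auto simp: deglex_lt_def)
    obtain i where i: "i \<in> {1..<M}" "e3 i < e2 i" "\<And>l. l \<in> {1..<i} \<Longrightarrow> e3 l = e2 l"
      using 1 s by (auto simp: deglex_lt_def)
    obtain j where j: "j \<in> {1..<M}" "e2 j < e1 j" "\<And>l. l \<in> {1..<j} \<Longrightarrow> e2 l = e1 l"
      using 2 s by (auto simp: deglex_lt_def)
    have "e3 (min i j) < e1 (min i j) \<and> (\<forall>l\<in>{1..<min i j}. e3 l = e1 l) \<and> min i j \<in> {1..<M}"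
      using i j by (cases i j rule: linorder_cases) (auto simp: min_def)
    then show ?thesis using s by (auto simp: deglex_lt_def)
  qed (simp add: deglex_lt_def)
qed

lemma block_lt_trans: "block_lt M p3 q3 p2 q2 \<Longrightarrow> block_lt M p2 q2 p1 q1 \<Longrightarrow> block_lt M p3 q3 p1 q1"
  unfolding block_lt_def using deglex_lt_trans agree_trans agree_dl deglex_lt_eqr by blast

lemma sum_fun_upd_Suc:
  fixes c M :: nat and e :: "nat \<Rightarrow> nat"
  shows "c \<in> {1..<M} \<Longrightarrow> sum (e(c := Suc (e c))) {1..<M} = Suc (sum e {1..<M})"
  using sum.remove[OF finite_atLeastLessThan[of 1 M], of c "e(c := Suc (e c))"]
    sum.remove[OF finite_atLeastLessThan[of 1 M], of c e] by simp

definition move :: "nat \<Rightarrow> nat \<Rightarrow> nat \<Rightarrow> (nat \<Rightarrow> nat) \<Rightarrow> nat \<Rightarrow> nat" where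
  "move a b j e = e(a := e a - j, b := e b + j)"

lemma sum_move:
  assumes "a \<in> {1..<M}" "b \<in> {1..<M}" "a \<noteq> b" "j \<le> e a"
  shows "sum (move a b j e) {1..<M} = sum e {1..<M}"
proof -
  have split: "sum g {1..<M} = g a + (g b + sum g ({1..<M} - {a} - {b}))" for g :: "nat \<Rightarrow> nat"
    using assms by (simp add: sum.remove)
  show ?thesis using split[of e] split[of "move a b j e"] assms(3,4) by (simp add: move_def)
qed

lemma shift_exp_move: "a \<noteq> b \<Longrightarrow> shift_exp a b e = move a b 1 e"
  by (auto simp: shift_exp_def move_def Let_def)

lemma shift_exp_same: "e a > 0 \<Longrightarrow> shift_exp a a e = e"
  by (auto simp: shift_exp_def Let_def)

lemma deglex_lt_move_up:
  assumes "a \<in> {1..<M}" "b \<in> {1..<M}" "a < b" "e a > 0"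
  shows "deglex_lt M (shift_exp a b e) e"
  using assms sum_move[of a M b 1 e] by (auto simp: deglex_lt_def shift_exp_move move_def intro!: bexI[of _ a])

text \<open>The coarse bound for error terms. It ignores the minus exponents, as
  \<open>gen_yminus\<close> requires; for \<open>d\<close> the plus degree of a block it implies
  \<open>block_lt\<close>, because the plus degree is compared first.\<close>

definition plus_degree_lt :: "nat \<Rightarrow> nat \<Rightarrow> (nat \<Rightarrow> nat) \<Rightarrow> (nat \<Rightarrow> nat) \<Rightarrow> bool" where
  "plus_degree_lt M d pl mi \<longleftrightarrow> sum pl {1..<M} < d"

context so_module
begin

definition singular :: "nat \<Rightarrow> 'v set \<Rightarrow> 'v \<Rightarrow> (nat \<Rightarrow> complex) \<Rightarrow> bool" where
  "singular m W v lam \<longleftrightarrow>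
     (\<forall>i j. 1 \<le> i \<longrightarrow> i < j \<longrightarrow> j \<le> m \<longrightarrow> L (int i) (int j) v \<in> W \<and> L (int i) (- int j) v \<in> W) \<and>
     (\<forall>i. 1 \<le> i \<longrightarrow> i \<le> m \<longrightarrow> L (int i) (int i) v - lam i *s v \<in> W)"

lemma yw_single:
  assumes "a \<in> {1..<M}" "lev M s"
  shows "yw M s (\<lambda>i. if i = a then t else 0) u = (L s (int a) ^^ t) u"
proof (induction t)
  case 0
  then show ?case by (simp add: yw_0)
next
  case (Suc t)
  have "(\<lambda>i. if i = a then Suc t else 0) = (\<lambda>i. if i = a then t else 0)(a := Suc ((\<lambda>i. if i = a then t else 0) a))"
    by auto
  then show ?case using yw_Suc[OF assms(2,1), of "\<lambda>i. if i = a then t else 0" u] Suc by simp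
qed

section \<open>sl2-triples modulo an invariant subspace\<close>

lemma pow_in: "(\<And>w. w \<in> T \<Longrightarrow> g w \<in> T) \<Longrightarrow> w \<in> T \<Longrightarrow> (g ^^ N) w \<in> T"
  by (induction N) auto

text \<open>The usual formula e f^N u = N (\<mu> - N + 1) f^(N-1) u for e = \<open>L a b\<close>, f
  = \<open>L b a\<close> and h = \<open>L a a - L b b\<close>, valid modulo \<open>W\<close>. The
  auxiliary fact follows the eigenvalue \<mu> - 2 N of h along the string.\<close>

lemma sl2_action:
  assumes ix: "ix n a" "ix n b" "a \<noteq> b" "a \<noteq> - b"
    and W: "subspace W" "\<And>w. w \<in> W \<Longrightarrow> L b a w \<in> W" "\<And>w. w \<in> W \<Longrightarrow> L a a w \<in> W" "\<And>w. w \<in> W \<Longrightarrow> L b b w \<in> W"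
    and u: "L a b u \<in> W" "L a a u - L b b u - \<mu> *s u \<in> W"
  shows "L a b ((L b a ^^ N) u) - (of_nat N * (\<mu> - of_nat N + 1)) *s (L b a ^^ (N - 1)) u \<in> W"
proof -
  let ?f = "L b a"
  have h: "L a a ((?f ^^ N) u) - L b b ((?f ^^ N) u) - (\<mu> - 2 * of_nat N) *s (?f ^^ N) u \<in> W" for N
  proof (induction N)
    case (Suc N)
    let ?w = "(?f ^^ N) u"
    have "L a a (?f ?w) = ?f (L a a ?w) - ?f ?w" "L b b (?f ?w) = ?f (L b b ?w) + ?f ?w"
      using ix L_bracket[of a a b a ?w] L_bracket[of b b b a ?w] by (auto simp: ix_def)
    moreover have "(\<mu> - 2 * of_nat (Suc N)) *s ?f ?w = (\<mu> - 2 * of_nat N) *s ?f ?w - ?f ?w - ?f ?w"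
    proof -
      have "\<mu> - 2 * of_nat (Suc N) = (\<mu> - 2 * of_nat N) - 1 - 1" by (simp add: of_nat_Suc)
      then show ?thesis by (simp only: scale_left_diff_distrib scale_one)
    qed
    ultimately have "L a a (?f ?w) - L b b (?f ?w) - (\<mu> - 2 * of_nat (Suc N)) *s ?f ?w
       = (?f (L a a ?w) - ?f ?w) - (?f (L b b ?w) + ?f ?w) - ((\<mu> - 2 * of_nat N) *s ?f ?w - ?f ?w - ?f ?w)"
      by (simp only:)
    also have "\<dots> = ?f (L a a ?w - L b b ?w - (\<mu> - 2 * of_nat N) *s ?w)"
      using ix by (simp add: L_lin)
    finally have "L a a (?f ?w) - L b b (?f ?w) - (\<mu> - 2 * of_nat (Suc N)) *s ?f ?w
       = ?f (L a a ?w - L b b ?w - (\<mu> - 2 * of_nat N) *s ?w)" .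
    then show ?case using W(2)[OF Suc] by simp
  qed (use u in simp)
  show ?thesis
  proof (induction N)
    case 0
    then show ?case using u by simp
  next
    case (Suc N)
    let ?w = "(?f ^^ N) u"
    have 1: "L a b (?f ?w) = ?f (L a b ?w) + (L a a ?w - L b b ?w)"
      using ix L_bracket[of a b b a ?w] by (auto simp: ix_def)
    have 2: "(of_nat N * (\<mu> - of_nat N + 1)) *s ?w = ?f ((of_nat N * (\<mu> - of_nat N + 1)) *s (?f ^^ (N - 1)) u)"
      using ix by (cases N) (simp_all add: L_lin)
    have "of_nat (Suc N) * (\<mu> - of_nat (Suc N) + 1) = of_nat N * (\<mu> - of_nat N + 1) + (\<mu> - 2 * of_nat N)"
      by (simp add: algebra_simps of_nat_Suc)
    then have "L a b (?f ?w) - (of_nat (Suc N) * (\<mu> - of_nat (Suc N) + 1)) *s ?w =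
       ?f (L a b ?w - (of_nat N * (\<mu> - of_nat N + 1)) *s (?f ^^ (N - 1)) u)
       + (L a a ?w - L b b ?w - (\<mu> - 2 * of_nat N) *s ?w)"
      using ix 1 2 by (simp add: L_diff scale_left_distrib)
    then show ?case using subspace_add[OF W(1) W(2)[OF Suc] h[of N]] by simp
  qed
qed

text \<open>Local nilpotency takes the place of finite dimension. If f^(N+1) u is in
  \<open>W\<close> and N \<ge> K > k, applying e puts (N + 1) (k - N) f^N u into \<open>W\<close>;
  the coefficient is nonzero, so the exponent can be lowered until it reaches
  \<open>K\<close>.\<close>

lemma sl2_vanish:
  assumes ix: "ix n a" "ix n b" "a \<noteq> b" "a \<noteq> - b"
    and W: "subspace W" "\<And>w. w \<in> W \<Longrightarrow> L a b w \<in> W" "\<And>w. w \<in> W \<Longrightarrow> L b a w \<in> W" "\<And>w. w \<in> W \<Longrightarrow> L a a w \<in> W" "\<And>w. w \<in> W \<Longrightarrow> L b b w \<in> W"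
    and u: "L a b u \<in> W" "L a a u - L b b u - of_nat k *s u \<in> W"
    and nil: "(L b a ^^ N) u \<in> W" and "k < K"
  shows "(L b a ^^ K) u \<in> W"
  using nil
proof (induction N)
  case 0
  then show ?case using W(3) by (intro pow_in) auto
next
  case (Suc N)
  show ?case
  proof (cases "N \<ge> K")
    case False
    have "(L b a ^^ (K - Suc N)) ((L b a ^^ Suc N) u) \<in> W"
      by (rule pow_in[of W, OF W(3) Suc.prems])
    moreover have "(L b a ^^ K) u = (L b a ^^ ((K - Suc N) + Suc N)) u" using False by simp
    ultimately show ?thesis by (simp only: funpow_add comp_apply)
  next
    case True
    let ?c = "of_nat (Suc N) * (of_nat k - of_nat (Suc N) + 1) :: complex"
    have "L a b ((L b a ^^ Suc N) u) - ?c *s (L b a ^^ N) u \<in> W"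
      using sl2_action[OF ix W(1,3-5) u, of "Suc N"] by simp
    then have "?c *s (L b a ^^ N) u \<in> W"
      using subspace_diff[OF W(1) W(2)[OF Suc.prems]] by fastforce
    then have "inverse ?c *s ?c *s (L b a ^^ N) u \<in> W" using subspace_scale[OF W(1)] by blast
    moreover have "?c \<noteq> 0"
    proof -
      have "?c = of_int (int (Suc N) * (int k - int N))" by (simp add: of_nat_Suc)
      then show ?thesis using True \<open>k < K\<close> by (simp only: of_int_eq_0_iff) simp
    qed
    then have "inverse ?c * ?c = 1" by (rule Fields.division_ring_class.left_inverse)
    ultimately have "(L b a ^^ N) u \<in> W" by (simp only: scale_scale scale_one)
    then show ?thesis by (rule Suc.IH)
  qed
qed

end

section \<open>Raising operators on the monomials of one level\<close>

locale rel_module = so_module +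
  fixes m :: nat and W :: "'a set" and v :: 'a and lam :: "nat \<Rightarrow> complex"
  assumes Mn: "Suc m \<le> n" and Winv: "stable (Suc m) W" and singular: "singular (Suc m) W v lam"
begin

abbreviation "M \<equiv> Suc m"
abbreviation "G Q \<equiv> gen m W {v} Q"

lemma W_sub: "subspace W" using Winv by (simp add: stable_def)

lemma W_op: "w \<in> W \<Longrightarrow> ix M a \<Longrightarrow> ix M b \<Longrightarrow> L a b w \<in> W" using Winv by (simp add: stable_def)

lemma W_y: "w \<in> W \<Longrightarrow> i \<in> {1..m} \<Longrightarrow> L (int M) (int i) w \<in> W \<and> L (- int M) (int i) w \<in> W"
  by (intro conjI W_op) auto

lemma yw_W: "w \<in> W \<Longrightarrow> s = int M \<or> s = - int M \<Longrightarrow> yw M s e w \<in> W"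
  using Mn W_y by (intro yw_in[where T = W]) auto

lemma X_W: "w \<in> W \<Longrightarrow> X M pl mi w \<in> W"
  by (simp add: X_def yw_W)

lemma v_raise: "1 \<le> i \<Longrightarrow> i < j \<Longrightarrow> j \<le> M \<Longrightarrow> L (int i) (int j) v \<in> W \<and> L (int i) (- int j) v \<in> W"
  and v_cartan: "1 \<le> i \<Longrightarrow> i \<le> M \<Longrightarrow> L (int i) (int i) v - lam i *s v \<in> W"
  using singular by (auto simp: singular_def)

lemma plus_in: "Q pl (\<lambda>_. 0) \<Longrightarrow> yw M (- int M) pl v \<in> G Q"
  using gen_low(10)[of v "{v}" Q pl "\<lambda>_. 0" m W] by (simp add: X_def yw_0)

lemma G_mono: "u \<in> G Q \<Longrightarrow> (\<And>pl mi. Q pl mi \<Longrightarrow> Q' pl mi) \<Longrightarrow> u \<in> G Q'"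
  using gen_mono[of Q Q'] by blast

lemma G_yplus: "u \<in> G (plus_degree_lt M d) \<Longrightarrow> c \<in> {1..m} \<Longrightarrow> L (- int M) (int c) u \<in> G (plus_degree_lt M (Suc d))"
  using Mn W_y by (rule_tac gen_yplus[where Q = "plus_degree_lt M d"]) (auto simp: plus_degree_lt_def sum_fun_upd_Suc simp del: fun_upd_apply)

lemma G_yminus:
  assumes "u \<in> G (\<lambda>pl mi. Q pl)" "c \<in> {1..m}"
  shows "L (int M) (int c) u \<in> G (\<lambda>pl mi. Q pl)"
  using assms Mn W_y by (intro gen_yminus) auto

lemma G_yw_minus:
  assumes "u \<in> G (\<lambda>pl mi. Q pl)"
  shows "yw M (int M) e u \<in> G (\<lambda>pl mi. Q pl)"
  using assms Mn G_yminus by (intro yw_in) auto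

lemma plus_degree_lt_eq: "plus_degree_lt M d = (\<lambda>pl mi. sum pl {1..<M} < d)"
  by (auto simp: plus_degree_lt_def fun_eq_iff)

lemma gl_plus:
  assumes "b \<in> {1..m}" "c \<in> {1..m}"
  shows "L (int b) (int c) (yw M (- int M) pl v) \<in> G (plus_degree_lt M (Suc (sum pl {1..<M})))"
proof -
  let ?G = "G (plus_degree_lt M (Suc (sum pl {1..<M})))"
  have z: "yw M (- int M) pl v \<in> ?G" by (rule plus_in) (simp add: plus_degree_lt_def)
  show ?thesis
  proof (cases "c < b")
    case True
    then show ?thesis using z assms by simp
  next
    case False
    have "yw M (- int M) pl (L (int b) (int c) v) \<in> ?G"
    proof (cases "b = c")
      case True
      have "L (int b) (int b) v = (L (int b) (int b) v - lam b *s v) + lam b *s v" by simp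
      then have "yw M (- int M) pl (L (int b) (int b) v) = yw M (- int M) pl (L (int b) (int b) v - lam b *s v) + lam b *s yw M (- int M) pl v"
        using Mn yw_add[of M "- int M" pl "L (int b) (int b) v - lam b *s v" "lam b *s v"] by (simp add: yw_scale)
      moreover have "yw M (- int M) pl (L (int b) (int b) v - lam b *s v) \<in> W" using v_cartan assms yw_W by simp
      ultimately show ?thesis using True z by simp
    next
      case neq: False
      then have "L (int b) (int c) v \<in> W" using False v_raise[of b c] assms by simp
      then show ?thesis using yw_W by simp
    qed
    moreover have "of_nat (pl b) *s yw M (- int M) (shift_exp b c pl) v \<in> ?G"
    proof (cases "pl b = 0")
      case False
      then have "sum (shift_exp b c pl) {1..<M} = sum pl {1..<M}"
        using assms by (cases "b = c") (auto simp: shift_exp_same shift_exp_move sum_move)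
      then show ?thesis by (intro gen_low plus_in) (simp add: plus_degree_lt_def)
    qed simp
    ultimately show ?thesis using gl_yw[of M "- int M" b c pl v] assms Mn by simp
  qed
qed

text \<open>The operator belongs to the positive root \<epsilon>_M + \<epsilon>_b. Against a factor
  \<open>L (-M) c\<close> it turns into \<open>L b c\<close> and, for \<open>b = c\<close>, also
  into \<open>L M M\<close>; both keep the remaining monomial at its plus degree, so one plus factor
  is lost.\<close>

lemma raiseM_plus:
  assumes "b \<in> {1..m}"
  shows "L (int M) (- int b) (yw M (- int M) pl v) \<in> G (plus_degree_lt M (sum pl {1..<M}))"
proof (induction pl rule: exponent_induct[where M = M])
  case (zero pl)
  have "L (int M) (- int b) v = - L (int b) (- int M) v"
    using L_skew[of "int b" "- int M" v] assms Mn by simp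
  then have "L (int M) (- int b) v \<in> W" using v_raise[of b M] assms W_sub subspace_neg by auto
  then show ?case by (simp only: yw_0[OF zero]) simp
next
  case (step pl c)
  let ?z = "yw M (- int M) pl v" and ?G = "G (plus_degree_lt M (Suc (sum pl {1..<M})))"
  have c: "c \<in> {1..m}" using step by auto
  have sum: "sum (pl(c := Suc (pl c))) {1..<M} = Suc (sum pl {1..<M})" by (rule sum_fun_upd_Suc[OF step(1)])
  have z: "?z \<in> ?G" by (rule plus_in) (simp add: plus_degree_lt_def)
  \<comment> \<open>Each factor of the root -(\<epsilon>_c + \<epsilon>_M) lowers the eigenvalue of
    \<open>L M M\<close> by one.\<close>
  have "L (int M) (int M) ?z - (lam M - of_nat (sum pl {1..<M})) *s ?z \<in> W"
  proof (induction pl rule: exponent_induct[where M = M])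
    case (zero pl)
    then show ?case using v_cartan[of M] by (simp only: yw_0) simp
  next
    case (step pl c)
    let ?z = "yw M (- int M) pl v"
    have "L (int M) (int M) (L (- int M) (int c) ?z) - (lam M - of_nat (Suc (sum pl {1..<M}))) *s L (- int M) (int c) ?z
      = L (- int M) (int c) (L (int M) (int M) ?z - (lam M - of_nat (sum pl {1..<M})) *s ?z)"
    proof -
      have e: "lam M - of_nat (Suc (sum pl {1..<M})) = (lam M - of_nat (sum pl {1..<M})) - 1"
        by (simp add: of_nat_Suc)
      show ?thesis unfolding e scale_left_diff_distrib[of _ 1]
        using step Mn by (simp add: cartanM_y[of M] L_lin)
    qed
    then show ?case using step(2) W_y step(1) Mn
      by (simp only: yw_Suc sum_fun_upd_Suc lev_simps) auto
  qed
  then have "L (int M) (int M) ?z - (lam M - of_nat (sum pl {1..<M})) *s ?z + (lam M - of_nat (sum pl {1..<M})) *s ?z \<in> ?G"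
    by (rule gen_low(2)[OF gen_low(9) gen_low(5)[OF z]])
  then have MM: "L (int M) (int M) ?z \<in> ?G" by simp
  have "L (int M) (- int b) (L (- int M) (int c) ?z) = L (- int M) (int c) (L (int M) (- int b) ?z)
      - (if b = c then L (int M) (int M) ?z else 0) - L (int b) (int c) ?z"
    using raiseM_y(2)[of M "int M" c b ?z] c assms Mn by simp
  also have "\<dots> \<in> ?G"
    using G_yplus[OF step(2) c] MM gl_plus[OF assms c, of pl] by auto
  finally have "L (int M) (- int b) (yw M (- int M) (pl(c := Suc (pl c))) v) \<in> ?G"
    using step Mn by (simp only: yw_Suc lev_simps)
  then show ?case by (simp only: sum)
qed

lemma raiseM_X:
  assumes "b \<in> {1..m}"
  shows "L (int M) (- int b) (X M pl mi v) \<in> G (plus_degree_lt M (sum pl {1..<M}))"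
proof -
  have "L (int M) (- int b) (X M pl mi v) = yw M (int M) mi (L (int M) (- int b) (yw M (- int M) pl v))"
    unfolding X_def using assms Mn by (intro yw_commute) (simp add: raiseM_y[of M])
  then show ?thesis using raiseM_plus[OF assms, of pl] G_yw_minus by (simp add: plus_degree_lt_eq)
qed

text \<open>On the plus monomial the corrections of \<open>raise_y\<close> are raising operators
  \<open>L (-M) (-c)\<close>, which commute with all plus factors and so reach \<open>v\<close>. On
  the minus factors they are \<open>L M (-c)\<close>, which lower the plus degree by
  \<open>raiseM_X\<close>.\<close>

lemma raise_X:
  assumes "1 \<le> a" "a < b" "b \<le> m"
  shows "L (int a) (- int b) (X M pl mi v) \<in> G (plus_degree_lt M (sum pl {1..<M}))"
proof (induction mi rule: exponent_induct[where M = M])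
  case (zero mi)
  have neg: "L (- int M) (- int c) (yw M (- int M) pl v) \<in> W" if "c \<in> {1..m}" for c pl
  proof -
    have "L (- int M) (- int c) (yw M (- int M) pl v) = yw M (- int M) pl (L (- int M) (- int c) v)"
      using that Mn by (intro yw_commute) (simp add: raiseM_y[of M])
    moreover have "L (- int M) (- int c) v = - L (int c) (int M) v"
      using L_skew[of "int c" "int M" v] that Mn by simp
    moreover have "L (int c) (int M) v \<in> W" using v_raise[of c M] that by simp
    ultimately show ?thesis using yw_W W_sub subspace_neg by simp
  qed
  have "L (int a) (- int b) (yw M (- int M) pl v) \<in> W"
  proof (induction pl rule: exponent_induct[where M = M])
    case (zero pl)
    then show ?case using v_raise[of a b] assms by (simp only: yw_0)
  next
    case (step pl c)
    let ?z = "yw M (- int M) pl v"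
    have "L (int a) (- int b) (L (- int M) (int c) ?z) = L (- int M) (int c) (L (int a) (- int b) ?z)
    - (if a = c then L (- int M) (- int b) ?z else 0) + (if b = c then L (- int M) (- int a) ?z else 0)"
      using step assms Mn by (intro raise_y[of M]) auto
    also have "\<dots> \<in> W"
      using neg[of a] neg[of b] assms W_y[OF step(2), of c] step(1) W_sub
      by (intro subspace_add[OF W_sub] subspace_diff[OF W_sub]) (auto simp: subspace_0)
    finally show ?case using step(1) Mn by (simp only: yw_Suc lev_simps)
  qed
  then show ?case unfolding X_def by (simp only: yw_0[OF zero]) simp
next
  case (step mi c)
  let ?z = "X M pl mi v"
  have "L (int a) (- int b) (L (int M) (int c) ?z) = L (int M) (int c) (L (int a) (- int b) ?z)
    - (if a = c then L (int M) (- int b) ?z else 0) + (if b = c then L (int M) (- int a) ?z else 0)"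
    using step assms Mn by (intro raise_y[of M]) auto
  also have "\<dots> \<in> G (plus_degree_lt M (sum pl {1..<M}))"
    using G_yminus[OF step(2)[unfolded plus_degree_lt_eq], of c] step(1) raiseM_X[of b pl mi] raiseM_X[of a pl mi] assms
    by (auto simp: plus_degree_lt_eq)
  finally show ?case using X_minus[OF Mn step(1), of pl mi v] by (simp only:)
qed

lemma cartan_X:
  assumes "i \<in> {1..m}"
  shows "L (int i) (int i) (X M pl mi v) - (lam i - of_nat (pl i + mi i)) *s X M pl mi v \<in> W"
proof -
  have same: "of_nat (e i) *s X M pl (shift_exp i i e) v = of_nat (e i) *s X M pl e v"
    "of_nat (e i) *s X M (shift_exp i i e) mi v = of_nat (e i) *s X M e mi v" for e
    by (cases "e i = 0"; simp add: shift_exp_same)+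
  have "L (int i) (int i) (X M pl mi v) - (lam i - of_nat (pl i + mi i)) *s X M pl mi v
     = X M pl mi (L (int i) (int i) v - lam i *s v)"
    using gl_X[of M i i pl mi v] assms Mn by (simp add: same X_linear scale_left_diff_distrib scale_left_distrib)
  also have "\<dots> \<in> W" using v_cartan[of i] assms by (simp add: X_W)
  finally show ?thesis .
qed

lemma gl_raise_X:
  assumes "1 \<le> a" "a < b" "b \<le> m"
  shows "L (int a) (int b) (X M pl mi v) \<in> G (\<lambda>p q. block_lt M p q pl mi)"
proof -
  have "X M pl mi (L (int a) (int b) v) \<in> W" using v_raise[of a b] assms by (simp add: X_W)
  moreover have "of_nat (mi a) *s X M pl (shift_exp a b mi) v \<in> G (\<lambda>p q. block_lt M p q pl mi)"
    using deglex_lt_move_up[of a M b mi] assms by (cases "mi a = 0") (auto simp: block_lt_def intro!: gen_low)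
  moreover have "of_nat (pl a) *s X M (shift_exp a b pl) mi v \<in> G (\<lambda>p q. block_lt M p q pl mi)"
    using deglex_lt_move_up[of a M b pl] assms by (cases "pl a = 0") (auto simp: block_lt_def intro!: gen_low)
  ultimately show ?thesis using gl_X[of M a b pl mi v] assms Mn by simp
qed

lemma plus_degree_lt_bl: "plus_degree_lt M (sum pl {1..<M}) p q \<Longrightarrow> block_lt M p q pl mi"
  by (simp add: plus_degree_lt_def block_lt_def deglex_lt_def)

text \<open>A raising operator of level \<open>m\<close> either moves an exponent to a larger index, which decreases it lexicographically, or
  replaces a factor of a root \<open>\<epsilon>\<^sub>i + \<epsilon>\<^sub>M\<close> by one of a root \<open>\<epsilon>\<^sub>j - \<epsilon>\<^sub>M\<close>, which lowers the degree that is compared first.\<close>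
theorem filtration:
  shows "stable m (G (\<lambda>p q. block_lt M p q pl mi))"
    and "singular m (G (\<lambda>p q. block_lt M p q pl mi)) (X M pl mi v) (\<lambda>i. lam i - of_nat (pl i + mi i))"
proof -
  have raise: "L (int i) (int j) (X M pl mi v) \<in> G (\<lambda>p q. block_lt M p q pl mi) \<and>
        L (int i) (- int j) (X M pl mi v) \<in> G (\<lambda>p q. block_lt M p q pl mi)" if "1 \<le> i" "i < j" "j \<le> m" for i j pl mi
    using gl_raise_X[OF that] G_mono[OF raise_X[OF that], where Q' = "\<lambda>p q. block_lt M p q pl mi"] plus_degree_lt_bl by blast
  show "stable m (G (\<lambda>p q. block_lt M p q pl mi))"
    unfolding gen_def
  proof (rule low_inv)
    fix s i j assume s: "s \<in> W \<union> {X M p q s |p q s. s \<in> {v} \<and> block_lt M p q pl mi}" and ij: "1 \<le> i" "i < j" "j \<le> m"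
    show "L (int i) (int j) s \<in> low m (W \<union> {X M p q s |p q s. s \<in> {v} \<and> block_lt M p q pl mi}) \<and>
       L (int i) (- int j) s \<in> low m (W \<union> {X M p q s |p q s. s \<in> {v} \<and> block_lt M p q pl mi})"
      unfolding gen_def[symmetric]
      using s
    proof
      assume "s \<in> W"
      then show "L (int i) (int j) s \<in> G (\<lambda>p q. block_lt M p q pl mi) \<and> L (int i) (- int j) s \<in> G (\<lambda>p q. block_lt M p q pl mi)"
        using ij W_op[of s "int i" "int j"] W_op[of s "int i" "- int j"] by simp
    next
      assume "s \<in> {X M p q s |p q s. s \<in> {v} \<and> block_lt M p q pl mi}"
      then obtain p q where pq: "s = X M p q v" "block_lt M p q pl mi" by auto
      have "u \<in> G (\<lambda>p' q'. block_lt M p' q' pl mi)" if "u \<in> G (\<lambda>p' q'. block_lt M p' q' p q)" for u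
        using that pq(2) block_lt_trans by (auto elim!: G_mono)
      then show "L (int i) (int j) s \<in> G (\<lambda>p q. block_lt M p q pl mi) \<and> L (int i) (- int j) s \<in> G (\<lambda>p q. block_lt M p q pl mi)"
        using raise[OF ij] pq(1) by blast
    qed
  next
    fix s i assume s: "s \<in> W \<union> {X M p q s |p q s. s \<in> {v} \<and> block_lt M p q pl mi}" and i: "1 \<le> i" "i \<le> m"
    show "L (int i) (int i) s \<in> low m (W \<union> {X M p q s |p q s. s \<in> {v} \<and> block_lt M p q pl mi})"
      unfolding gen_def[symmetric]
      using s
    proof
      assume "s \<in> W"
      then show "L (int i) (int i) s \<in> G (\<lambda>p q. block_lt M p q pl mi)"
        using i W_op[of s "int i" "int i"] by simp
    next
      assume "s \<in> {X M p q s |p q s. s \<in> {v} \<and> block_lt M p q pl mi}"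
      then obtain p q where pq: "s = X M p q v" "block_lt M p q pl mi" by auto
      have "L (int i) (int i) s - (lam i - of_nat (p i + q i)) *s s + (lam i - of_nat (p i + q i)) *s s \<in> G (\<lambda>p q. block_lt M p q pl mi)"
        unfolding pq(1) using cartan_X[of i p q] i pq by (intro gen_low) auto
      then show "L (int i) (int i) s \<in> G (\<lambda>p q. block_lt M p q pl mi)" by simp
    qed
  qed (use Mn in simp)
  show "singular m (G (\<lambda>p q. block_lt M p q pl mi)) (X M pl mi v) (\<lambda>i. lam i - of_nat (pl i + mi i))"
    unfolding singular_def using raise cartan_X by auto
qed

end

section \<open>The upper bound\<close>

text \<open>The inequalities 1, 2, 3, 4 and 6 of the theorem for \<open>n = m + 1\<close> and \<open>j = n\<close>; inequality 5 emerges from the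
  change of the highest weight in the passage to lower levels.\<close>
definition block_cond :: "nat \<Rightarrow> (nat \<Rightarrow> nat) \<Rightarrow> (nat \<Rightarrow> nat) \<Rightarrow> (nat \<Rightarrow> nat) \<Rightarrow> bool" where
  "block_cond m k pl mi \<longleftrightarrow>
     (\<forall>i\<in>{1..<m}. pl i \<le> k i \<and> pl i + mi i \<le> k i + pl (Suc i)) \<and>
     mi m \<le> k m \<and> pl m \<le> k (Suc m) \<and>
     (2 \<le> m \<longrightarrow> mi (m - 1) + pl (m - 1) + mi m \<le> k (m - 1) + k m)"

lemma move_0 [simp]: "a \<noteq> b \<Longrightarrow> move a b 0 e = e"
  by (auto simp: move_def)

lemma move_shift: "a \<noteq> b \<Longrightarrow> 0 < e a \<Longrightarrow> move a b j (shift_exp a b e) = move a b (Suc j) e"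
  by (auto simp: shift_exp_def move_def Let_def fun_eq_iff)

context so_module
begin

text \<open>Moving f = \<open>L a b\<close> out of the monomial either puts it in front or moves one
  unit of the exponent from \<open>a\<close> to \<open>b\<close>, with coefficient
  \<open>e a\<close>. All coefficients are nonnegative, so nothing cancels: the term with the
  largest number \<open>t\<close> = min \<open>N\<close> \<open>(e a)\<close> of moves survives, and
  the others are lowerings of monomials with fewer moves.\<close>

lemma yw_pow:
  assumes "lev M s" "a \<in> {1..<M}" "b \<in> {1..<M}" "b < a" "t \<le> N" "t \<le> e a" "t = N \<or> t = e a" "M = Suc m"
  shows "\<exists>c::nat. c > 0 \<and> yw M s e ((L (int a) (int b) ^^ N) u)
     - of_nat c *s (L (int a) (int b) ^^ (N - t)) (yw M s (move a b t e) u) \<in> low m {yw M s (move a b j e) u | j. j < t}"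
  using assms(5-7)
proof (induction N arbitrary: e t)
  case 0
  then show ?case using assms(4) by (intro exI[of _ 1]) (simp add: low_zero)
next
  case (Suc N)
  let ?f = "L (int a) (int b)"
  have eq: "yw M s e ((?f ^^ Suc N) u) = ?f (yw M s e ((?f ^^ N) u)) + of_nat (e a) *s yw M s (shift_exp a b e) ((?f ^^ N) u)"
    using gl_yw[of M s a b e "(?f ^^ N) u"] assms by simp
  have lowf: "?f w \<in> low m S" if "w \<in> low m S" for w S
    using that assms by (intro low_minus) auto
  let ?S = "\<lambda>t. low m {yw M s (move a b j e) u | j. j < t}"
  have shift: "\<exists>c::nat. c > 0 \<and> yw M s (shift_exp a b e) ((?f ^^ N) u) - of_nat c *s (?f ^^ (N - t')) (yw M s (move a b (Suc t') e) u) \<in> ?S (Suc t')"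
    if "t' \<le> N" "Suc t' \<le> e a" "t' = N \<or> Suc t' = e a" for t'
  proof -
    have ea: "shift_exp a b e a = e a - 1" using assms(4) by (simp add: shift_exp_def Let_def)
    have mv: "move a b j (shift_exp a b e) = move a b (Suc j) e" for j
      using that assms(4) by (intro move_shift) auto
    have "low m {yw M s (move a b (Suc j) e) u | j. j < t'} \<subseteq> ?S (Suc t')"
      by (rule low_mono) (auto intro!: low_base)
    then show ?thesis
      using Suc.IH[of t' "shift_exp a b e"] that unfolding mv ea by fastforce
  qed
  consider (zero) "e a = 0" | (top) "t = Suc N" | (mid) "t = e a" "0 < e a" "t \<le> N"
    using Suc.prems by linarith
  then show ?case
  proof cases
    case zero
    then have t: "t = 0" using Suc.prems by simp
    obtain c :: nat where c: "c > 0" "yw M s e ((?f ^^ N) u) - of_nat c *s (?f ^^ N) (yw M s (move a b 0 e) u) \<in> ?S 0"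
      using Suc.IH[of 0 e] zero by auto
    have "yw M s e ((?f ^^ Suc N) u) - of_nat c *s (?f ^^ Suc N) (yw M s (move a b 0 e) u)
       = ?f (yw M s e ((?f ^^ N) u) - of_nat c *s (?f ^^ N) (yw M s (move a b 0 e) u))"
      unfolding eq using assms zero by (auto simp: L_lin lev_def)
    then show ?thesis using c lowf[OF c(2)] t by (intro exI[of _ c]) simp
  next
    case top
    obtain c :: nat where c: "c > 0" "yw M s e ((?f ^^ N) u) - of_nat c *s (?f ^^ (N - N)) (yw M s (move a b N e) u) \<in> ?S N"
      using Suc.IH[of N e] top Suc.prems by auto
    obtain c' :: nat where c': "c' > 0" "yw M s (shift_exp a b e) ((?f ^^ N) u) - of_nat c' *s (?f ^^ (N - N)) (yw M s (move a b (Suc N) e) u) \<in> ?S (Suc N)"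
      using shift[of N] top Suc.prems by auto
    have "?S N \<subseteq> ?S (Suc N)" by (rule low_mono) (auto intro!: low_base)
    then have "yw M s e ((?f ^^ N) u) - of_nat c *s yw M s (move a b N e) u \<in> ?S (Suc N)"
      using c by auto
    then have "yw M s e ((?f ^^ N) u) - of_nat c *s yw M s (move a b N e) u + of_nat c *s yw M s (move a b N e) u \<in> ?S (Suc N)"
      by (rule low_add) (intro low_scale low_base; auto)
    then have "?f (yw M s e ((?f ^^ N) u)) \<in> ?S (Suc N)" by (intro lowf) simp
    moreover have "of_nat (e a) *s (yw M s (shift_exp a b e) ((?f ^^ N) u) - of_nat c' *s yw M s (move a b (Suc N) e) u) \<in> ?S (Suc N)"
      using c' by (intro low_scale) simp
    ultimately have "?f (yw M s e ((?f ^^ N) u)) + of_nat (e a) *s (yw M s (shift_exp a b e) ((?f ^^ N) u) - of_nat c' *s yw M s (move a b (Suc N) e) u) \<in> ?S (Suc N)"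
      by (rule low_add)
    also have "?f (yw M s e ((?f ^^ N) u)) + of_nat (e a) *s (yw M s (shift_exp a b e) ((?f ^^ N) u) - of_nat c' *s yw M s (move a b (Suc N) e) u)
      = yw M s e ((?f ^^ Suc N) u) - of_nat (e a * c') *s yw M s (move a b (Suc N) e) u"
      unfolding eq scale_right_diff_distrib scale_scale of_nat_mult by (simp only: add_diff_eq)
    finally have "yw M s e ((?f ^^ Suc N) u) - of_nat (e a * c') *s yw M s (move a b (Suc N) e) u \<in> ?S (Suc N)" .
    then show ?thesis using top Suc.prems c' by (intro exI[of _ "e a * c'"]) simp
  next
    case mid
    then obtain t' where t': "t = Suc t'" by (metis Suc_pred)
    obtain c :: nat where c: "c > 0" "yw M s e ((?f ^^ N) u) - of_nat c *s (?f ^^ (N - t)) (yw M s (move a b t e) u) \<in> ?S t"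
      using Suc.IH[of t e] mid by auto
    obtain c' :: nat where c': "c' > 0" "yw M s (shift_exp a b e) ((?f ^^ N) u) - of_nat c' *s (?f ^^ (N - t')) (yw M s (move a b t e) u) \<in> ?S t"
      using shift[of t'] mid t' by auto
    have N: "N - t' = Suc (N - t)" "Suc N - t = Suc (N - t)" using mid t' by auto
    have "?f (yw M s e ((?f ^^ N) u) - of_nat c *s (?f ^^ (N - t)) (yw M s (move a b t e) u))
      + of_nat (e a) *s (yw M s (shift_exp a b e) ((?f ^^ N) u) - of_nat c' *s (?f ^^ (N - t')) (yw M s (move a b t e) u)) \<in> ?S t"
      by (intro low_add low_scale lowf c c')
    also have "?f (yw M s e ((?f ^^ N) u) - of_nat c *s (?f ^^ (N - t)) (yw M s (move a b t e) u))
      + of_nat (e a) *s (yw M s (shift_exp a b e) ((?f ^^ N) u) - of_nat c' *s (?f ^^ (N - t')) (yw M s (move a b t e) u))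
      = yw M s e ((?f ^^ Suc N) u) - of_nat (c + e a * c') *s (?f ^^ (Suc N - t)) (yw M s (move a b t e) u)"
      unfolding eq N using assms
      by (auto simp: L_lin lev_def scale_right_diff_distrib scale_left_distrib)
    finally show ?thesis using c by (intro exI[of _ "c + e a * c'"]) simp
  qed
qed

end

text \<open>\<open>k\<close> consists of the Dynkin labels of \<open>lam\<close>: \<open>k i\<close>
  belongs to \<epsilon>_i - \<epsilon>_(i+1) for \<open>i \<le> m\<close>, and
  \<open>k (Suc m)\<close> to \<epsilon>_m + \<epsilon>_(m+1). The nilpotency assumptions stand in
  for finite dimension.\<close>

locale dom_module = rel_module +
  fixes k :: "nat \<Rightarrow> nat"
  assumes dom: "\<And>i. 1 \<le> i \<Longrightarrow> i \<le> m \<Longrightarrow> lam i - lam (Suc i) = of_nat (k i)"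
    and dom_last: "1 \<le> m \<Longrightarrow> lam m + lam (Suc m) = of_nat (k (Suc m))"
    and nilp: "\<And>i j w. 1 \<le> i \<Longrightarrow> i < j \<Longrightarrow> j \<le> n \<Longrightarrow> \<exists>N. (L (int j) (int i) ^^ N) w = 0"
      "\<And>i j w. 1 \<le> i \<Longrightarrow> i < j \<Longrightarrow> j \<le> n \<Longrightarrow> \<exists>N. (L (- int j) (int i) ^^ N) w = 0"
begin

lemma vanish_minus:
  assumes "1 \<le> i" "i < j" "j \<le> M" "L (int i) (int j) u \<in> W"
    "L (int i) (int i) u - a *s u \<in> W" "L (int j) (int j) u - b *s u \<in> W" "a - b = of_nat \<kappa>" "\<kappa> < K"
  shows "(L (int j) (int i) ^^ K) u \<in> W"
proof -
  obtain N where N: "(L (int j) (int i) ^^ N) u = 0" using nilp(1)[of i j u] assms Mn by auto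
  have "(L (int i) (int i) u - a *s u) - (L (int j) (int j) u - b *s u) \<in> W"
    by (rule subspace_diff[OF W_sub assms(5,6)])
  also have "(L (int i) (int i) u - a *s u) - (L (int j) (int j) u - b *s u) = L (int i) (int i) u - L (int j) (int j) u - of_nat \<kappa> *s u"
    unfolding assms(7)[symmetric] by (simp add: scale_left_diff_distrib)
  finally show ?thesis
    using assms(1-4,8) Mn N W_op subspace_0[OF W_sub]
    by (rule_tac sl2_vanish[where W = W and N = N and k = \<kappa>, OF _ _ _ _ W_sub]) auto
qed

lemma vanish_plus:
  assumes "1 \<le> i" "i < j" "j \<le> M" "lam i + lam j = of_nat \<kappa>" "\<kappa> < K"
  shows "(L (- int j) (int i) ^^ K) v \<in> W"
proof -
  obtain N where N: "(L (- int j) (int i) ^^ N) v = 0" using nilp(2)[of i j v] assms Mn by auto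
  have "L (- int j) (- int j) v = - L (int j) (int j) v" using L_skew[of "int j" "int j" v] assms Mn by simp
  moreover have "(L (int i) (int i) v - lam i *s v) + (L (int j) (int j) v - lam j *s v) \<in> W"
    by (rule subspace_add[OF W_sub v_cartan v_cartan]) (use assms in auto)
  moreover have "(L (int i) (int i) v - lam i *s v) + (L (int j) (int j) v - lam j *s v) = L (int i) (int i) v - - L (int j) (int j) v - of_nat \<kappa> *s v"
    unfolding assms(4)[symmetric] by (simp add: scale_left_distrib)
  ultimately have h: "L (int i) (int i) v - L (- int j) (- int j) v - of_nat \<kappa> *s v \<in> W" by (simp only:)
  show ?thesis
  proof (rule sl2_vanish[where W = W and N = N and k = \<kappa>, OF _ _ _ _ W_sub _ _ _ _ _ h])
    show "(L (- int j) (int i) ^^ N) v \<in> W" using N subspace_0[OF W_sub] by (simp only:)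
    show "L (int i) (- int j) v \<in> W" using v_raise assms by blast
  qed (use assms Mn W_op in auto)
qed

lemma vanish_v: "1 \<le> i \<Longrightarrow> i < j \<Longrightarrow> j \<le> M \<Longrightarrow> lam i - lam j = of_nat \<kappa> \<Longrightarrow> \<kappa> < K \<Longrightarrow> (L (int j) (int i) ^^ K) v \<in> W"
  by (rule vanish_minus[of i j v "lam i" "lam j"]) (auto intro: v_cartan simp: v_raise)

lemma G_scale_cancel: "of_nat c *s u \<in> G Q \<Longrightarrow> (0::nat) < c \<Longrightarrow> u \<in> G Q"
  using gen_low(5)[of "of_nat c *s u" m W "{v}" Q "inverse (of_nat c)"] by simp

lemma GP_GB: "u \<in> G (\<lambda>p q. deglex_lt M p pl) \<Longrightarrow> u \<in> G (\<lambda>p q. block_lt M p q pl mi)"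
  by (erule G_mono) (simp add: block_lt_def)

lemma yw_GP: "yw M (- int M) pl v \<in> G (\<lambda>p q. deglex_lt M p pl) \<Longrightarrow> X M pl mi v \<in> G (\<lambda>p q. block_lt M p q pl mi)"
  unfolding X_def by (intro GP_GB G_yw_minus)

lemma plus_GP: "deglex_lt M p pl \<Longrightarrow> yw M (- int M) p v \<in> G (\<lambda>p q. deglex_lt M p pl)"
  by (rule plus_in)

lemma low_G: "S \<subseteq> G Q \<Longrightarrow> low m S \<subseteq> G Q"
  unfolding gen_def by (rule low_mono)

lemma plus_degree_lt_GP: "u \<in> G (plus_degree_lt M (sum pl {1..<M})) \<Longrightarrow> u \<in> G (\<lambda>p q. deglex_lt M p pl)"
  by (erule G_mono) (simp add: plus_degree_lt_def deglex_lt_def)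

lemma X_low:
  assumes "u \<in> low m (W \<union> {v})"
  shows "X M pl mi u \<in> G (plus_degree_lt M (Suc (sum pl {1..<M})))"
  using assms
proof (induction arbitrary: pl mi)
  case (low_base s)
  then show ?case by (auto simp: X_W plus_degree_lt_def)
next
  case (low_minus u i j)
  have shift: "of_nat (pl j) *s X M (shift_exp j i pl) mi u \<in> G (plus_degree_lt M (Suc (sum pl {1..<M})))"
  proof (cases "pl j = 0")
    case False
    then have "sum (shift_exp j i pl) {1..<M} = sum pl {1..<M}"
      using low_minus by (auto simp: shift_exp_move sum_move)
    then show ?thesis using low_minus.IH[of "shift_exp j i pl" mi] by simp
  qed simp
  have "X M pl mi (L (int j) (int i) u) = L (int j) (int i) (X M pl mi u) + of_nat (mi j) *s X M pl (shift_exp j i mi) u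
    + of_nat (pl j) *s X M (shift_exp j i pl) mi u"
    using gl_X[of M j i pl mi u] low_minus Mn by simp
  then show ?case using low_minus shift by simp
next
  case (low_plus u i j)
  have "X M pl mi (L (- int j) (int i) u) = L (- int j) (int i) (X M pl mi u)"
    using low_plus Mn unfolding X_def by (simp add: lowplus_yw[symmetric])
  then show ?case using low_plus by simp
qed (use Mn in \<open>simp_all add: X_linear\<close>)

text \<open>Exchanging the two monomials costs only terms of smaller plus degree. A relation among
  minus factors on \<open>v\<close> can thus be proved with the minus monomial acting first and then
  be transferred to the order used in \<open>X\<close>.\<close>

lemma yw_comm:
  assumes "u \<in> low m (W \<union> {v})"
  shows "yw M (- int M) pl (yw M (int M) e u) - X M pl e u \<in> G (plus_degree_lt M (sum pl {1..<M}))"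
proof -
  have yP: "L (- int M) (int c) (X M pl e u) - X M (pl(c := Suc (pl c))) e u \<in> G (plus_degree_lt M (Suc (sum pl {1..<M})))"
    if c: "c \<in> {1..m}" for c pl e
  proof (induction e rule: exponent_induct[where M = M])
    case (zero e)
    have "X M (pl(c := Suc (pl c))) e u = L (- int M) (int c) (X M pl e u)"
      using yw_0[OF zero] yw_Suc[of M "- int M" c pl u] c Mn by (simp add: X_def)
    then show ?case by (simp only: diff_self gen_low(1))
  next
    case (step e i)
    have "L (- int M) (int c) (L (int M) (int i) (X M pl e u)) - L (int M) (int i) (X M (pl(c := Suc (pl c))) e u)
      = L (int M) (int i) (L (- int M) (int c) (X M pl e u) - X M (pl(c := Suc (pl c))) e u) + L (- int i) (int c) (X M pl e u)"
      using step c Mn y_comm_pm[of M c i "X M pl e u"] by (simp add: L_lin)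
    also have "\<dots> \<in> G (plus_degree_lt M (Suc (sum pl {1..<M})))"
    proof (rule gen_low(2))
      show "L (int M) (int i) (L (- int M) (int c) (X M pl e u) - X M (pl(c := Suc (pl c))) e u) \<in> G (plus_degree_lt M (Suc (sum pl {1..<M})))"
        using G_yminus[OF step(2)[unfolded plus_degree_lt_eq]] step(1) unfolding plus_degree_lt_eq by (simp only: atLeastLessThanSuc_atLeastAtMost)
      show "L (- int i) (int c) (X M pl e u) \<in> G (plus_degree_lt M (Suc (sum pl {1..<M})))"
        using step(1) c Mn X_low[OF assms, of pl e] by (intro gen_low(8)) auto
    qed
    finally show ?case using step Mn by (simp only: X_minus)
  qed
  show ?thesis
  proof (induction pl rule: exponent_induct[where M = M])
    case (zero pl)
    then show ?case unfolding X_def by (simp only: yw_0) simp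
  next
    case (step pl c)
    have c: "c \<in> {1..m}" using step by auto
    have "L (- int M) (int c) (yw M (- int M) pl (yw M (int M) e u)) - X M (pl(c := Suc (pl c))) e u =
      L (- int M) (int c) (yw M (- int M) pl (yw M (int M) e u) - X M pl e u)
      + (L (- int M) (int c) (X M pl e u) - X M (pl(c := Suc (pl c))) e u)"
      using c Mn by (simp add: L_lin)
    also have "\<dots> \<in> G (plus_degree_lt M (Suc (sum pl {1..<M})))"
      by (rule gen_low(2)[OF G_yplus[OF step(2) c] yP[OF c]])
    finally show ?case using step(1) Mn by (simp only: yw_Suc sum_fun_upd_Suc lev_simps)
  qed
qed

lemma v_low: "v \<in> low m (W \<union> {v})" by (auto intro: low_base)

text \<open>\<epsilon>_m + \<epsilon>_M is a simple root with label \<open>k M\<close>, so the power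
  \<open>pl m\<close> of its lowering operator already sends \<open>v\<close> into
  \<open>W\<close>.\<close>

lemma upper_plus_last:
  assumes "1 \<le> m" "k M < pl m"
  shows "X M pl mi v \<in> G (\<lambda>p q. block_lt M p q pl mi)"
proof -
  have "(L (- int M) (int m) ^^ pl m) v \<in> W"
    using vanish_plus[of m M "k M" "pl m"] assms dom_last by simp
  then have "yw M (- int M) (pl(m := 0)) (yw M (- int M) (\<lambda>i. if i = m then pl m else 0) v) \<in> W"
    using yw_single[of m M "- int M" "pl m" v] assms Mn by (simp add: yw_W)
  moreover have "(\<lambda>i. (pl(m := 0)) i + (if i = m then pl m else 0)) = pl" by auto
  ultimately have "yw M (- int M) pl v \<in> W" using Mn by (simp add: yw_yw)
  then show ?thesis by (intro yw_GP) simp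
qed

text \<open>\<epsilon>_m - \<epsilon>_M is simple with label \<open>k m\<close>. The plus monomial
  is applied after the vanishing minus power and then exchanged with it by
  \<open>yw_comm\<close>.\<close>

lemma upper_minus_last:
  assumes "1 \<le> m" "k m < mi m"
  shows "X M pl mi v \<in> G (\<lambda>p q. block_lt M p q pl mi)"
proof -
  let ?e = "\<lambda>i. if i = m then mi m else 0"
  have "(L (int M) (int m) ^^ mi m) v \<in> W"
    using vanish_v[of m M "k m" "mi m"] assms dom[of m] by simp
  then have "yw M (int M) ?e v \<in> W" using yw_single[of m M "int M" "mi m" v] assms Mn by simp
  then have "yw M (- int M) pl (yw M (int M) ?e v) \<in> G (\<lambda>p q. deglex_lt M p pl)" by (simp add: yw_W)
  moreover have "yw M (- int M) pl (yw M (int M) ?e v) - X M pl ?e v \<in> G (\<lambda>p q. deglex_lt M p pl)"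
    by (rule plus_degree_lt_GP[OF yw_comm[OF v_low]])
  ultimately have "X M pl ?e v \<in> G (\<lambda>p q. deglex_lt M p pl)" using gen_low(3) by fastforce
  then have "yw M (int M) (mi(m := 0)) (X M pl ?e v) \<in> G (\<lambda>p q. deglex_lt M p pl)" by (rule G_yw_minus)
  moreover have "(\<lambda>i. (mi(m := 0)) i + ?e i) = mi" by auto
  ultimately have "X M pl mi v \<in> G (\<lambda>p q. deglex_lt M p pl)" unfolding X_def using Mn by (simp add: yw_yw)
  then show ?thesis by (rule GP_GB)
qed

text \<open>For f = \<open>L (i+1) i\<close> the power \<open>pl i\<close> sends \<open>v\<close>
  into \<open>W\<close>. To this relation a plus monomial is applied whose exponent at
  \<open>i\<close> has been stored at \<open>i + 1\<close>. By \<open>yw_pow\<close> its leading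
  term moves these units back and is the monomial wanted; the other terms keep a smaller exponent at
  \<open>i\<close> and are lexicographically smaller.\<close>

lemma upper_plus:
  assumes i: "1 \<le> i" "i < m" and "k i < pl i"
  shows "X M pl mi v \<in> G (\<lambda>p q. block_lt M p q pl mi)"
proof (rule yw_GP)
  let ?f = "L (int (Suc i)) (int i)"
  let ?e = "pl(i := 0, Suc i := pl (Suc i) + pl i)"
  have W: "yw M (- int M) ?e ((?f ^^ pl i) v) \<in> W"
    using vanish_v[of i "Suc i" "k i" "pl i"] assms dom[of i] by (intro yw_W) auto
  have mv: "move (Suc i) i j ?e = pl(i := j, Suc i := pl (Suc i) + pl i - j)" for j
    by (auto simp: move_def)
  have "\<exists>c::nat. c > 0 \<and> yw M (- int M) ?e ((?f ^^ pl i) v) - of_nat c *s (?f ^^ (pl i - pl i)) (yw M (- int M) (move (Suc i) i (pl i) ?e) v)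
     \<in> low m {yw M (- int M) (move (Suc i) i j ?e) v | j. j < pl i}"
    using i Mn by (intro yw_pow) auto
  then obtain c :: nat where c: "c > 0" "yw M (- int M) ?e ((?f ^^ pl i) v) - of_nat c *s yw M (- int M) pl v
     \<in> low m {yw M (- int M) (pl(i := j, Suc i := pl (Suc i) + pl i - j)) v | j. j < pl i}"
    unfolding mv by auto
  have "low m {yw M (- int M) (pl(i := j, Suc i := pl (Suc i) + pl i - j)) v | j. j < pl i} \<subseteq> G (\<lambda>p q. deglex_lt M p pl)"
  proof (intro low_G, clarify)
    fix j assume j: "j < pl i"
    have "sum (move i (Suc i) (pl i - j) pl) {1..<M} = sum pl {1..<M}" using i by (intro sum_move) auto
    moreover have "move i (Suc i) (pl i - j) pl = pl(i := j, Suc i := pl (Suc i) + pl i - j)"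
      using j by (auto simp: move_def)
    ultimately have "deglex_lt M (pl(i := j, Suc i := pl (Suc i) + pl i - j)) pl"
      using i j by (auto simp: deglex_lt_def intro!: bexI[of _ i])
    then show "yw M (- int M) (pl(i := j, Suc i := pl (Suc i) + pl i - j)) v \<in> G (\<lambda>p q. deglex_lt M p pl)" by (rule plus_GP)
  qed
  with c(2) have "yw M (- int M) ?e ((?f ^^ pl i) v) - of_nat c *s yw M (- int M) pl v \<in> G (\<lambda>p q. deglex_lt M p pl)" by blast
  from gen_low(3)[OF gen_low(9)[OF W] this] have "of_nat c *s yw M (- int M) pl v \<in> G (\<lambda>p q. deglex_lt M p pl)" by simp
  then show "yw M (- int M) pl v \<in> G (\<lambda>p q. deglex_lt M p pl)" using c(1) by (rule G_scale_cancel)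
qed

lemma deglex_lt_lower_at:
  assumes "i \<in> {1..<m}" "j < pl i" "\<And>l. l \<noteq> i \<Longrightarrow> l \<noteq> Suc i \<Longrightarrow> p l = pl l" "p i = j" "p (Suc i) = pl (Suc i) + (pl i - j)"
  shows "deglex_lt M p pl"
proof -
  have "p = move i (Suc i) (pl i - j) pl" using assms by (auto simp: move_def fun_eq_iff)
  moreover have "sum (move i (Suc i) (pl i - j) pl) {1..<M} = sum pl {1..<M}" using assms by (intro sum_move) auto
  ultimately show ?thesis using assms by (auto simp: deglex_lt_def intro!: bexI[of _ i])
qed

text \<open>Without its factors at \<open>i\<close>, the plus monomial on \<open>v\<close> is
  singular for \<epsilon>_i - \<epsilon>_(i+1) with label \<open>k i + pl (i+1)\<close>, so the
  power \<open>pl i + mi i\<close> of f = \<open>L (i+1) i\<close> sends it into \<open>W\<close>.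
  The plus factors absorb \<open>pl i\<close> copies of f and the minus factors the remaining
  \<open>mi i\<close>; both are extracted by \<open>yw_pow\<close>.\<close>

lemma upper_both:
  assumes i: "1 \<le> i" "i < m" and gt: "k i + pl (Suc i) < pl i + mi i"
  shows "X M pl mi v \<in> G (\<lambda>p q. block_lt M p q pl mi)"
proof -
  let ?f = "L (int (Suc i)) (int i)" and ?N = "pl i + mi i"
  let ?q = "pl(i := 0)"
  let ?u = "yw M (- int M) ?q v"
  let ?e = "\<lambda>l. if l = Suc i then pl i else 0"
  have X0: "?u = X M ?q (\<lambda>_. 0) v" by (simp add: X_def yw_0)
  have "L (int i) (int (Suc i)) ?u = yw M (- int M) ?q (L (int i) (int (Suc i)) v)"
    using gl_yw[of M "- int M" i "Suc i" ?q v] i Mn by simp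
  then have eu: "L (int i) (int (Suc i)) ?u \<in> W" using v_raise[of i "Suc i"] i by (simp add: yw_W)
  have fN: "(?f ^^ ?N) ?u \<in> W"
  proof (rule vanish_minus[OF _ _ _ eu])
    show "L (int i) (int i) ?u - (lam i - of_nat 0) *s ?u \<in> W"
      using cartan_X[of i ?q "\<lambda>_. 0"] i unfolding X0 by simp
    show "L (int (Suc i)) (int (Suc i)) ?u - (lam (Suc i) - of_nat (pl (Suc i))) *s ?u \<in> W"
      using cartan_X[of "Suc i" ?q "\<lambda>_. 0"] i unfolding X0 by simp
    show "lam i - of_nat 0 - (lam (Suc i) - of_nat (pl (Suc i))) = of_nat (k i + pl (Suc i))"
      using dom[of i] i by (simp add: algebra_simps)
  qed (use i gt in auto)
  have mv: "(\<lambda>l. move (Suc i) i j ?e l + ?q l) = pl(i := j, Suc i := pl (Suc i) + (pl i - j))" for j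
    by (auto simp: move_def)
  have mv': "yw M (- int M) (move (Suc i) i j ?e) ?u = yw M (- int M) (pl(i := j, Suc i := pl (Suc i) + (pl i - j))) v" for j
    unfolding mv[symmetric] using Mn by (simp add: yw_yw)
  have "\<exists>c::nat. c > 0 \<and> yw M (- int M) ?e ((?f ^^ ?N) ?u) - of_nat c *s (?f ^^ (?N - pl i)) (yw M (- int M) (move (Suc i) i (pl i) ?e) ?u)
     \<in> low m {yw M (- int M) (move (Suc i) i j ?e) ?u | j. j < pl i}"
    using i Mn by (intro yw_pow) auto
  then obtain c :: nat where c: "c > 0" "yw M (- int M) ?e ((?f ^^ ?N) ?u) - of_nat c *s (?f ^^ mi i) (yw M (- int M) pl v)
     \<in> low m {yw M (- int M) (pl(i := j, Suc i := pl (Suc i) + (pl i - j))) v | j. j < pl i}"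
    unfolding mv' by auto
  have "low m {yw M (- int M) (pl(i := j, Suc i := pl (Suc i) + (pl i - j))) v | j. j < pl i} \<subseteq> G (\<lambda>p q. deglex_lt M p pl)"
    using i by (intro low_G) (auto intro!: plus_GP deglex_lt_lower_at)
  with c(2) have "yw M (- int M) ?e ((?f ^^ ?N) ?u) - of_nat c *s (?f ^^ mi i) (yw M (- int M) pl v) \<in> G (\<lambda>p q. deglex_lt M p pl)" by blast
  from gen_low(3)[OF gen_low(9)[OF yw_W[OF fN disjI2[OF refl], of ?e]] this]
  have "of_nat c *s (?f ^^ mi i) (yw M (- int M) pl v) \<in> G (\<lambda>p q. deglex_lt M p pl)" by simp
  then have fs: "(?f ^^ mi i) (yw M (- int M) pl v) \<in> G (\<lambda>p q. deglex_lt M p pl)" using c(1) by (rule G_scale_cancel)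
  \<comment> \<open>The remaining power of f is absorbed by the minus monomial in the same way; only
    here do the minus exponents enter the comparison.\<close>
  let ?e2 = "mi(i := 0, Suc i := mi (Suc i) + mi i)" and ?z = "yw M (- int M) pl v"
  have mv2: "move (Suc i) i j ?e2 = mi(i := j, Suc i := mi (Suc i) + mi i - j)" for j
    by (auto simp: move_def)
  have "\<exists>c::nat. c > 0 \<and> yw M (int M) ?e2 ((?f ^^ mi i) ?z) - of_nat c *s (?f ^^ (mi i - mi i)) (yw M (int M) (move (Suc i) i (mi i) ?e2) ?z)
     \<in> low m {yw M (int M) (move (Suc i) i j ?e2) ?z | j. j < mi i}"
    using i Mn by (intro yw_pow) auto
  then obtain c :: nat where c: "c > 0" "yw M (int M) ?e2 ((?f ^^ mi i) ?z) - of_nat c *s X M pl mi v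
     \<in> low m {X M pl (mi(i := j, Suc i := mi (Suc i) + mi i - j)) v | j. j < mi i}"
    unfolding mv2 X_def by auto
  have "low m {X M pl (mi(i := j, Suc i := mi (Suc i) + mi i - j)) v | j. j < mi i} \<subseteq> G (\<lambda>p q. block_lt M p q pl mi)"
    using i by (intro low_G) (auto simp: block_lt_def intro!: gen_low(10) deglex_lt_lower_at)
  with c(2) have "yw M (int M) ?e2 ((?f ^^ mi i) ?z) - of_nat c *s X M pl mi v \<in> G (\<lambda>p q. block_lt M p q pl mi)" by blast
  from gen_low(3)[OF GP_GB[OF G_yw_minus[OF fs, of ?e2], of mi] this]
  have "of_nat c *s X M pl mi v \<in> G (\<lambda>p q. block_lt M p q pl mi)" by simp
  then show ?thesis using c(1) by (rule G_scale_cancel)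
qed

text \<open>For \<open>t = 0\<close> this is the sl2 relation of \<epsilon>_i - \<epsilon>_M, whose
  label is \<open>k i + k m\<close>. The raising operator of \<epsilon>_m - \<epsilon>_M turns one
  factor of \<epsilon>_i - \<epsilon>_M into one of \<epsilon>_i - \<epsilon>_m and sends
  \<open>v\<close> into \<open>W\<close>; applied to the relation for \<open>a + 1\<close> and
  \<open>t\<close> it yields the one for \<open>a\<close> and \<open>t + 1\<close>.\<close>

lemma rank_two_vanish:
  assumes m: "1 \<le> i" "Suc i = m" and "k i + k m < a + t"
  shows "(L (int M) (int i) ^^ a) ((L (int m) (int i) ^^ t) v) \<in> W"
  using assms(3)
proof (induction t arbitrary: a)
  case 0
  have "lam i - lam M = of_nat (k i + k m)"
    using dom[of i] dom[of m] m Mn by (simp add: algebra_simps)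
  then show ?case using vanish_v[of i M "k i + k m" a] 0 m by simp
next
  case (Suc t)
  let ?A = "L (int M) (int i)" and ?f = "L (int m) (int i)" and ?e = "L (int m) (int M)"
  have ix: "ix n (int M)" "ix n (int m)" "ix n (int i)" "ix n (- int M)" using m Mn by auto
  have eA: "?e (?A u) = ?A (?e u) + ?f u" and ef: "?e (?f u) = ?f (?e u)" and fA: "?f (?A u) = ?A (?f u)" for u
    using m Mn by (subst L_bracket; auto)+
  have pow: "?e ((?A ^^ p) u) = (?A ^^ p) (?e u) + of_nat p *s (?A ^^ (p - 1)) (?f u)" for p u
  proof (induction p)
    case (Suc p)
    have "of_nat p *s ?A ((?A ^^ (p - 1)) (?f u)) = of_nat p *s (?A ^^ p) (?f u)"
      by (cases p) auto
    then show ?case using Suc eA[of "(?A ^^ p) u"] ix funpow_commute[of ?f ?A, OF fA]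
      by (simp add: L_lin scale_left_distrib of_nat_Suc)
  qed simp
  have et: "?e ((?f ^^ t) v) = (?f ^^ t) (?e v)" by (rule funpow_commute[of ?e ?f, OF ef])
  have "?e v \<in> W" using v_raise[of m M] m by simp
  then have "(?f ^^ t) (?e v) \<in> W" by (rule pow_in[of W, rotated]) (use m in \<open>auto intro: W_op\<close>)
  then have 1: "(?A ^^ Suc a) (?e ((?f ^^ t) v)) \<in> W" unfolding et by (rule pow_in[of W, rotated]) (use m in \<open>auto intro: W_op\<close>)
  have "(?A ^^ Suc a) ((?f ^^ t) v) \<in> W" by (rule Suc.IH) (use Suc.prems in simp)
  then have "?e ((?A ^^ Suc a) ((?f ^^ t) v)) \<in> W" using m by (intro W_op) auto
  then have "(?A ^^ Suc a) (?e ((?f ^^ t) v)) + of_nat (Suc a) *s (?A ^^ a) (?f ((?f ^^ t) v)) \<in> W"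
    unfolding pow[of "Suc a"] by simp
  from subspace_diff[OF W_sub this 1] have "of_nat (Suc a) *s (?A ^^ a) ((?f ^^ Suc t) v) \<in> W" by simp
  then have "inverse (of_nat (Suc a)) *s of_nat (Suc a) *s (?A ^^ a) ((?f ^^ Suc t) v) \<in> W"
    by (rule subspace_scale[OF W_sub])
  then show ?case by simp
qed

text \<open>\<open>Z a c t\<close> has minus exponents \<open>a\<close> at \<open>m - 1\<close> and
  \<open>c\<close> at \<open>m\<close>, acting on f^t v with f = \<open>L m (m-1)\<close>. Modulo
  terms with smaller \<open>t\<close> it lies in \<open>W\<close> once \<open>a + c + t\<close>
  exceeds \<open>k (m-1) + k m\<close>. A plus monomial with its exponent at \<open>m - 1\<close>
  stored at \<open>m\<close> then converts f^t with \<open>t = pl (m-1)\<close> into the plus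
  exponent wanted, and smaller \<open>t\<close> into smaller plus monomials.\<close>

lemma upper_triple:
  assumes m: "2 \<le> m" and gt: "k (m - 1) + k m < mi (m - 1) + pl (m - 1) + mi m"
  shows "X M pl mi v \<in> G (\<lambda>p q. block_lt M p q pl mi)"
proof -
  define i where "i = m - 1"
  have i: "1 \<le> i" "i < m" "Suc i = m" using m by (auto simp: i_def)
  let ?f = "L (int m) (int i)" and ?E = "L (int i) (int m)"
  define z2 where "z2 a c = (\<lambda>l. if l = i then a else if l = m then c else (0::nat))" for a c
  define Z where "Z a c t = yw M (int M) (z2 a c) ((?f ^^ t) v)" for a c t
  define T where "T t = span (W \<union> {Z a c t' | a c t'. t' < t})" for t
  have WT: "w \<in> T t" if "w \<in> W" for w t unfolding T_def using that by (intro span_base) auto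
  have ZT: "Z a c t' \<in> T t" if "t' < t" for a c t' t unfolding T_def using that by (intro span_base) auto
  have Tsub: "subspace (T t)" for t by (simp add: T_def)
  \<comment> \<open>The raising operator of \<epsilon>_i - \<epsilon>_m either moves a minus factor
    from \<open>i\<close> to \<open>m\<close> or removes one f; the second term has a smaller
    \<open>t\<close>.\<close>
  have EZ: "\<exists>\<kappa>. ?E (Z a c t) + of_nat a *s Z (a - 1) (Suc c) t - \<kappa> *s Z a c (t - 1) \<in> W \<and> (t = 0 \<longrightarrow> \<kappa> = 0)" for a c t
  proof -
    let ?\<mu> = "of_nat (k i) :: complex"
    let ?\<kappa> = "of_nat t * (?\<mu> - of_nat t + 1) :: complex"
    have h: "L (int i) (int i) v - L (int m) (int m) v - ?\<mu> *s v \<in> W"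
    proof -
      have "(L (int i) (int i) v - lam i *s v) - (L (int m) (int m) v - lam m *s v) \<in> W"
        by (rule subspace_diff[OF W_sub v_cartan v_cartan]) (use i in auto)
      also have "(L (int i) (int i) v - lam i *s v) - (L (int m) (int m) v - lam m *s v) = L (int i) (int i) v - L (int m) (int m) v - ?\<mu> *s v"
        using dom[of i] i by (simp add: scale_left_diff_distrib flip: dom[of i])
      finally show ?thesis .
    qed
    have "?E ((?f ^^ t) v) - ?\<kappa> *s (?f ^^ (t - 1)) v \<in> W"
      by (rule sl2_action[OF _ _ _ _ W_sub _ _ _ _ h]) (use i Mn W_op v_raise[of i m] in auto)
    then have "yw M (int M) (z2 a c) (?E ((?f ^^ t) v) - ?\<kappa> *s (?f ^^ (t - 1)) v) \<in> W" by (intro yw_W) auto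
    moreover have "?E (Z a c t) = yw M (int M) (z2 a c) (?E ((?f ^^ t) v)) - of_nat (z2 a c i) *s yw M (int M) (shift_exp i m (z2 a c)) ((?f ^^ t) v)"
      unfolding Z_def using i Mn by (intro gl_yw) auto
    moreover have "z2 a c i = a" "shift_exp i m (z2 a c) = z2 (a - 1) (Suc c)"
      using i by (auto simp: z2_def shift_exp_def Let_def)
    ultimately show ?thesis
      using Mn by (intro exI[of _ ?\<kappa>]) (simp add: Z_def yw_diff yw_scale)
  qed
  have ET: "?E u \<in> T t" if "u \<in> T t" for u t
    using that unfolding T_def
  proof (induction rule: span_induct_alt)
    case base
    then show ?case using i Mn by (simp add: L_lin span_zero)
  next
    case (step c x y)
    have "?E x \<in> T t"
      using step(1)
    proof
      assume "x \<in> W"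
      then show ?thesis using i by (intro WT W_op) auto
    next
      assume "x \<in> {Z a c t' |a c t'. t' < t}"
      then obtain a c t' where x: "x = Z a c t'" "t' < t" by auto
      obtain \<kappa> where \<kappa>: "?E (Z a c t') + of_nat a *s Z (a - 1) (Suc c) t' - \<kappa> *s Z a c (t' - 1) \<in> W" using EZ by blast
      have "?E (Z a c t') + of_nat a *s Z (a - 1) (Suc c) t' - \<kappa> *s Z a c (t' - 1) - of_nat a *s Z (a - 1) (Suc c) t' + \<kappa> *s Z a c (t' - 1) \<in> T t"
        using x by (intro subspace_add[OF Tsub] subspace_diff[OF Tsub] subspace_scale[OF Tsub] WT[OF \<kappa>] ZT) auto
      then show ?thesis using x by simp
    qed
    then show ?case using step i Mn Tsub[of t] unfolding T_def by (simp add: L_lin span_add span_scale)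
  qed
  \<comment> \<open>For \<open>c = 0\<close> this is \<open>rank_two_vanish\<close>; the raising
    operator then trades \<open>(a + 1, c)\<close> for \<open>(a, c + 1)\<close> with a nonzero
    coefficient.\<close>
  have Zin: "Z a c t \<in> T t" if "k i + k m < a + c + t" for a c t
    using that
  proof (induction c arbitrary: a)
    case 0
    have "(\<lambda>l. if l = i then a else 0) = z2 a 0" by (auto simp: z2_def)
    then have "Z a 0 t = (L (int M) (int i) ^^ a) ((?f ^^ t) v)"
      unfolding Z_def using yw_single[of i M "int M" a "(?f ^^ t) v"] i Mn by simp
    then show ?case using rank_two_vanish[OF i(1,3), of a t] 0 WT by simp
  next
    case (Suc c)
    have "Z (Suc a) c t \<in> T t" by (rule Suc.IH) (use Suc.prems in simp)
    then have 1: "?E (Z (Suc a) c t) \<in> T t" by (rule ET)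
    obtain \<kappa> where \<kappa>: "?E (Z (Suc a) c t) + of_nat (Suc a) *s Z a (Suc c) t - \<kappa> *s Z (Suc a) c (t - 1) \<in> W" "t = 0 \<longrightarrow> \<kappa> = 0"
      using EZ[of "Suc a" c t] by auto
    have 2: "\<kappa> *s Z (Suc a) c (t - 1) \<in> T t"
      using \<kappa>(2) ZT[of "t - 1" t] Tsub[of t] by (cases "t = 0") (auto simp: subspace_0 subspace_scale)
    have "?E (Z (Suc a) c t) + of_nat (Suc a) *s Z a (Suc c) t - \<kappa> *s Z (Suc a) c (t - 1) + \<kappa> *s Z (Suc a) c (t - 1) - ?E (Z (Suc a) c t) \<in> T t"
      by (rule subspace_diff[OF Tsub subspace_add[OF Tsub WT[OF \<kappa>(1)] 2] 1])
    then have "of_nat (Suc a) *s Z a (Suc c) t \<in> T t" by simp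
    then have "inverse (of_nat (Suc a)) *s of_nat (Suc a) *s Z a (Suc c) t \<in> T t" by (rule subspace_scale[OF Tsub])
    then show ?case by simp
  qed
  let ?q = "pl(i := 0, m := pl m + pl i)"
  have fl: "(?f ^^ t) v \<in> low m (W \<union> {v})" for t
    using i by (intro pow_in[of "low m (W \<union> {v})"] low_minus v_low) auto
  have mv: "move m i j ?q = pl(i := j, m := pl m + pl i - j)" for j
    using i by (auto simp: move_def)
  have sq: "sum ?q {1..<M} = sum pl {1..<M}"
  proof -
    have "?q = move i m (pl i) pl" using i by (auto simp: move_def)
    then show ?thesis using sum_move[of i M m "pl i" pl] i by simp
  qed
  have comm: "yw M (- int M) ?q (Z a c t) - yw M (int M) (z2 a c) (yw M (- int M) ?q ((?f ^^ t) v)) \<in> G (\<lambda>p q. deglex_lt M p pl)" for a c t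
    using yw_comm[OF fl, of ?q "z2 a c" t] unfolding sq Z_def X_def by (rule plus_degree_lt_GP)
  have lower: "yw M (- int M) (pl(i := j, m := pl m + pl i - j)) v \<in> G (\<lambda>p q. deglex_lt M p pl)" if "j < pl i" for j
    using that i by (intro plus_GP deglex_lt_lower_at[of i j]) auto
  have pw: "\<exists>c::nat. c > 0 \<and> yw M (- int M) ?q ((?f ^^ t) v) - of_nat c *s yw M (- int M) (pl(i := t, m := pl m + pl i - t)) v \<in> G (\<lambda>p q. deglex_lt M p pl)"
    if "t \<le> pl i" for t
  proof -
    have "\<exists>c::nat. c > 0 \<and> yw M (- int M) ?q ((?f ^^ t) v) - of_nat c *s (?f ^^ (t - t)) (yw M (- int M) (move m i t ?q) v)
       \<in> low m {yw M (- int M) (move m i j ?q) v | j. j < t}"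
      using i Mn that by (intro yw_pow) auto
    moreover have "low m {yw M (- int M) (move m i j ?q) v | j. j < t} \<subseteq> G (\<lambda>p q. deglex_lt M p pl)"
      unfolding mv by (intro low_G) (use that lower in auto)
    ultimately show ?thesis unfolding mv by auto
  qed
  \<comment> \<open>For \<open>t < pl i\<close> even the leading term supplied by \<open>pw\<close>
    has a smaller exponent at \<open>i\<close>, so the whole vector is small.\<close>
  have small: "yw M (- int M) ?q (Z a c t) \<in> G (\<lambda>p q. deglex_lt M p pl)" if t: "t < pl i" for a c t
  proof -
    obtain c' :: nat where "yw M (- int M) ?q ((?f ^^ t) v) - of_nat c' *s yw M (- int M) (pl(i := t, m := pl m + pl i - t)) v \<in> G (\<lambda>p q. deglex_lt M p pl)"
      using pw[OF less_imp_le[OF t]] by blast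
    from gen_low(2)[OF this gen_low(5)[OF lower[OF t], of "of_nat c'"]] have "yw M (- int M) ?q ((?f ^^ t) v) \<in> G (\<lambda>p q. deglex_lt M p pl)" by simp
    from gen_low(2)[OF comm[of a c t] G_yw_minus[OF this, of "z2 a c"]] show ?thesis by simp
  qed
  have TG: "yw M (- int M) ?q u \<in> G (\<lambda>p q. deglex_lt M p pl)" if "u \<in> T (pl i)" for u
    using that unfolding T_def
  proof (induction rule: span_induct_alt)
    case base
    then show ?case using Mn by (simp add: yw_zero)
  next
    case (step c x y)
    have x: "yw M (- int M) ?q x \<in> G (\<lambda>p q. deglex_lt M p pl)"
      using step(1) small yw_W by auto
    have "c *s yw M (- int M) ?q x + yw M (- int M) ?q y \<in> G (\<lambda>p q. deglex_lt M p pl)"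
      by (rule gen_low(2)[OF gen_low(5)[OF x]]) (rule step)
    then show ?case using Mn by (simp only: yw_add yw_scale lev_simps)
  qed
  let ?Z = "Z (mi i) (mi m) (pl i)"
  have "?Z \<in> T (pl i)" using gt by (intro Zin) (simp add: i_def)
  from gen_low(3)[OF TG[OF this] comm[of "mi i" "mi m" "pl i"]]
  have 1: "yw M (int M) (z2 (mi i) (mi m)) (yw M (- int M) ?q ((?f ^^ pl i) v)) \<in> G (\<lambda>p q. deglex_lt M p pl)" by simp
  have "pl(i := pl i, m := pl m + pl i - pl i) = pl" using i by auto
  then obtain c :: nat where c: "c > 0" "yw M (- int M) ?q ((?f ^^ pl i) v) - of_nat c *s yw M (- int M) pl v \<in> G (\<lambda>p q. deglex_lt M p pl)"
    using pw[of "pl i"] by auto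
  from gen_low(3)[OF 1 G_yw_minus[OF c(2), of "z2 (mi i) (mi m)"]]
  have "of_nat c *s yw M (int M) (z2 (mi i) (mi m)) (yw M (- int M) pl v) \<in> G (\<lambda>p q. deglex_lt M p pl)"
    using Mn by (simp add: yw_diff yw_scale)
  from G_scale_cancel[OF this c(1)]
  have "yw M (int M) (mi(i := 0, m := 0)) (yw M (int M) (z2 (mi i) (mi m)) (yw M (- int M) pl v)) \<in> G (\<lambda>p q. deglex_lt M p pl)"
    by (rule G_yw_minus)
  moreover have "(\<lambda>l. (mi(i := 0, m := 0)) l + z2 (mi i) (mi m) l) = mi" by (auto simp: z2_def)
  ultimately have "X M pl mi v \<in> G (\<lambda>p q. deglex_lt M p pl)" using Mn by (simp add: yw_yw X_def)
  then show ?thesis by (rule GP_GB)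
qed

theorem upper_bound:
  assumes "1 \<le> m" "\<not> block_cond m k pl mi"
  shows "X M pl mi v \<in> G (\<lambda>p q. block_lt M p q pl mi)"
proof -
  consider i where "1 \<le> i" "i < m" "k i < pl i" | i where "1 \<le> i" "i < m" "k i + pl (Suc i) < pl i + mi i"
    | "k m < mi m" | "k M < pl m" | "2 \<le> m" "k (m - 1) + k m < mi (m - 1) + pl (m - 1) + mi m"
    using assms(2) unfolding block_cond_def by (auto simp: not_le)
  then show ?thesis
    by cases (use assms(1) in \<open>auto intro: upper_plus upper_both upper_minus_last upper_plus_last upper_triple\<close>)
qed

end

section \<open>The lower bound from a unitary module\<close>

definition fscale :: "complex \<Rightarrow> ('a \<Rightarrow> complex) \<Rightarrow> 'a \<Rightarrow> complex" where
  "fscale c f = (\<lambda>x. c * f x)"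

definition supp :: "'a set \<Rightarrow> ('a \<Rightarrow> complex) \<Rightarrow> bool" where
  "supp B f \<longleftrightarrow> (\<forall>x. x \<notin> B \<longrightarrow> f x = 0)"

definition ip :: "'a set \<Rightarrow> ('a \<Rightarrow> complex) \<Rightarrow> ('a \<Rightarrow> complex) \<Rightarrow> complex" where
  "ip B f g = (\<Sum>x\<in>B. cnj (f x) * g x)"

lemma vector_space_fscale: "vector_space fscale"
  by unfold_locales (auto simp: fscale_def fun_eq_iff algebra_simps)

lemma supp_simps [simp]:
  "supp B 0" "supp B f \<Longrightarrow> supp B g \<Longrightarrow> supp B (f + g)" "supp B f \<Longrightarrow> supp B (fscale c f)"
  by (auto simp: supp_def fscale_def)

lemma ip_simps [simp]:
  "ip B f 0 = 0" "ip B 0 g = 0"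
  "ip B f (g + h) = ip B f g + ip B f h" "ip B (f + g) h = ip B f h + ip B g h"
  "ip B f (g - h) = ip B f g - ip B f h"
  "ip B f (fscale c g) = c * ip B f g" "ip B (fscale c f) g = cnj c * ip B f g"
  by (auto simp: ip_def fscale_def algebra_simps sum.distrib sum_distrib_left sum_subtractf)

lemma ip_self_eq_0:
  assumes "finite B" "supp B f" "ip B f f = 0"
  shows "f = 0"
proof -
  have "of_real (\<Sum>x\<in>B. (cmod (f x))\<^sup>2) = ip B f f"
    unfolding ip_def of_real_sum by (intro sum.cong refl) (simp only: complex_norm_square mult.commute)
  then have "(\<Sum>x\<in>B. (cmod (f x))\<^sup>2) = 0" using assms(3) by (metis of_real_eq_0_iff)
  then have "\<forall>x\<in>B. f x = 0" using assms(1) by (simp add: sum_nonneg_eq_0_iff)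
  then show ?thesis using assms(2) by (auto simp: supp_def fun_eq_iff)
qed

text \<open>Only the functions supported on the finite set \<open>B\<close> form the Hermitian
  space; the operators act on all functions, so that \<open>so_module\<close> applies without a
  carrier set. Adjointness of \<open>L a b\<close> and \<open>L b a\<close> expresses unitarity for
  the compact real form.\<close>

locale unitary_module = so_module fscale n L
  for n and L :: "int \<Rightarrow> int \<Rightarrow> ('a \<Rightarrow> complex) \<Rightarrow> 'a \<Rightarrow> complex" +
  fixes B :: "'a set"
  assumes finB: "finite B"
    and supp_L: "\<And>a b f. ix n a \<Longrightarrow> ix n b \<Longrightarrow> supp B f \<Longrightarrow> supp B (L a b f)"
    and adj: "\<And>a b f g. ix n a \<Longrightarrow> ix n b \<Longrightarrow> supp B f \<Longrightarrow> supp B g \<Longrightarrow> ip B (L a b f) g = ip B f (L b a g)"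
begin

text \<open>With e = \<open>L a b\<close> and f = \<open>L b a\<close>, the coefficient in
  \<open>sl2_action\<close> is zero for the power \<kappa> + 1, so e f^(\<kappa>+1) u = 0. As e is
  adjoint to f, the vector f^(\<kappa>+1) u has norm zero.\<close>

lemma unitary_vanish:
  assumes ix: "ix n a" "ix n b" "a \<noteq> b" "a \<noteq> - b" and u: "supp B u" "L a b u = 0" "L a a u - L b b u = fscale (of_nat \<kappa>) u"
  shows "(L b a ^^ Suc \<kappa>) u = 0"
proof -
  let ?w = "(L b a ^^ \<kappa>) u"
  have "L a b ((L b a ^^ Suc \<kappa>) u) - fscale (of_nat (Suc \<kappa>) * (of_nat \<kappa> - of_nat (Suc \<kappa>) + 1)) ((L b a ^^ (Suc \<kappa> - 1)) u) \<in> {0}"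
    by (rule sl2_action[OF ix]) (use u ix in \<open>auto simp: L_zero\<close>)
  then have "L a b (L b a ?w) = 0" by (simp add: of_nat_Suc)
  moreover have s: "supp B ((L b a ^^ N) u)" for N by (induction N) (auto simp: u supp_L ix)
  ultimately have "ip B (L b a ?w) (L b a ?w) = 0"
    using adj[OF ix(2,1) s, of "L b a ?w"] supp_L[OF ix(2,1) s] by simp
  then show ?thesis using ip_self_eq_0[OF finB] supp_L[OF ix(2,1) s] by simp
qed

end

section \<open>Separation of weights by the height\<close>

context so_module
begin

text \<open>The half sum of the positive coroots of type D_M, with coordinates M - 1, ..., 0. A
  lowering operator decreases its eigenvalue by the height of the root, a positive integer.\<close>

definition height :: "nat \<Rightarrow> 'v \<Rightarrow> 'v" where
  "height M x = (\<Sum>i\<in>{1..M}. of_nat (M - i) *s L (int i) (int i) x)"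

lemma height_low:
  assumes "M \<le> n" "1 \<le> i" "i < j" "j \<le> M"
  shows "height M (L (int j) (int i) x) = L (int j) (int i) (height M x) - of_nat (j - i) *s L (int j) (int i) x"
    and "height M (L (- int j) (int i) x) = L (- int j) (int i) (height M x) - of_nat (2 * M - i - j) *s L (- int j) (int i) x"
proof -
  have lin: "L a (int i) (height M x) = (\<Sum>l\<in>{1..M}. of_nat (M - l) *s L a (int i) (L (int l) (int l) x))" if "ix n a" for a
  proof -
    have "L a (int i) (sum g A) = (\<Sum>l\<in>A. L a (int i) (g l))" if "finite A" for g :: "nat \<Rightarrow> 'v" and A
      using that \<open>ix n a\<close> assms by (induction rule: finite_induct) (simp_all add: L_lin)
    then show ?thesis using that assms by (simp add: height_def L_scale)
  qed
  have "height M (L (int j) (int i) x) = (\<Sum>l\<in>{1..M}. of_nat (M - l) *s L (int j) (int i) (L (int l) (int l) x)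
      + (if l = j then of_nat (M - j) *s L (int j) (int i) x else 0) - (if l = i then of_nat (M - i) *s L (int j) (int i) x else 0))"
    unfolding height_def
    by (intro sum.cong refl) (use assms in \<open>auto simp: L_bracket[of "int l" "int l" "int j" "int i" for l] scale_right_diff_distrib scale_right_distrib\<close>)
  also have "\<dots> = L (int j) (int i) (height M x) + of_nat (M - j) *s L (int j) (int i) x - of_nat (M - i) *s L (int j) (int i) x"
    using assms by (simp add: sum_subtractf sum.distrib lin)
  also have "of_nat (M - i) *s L (int j) (int i) x = of_nat (M - j) *s L (int j) (int i) x + of_nat (j - i) *s L (int j) (int i) x"
    using assms by (simp flip: scale_left_distrib of_nat_add)
  finally show "height M (L (int j) (int i) x) = L (int j) (int i) (height M x) - of_nat (j - i) *s L (int j) (int i) x"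
    by simp
  have sk: "L (- int i) (int j) x = - L (- int j) (int i) x"
    using L_skew[of "- int j" "int i" x] assms by simp
  have "height M (L (- int j) (int i) x) = (\<Sum>l\<in>{1..M}. of_nat (M - l) *s L (- int j) (int i) (L (int l) (int l) x)
      - (if l = j then of_nat (M - j) *s L (- int j) (int i) x else 0) - (if l = i then of_nat (M - i) *s L (- int j) (int i) x else 0))"
    unfolding height_def
    by (intro sum.cong refl) (use assms sk in \<open>auto simp: L_bracket[of "int l" "int l" "- int j" "int i" for l] scale_right_diff_distrib scale_right_distrib\<close>)
  also have "\<dots> = L (- int j) (int i) (height M x) - of_nat (M - j) *s L (- int j) (int i) x - of_nat (M - i) *s L (- int j) (int i) x"
    using assms by (simp add: sum_subtractf sum.distrib lin)
  also have "\<dots> = L (- int j) (int i) (height M x) - of_nat ((M - j) + (M - i)) *s L (- int j) (int i) x"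
    by (simp add: scale_left_distrib)
  finally show "height M (L (- int j) (int i) x) = L (- int j) (int i) (height M x) - of_nat (2 * M - i - j) *s L (- int j) (int i) x"
    using assms by (simp add: algebra_simps)
qed

lemma height_linear:
  assumes "M \<le> n"
  shows "height M (x + y) = height M x + height M y" "height M (x - y) = height M x - height M y" "height M (c *s x) = c *s height M x"
proof -
  have "L (int i) (int i) (x + y) = L (int i) (int i) x + L (int i) (int i) y"
    "L (int i) (int i) (x - y) = L (int i) (int i) x - L (int i) (int i) y"
    "L (int i) (int i) (c *s x) = c *s L (int i) (int i) x" if "i \<in> {1..M}" for i
    using that assms by (simp_all add: L_lin)
  then show "height M (x + y) = height M x + height M y" "height M (x - y) = height M x - height M y" "height M (c *s x) = c *s height M x"
    unfolding height_def sum.distrib[symmetric] sum_subtractf[symmetric] scale_sum_right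
    by (auto intro!: sum.cong simp: scale_right_distrib scale_right_diff_distrib mult.commute)
qed

lemma height_in: "stable M W \<Longrightarrow> w \<in> W \<Longrightarrow> height M w \<in> W"
  unfolding height_def by (intro subspace_sum subspace_scale) (auto simp: stable_def)

lemma height_sing:
  assumes "stable M W" "singular M W v lam"
  shows "height M v - (\<Sum>i\<in>{1..M}. of_nat (M - i) * lam i) *s v \<in> W"
proof -
  have "height M v - (\<Sum>i\<in>{1..M}. of_nat (M - i) * lam i) *s v = (\<Sum>i\<in>{1..M}. of_nat (M - i) *s (L (int i) (int i) v - lam i *s v))"
    by (simp add: height_def scale_right_diff_distrib sum_subtractf scale_sum_left)
  also have "\<dots> \<in> W"
    using assms by (intro subspace_sum subspace_scale) (auto simp: stable_def singular_def)
  finally show ?thesis .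
qed

text \<open>The polynomial in \<^term>\<open>height M\<close> that separates the eigenvalue \<open>c\<close> from \<open>c - 1, \<dots>, c - D\<close>.\<close>
primrec sep :: "nat \<Rightarrow> complex \<Rightarrow> nat \<Rightarrow> 'v \<Rightarrow> 'v" where
  "sep M c 0 x = x"
| "sep M c (Suc D) x = height M (sep M c D x) - (c - of_nat (Suc D)) *s sep M c D x"

lemma sep_linear:
  assumes "M \<le> n"
  shows "sep M c D (x + y) = sep M c D x + sep M c D y" "sep M c D (a *s x) = a *s sep M c D x"
  by (induction D) (simp_all add: height_linear assms algebra_simps scale_left_commute)

lemma sep_in: "stable M W \<Longrightarrow> w \<in> W \<Longrightarrow> sep M c D w \<in> W"
  by (induction D) (auto simp: stable_def intro!: subspace_diff subspace_scale height_in[unfolded stable_def])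

text \<open>The factor for e subtracts c - e from the height operator and so acts on the eigenvalue
  c - d as e - d. The product vanishes for 1 \<le> d \<le> D and equals D! for d = 0.\<close>

lemma sep_eigen:
  assumes "M \<le> n" "stable M W" "height M x - (c - of_nat d) *s x \<in> W"
  shows "sep M c D x - (\<Prod>e\<in>{1..D}. of_nat e - of_nat d) *s x \<in> W"
proof (induction D)
  case 0
  then show ?case using assms by (simp add: stable_def subspace_0)
next
  case (Suc D)
  let ?p = "(\<Prod>e\<in>{1..D}. of_nat e - of_nat d) :: complex" and ?s = "sep M c D x" and ?t = "c - of_nat (Suc D)"
  have W: "subspace W" using assms by (simp add: stable_def)
  have "height M (?s - ?p *s x) - ?t *s (?s - ?p *s x) + ?p *s (height M x - (c - of_nat d) *s x) \<in> W"
    by (intro subspace_add[OF W] subspace_diff[OF W] subspace_scale[OF W] height_in[OF assms(2)] Suc assms)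
  also have "height M (?s - ?p *s x) - ?t *s (?s - ?p *s x) + ?p *s (height M x - (c - of_nat d) *s x)
    = height M ?s - ?t *s ?s - (?p * (c - of_nat d) - ?p * ?t) *s x"
    unfolding height_linear[OF assms(1)] scale_right_diff_distrib scale_left_diff_distrib scale_scale
    by (simp add: algebra_simps)
  also have "?p * (c - of_nat d) - ?p * ?t = (\<Prod>e\<in>{1..Suc D}. of_nat e - of_nat d)"
    by (simp add: algebra_simps prod.cl_ivl_Suc)
  finally show ?case by simp
qed

end

lemma so_module_mono: "so_module s n L \<Longrightarrow> M \<le> n \<Longrightarrow> so_module s M L"
proof -
  assume "so_module s n L" and "M \<le> n"
  then interpret so_module s n L by simp
  have ix: "ix M a \<Longrightarrow> ix n a" for a using \<open>M \<le> n\<close> ix_mono by blast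
  show ?thesis
    by (intro so_module.intro vector_space_axioms so_module_axioms.intro)
      (rule L_linear L_skew L_bracket; erule ix)+
qed

section \<open>The submodule generated by a pair of highest weight vectors\<close>

definition pscale :: "('c \<Rightarrow> 'v \<Rightarrow> 'v) \<Rightarrow> ('c \<Rightarrow> 'w \<Rightarrow> 'w) \<Rightarrow> 'c \<Rightarrow> 'v \<times> 'w \<Rightarrow> 'v \<times> 'w" where
  "pscale s t c = map_prod (s c) (t c)"

definition pop :: "(int \<Rightarrow> int \<Rightarrow> 'v \<Rightarrow> 'v) \<Rightarrow> (int \<Rightarrow> int \<Rightarrow> 'w \<Rightarrow> 'w) \<Rightarrow> int \<Rightarrow> int \<Rightarrow> 'v \<times> 'w \<Rightarrow> 'v \<times> 'w" where
  "pop L K a b = map_prod (L a b) (K a b)"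

lemma so_module_prod:
  assumes "so_module s n L" "so_module t n K"
  shows "so_module (pscale s t) n (pop L K)"
proof -
  interpret V: so_module s n L by fact
  interpret R: so_module t n K by fact
  interpret P: vector_space "pscale s t"
    by unfold_locales (auto simp: pscale_def V.scale_right_distrib R.scale_right_distrib V.scale_left_distrib R.scale_left_distrib)
  show ?thesis
  proof (intro so_module.intro P.vector_space_axioms so_module_axioms.intro)
    show "Vector_Spaces.linear (pscale s t) (pscale s t) (pop L K a b)" if "ix n a" "ix n b" for a b
      using that P.vector_space_axioms by (auto simp: Vector_Spaces.linear_iff pop_def pscale_def V.L_lin R.L_lin)
    show "pop L K (- b) (- a) u = - pop L K a b u" if "ix n a" "ix n b" for a b u
      using that by (cases u) (simp add: pop_def V.L_skew R.L_skew)
    show "pop L K a b (pop L K c d u) = pop L K c d (pop L K a b u) +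
       ((if b = c then pop L K a d u else 0) - (if a = d then pop L K c b u else 0) -
        (if b = - d then pop L K a (- c) u else 0) + (if a = - c then pop L K (- d) b u else 0))"
      if "ix n a" "ix n b" "ix n c" "ix n d" for a b c d u
    proof (cases u)
      case (Pair x y)
      have if_pair: "(if P then (x, y) else 0) = (if P then x else 0, if P then y else 0)" for P and x :: 'a and y :: 'b
        by (simp add: zero_prod_def)
      show ?thesis
        unfolding Pair pop_def map_prod_simp if_pair add_Pair diff_Pair
          V.L_bracket[OF that, of x] R.L_bracket[OF that, of y] ..
    qed
  qed
qed

locale pairing = V: so_module scale n L + R: unitary_module M K B
  for scale :: "complex \<Rightarrow> 'v::ab_group_add \<Rightarrow> 'v" (infixr "*s" 75) and n L M
    and K :: "int \<Rightarrow> int \<Rightarrow> ('a \<Rightarrow> complex) \<Rightarrow> 'a \<Rightarrow> complex" and B +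
  fixes W :: "'v set" and v :: 'v and u :: "'a \<Rightarrow> complex" and lam :: "nat \<Rightarrow> complex"
  assumes Mn: "M \<le> n" and Winv: "V.stable M W" and vsing: "V.singular M W v lam" and vW: "v \<notin> W"
    and using_u: "supp B u" "u \<noteq> 0" "R.singular M {0} u lam"
begin

sublocale P: so_module "pscale scale fscale" M "pop L K"
  by (intro so_module_prod so_module_mono[OF V.so_module_axioms Mn] R.so_module_axioms)

text \<open>Unitarity forces \<open>N\<close> to meet the second factor trivially, so linear relations between monomials applied to
  \<open>v\<close> modulo \<open>W\<close> also hold for \<open>u\<close>.\<close>
definition N :: "('v \<times> ('a \<Rightarrow> complex)) set" where
  "N = P.low M (W \<times> {0} \<union> {(v, u)})"

lemma W_sub: "V.subspace W" using Winv by (simp add: V.stable_def)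

lemma N_inv: "P.stable M N"
  unfolding N_def
proof (rule P.low_inv)
  fix s i j assume s: "s \<in> W \<times> {0} \<union> {(v, u)}" and ij: "1 \<le> i" "i < j" "j \<le> M"
  have "pop L K (int i) (int j) s \<in> W \<times> {0}" "pop L K (int i) (- int j) s \<in> W \<times> {0}"
    using s ij Winv vsing using_u(3) by (auto simp: pop_def V.stable_def V.singular_def R.singular_def R.L_zero)
  then show "pop L K (int i) (int j) s \<in> P.low M (W \<times> {0} \<union> {(v, u)}) \<and>
     pop L K (int i) (- int j) s \<in> P.low M (W \<times> {0} \<union> {(v, u)})"
    by (auto intro: P.low_base)
next
  fix s i assume s: "s \<in> W \<times> {0} \<union> {(v, u)}" and i: "1 \<le> i" "i \<le> M"
  show "pop L K (int i) (int i) s \<in> P.low M (W \<times> {0} \<union> {(v, u)})"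
    using s
  proof
    assume "s \<in> W \<times> {0}"
    then have "pop L K (int i) (int i) s \<in> W \<times> {0}"
      using i Winv by (auto simp: pop_def V.stable_def R.L_zero)
    then show ?thesis by (auto intro: P.low_base)
  next
    assume "s \<in> {(v, u)}"
    then have eq: "pop L K (int i) (int i) s = (L (int i) (int i) v - lam i *s v, 0) + pscale scale fscale (lam i) (v, u)"
      using i using_u(3) by (simp add: pop_def pscale_def R.singular_def)
    have "L (int i) (int i) v - lam i *s v \<in> W" using i vsing by (simp add: V.singular_def)
    then have "(L (int i) (int i) v - lam i *s v, 0) \<in> P.low M (W \<times> {0} \<union> {(v, u)})"
      by (intro P.low_base) simp
    moreover have "(v, u) \<in> P.low M (W \<times> {0} \<union> {(v, u)})" by (rule P.low_base) simp
    ultimately show ?thesis unfolding eq by (rule P.low_add[OF _ P.low_scale])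
  qed
qed simp

lemma N_supp: "(x, f) \<in> N \<Longrightarrow> supp B f"
proof -
  have "N \<subseteq> {s. supp B (snd s)}"
    unfolding N_def
  proof (rule P.low_least)
    show "P.subspace {s. supp B (snd s)}"
      by (auto simp: P.subspace_def pscale_def)
  qed (use using_u in \<open>auto simp: pop_def R.supp_L\<close>)
  then show "(x, f) \<in> N \<Longrightarrow> supp B f" by auto
qed

definition c0 :: complex where "c0 = (\<Sum>i\<in>{1..M}. of_nat (M - i) * lam i)"

text \<open>Eigenvectors are required modulo \<open>W\<close> in the first factor but exactly in the
  second one, matching the singularity of \<open>v\<close> and of \<open>u\<close>.\<close>

definition eig :: "nat \<Rightarrow> ('v \<times> ('a \<Rightarrow> complex)) set" where
  "eig d = {(x, f). V.height M x - (c0 - of_nat d) *s x \<in> W \<and> R.height M f = fscale (c0 - of_nat d) f \<and> supp B f}"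

lemma eig_lower:
  assumes "s \<in> eig d" "1 \<le> i" "i < j" "j \<le> M"
  shows "pop L K (int j) (int i) s \<in> eig (d + (j - i))" "pop L K (- int j) (int i) s \<in> eig (d + (2 * M - i - j))"
proof -
  obtain x f where s: "s = (x, f)" "V.height M x - (c0 - of_nat d) *s x \<in> W" "R.height M f = fscale (c0 - of_nat d) f" "supp B f"
    using assms by (auto simp: eig_def)
  have *: "V.height M (L a (int i) x) - (c0 - of_nat (d + d')) *s L a (int i) x \<in> W \<and>
     R.height M (K a (int i) f) = fscale (c0 - of_nat (d + d')) (K a (int i) f)"
    if "V.height M (L a (int i) x) = L a (int i) (V.height M x) - of_nat d' *s L a (int i) x"
      "R.height M (K a (int i) f) = K a (int i) (R.height M f) - fscale (of_nat d') (K a (int i) f)" "ix M a" for a d'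
  proof -
    have e: "c0 - of_nat (d + d') = (c0 - of_nat d) - of_nat d'" by simp
    have "L a (int i) (V.height M x - (c0 - of_nat d) *s x) \<in> W"
      using s that(3) Winv assms by (auto simp: V.stable_def)
    moreover have "ix n a" using that(3) ix_mono Mn by blast
    ultimately show ?thesis
      unfolding that(1,2) e V.scale_left_diff_distrib[of _ "of_nat d'"] R.scale_left_diff_distrib[of _ "of_nat d'"]
      using s assms that(3) Mn by (simp add: V.L_lin R.L_lin)
  qed
  have 1: "(L (int j) (int i) x, K (int j) (int i) f) \<in> eig (d + (j - i))"
    using *[of "int j" "j - i"] V.height_low(1)[OF Mn assms(2-4), of x] R.height_low(1)[OF order.refl assms(2-4), of f] assms s
    by (simp add: eig_def R.supp_L)
  have 2: "(L (- int j) (int i) x, K (- int j) (int i) f) \<in> eig (d + (2 * M - i - j))"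
    using *[of "- int j" "2 * M - i - j"] V.height_low(2)[OF Mn assms(2-4), of x] R.height_low(2)[OF order.refl assms(2-4), of f] assms s
    by (simp add: eig_def R.supp_L)
  show "pop L K (int j) (int i) s \<in> eig (d + (j - i))" "pop L K (- int j) (int i) s \<in> eig (d + (2 * M - i - j))"
    using 1 2 s by (simp_all add: pop_def)
qed

definition E :: "('v \<times> ('a \<Rightarrow> complex)) set" where
  "E = P.span (\<Union>d\<in>{1..}. eig d)"

lemma E_lower:
  assumes "s \<in> E" "1 \<le> i" "i < j" "j \<le> M"
  shows "pop L K (int j) (int i) s \<in> E \<and> pop L K (- int j) (int i) s \<in> E"
  using assms(1) unfolding E_def
proof (induction rule: P.span_induct_alt)
  case base
  then show ?case using assms by (simp add: P.L_zero P.span_zero)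
next
  case (step c s t)
  then obtain d where d: "d \<ge> 1" "s \<in> eig d" by auto
  have "pop L K (int j) (int i) s \<in> P.span (\<Union>d\<in>{1..}. eig d)" "pop L K (- int j) (int i) s \<in> P.span (\<Union>d\<in>{1..}. eig d)"
  proof -
    have "1 \<le> d + (j - i)" "1 \<le> d + (2 * M - i - j)" using d(1) by auto
    then show "pop L K (int j) (int i) s \<in> P.span (\<Union>d\<in>{1..}. eig d)" "pop L K (- int j) (int i) s \<in> P.span (\<Union>d\<in>{1..}. eig d)"
      using eig_lower[OF d(2) assms(2-4)] by (blast intro: P.span_base)+
  qed
  then show ?case using step assms by (simp add: P.L_add P.L_scale P.span_add P.span_scale)
qed

lemma vu_eig: "(v, u) \<in> eig 0"
proof -
  have "R.stable M {0}" by (auto simp: R.stable_def R.L_zero)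
  then have "R.height M u = fscale c0 u" using R.height_sing[of M "{0}" u lam] using_u by (simp add: c0_def)
  then show ?thesis using V.height_sing[OF Winv vsing] using_u by (simp add: eig_def c0_def)
qed

text \<open>Every nonempty lowering word decreases the height, so apart from
  \<open>W \<times> {0}\<close> only multiples of \<open>(v, u)\<close> itself contribute at the top
  eigenvalue.\<close>

lemma N_decomp: "s \<in> N \<Longrightarrow> \<exists>c w z. w \<in> W \<and> z \<in> E \<and> s = pscale scale fscale c (v, u) + (w, 0) + z"
proof -
  let ?T = "{pscale scale fscale c (v, u) + (w, 0) + z | c w z. w \<in> W \<and> z \<in> E}"
  have E0: "0 \<in> E" by (simp add: E_def P.span_zero)
  have "N \<subseteq> ?T"
    unfolding N_def
  proof (rule P.low_least)
    have "(w, 0) \<in> ?T" if "w \<in> W" for w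
    proof -
      have "(w, 0) = pscale scale fscale 0 (v, u) + (w, 0) + 0" by simp
      then show ?thesis using that E0 by blast
    qed
    moreover have "(v, u) = pscale scale fscale 1 (v, u) + (0, 0) + 0" by simp
    then have "(v, u) \<in> ?T" using V.subspace_0[OF W_sub] E0 by blast
    ultimately show "W \<times> {0} \<union> {(v, u)} \<subseteq> ?T" by auto
    show "P.subspace ?T"
      unfolding P.subspace_def
    proof (intro conjI ballI allI)
      have "0 = pscale scale fscale 0 (v, u) + (0, 0) + 0" by (simp add: zero_prod_def)
      then show "0 \<in> ?T" using V.subspace_0[OF W_sub] E0 by blast
      fix x assume "x \<in> ?T"
      then obtain c w z where x: "w \<in> W" "z \<in> E" "x = pscale scale fscale c (v, u) + (w, 0) + z" by auto
      {
        fix y assume "y \<in> ?T"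
        then obtain c' w' z' where y: "w' \<in> W" "z' \<in> E" "y = pscale scale fscale c' (v, u) + (w', 0) + z'" by auto
        have "x + y = pscale scale fscale (c + c') (v, u) + (w + w', 0) + (z + z')"
          unfolding x y P.scale_left_distrib by (cases z; cases z') (simp add: pscale_def algebra_simps)
        then show "x + y \<in> ?T"
          using x y V.subspace_add[OF W_sub] P.span_add unfolding E_def by blast
      }
      {
        fix a
        have "pscale scale fscale a x = pscale scale fscale (a * c) (v, u) + (a *s w, 0) + pscale scale fscale a z"
          unfolding x P.scale_right_distrib P.scale_scale by (simp add: pscale_def)
        then show "pscale scale fscale a x \<in> ?T"
          using x V.subspace_scale[OF W_sub] P.span_scale unfolding E_def by blast
      }
    qed
    fix s i j assume "s \<in> ?T" and ij: "1 \<le> i" "i < j" "j \<le> M"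
    then obtain c w z where s: "w \<in> W" "z \<in> E" "s = pscale scale fscale c (v, u) + (w, 0) + z" by auto
    have one: "pop L K a (int i) s \<in> ?T"
      if a: "ix M a" "pop L K a (int i) (v, u) \<in> E" "pop L K a (int i) z \<in> E" for a
    proof -
      have "pop L K a (int i) s = pscale scale fscale 0 (v, u) + (L a (int i) w, 0) +
         (pscale scale fscale c (pop L K a (int i) (v, u)) + pop L K a (int i) z)"
      proof -
        have "pop L K a (int i) s = pscale scale fscale c (pop L K a (int i) (v, u)) + pop L K a (int i) (w, 0) + pop L K a (int i) z"
          unfolding s using a ij by (simp add: P.L_add P.L_scale)
        moreover have "pop L K a (int i) (w, 0) = (L a (int i) w, 0)"
          using a ij by (simp add: pop_def R.L_zero)
        ultimately show ?thesis by (simp add: ac_simps)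
      qed
      moreover have "L a (int i) w \<in> W" using s a ij Winv by (auto simp: V.stable_def)
      moreover have "pscale scale fscale c (pop L K a (int i) (v, u)) + pop L K a (int i) z \<in> E"
        using a unfolding E_def by (intro P.span_add P.span_scale)
      ultimately show ?thesis by blast
    qed
    have "pop L K (int j) (int i) (v, u) \<in> E" "pop L K (- int j) (int i) (v, u) \<in> E"
    proof -
      have "1 \<le> 0 + (j - i)" "1 \<le> 0 + (2 * M - i - j)" using ij by auto
      then show "pop L K (int j) (int i) (v, u) \<in> E" "pop L K (- int j) (int i) (v, u) \<in> E"
        using eig_lower[OF vu_eig ij] unfolding E_def by (blast intro: P.span_base)+
    qed
    then show "pop L K (int j) (int i) s \<in> ?T \<and> pop L K (- int j) (int i) s \<in> ?T"
      using one E_lower[OF s(2) ij] ij by auto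
  qed
  then show "s \<in> N \<Longrightarrow> ?thesis" by blast
qed

lemma height_adj:
  assumes "supp B f" "supp B g"
  shows "ip B (R.height M f) g = ip B f (R.height M g)"
proof -
  have sum_l: "ip B (sum h A) g = (\<Sum>i\<in>A. ip B (h i) g)" and sum_r: "ip B f (sum h A) = (\<Sum>i\<in>A. ip B f (h i))" for h and A :: "nat set" and f g :: "'a \<Rightarrow> complex"
    by (induction A rule: infinite_finite_induct) simp_all
  show ?thesis
    unfolding R.height_def sum_l sum_r using assms by (intro sum.cong refl) (simp add: R.adj)
qed

lemma N_op: "s \<in> N \<Longrightarrow> ix M a \<Longrightarrow> ix M b \<Longrightarrow> pop L K a b s \<in> N"
  using N_inv by (simp add: P.stable_def)

text \<open>In the decomposition of \<open>(0, f)\<close> the coefficient of \<open>(v, u)\<close>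
  is zero because \<open>v\<close> is not in \<open>W\<close>; so \<open>f\<close> comes from lower
  heights and is orthogonal to \<open>u\<close>. The vectors g with \<open>(0, g)\<close> in
  \<open>N\<close> are permuted among themselves by all operators of level \<open>M\<close>. Hence
  the pairs whose second component is orthogonal to all such g are closed under lowering, and they
  contain the generators of \<open>N\<close>. So \<open>f\<close> is orthogonal to itself.\<close>

lemma N_zero:
  assumes "(0, f) \<in> N"
  shows "f = 0"
proof -
  have eigen: "ip B u g = 0" if "(x, g) \<in> eig d" "d \<ge> 1" for x g d
  proof -
    have u: "R.height M u = fscale c0 u" "supp B u" using vu_eig by (auto simp: eig_def)
    have "cnj c0 * ip B u u = c0 * ip B u u"
      using height_adj[OF u(2,2)] u by simp
    \<comment> \<open>The first argument of \<open>ip\<close> is conjugated: the eigenvalue of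
      \<open>u\<close> can be compared with \<open>c0 - d\<close> only once it is known to be
      real.\<close>
    then have real: "cnj c0 = c0" using ip_self_eq_0[OF R.finB u(2)] using_u(2) by auto
    have "cnj c0 * ip B u g = (c0 - of_nat d) * ip B u g"
      using height_adj[OF u(2), of g] u that by (simp add: eig_def)
    then show ?thesis using real that by (auto simp: algebra_simps)
  qed
  have E_ip: "ip B u (snd z) = 0" if "z \<in> E" for z
  proof -
    have "E \<subseteq> {z. ip B u (snd z) = 0}"
      unfolding E_def by (rule P.span_minimal) (auto simp: eigen P.subspace_def pscale_def)
    then show ?thesis using that by auto
  qed
  have E_sep: "\<exists>D0. \<forall>D\<ge>D0. V.sep M c0 D (fst z) \<in> W" if "z \<in> E" for z
    using that unfolding E_def
  proof (induction rule: P.span_induct_alt)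
    case base
    then show ?case using V.sep_in[OF Winv V.subspace_0[OF W_sub]] by auto
  next
    case (step c s t)
    then obtain d x g where d: "d \<ge> 1" "s = (x, g)" "V.height M x - (c0 - of_nat d) *s x \<in> W" by (auto simp: eig_def)
    have "V.sep M c0 D x \<in> W" if "D \<ge> d" for D
    proof -
      have "(\<Prod>e\<in>{1..D}. of_nat e - of_nat d :: complex) = 0" using that d(1) by (intro prod_zero) auto
      with V.sep_eigen[OF Mn Winv d(3), of D] show ?thesis by (simp only: V.scale_zero_left diff_zero)
    qed
    moreover obtain D0 where "\<And>D. D \<ge> D0 \<Longrightarrow> V.sep M c0 D (fst t) \<in> W" using step.IH by auto
    ultimately have "V.sep M c0 D (fst (pscale scale fscale c s + t)) \<in> W" if "D \<ge> max d D0" for D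
      using that d(2) Mn by (auto simp: pscale_def V.sep_linear intro!: V.subspace_add[OF W_sub] V.subspace_scale[OF W_sub])
    then show ?case by blast
  qed
  have ip0: "ip B u g = 0" if g: "(0, g) \<in> N" for g
  proof -
    obtain c w z where z: "w \<in> W" "z \<in> E" "(0, g) = pscale scale fscale c (v, u) + (w, 0) + z"
      using N_decomp[OF g] by blast
    then have z1: "0 = c *s v + w + fst z" and z2: "g = fscale c u + snd z"
      by (cases z; simp add: pscale_def)+
    obtain D where D: "V.sep M c0 D (fst z) \<in> W" using E_sep[OF z(2)] by auto
    have v1: "V.sep M c0 D v - (\<Prod>e\<in>{1..D}. of_nat e) *s v \<in> W"
      using V.sep_eigen[OF Mn Winv, of v c0 0 D] vu_eig by (simp add: eig_def)
    have "V.sep M c0 D (c *s v + w + fst z) = c *s V.sep M c0 D v + V.sep M c0 D w + V.sep M c0 D (fst z)"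
      using Mn by (simp add: V.sep_linear)
    then have "V.sep M c0 D 0 = c *s V.sep M c0 D v + V.sep M c0 D w + V.sep M c0 D (fst z)"
      by (simp only: z1[symmetric])
    moreover have "V.sep M c0 D 0 = 0" using V.sep_linear(2)[OF Mn, of c0 D 0 0] by simp
    ultimately have "c *s V.sep M c0 D v + (V.sep M c0 D w + V.sep M c0 D (fst z)) = 0"
      by (simp only: add.assoc)
    then have "c *s V.sep M c0 D v = - (V.sep M c0 D w + V.sep M c0 D (fst z))"
      by (simp only: eq_neg_iff_add_eq_0)
    then have "c *s V.sep M c0 D v \<in> W"
      using V.sep_in[OF Winv z(1)] D by (simp only: V.subspace_neg[OF W_sub] V.subspace_add[OF W_sub])
    from V.subspace_diff[OF W_sub this V.subspace_scale[OF W_sub v1, of c]]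
    have cv: "(c * (\<Prod>e\<in>{1..D}. of_nat e)) *s v \<in> W" by (simp add: V.scale_right_diff_distrib)
    \<comment> \<open>The separating polynomial multiplies \<open>v\<close> by D! modulo
      \<open>W\<close>, so a nonzero \<open>c\<close> would put \<open>v\<close> into
      \<open>W\<close>.\<close>
    have "c = 0"
    proof (rule ccontr)
      assume "c \<noteq> 0"
      then have ne: "c * (\<Prod>e\<in>{1..D}. of_nat e) \<noteq> 0" by simp
      have "inverse (c * (\<Prod>e\<in>{1..D}. of_nat e)) *s (c * (\<Prod>e\<in>{1..D}. of_nat e)) *s v \<in> W"
        by (rule V.subspace_scale[OF W_sub cv])
      then show False using vW by (simp only: V.scale_scale Fields.division_ring_class.left_inverse[OF ne] V.scale_one) 
    qed
    then show ?thesis using z2 E_ip[OF z(2)] by simp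
  qed
  have "N \<subseteq> {s. supp B (snd s) \<and> (\<forall>g. (0, g) \<in> N \<longrightarrow> ip B (snd s) g = 0)}"
    unfolding N_def[of ] 
  proof (rule P.low_least, fold N_def)
    show "P.subspace {s. supp B (snd s) \<and> (\<forall>g. (0, g) \<in> N \<longrightarrow> ip B (snd s) g = 0)}"
      by (auto simp: P.subspace_def pscale_def)
    fix s :: "'v \<times> ('a \<Rightarrow> complex)" and i j assume s: "s \<in> {s. supp B (snd s) \<and> (\<forall>g. (0, g) \<in> N \<longrightarrow> ip B (snd s) g = 0)}" and ij: "1 \<le> i" "i < j" "j \<le> M"
    have "ip B (snd (pop L K a b s)) g = 0" if "(0, g) \<in> N" "ix M a" "ix M b" for a b g
    proof -
      have "pop L K b a (0, g) \<in> N" using N_inv that by (auto simp: P.stable_def)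
      moreover have "L b a 0 = 0" using that ix_mono[OF _ Mn] by (simp add: V.L_zero)
      ultimately have "(0, K b a g) \<in> N" by (simp add: pop_def)
      then show ?thesis using s R.adj[of a b "snd s" g] that N_supp[OF that(1)] by (simp add: pop_def)
    qed
    then show "pop L K (int j) (int i) s \<in> {s. supp B (snd s) \<and> (\<forall>g. (0, g) \<in> N \<longrightarrow> ip B (snd s) g = 0)} \<and>
       pop L K (- int j) (int i) s \<in> {s. supp B (snd s) \<and> (\<forall>g. (0, g) \<in> N \<longrightarrow> ip B (snd s) g = 0)}"
      using s ij by (auto simp: pop_def R.supp_L)
  qed (use ip0 using_u in auto)
  then have "ip B f f = 0" using assms by auto
  then show ?thesis using ip_self_eq_0[OF R.finB N_supp[OF assms]] by simp
qed

lemma N_sub: "P.subspace N" by (simp add: N_def P.low_subspace)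

lemma vu_N: "(v, u) \<in> N" by (simp add: N_def P.low_base)

text \<open>In an irreducible module with \<open>M = n\<close> this subspace is zero, as it is
  proper by \<open>v_kernel\<close>. The second component of an element of \<open>N\<close> then
  determines the first, and relations satisfied by \<open>u\<close> carry over to
  \<open>v\<close>.\<close>

lemma kernel_inv: "V.stable M {x. (x, 0) \<in> N}"
  unfolding V.stable_def
proof (intro conjI allI impI ballI)
  show "V.subspace {x. (x, 0) \<in> N}"
    unfolding V.subspace_def
  proof (intro conjI ballI allI)
    show "0 \<in> {x. (x, 0) \<in> N}" using P.subspace_0[OF N_sub] by (simp add: zero_prod_def)
    fix x assume x: "x \<in> {x. (x, 0) \<in> N}"
    show "c *s x \<in> {x. (x, 0) \<in> N}" for c
      using P.subspace_scale[OF N_sub, of "(x, 0)" c] x by (simp add: pscale_def)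
    show "x + y \<in> {x. (x, 0) \<in> N}" if "y \<in> {x. (x, 0) \<in> N}" for y
      using P.subspace_add[OF N_sub, of "(x, 0)" "(y, 0)"] x that by simp
  qed
  fix a b w assume "ix M a" "ix M b" "w \<in> {x. (x, 0) \<in> N}"
  moreover from this have "pop L K a b (w, 0) \<in> N" by (intro N_op) simp_all
  ultimately show "L a b w \<in> {x. (x, 0) \<in> N}" by (simp add: pop_def R.L_zero)
qed

lemma v_kernel: "(v, 0) \<notin> N"
proof
  assume "(v, 0) \<in> N"
  from P.subspace_diff[OF N_sub vu_N this] have "(0, u) \<in> N" by simp
  then show False using N_zero using_u(2) by simp
qed

lemma pow_pop: "(pop L K a b ^^ p) (x, f) = ((L a b ^^ p) x, (K a b ^^ p) f)"
  by (induction p) (simp_all add: pop_def)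

lemma pow_N:
  assumes "ix M a" "ix M b"
  shows "((L a b ^^ p) v, (K a b ^^ p) u) \<in> N"
  using P.pow_in[of N "pop L K a b" "(v, u)" p] N_op[OF _ assms] vu_N by (simp only: pow_pop)

lemma yw_pop: "P.yw m s e (x, f) = (V.yw m s e x, R.yw m s e f)"
proof -
  have "foldr (\<lambda>i. pop L K s (int i) ^^ e i) l (x, f) = (foldr (\<lambda>i. L s (int i) ^^ e i) l x, foldr (\<lambda>i. K s (int i) ^^ e i) l f)" for l
    by (induction l) (simp_all add: pow_pop)
  then show ?thesis by (simp add: P.yw_def V.yw_def R.yw_def)
qed

lemma X_N: "(V.X M pl mi v, R.X M pl mi u) \<in> N"
proof -
  have "P.X M pl mi (v, u) \<in> N"
    using vu_N by (intro P.X_in[of M N]) (auto intro: N_op)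
  then show ?thesis by (simp add: P.X_def V.X_def R.X_def yw_pop)
qed

text \<open>An expression of \<open>X v\<close> through smaller monomials, repeated on
  \<open>u\<close>, gives f with \<open>(X v, f)\<close> in \<open>N\<close>. Since
  \<open>(X v, X u)\<close> is in \<open>N\<close> as well, \<open>N_zero\<close> yields X u = f.
  But \<open>g\<close> is orthogonal to f, because the adjoints of the lowering operators of level
  \<open>m\<close> are raising operators and kill \<open>g\<close>.\<close>

theorem lower_bound:
  assumes M: "M = Suc m" and g: "supp B g"
    "\<And>i j. 1 \<le> i \<Longrightarrow> i < j \<Longrightarrow> j \<le> m \<Longrightarrow> K (int i) (int j) g = 0 \<and> K (int i) (- int j) g = 0"
    and zero: "\<And>p q. block_lt M p q pl mi \<Longrightarrow> ip B g (R.X M p q u) = 0"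
    and ne: "ip B g (R.X M pl mi u) \<noteq> 0"
  shows "V.X M pl mi v \<notin> V.gen m W {v} (\<lambda>p q. block_lt M p q pl mi)"
proof
  assume "V.X M pl mi v \<in> V.gen m W {v} (\<lambda>p q. block_lt M p q pl mi)"
  moreover have "\<exists>f \<in> R.gen m {} {u} (\<lambda>p q. block_lt M p q pl mi). (x, f) \<in> N"
    if "x \<in> V.gen m W {v} (\<lambda>p q. block_lt M p q pl mi)" for x
    using that
  proof (induction rule: V.gen_induct)
    case (W w)
    then have "(w, 0) \<in> N" by (auto simp: N_def intro: P.low_base)
    then show ?case using R.gen_low(1) by blast
  next
    case (X p q s)
    then show ?case using X_N[of p q] M by (intro bexI[of _ "R.X M p q u"]) simp_all
  next
    case zero
    have "(0, 0) \<in> N" using P.subspace_0[OF N_sub] by (simp add: zero_prod_def)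
    then show ?case using R.gen_low(1) by blast
  next
    case (add x y)
    then obtain f g where fg: "f \<in> R.gen m {} {u} (\<lambda>p q. block_lt M p q pl mi)" "(x, f) \<in> N"
      "g \<in> R.gen m {} {u} (\<lambda>p q. block_lt M p q pl mi)" "(y, g) \<in> N" by blast
    from P.subspace_add[OF N_sub fg(2,4)] have "(x + y, f + g) \<in> N" by (simp only: add_Pair)
    then show ?case using R.gen_low(2)[OF fg(1,3)] by (rule bexI)
  next
    case (scale c x)
    then obtain f where "f \<in> R.gen m {} {u} (\<lambda>p q. block_lt M p q pl mi)" "(x, f) \<in> N" by blast
    then show ?case using P.subspace_scale[OF N_sub, of "(x, f)" c]
      by (intro bexI[of _ "fscale c f"]) (simp_all add: pscale_def)
  next
    case (minus x i j)
    then obtain f where "f \<in> R.gen m {} {u} (\<lambda>p q. block_lt M p q pl mi)" "(x, f) \<in> N" by blast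
    moreover have "pop L K (int j) (int i) (x, f) \<in> N"
      by (rule N_op[OF calculation(2)]) (use minus M in auto)
    ultimately show ?case using minus by (intro bexI[of _ "K (int j) (int i) f"]) (simp_all add: pop_def)
  next
    case (plus x i j)
    then obtain f where "f \<in> R.gen m {} {u} (\<lambda>p q. block_lt M p q pl mi)" "(x, f) \<in> N" by blast
    moreover have "pop L K (- int j) (int i) (x, f) \<in> N"
      by (rule N_op[OF calculation(2)]) (use plus M in auto)
    ultimately show ?case using plus by (intro bexI[of _ "K (- int j) (int i) f"]) (simp_all add: pop_def)
  qed
  ultimately obtain f where f: "f \<in> R.gen m {} {u} (\<lambda>p q. block_lt M p q pl mi)" "(V.X M pl mi v, f) \<in> N" by blast
  from P.subspace_diff[OF N_sub X_N[of pl mi] f(2)] have "(0, R.X M pl mi u - f) \<in> N" by simp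
  then have eq: "R.X M pl mi u = f" using N_zero by fastforce
  have "ip B g f = 0 \<and> supp B f"
    using f(1)
  proof (induction rule: R.gen_induct)
    case (X p q s)
    then show ?case using zero M N_supp[OF X_N] by auto
  next
    case (minus x i j)
    then show ?case using R.adj[of "int i" "int j" g x] g M by (auto simp: R.supp_L)
  next
    case (plus x i j)
    then show ?case using R.adj[of "int i" "- int j" g x] g M by (auto simp: R.supp_L)
  next
    case (add x y)
    then show ?case by (simp only: ip_simps supp_simps add_0_left simp_thms)
  qed (simp_all only: ip_simps supp_simps empty_iff mult_zero_right simp_thms)
  then show False using ne eq by simp
qed

end

section \<open>Tensor products of unitary modules\<close>

lemma deglex_lt_irrefl: "\<not> deglex_lt M e e"
  by (auto simp: deglex_lt_def)

lemma deglex_lt_total: "deglex_lt M e f \<or> agree M e f \<or> deglex_lt M f e"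
proof (cases "agree M e f")
  case False
  define i where "i = (LEAST i. i \<in> {1..<M} \<and> e i \<noteq> f i)"
  have ex: "\<exists>i. i \<in> {1..<M} \<and> e i \<noteq> f i" using False by (auto simp: agree_def)
  have i: "i \<in> {1..<M}" "e i \<noteq> f i" using LeastI_ex[OF ex] by (auto simp: i_def)
  have "e j = f j" if "j \<in> {1..<i}" for j
    using not_less_Least[of j "\<lambda>i. i \<in> {1..<M} \<and> e i \<noteq> f i"] that i by (auto simp: i_def)
  then show ?thesis
    using i by (cases "sum e {1..<M}" "sum f {1..<M}" rule: linorder_cases; cases "e i" "f i" rule: linorder_cases)
      (auto simp: deglex_lt_def intro!: bexI[of _ i])
qed simp

lemma deglex_lt_add:
  assumes "deglex_lt M e f" "deglex_lt M e' f' \<or> agree M e' f'"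
  shows "deglex_lt M (\<lambda>i. e i + e' i) (\<lambda>i. f i + f' i)"
proof -
  have le: "sum e {1..<M} \<le> sum f {1..<M}" "sum e' {1..<M} \<le> sum f' {1..<M}"
    using assms agree_sum by (fastforce simp: deglex_lt_def)+
  show ?thesis
  proof (cases "sum e {1..<M} + sum e' {1..<M} < sum f {1..<M} + sum f' {1..<M}")
    case True
    then show ?thesis by (simp add: deglex_lt_def sum.distrib)
  next
    case False
    then have s: "sum e {1..<M} = sum f {1..<M}" "sum e' {1..<M} = sum f' {1..<M}" using le by auto
    obtain i where i: "i \<in> {1..<M}" "e i < f i" "\<And>l. l \<in> {1..<i} \<Longrightarrow> e l = f l"
      using assms(1) s by (auto simp: deglex_lt_def)
    show ?thesis
    proof (cases "agree M e' f'")
      case True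
      then have "e i + e' i < f i + f' i \<and> (\<forall>l\<in>{1..<i}. e l + e' l = f l + f' l)"
        using i by (auto simp: agree_def)
      then show ?thesis using s i(1) by (auto simp: deglex_lt_def sum.distrib)
    next
      case False
      then obtain j where j: "j \<in> {1..<M}" "e' j < f' j" "\<And>l. l \<in> {1..<j} \<Longrightarrow> e' l = f' l"
        using assms(2) s by (auto simp: deglex_lt_def)
      have "e (min i j) + e' (min i j) < f (min i j) + f' (min i j) \<and> (\<forall>l\<in>{1..<min i j}. e l + e' l = f l + f' l) \<and> min i j \<in> {1..<M}"
        using i j by (cases i j rule: linorder_cases) (auto simp: min_def)
      then show ?thesis using s by (auto simp: deglex_lt_def sum.distrib)
    qed
  qed
qed

lemma agree_add: "agree M e f \<Longrightarrow> agree M e' f' \<Longrightarrow> agree M (\<lambda>i. e i + e' i) (\<lambda>i. f i + f' i)"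
  by (auto simp: agree_def)

lemma deglex_lt_add': 
  assumes "deglex_lt M e f \<or> agree M e f" "deglex_lt M e' f'"
  shows "deglex_lt M (\<lambda>i. e i + e' i) (\<lambda>i. f i + f' i)"
  using deglex_lt_add[OF assms(2,1)] by (simp add: add.commute)

text \<open>The order is compatible with addition: if neither summand is below its target and the
  sum is not above the sum of the targets, both must agree with their targets. The plus exponents
  are settled first, since the minus exponents are compared only when those agree.\<close>

lemma block_lt_split:
  assumes le: "block_lt M p q (\<lambda>i. a1 i + a2 i) (\<lambda>i. b1 i + b2 i) \<or> agree M p (\<lambda>i. a1 i + a2 i) \<and> agree M q (\<lambda>i. b1 i + b2 i)"
    and p: "agree M (\<lambda>i. p1 i + p2 i) p" and q: "agree M (\<lambda>i. q1 i + q2 i) q"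
    and n: "\<not> block_lt M p1 q1 a1 b1" "\<not> block_lt M p2 q2 a2 b2"
  shows "agree M p1 a1 \<and> agree M p2 a2 \<and> agree M q1 b1 \<and> agree M q2 b2 \<and>
    \<not> block_lt M p q (\<lambda>i. a1 i + a2 i) (\<lambda>i. b1 i + b2 i)"
proof -
  let ?a = "\<lambda>i. a1 i + a2 i" and ?b = "\<lambda>i. b1 i + b2 i"
  have "deglex_lt M p ?a \<or> agree M p ?a" using le by (auto simp: block_lt_def)
  then have pa: "\<not> deglex_lt M ?a p" using deglex_lt_trans deglex_lt_irrefl deglex_lt_eqr by blast
  have 1: "deglex_lt M a1 p1 \<or> agree M a1 p1" "deglex_lt M a2 p2 \<or> agree M a2 p2"
    using n deglex_lt_total[of M a1 p1] deglex_lt_total[of M a2 p2] by (auto simp: block_lt_def)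
  have "\<not> deglex_lt M a1 p1" "\<not> deglex_lt M a2 p2"
    using deglex_lt_add[OF _ 1(2)] deglex_lt_add'[OF 1(1)] pa agree_dl[OF p] by blast+
  then have e: "agree M a1 p1" "agree M a2 p2" using 1 by auto
  then have "agree M ?a p" using agree_trans[OF agree_add[OF e] p] by simp
  then have "\<not> deglex_lt M p ?a" using deglex_lt_irrefl deglex_lt_eqr by blast
  then have "deglex_lt M q ?b \<or> agree M q ?b" using le by (auto simp: block_lt_def)
  then have qb: "\<not> deglex_lt M ?b q" using deglex_lt_trans deglex_lt_irrefl deglex_lt_eqr by blast
  have 2: "deglex_lt M b1 q1 \<or> agree M b1 q1" "deglex_lt M b2 q2 \<or> agree M b2 q2"
    using n e[THEN agree_sym] deglex_lt_total[of M b1 q1] deglex_lt_total[of M b2 q2] by (auto simp: block_lt_def)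
  have "\<not> deglex_lt M b1 q1" "\<not> deglex_lt M b2 q2"
    using deglex_lt_add[OF _ 2(2)] deglex_lt_add'[OF 2(1)] qb agree_dl[OF q] by blast+
  then have f: "agree M b1 q1" "agree M b2 q2" using 2 by auto
  then have "agree M ?b q" using agree_trans[OF agree_add[OF f] q] by simp
  then have "\<not> deglex_lt M q ?b" using deglex_lt_irrefl deglex_lt_eqr by blast
  then show ?thesis using e[THEN agree_sym] f[THEN agree_sym] \<open>\<not> deglex_lt M p ?a\<close> by (simp add: block_lt_def)
qed

text \<open>Functionals that depend on finitely many coordinates; such functionals commute with
  every linear functional in the other tensor factor.\<close>

inductive evalfun :: "(('a \<Rightarrow> complex) \<Rightarrow> complex) \<Rightarrow> bool" where
  eval: "evalfun (\<lambda>f. f x)"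
| zero: "evalfun (\<lambda>f. 0)"
| add: "evalfun \<phi> \<Longrightarrow> evalfun \<psi> \<Longrightarrow> evalfun (\<lambda>f. \<phi> f + \<psi> f)"
| scale: "evalfun \<phi> \<Longrightarrow> evalfun (\<lambda>f. c * \<phi> f)"

lemma evalfun_swap:
  fixes \<tau> :: "('b \<Rightarrow> complex) \<Rightarrow> complex"
  assumes "evalfun \<phi>"
    and \<tau>: "\<And>f g. \<tau> (f + g) = \<tau> f + \<tau> g" "\<And>c f. \<tau> (fscale c f) = c * \<tau> f"
  shows "\<phi> (\<lambda>x. \<tau> (F x)) = \<tau> (\<lambda>y. \<phi> (\<lambda>x. F x y))"
  using assms(1)
proof induction
  case zero
  have "\<tau> (fscale 0 (\<lambda>_. 0)) = 0" by (simp only: \<tau>(2) mult_zero_left)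
  then show ?case by (simp add: fscale_def)
next
  case (add \<phi> \<psi>)
  then show ?case using \<tau>(1)[of "\<lambda>y. \<phi> (\<lambda>x. F x y)" "\<lambda>y. \<psi> (\<lambda>x. F x y)"] by (simp add: plus_fun_def)
next
  case (scale \<phi> c)
  then show ?case using \<tau>(2)[of c "\<lambda>y. \<phi> (\<lambda>x. F x y)"] by (simp add: fscale_def)
qed simp

lemma evalfun_comp: "evalfun \<phi> \<Longrightarrow> evalfun (\<lambda>f. \<phi> (\<lambda>y. f (h y)))"
  by (induction rule: evalfun.induct) (auto intro: evalfun.intros)

text \<open>The condition lets the operators of two tensor factors commute, by
  \<open>evalfun_swap\<close>, although a function on lists need not be a finite sum of pure
  tensors.\<close>

locale model = unitary_module +
  assumes evalfun_L: "\<And>a b x. ix n a \<Longrightarrow> ix n b \<Longrightarrow> evalfun (\<lambda>f. L a b f x)"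

text \<open>The tensor product of \<open>r\<close> function spaces is modelled by functions on lists of length \<open>r\<close>.\<close>
definition tensor_op ::
    "(int \<Rightarrow> int \<Rightarrow> ('a \<Rightarrow> complex) \<Rightarrow> 'a \<Rightarrow> complex) \<Rightarrow> (int \<Rightarrow> int \<Rightarrow> ('a list \<Rightarrow> complex) \<Rightarrow> 'a list \<Rightarrow> complex)
      \<Rightarrow> int \<Rightarrow> int \<Rightarrow> ('a list \<Rightarrow> complex) \<Rightarrow> 'a list \<Rightarrow> complex" where
  "tensor_op L1 L2 a b f l =
     (case l of [] \<Rightarrow> 0 | x # xs \<Rightarrow> L1 a b (\<lambda>y. f (y # xs)) x + L2 a b (\<lambda>ys. f (x # ys)) xs)"

definition tensor :: "('a \<Rightarrow> complex) \<Rightarrow> ('a list \<Rightarrow> complex) \<Rightarrow> 'a list \<Rightarrow> complex" where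
  "tensor f g l = (case l of [] \<Rightarrow> 0 | x # xs \<Rightarrow> f x * g xs)"

definition tensor_basis :: "'a set \<Rightarrow> 'a list set \<Rightarrow> 'a list set" where
  "tensor_basis B1 B2 = (\<lambda>(x, xs). x # xs) ` (B1 \<times> B2)"

lemma tensor_basis_simps [simp]: "x # xs \<in> tensor_basis B1 B2 \<longleftrightarrow> x \<in> B1 \<and> xs \<in> B2" "[] \<notin> tensor_basis B1 B2"
  by (auto simp: tensor_basis_def)

lemma ip_tensor_basis: "ip (tensor_basis B1 B2) f g = (\<Sum>x\<in>B1. \<Sum>xs\<in>B2. cnj (f (x # xs)) * g (x # xs))"
proof -
  have "inj_on (\<lambda>(x, xs). x # xs) (B1 \<times> B2)" by (auto simp: inj_on_def)
  then show ?thesis unfolding ip_def tensor_basis_def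
    by (subst sum.reindex) (simp_all add: sum.cartesian_product case_prod_beta)
qed

lemma ip_tensor: "ip (tensor_basis B1 B2) (tensor f g) (tensor f' g') = ip B1 f f' * ip B2 g g'"
  unfolding ip_tensor_basis by (simp add: tensor_def ip_def sum_product mult_ac)

lemma supp_tensor: "supp B1 f \<Longrightarrow> supp B2 g \<Longrightarrow> supp (tensor_basis B1 B2) (tensor f g)"
  by (auto simp: supp_def tensor_def split: list.splits)

lemma supp_slice:
  assumes "supp (tensor_basis B1 B2) f"
  shows "supp B1 (\<lambda>y. f (y # xs))" "supp B2 (\<lambda>ys. f (x # ys))"
  using assms by (auto simp: supp_def)

context
  fixes n :: nat and L1 :: "int \<Rightarrow> int \<Rightarrow> ('a \<Rightarrow> complex) \<Rightarrow> 'a \<Rightarrow> complex" and B1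
    and L2 :: "int \<Rightarrow> int \<Rightarrow> ('a list \<Rightarrow> complex) \<Rightarrow> 'a list \<Rightarrow> complex" and B2
  assumes m1: "model n L1 B1" and m2: "model n L2 B2"
begin

interpretation M1: model n L1 B1 by (rule m1)
interpretation M2: model n L2 B2 by (rule m2)

lemma tensor_op_add: "ix n a \<Longrightarrow> ix n b \<Longrightarrow> tensor_op L1 L2 a b (f + g) = tensor_op L1 L2 a b f + tensor_op L1 L2 a b g"
proof (rule ext)
  fix l assume ix: "ix n a" "ix n b"
  show "tensor_op L1 L2 a b (f + g) l = (tensor_op L1 L2 a b f + tensor_op L1 L2 a b g) l"
  proof (cases l)
    case (Cons x xs)
    have "(\<lambda>y. (f + g) (y # xs)) = (\<lambda>y. f (y # xs)) + (\<lambda>y. g (y # xs))" "(\<lambda>ys. (f + g) (x # ys)) = (\<lambda>ys. f (x # ys)) + (\<lambda>ys. g (x # ys))"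
      by auto
    then have "tensor_op L1 L2 a b (f + g) (x # xs) =
      (L1 a b (\<lambda>y. f (y # xs)) + L1 a b (\<lambda>y. g (y # xs))) x + (L2 a b (\<lambda>ys. f (x # ys)) + L2 a b (\<lambda>ys. g (x # ys))) xs"
      by (simp only: tensor_op_def list.case M1.L_add[OF ix] M2.L_add[OF ix])
    then show ?thesis by (simp add: tensor_op_def Cons)
  qed (simp add: tensor_op_def)
qed

lemma tensor_op_scale: "ix n a \<Longrightarrow> ix n b \<Longrightarrow> tensor_op L1 L2 a b (fscale c f) = fscale c (tensor_op L1 L2 a b f)"
proof (rule ext)
  fix l assume ix: "ix n a" "ix n b"
  show "tensor_op L1 L2 a b (fscale c f) l = fscale c (tensor_op L1 L2 a b f) l"
  proof (cases l)
    case (Cons x xs)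
    have "(\<lambda>y. fscale c f (y # xs)) = fscale c (\<lambda>y. f (y # xs))" "(\<lambda>ys. fscale c f (x # ys)) = fscale c (\<lambda>ys. f (x # ys))"
      by (auto simp: fscale_def)
    then have "tensor_op L1 L2 a b (fscale c f) (x # xs) =
      fscale c (L1 a b (\<lambda>y. f (y # xs))) x + fscale c (L2 a b (\<lambda>ys. f (x # ys))) xs"
      by (simp only: tensor_op_def list.case M1.L_scale[OF ix] M2.L_scale[OF ix])
    then show ?thesis by (simp add: tensor_op_def Cons fscale_def distrib_left)
  qed (simp add: tensor_op_def fscale_def)
qed

lemma tensor_op_tensor:
  assumes "ix n a" "ix n b"
  shows "tensor_op L1 L2 a b (tensor u w) = tensor (L1 a b u) w + tensor u (L2 a b w)"
proof (rule ext)
  fix l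
  show "tensor_op L1 L2 a b (tensor u w) l = (tensor (L1 a b u) w + tensor u (L2 a b w)) l"
  proof (cases l)
    case (Cons x xs)
    have "(\<lambda>y. tensor u w (y # xs)) = fscale (w xs) u" "(\<lambda>ys. tensor u w (x # ys)) = fscale (u x) w"
      by (auto simp: tensor_def fscale_def)
    then show ?thesis using assms Cons
      by (simp add: tensor_op_def M1.L_scale M2.L_scale) (simp add: tensor_def fscale_def)
  qed (simp add: tensor_op_def tensor_def)
qed

text \<open>Exchanging \<open>(a, b)\<close> and \<open>(c, d)\<close> interchanges the two mixed
  terms in this form, so they cancel in the commutator.\<close>

lemma tensor_op_op:
  assumes "ix n a" "ix n b" "ix n c" "ix n d"
  shows "tensor_op L1 L2 a b (tensor_op L1 L2 c d f) (x # xs) =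
    L1 a b (L1 c d (\<lambda>y. f (y # xs))) x + L2 c d (\<lambda>ys. L1 a b (\<lambda>y. f (y # ys)) x) xs
    + L2 a b (\<lambda>ys. L1 c d (\<lambda>y. f (y # ys)) x) xs + L2 a b (L2 c d (\<lambda>ys. f (x # ys))) xs"
proof -
  have "(\<lambda>y. tensor_op L1 L2 c d f (y # xs)) = L1 c d (\<lambda>y. f (y # xs)) + (\<lambda>y. L2 c d (\<lambda>ys. f (y # ys)) xs)"
    "(\<lambda>ys. tensor_op L1 L2 c d f (x # ys)) = (\<lambda>ys. L1 c d (\<lambda>y. f (y # ys)) x) + L2 c d (\<lambda>ys. f (x # ys))"
    by (auto simp: tensor_op_def)
  moreover have "L1 a b (\<lambda>y. L2 c d (\<lambda>ys. f (y # ys)) xs) x = L2 c d (\<lambda>ys. L1 a b (\<lambda>y. f (y # ys)) x) xs"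
    by (rule evalfun_swap[OF M1.evalfun_L[OF assms(1,2)], of "\<lambda>h. L2 c d h xs" "\<lambda>y ys. f (y # ys)"])
      (use assms in \<open>simp_all add: M2.L_lin\<close>, simp add: fscale_def)
  ultimately show ?thesis using assms
    by (simp add: tensor_op_def[of _ _ a b] M1.L_add M2.L_add)
qed

lemma model_tensor: "model n (tensor_op L1 L2) (tensor_basis B1 B2)"
proof (intro model.intro unitary_module.intro so_module.intro so_module_axioms.intro unitary_module_axioms.intro model_axioms.intro vector_space_fscale)
  show "Vector_Spaces.linear fscale fscale (tensor_op L1 L2 a b)" if "ix n a" "ix n b" for a b
    using vector_space_fscale that by (simp add: Vector_Spaces.linear_iff tensor_op_add tensor_op_scale)
  show "tensor_op L1 L2 (- b) (- a) f = - tensor_op L1 L2 a b f" if "ix n a" "ix n b" for a b f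
    using that by (auto simp: tensor_op_def M1.L_skew M2.L_skew split: list.splits)
  show "tensor_op L1 L2 a b (tensor_op L1 L2 c d f) = tensor_op L1 L2 c d (tensor_op L1 L2 a b f) +
     ((if b = c then tensor_op L1 L2 a d f else 0) - (if a = d then tensor_op L1 L2 c b f else 0) -
      (if b = - d then tensor_op L1 L2 a (- c) f else 0) + (if a = - c then tensor_op L1 L2 (- d) b f else 0))"
    if "ix n a" "ix n b" "ix n c" "ix n d" for a b c d f
  proof (rule ext)
    fix l
    show "tensor_op L1 L2 a b (tensor_op L1 L2 c d f) l = (tensor_op L1 L2 c d (tensor_op L1 L2 a b f) +
     ((if b = c then tensor_op L1 L2 a d f else 0) - (if a = d then tensor_op L1 L2 c b f else 0) -
      (if b = - d then tensor_op L1 L2 a (- c) f else 0) + (if a = - c then tensor_op L1 L2 (- d) b f else 0))) l"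
    proof (cases l)
      case Nil
      then show ?thesis by (simp add: tensor_op_def)
    next
      case (Cons x xs)
      let ?fx = "\<lambda>y. f (y # xs)" and ?fy = "\<lambda>ys. f (x # ys)"
      have "tensor_op L1 L2 a b (tensor_op L1 L2 c d f) (x # xs) - tensor_op L1 L2 c d (tensor_op L1 L2 a b f) (x # xs) =
        (L1 a b (L1 c d (\<lambda>y. f (y # xs))) x - L1 c d (L1 a b (\<lambda>y. f (y # xs))) x)
        + (L2 a b (L2 c d (\<lambda>ys. f (x # ys))) xs - L2 c d (L2 a b (\<lambda>ys. f (x # ys))) xs)"
        unfolding tensor_op_op[OF that] tensor_op_op[OF that(3,4,1,2)] by simp
      then have eq: "tensor_op L1 L2 a b (tensor_op L1 L2 c d f) (x # xs) = tensor_op L1 L2 c d (tensor_op L1 L2 a b f) (x # xs) +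
        (((if b = c then L1 a d ?fx else 0) - (if a = d then L1 c b ?fx else 0)
        - (if b = - d then L1 a (- c) ?fx else 0) + (if a = - c then L1 (- d) b ?fx else 0)) x
        + ((if b = c then L2 a d ?fy else 0) - (if a = d then L2 c b ?fy else 0)
        - (if b = - d then L2 a (- c) ?fy else 0) + (if a = - c then L2 (- d) b ?fy else 0)) xs)"
        unfolding M1.L_bracket[OF that, of ?fx] M2.L_bracket[OF that, of ?fy]
        by (simp only: plus_fun_apply) (simp only: diff_eq_eq add_diff_cancel_left' add.commute add.left_commute)
      have top: "tensor_op L1 L2 a b f (x # xs) = L1 a b ?fx x + L2 a b ?fy xs" for a b by (simp add: tensor_op_def)
      have app: "(if P then F else 0) l = (if P then F l else 0)" for P and F :: "'b \<Rightarrow> complex" and l by simp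
      show ?thesis
        unfolding Cons eq plus_fun_apply minus_apply app top
        by (cases "b = c"; cases "a = d"; cases "b = - d"; cases "a = - c"; simp only: if_True if_False simp_thms; simp)
    qed
  qed
  show "finite (tensor_basis B1 B2)" by (simp add: tensor_basis_def M1.finB M2.finB)
  show "supp (tensor_basis B1 B2) (tensor_op L1 L2 a b f)"
    if "ix n a" "ix n b" "supp (tensor_basis B1 B2) f" for a b f
    unfolding supp_def
  proof (intro allI impI)
    fix l assume l: "l \<notin> tensor_basis B1 B2"
    show "tensor_op L1 L2 a b f l = 0"
    proof (cases l)
      case (Cons x xs)
      have s: "supp B1 (L1 a b (\<lambda>y. f (y # xs)))" "supp B2 (L2 a b (\<lambda>ys. f (x # ys)))"
        using that by (auto intro: M1.supp_L M2.supp_L supp_slice)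
      have z: "L1 a b (\<lambda>y. 0) = 0" "L2 a b (\<lambda>y. 0) = 0"
        using M1.L_zero[OF that(1,2)] M2.L_zero[OF that(1,2)] by (simp_all add: zero_fun_def)
      consider "x \<notin> B1" | "xs \<notin> B2" using l Cons by auto
      then show ?thesis
      proof cases
        case 1
        then have "(\<lambda>ys. f (x # ys)) = (\<lambda>_. 0)" using that(3) by (auto simp: supp_def)
        then show ?thesis using s 1 z by (simp add: Cons tensor_op_def supp_def)
      next
        case 2
        then have "(\<lambda>y. f (y # xs)) = (\<lambda>_. 0)" using that(3) by (auto simp: supp_def)
        then show ?thesis using s 2 z by (simp add: Cons tensor_op_def supp_def)
      qed
    qed (simp add: tensor_op_def)
  qed
  show "ip (tensor_basis B1 B2) (tensor_op L1 L2 a b f) g = ip (tensor_basis B1 B2) f (tensor_op L1 L2 b a g)"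
    if "ix n a" "ix n b" "supp (tensor_basis B1 B2) f" "supp (tensor_basis B1 B2) g" for a b f g
  proof -
    have 1: "(\<Sum>x\<in>B1. cnj (L1 a b (\<lambda>y. f (y # xs)) x) * g (x # xs)) = (\<Sum>x\<in>B1. cnj (f (x # xs)) * L1 b a (\<lambda>y. g (y # xs)) x)" for xs
      using M1.adj[OF that(1,2) supp_slice(1)[OF that(3)] supp_slice(1)[OF that(4)], of xs xs] by (simp add: ip_def)
    have 2: "(\<Sum>xs\<in>B2. cnj (L2 a b (\<lambda>ys. f (x # ys)) xs) * g (x # xs)) = (\<Sum>xs\<in>B2. cnj (f (x # xs)) * L2 b a (\<lambda>ys. g (x # ys)) xs)" for x
      using M2.adj[OF that(1,2) supp_slice(2)[OF that(3)] supp_slice(2)[OF that(4)], of x x] by (simp add: ip_def)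
    have "ip (tensor_basis B1 B2) (tensor_op L1 L2 a b f) g =
      (\<Sum>xs\<in>B2. \<Sum>x\<in>B1. cnj (L1 a b (\<lambda>y. f (y # xs)) x) * g (x # xs))
      + (\<Sum>x\<in>B1. \<Sum>xs\<in>B2. cnj (L2 a b (\<lambda>ys. f (x # ys)) xs) * g (x # xs))"
      unfolding ip_tensor_basis by (subst sum.swap[of _ B1 B2]) (simp add: tensor_op_def distrib_right sum.distrib sum.swap[of _ B2 B1])
    also have "\<dots> = (\<Sum>xs\<in>B2. \<Sum>x\<in>B1. cnj (f (x # xs)) * L1 b a (\<lambda>y. g (y # xs)) x)
      + (\<Sum>x\<in>B1. \<Sum>xs\<in>B2. cnj (f (x # xs)) * L2 b a (\<lambda>ys. g (x # ys)) xs)"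
      unfolding 1 2 ..
    also have "\<dots> = ip (tensor_basis B1 B2) f (tensor_op L1 L2 b a g)"
      unfolding ip_tensor_basis
      by (simp add: tensor_op_def distrib_left sum.distrib) (rule sum.swap)
    finally show ?thesis .
  qed
  show "evalfun (\<lambda>f. tensor_op L1 L2 a b f l)" if "ix n a" "ix n b" for a b l
  proof (cases l)
    case Nil
    then show ?thesis by (simp add: tensor_op_def evalfun.zero)
  next
    case (Cons x xs)
    have "evalfun (\<lambda>f. L1 a b (\<lambda>y. f (y # xs)) x + L2 a b (\<lambda>ys. f (x # ys)) xs)"
      by (rule evalfun.add[OF evalfun_comp[OF M1.evalfun_L[OF that]] evalfun_comp[OF M2.evalfun_L[OF that]]])
    then show ?thesis by (simp add: tensor_op_def Cons)
  qed
qed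

end

text \<open>By the Leibniz rule, a word of operators acts on \<open>x \<otimes> y\<close> as the sum over all ways to split it into two subwords.\<close>
primrec splits :: "'a list \<Rightarrow> ('a list \<times> 'a list) list" where
  "splits [] = [([], [])]"
| "splits (x # xs) = map (\<lambda>(p, q). (x # p, q)) (splits xs) @ map (\<lambda>(p, q). (p, x # q)) (splits xs)"

lemma splits_Cons: "(p, q) \<in> set (splits (x # xs)) \<longleftrightarrow>
    (\<exists>p'. p = x # p' \<and> (p', q) \<in> set (splits xs)) \<or> (\<exists>q'. q = x # q' \<and> (p, q') \<in> set (splits xs))"
  by auto

lemma splits_append: "(p, q) \<in> set (splits (xs @ ys)) \<longleftrightarrow>
    (\<exists>p1 p2 q1 q2. p = p1 @ p2 \<and> q = q1 @ q2 \<and> (p1, q1) \<in> set (splits xs) \<and> (p2, q2) \<in> set (splits ys))"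
proof (induction xs arbitrary: p q)
  case (Cons x xs)
  show ?case (is "?l \<longleftrightarrow> ?r")
  proof
    assume ?l
    then consider p' where "p = x # p'" "(p', q) \<in> set (splits (xs @ ys))" | q' where "q = x # q'" "(p, q') \<in> set (splits (xs @ ys))"
      unfolding append_Cons splits_Cons by blast
    then show ?r unfolding splits_Cons by cases (metis Cons.IH append_Cons)+
  next
    assume ?r
    then obtain p1 p2 q1 q2 where *: "p = p1 @ p2" "q = q1 @ q2" "(p1, q1) \<in> set (splits (x # xs))" "(p2, q2) \<in> set (splits ys)"
      by blast
    from *(3) consider p' where "p1 = x # p'" "(p', q1) \<in> set (splits xs)" | q' where "q1 = x # q'" "(p1, q') \<in> set (splits xs)"
      unfolding splits_Cons by blast
    then show ?l unfolding append_Cons splits_Cons using *(1,2,4) by cases (metis Cons.IH append_Cons)+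
  qed
qed simp

lemma splits_replicate: "(p, q) \<in> set (splits (replicate k x)) \<longleftrightarrow> (\<exists>i j. i + j = k \<and> p = replicate i x \<and> q = replicate j x)"
proof (induction k arbitrary: p q)
  case (Suc k)
  show ?case (is "?l \<longleftrightarrow> ?r")
  proof
    assume ?l
    then consider i j where "p = x # replicate i x" "q = replicate j x" "i + j = k" | i j where "p = replicate i x" "q = x # replicate j x" "i + j = k"
      unfolding replicate_Suc splits_Cons Suc by blast
    then show ?r
    proof cases
      case 1
      then show ?thesis by (intro exI[of _ "Suc i"] exI[of _ j]) simp
    next
      case 2
      then show ?thesis by (intro exI[of _ i] exI[of _ "Suc j"]) simp
    qed
  next
    assume ?r
    then obtain i j where ij: "i + j = Suc k" "p = replicate i x" "q = replicate j x" by blast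
    then show ?l
      unfolding replicate_Suc splits_Cons Suc
      by (cases i) (auto intro!: exI[of _ 0])
  qed
qed simp

definition word :: "int \<Rightarrow> (nat \<Rightarrow> nat) \<Rightarrow> nat list \<Rightarrow> (int \<times> nat) list" where
  "word s e is = concat (map (\<lambda>i. replicate (e i) (s, i)) is)"

text \<open>Splitting an ordered monomial into subwords amounts to splitting each exponent. Several
  splittings can give the same pair of exponents; these are the binomial multiplicities of the
  Leibniz rule.\<close>

lemma splits_word:
  "distinct is \<Longrightarrow> (p, q) \<in> set (splits (word s e is)) \<longleftrightarrow>
    (\<exists>e1 e2. (\<forall>i\<in>set is. e1 i + e2 i = e i) \<and> p = word s e1 is \<and> q = word s e2 is)"
proof (induction "is" arbitrary: p q)
  case (Cons i "is")
  have w: "word s e (i # is) = replicate (e i) (s, i) @ word s e is" for e by (simp add: word_def)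
  have cong: "word s e is = word s e' is" if "\<And>j. j \<in> set is \<Longrightarrow> e j = e' j" for e e'
    using that unfolding word_def by (intro arg_cong[where f = concat] map_cong) auto
  show ?case
  proof
    assume "(p, q) \<in> set (splits (word s e (i # is)))"
    then obtain x y p' q' where *: "x + y = e i" "p = replicate x (s, i) @ p'" "q = replicate y (s, i) @ q'" "(p', q') \<in> set (splits (word s e is))"
      unfolding w splits_append splits_replicate by blast
    then obtain e1 e2 where e: "\<forall>i\<in>set is. e1 i + e2 i = e i" "p' = word s e1 is" "q' = word s e2 is"
      using Cons by auto
    have "p = word s (e1(i := x)) (i # is)" "q = word s (e2(i := y)) (i # is)"
      unfolding w * e using Cons.prems by (auto intro!: cong)
    moreover have "\<forall>j\<in>set (i # is). (e1(i := x)) j + (e2(i := y)) j = e j"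
      using *(1) e(1) by auto
    ultimately show "\<exists>e1 e2. (\<forall>i\<in>set (i # is). e1 i + e2 i = e i) \<and> p = word s e1 (i # is) \<and> q = word s e2 (i # is)"
      by blast
  next
    assume "\<exists>e1 e2. (\<forall>i\<in>set (i # is). e1 i + e2 i = e i) \<and> p = word s e1 (i # is) \<and> q = word s e2 (i # is)"
    then obtain e1 e2 where e: "\<forall>i\<in>set (i # is). e1 i + e2 i = e i" "p = word s e1 (i # is)" "q = word s e2 (i # is)" by blast
    have "(word s e1 is, word s e2 is) \<in> set (splits (word s e is))" using Cons e(1) by auto
    then show "(p, q) \<in> set (splits (word s e (i # is)))"
      unfolding w splits_append splits_replicate e(2,3) using e(1)
      by (intro exI conjI; (rule refl | assumption)?) auto
  qed
qed (auto simp: word_def)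

definition op_word :: "(int \<Rightarrow> int \<Rightarrow> 'v \<Rightarrow> 'v) \<Rightarrow> (int \<times> nat) list \<Rightarrow> 'v \<Rightarrow> 'v" where
  "op_word L ws u = foldr (\<lambda>(a, i). L a (int i)) ws u"

context so_module
begin

lemma yw_opw: "yw M s e u = op_word L (word s e [1..<M]) u"
proof -
  have rep: "foldr (\<lambda>(a, i). L a (int i)) (replicate k (s, i)) u = (L s (int i) ^^ k) u" for k i u
    by (induction k) auto
  have "foldr (\<lambda>i. L s (int i) ^^ e i) is u = op_word L (word s e is) u" for "is"
    by (induction "is") (simp_all add: op_word_def word_def rep)
  then show ?thesis by (simp add: yw_def)
qed

lemma X_opw: "X M pl mi u = op_word L (word (int M) mi [1..<M] @ word (- int M) pl [1..<M]) u"
  unfolding X_def yw_opw by (simp add: op_word_def)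

lemma X_cong: "agree M pl pl' \<Longrightarrow> agree M mi mi' \<Longrightarrow> X M pl mi u = X M pl' mi' u"
  unfolding X_def agree_def using yw_cong by metis

end

section \<open>Certificates for monomials and their tensor products\<close>

definition dominant :: "nat \<Rightarrow> (nat \<Rightarrow> nat) \<Rightarrow> (nat \<Rightarrow> complex) \<Rightarrow> bool" where
  "dominant M k lam \<longleftrightarrow> (\<forall>i. 1 \<le> i \<and> i < M \<longrightarrow> lam i - lam (Suc i) = of_nat (k i)) \<and>
     (2 \<le> M \<longrightarrow> lam (M - 1) + lam M = of_nat (k M))"

text \<open>A certificate, in the form used by \<open>lower_bound\<close>, that the monomial is not
  expressible by smaller ones. The bound \<open>j < M\<close> restricts the operators killing
  \<open>g\<close> to the level below \<open>M\<close>.\<close>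

definition witness :: "nat \<Rightarrow> (nat \<Rightarrow> nat) \<Rightarrow> (nat \<Rightarrow> nat) \<Rightarrow> (nat \<Rightarrow> nat) \<Rightarrow> (int \<Rightarrow> int \<Rightarrow> ('a \<Rightarrow> complex) \<Rightarrow> 'a \<Rightarrow> complex)
    \<Rightarrow> 'a set \<Rightarrow> ('a \<Rightarrow> complex) \<Rightarrow> ('a \<Rightarrow> complex) \<Rightarrow> (nat \<Rightarrow> complex) \<Rightarrow> bool" where
  "witness M k pl mi L B u g lam \<longleftrightarrow> model M L B \<and> supp B u \<and> supp B g \<and>
     so_module.singular fscale L M {0} u lam \<and> dominant M k lam \<and>
     (\<forall>i j. 1 \<le> i \<longrightarrow> i < j \<longrightarrow> j < M \<longrightarrow> L (int i) (int j) g = 0 \<and> L (int i) (- int j) g = 0) \<and>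
     (\<forall>p q. block_lt M p q pl mi \<longrightarrow> ip B g (so_module.X L M p q u) = 0) \<and>
     ip B g (so_module.X L M pl mi u) \<noteq> 0"

text \<open>Taking leading terms is multiplicative. The pairing with \<open>g1 \<otimes> g2\<close>
  is a sum over splittings of products of pairings. By \<open>block_lt_split\<close> a splitting
  contributes only if its exponents are the two given ones, and then always the same nonzero number,
  so the contributions add up instead of cancelling.\<close>

theorem witness_tensor:
  fixes L1 :: "int \<Rightarrow> int \<Rightarrow> ('a \<Rightarrow> complex) \<Rightarrow> 'a \<Rightarrow> complex"
  assumes w1: "witness M k1 pl1 mi1 L1 B1 u1 g1 lam1" and w2: "witness M k2 pl2 mi2 L2 B2 u2 g2 lam2"
  shows "witness M (\<lambda>i. k1 i + k2 i) (\<lambda>i. pl1 i + pl2 i) (\<lambda>i. mi1 i + mi2 i)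
    (tensor_op L1 L2) (tensor_basis B1 B2) (tensor u1 u2) (tensor g1 g2) (\<lambda>i. lam1 i + lam2 i)"
proof -
  have m1: "model M L1 B1" and m2: "model M L2 B2" using w1 w2 by (auto simp: witness_def)
  interpret M1: model M L1 B1 by (rule m1)
  interpret M2: model M L2 B2 by (rule m2)
  interpret T: model M "tensor_op L1 L2" "tensor_basis B1 B2" by (rule model_tensor[OF m1 m2])
  note op = tensor_op_tensor[OF m1 m2]
  have tz: "tensor 0 w = 0" "tensor w' 0 = 0" for w :: "'a list \<Rightarrow> complex" and w' :: "'a \<Rightarrow> complex"
    by (auto simp: tensor_def fun_eq_iff split: list.splits)
  have ts: "tensor (fscale c x) w = fscale c (tensor x w)" "tensor x (fscale c w) = fscale c (tensor x w)" for c x and w :: "'a list \<Rightarrow> complex"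
    by (auto simp: tensor_def fscale_def fun_eq_iff split: list.splits)
  let ?u = "tensor u1 u2" and ?g = "tensor g1 g2" and ?B = "tensor_basis B1 B2"
  have singular: "T.singular M {0} ?u (\<lambda>i. lam1 i + lam2 i)"
    using w1 w2 unfolding T.singular_def witness_def M1.singular_def M2.singular_def
    by (auto simp: op tz ts M2.scale_left_distrib)
  have g: "tensor_op L1 L2 (int i) (int j) ?g = 0 \<and> tensor_op L1 L2 (int i) (- int j) ?g = 0" if "1 \<le> i" "i < j" "j < M" for i j
    using w1 w2 that unfolding witness_def by (simp add: op tz)
  have expand: "op_word (tensor_op L1 L2) ws ?u = (\<Sum>(p, q)\<leftarrow>splits ws. tensor (op_word L1 p u1) (op_word L2 q u2))"
    if "\<And>a i. (a, i) \<in> set ws \<Longrightarrow> ix M a \<and> ix M (int i)" for ws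
    using that
  proof (induction ws)
    case (Cons x ws)
    obtain a i where x: "x = (a, i)" by (cases x)
    have ix: "ix M a" "ix M (int i)" using Cons.prems x by auto
    have suml: "tensor_op L1 L2 a (int i) (sum_list (map F ys)) = sum_list (map (\<lambda>y. tensor_op L1 L2 a (int i) (F y)) ys)" for F and ys :: "((int \<times> nat) list \<times> (int \<times> nat) list) list"
      by (induction ys) (simp_all add: T.L_zero T.L_add ix del: plus_fun_apply zero_fun_apply ix_of_nat)
    have "op_word (tensor_op L1 L2) (x # ws) ?u = tensor_op L1 L2 a (int i) (op_word (tensor_op L1 L2) ws ?u)"
      by (simp add: op_word_def x)
    also have "op_word (tensor_op L1 L2) ws ?u = (\<Sum>(p, q)\<leftarrow>splits ws. tensor (op_word L1 p u1) (op_word L2 q u2))"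
      by (rule Cons.IH) (rule Cons.prems, simp)
    also have "tensor_op L1 L2 a (int i) \<dots> = (\<Sum>(p, q)\<leftarrow>splits ws. tensor (op_word L1 (x # p) u1) (op_word L2 q u2) + tensor (op_word L1 p u1) (op_word L2 (x # q) u2))"
      unfolding suml by (intro arg_cong[where f = sum_list] map_cong refl) (auto simp: op[OF ix] x op_word_def)
    also have "\<dots> = (\<Sum>(p, q)\<leftarrow>splits (x # ws). tensor (op_word L1 p u1) (op_word L2 q u2))"
      unfolding splits.simps map_append sum_list_append map_map case_prod_unfold comp_def sum_list_addf by simp
    finally show ?case .
  qed (simp add: op_word_def)
  let ?W = "\<lambda>pl mi. word (int M) mi [1..<M] @ word (- int M) pl [1..<M]"
  let ?t = "\<lambda>(p, q). ip B1 g1 (op_word L1 p u1) * ip B2 g2 (op_word L2 q u2)"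
  have coeff: "ip ?B ?g (T.X M pl mi ?u) = (\<Sum>pq\<leftarrow>splits (?W pl mi). ?t pq)" for pl mi
  proof -
    have ipl: "ip ?B ?g (sum_list (map F ys)) = sum_list (map (\<lambda>y. ip ?B ?g (F y)) ys)" for F and ys :: "((int \<times> nat) list \<times> (int \<times> nat) list) list"
      by (induction ys) (simp_all del: plus_fun_apply zero_fun_apply)
    have "op_word (tensor_op L1 L2) (?W pl mi) ?u = (\<Sum>(p, q)\<leftarrow>splits (?W pl mi). tensor (op_word L1 p u1) (op_word L2 q u2))"
      by (rule expand) (auto simp: word_def)
    then show ?thesis unfolding T.X_opw ipl case_prod_unfold ip_tensor[symmetric] by (simp only: ipl)
  qed
  have terms: "\<exists>p1 p2 q1 q2. agree M (\<lambda>i. p1 i + p2 i) pl \<and> agree M (\<lambda>i. q1 i + q2 i) mi \<and>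
      pq = (?W p1 q1, ?W p2 q2)" if "pq \<in> set (splits (?W pl mi))" for pq pl mi
  proof -
    obtain a b where ab: "pq = (a, b)" by (cases pq)
    have "(a, b) \<in> set (splits (?W pl mi))" using that by (simp only: ab)
    then obtain p p' q q' where *: "a = p @ p'" "b = q @ q'" "(p, q) \<in> set (splits (word (int M) mi [1..<M]))"
      "(p', q') \<in> set (splits (word (- int M) pl [1..<M]))"
      unfolding splits_append by blast
    obtain q1 q2 where "\<forall>i\<in>{1..<M}. q1 i + q2 i = mi i" "p = word (int M) q1 [1..<M]" "q = word (int M) q2 [1..<M]"
      using *(3) by (subst (asm) splits_word) auto
    moreover obtain p1 p2 where "\<forall>i\<in>{1..<M}. p1 i + p2 i = pl i" "p' = word (- int M) p1 [1..<M]" "q' = word (- int M) p2 [1..<M]"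
      using *(4) by (subst (asm) splits_word) auto
    ultimately show ?thesis
      unfolding ab *(1,2) by (intro exI[of _ p1] exI[of _ p2] exI[of _ q1] exI[of _ q2]) (simp add: agree_def)
  qed
  have t: "?t (?W p1 q1, ?W p2 q2) = ip B1 g1 (M1.X M p1 q1 u1) * ip B2 g2 (M2.X M p2 q2 u2)" for p1 p2 q1 q2
    by (simp add: M1.X_opw M2.X_opw)
  let ?pl = "\<lambda>i. pl1 i + pl2 i" and ?mi = "\<lambda>i. mi1 i + mi2 i"
  have zero1: "ip B1 g1 (M1.X M p q u1) = 0" if "block_lt M p q pl1 mi1" for p q
    using w1 that by (simp add: witness_def)
  have zero2: "ip B2 g2 (M2.X M p q u2) = 0" if "block_lt M p q pl2 mi2" for p q
    using w2 that by (simp add: witness_def)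
  have zero: "ip ?B ?g (T.X M p q ?u) = 0" if pq: "block_lt M p q ?pl ?mi" for p q
  proof -
    have "?t x = 0" if x: "x \<in> set (splits (?W p q))" for x
    proof -
      obtain p1 p2 q1 q2 where *: "agree M (\<lambda>i. p1 i + p2 i) p" "agree M (\<lambda>i. q1 i + q2 i) q" "x = (?W p1 q1, ?W p2 q2)"
        using terms[OF x] by blast
      have "block_lt M p1 q1 pl1 mi1 \<or> block_lt M p2 q2 pl2 mi2"
        using block_lt_split[OF _ *(1,2)] pq by blast
      then show ?thesis unfolding *(3) t using zero1 zero2 by auto
    qed
    then have "map ?t (splits (?W p q)) = map (\<lambda>_. 0) (splits (?W p q))" by (intro map_cong) auto
    then show ?thesis unfolding coeff by (simp only:) (simp add: sum_list_0)
  qed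
  have "ip ?B ?g (T.X M ?pl ?mi ?u) \<noteq> 0"
  proof -
    define C where "C = ip B1 g1 (M1.X M pl1 mi1 u1) * ip B2 g2 (M2.X M pl2 mi2 u2)"
    have C: "C \<noteq> 0" using w1 w2 by (simp add: C_def witness_def)
    have "?t x = 0 \<or> ?t x = C" if x: "x \<in> set (splits (?W ?pl ?mi))" for x
    proof -
      obtain p1 p2 q1 q2 where *: "agree M (\<lambda>i. p1 i + p2 i) ?pl" "agree M (\<lambda>i. q1 i + q2 i) ?mi" "x = (?W p1 q1, ?W p2 q2)"
        using terms[OF x] by blast
      consider "block_lt M p1 q1 pl1 mi1 \<or> block_lt M p2 q2 pl2 mi2" | "agree M p1 pl1 \<and> agree M p2 pl2 \<and> agree M q1 mi1 \<and> agree M q2 mi2"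
      proof -
        have "block_lt M ?pl ?mi ?pl ?mi \<or> agree M ?pl ?pl \<and> agree M ?mi ?mi" by simp
        from block_lt_split[OF this *(1,2)] show ?thesis using that by blast
      qed
      then show ?thesis
      proof cases
        case 1
        then show ?thesis unfolding *(3) t using zero1 zero2 by auto
      next
        case 2
        then have "M1.X M p1 q1 u1 = M1.X M pl1 mi1 u1" "M2.X M p2 q2 u2 = M2.X M pl2 mi2 u2"
          by (simp_all add: M1.X_cong M2.X_cong)
        then show ?thesis unfolding *(3) t C_def by (simp only: simp_thms)
      qed
    qed
    \<comment> \<open>The exact multiplicity is irrelevant as long as it is positive; the splitting
      into the two given blocks shows that it is.\<close>
    then have "\<exists>c::nat. (\<Sum>x\<leftarrow>xs. ?t x) = of_nat c * C \<and> ((\<exists>x\<in>set xs. ?t x = C) \<longrightarrow> c > 0)"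
      if "set xs \<subseteq> set (splits (?W ?pl ?mi))" for xs
      using that
    proof (induction xs)
      case (Cons x xs)
      then obtain c :: nat where c: "(\<Sum>x\<leftarrow>xs. ?t x) = of_nat c * C" "(\<exists>x\<in>set xs. ?t x = C) \<longrightarrow> c > 0" by auto
      have "?t x = 0 \<or> ?t x = C" using Cons by auto
      then show ?case
      proof
        assume "?t x = 0"
        then show ?thesis using c C by (intro exI[of _ c]) auto
      next
        assume "?t x = C"
        then show ?thesis using c C by (intro exI[of _ "Suc c"]) (simp add: of_nat_Suc algebra_simps)
      qed
    qed simp
    from this[OF order.refl] obtain c :: nat where c: "(\<Sum>x\<leftarrow>splits (?W ?pl ?mi). ?t x) = of_nat c * C" "(\<exists>x\<in>set (splits (?W ?pl ?mi)). ?t x = C) \<longrightarrow> c > 0"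
      by blast
    have "(?W pl1 mi1, ?W pl2 mi2) \<in> set (splits (?W ?pl ?mi))"
    proof -
      have "(word (int M) mi1 [1..<M], word (int M) mi2 [1..<M]) \<in> set (splits (word (int M) ?mi [1..<M]))"
        "(word (- int M) pl1 [1..<M], word (- int M) pl2 [1..<M]) \<in> set (splits (word (- int M) ?pl [1..<M]))"
        by (subst splits_word; auto)+
      then show ?thesis unfolding splits_append by blast
    qed
    moreover have "?t (?W pl1 mi1, ?W pl2 mi2) = C" by (simp only: t C_def)
    ultimately have "c > 0" using c(2) by blast
    then show ?thesis unfolding coeff c(1) using C by simp
  qed
  moreover have "dominant M (\<lambda>i. k1 i + k2 i) (\<lambda>i. lam1 i + lam2 i)"
  proof -
    have e: "a + b - (c + d) = (a - c) + (b - d)" "a + b + (c + d) = (a + c) + (b + d)" for a b c d :: complex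
      by simp_all
    show ?thesis using w1 w2 unfolding witness_def dominant_def e by simp
  qed
  ultimately show ?thesis
    unfolding witness_def using T.model_axioms singular g zero w1 w2 supp_tensor by (auto simp: witness_def)
qed

section \<open>Exterior powers and spin representations\<close>

text \<open>Fermionic Fock space: functions on finite sets of modes, with the sign convention given by the order of the modes.\<close>
definition below_sign :: "nat \<Rightarrow> nat set \<Rightarrow> complex" where
  "below_sign x A = (- 1) ^ card {y \<in> A. y < x}"

definition creat :: "nat \<Rightarrow> (nat set \<Rightarrow> complex) \<Rightarrow> nat set \<Rightarrow> complex" where
  "creat x f A = (if x \<in> A then below_sign x A * f (A - {x}) else 0)"

definition annih :: "nat \<Rightarrow> (nat set \<Rightarrow> complex) \<Rightarrow> nat set \<Rightarrow> complex" where
  "annih x f A = (if x \<in> A then 0 else below_sign x A * f (insert x A))"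

lemma below_sign_sq [simp]: "below_sign x A * below_sign x A = 1"
  by (simp add: below_sign_def flip: power_add mult_2)

lemma below_sign_insert: "y \<notin> A \<Longrightarrow> below_sign x (insert y A) = (if y < x then - below_sign x A else below_sign x A)"
proof -
  assume y: "y \<notin> A"
  have "{z \<in> insert y A. z < x} = (if y < x then insert y {z \<in> A. z < x} else {z \<in> A. z < x})" by auto
  then show ?thesis using y by (simp add: below_sign_def)
qed

lemma below_sign_remove: "y \<in> A \<Longrightarrow> below_sign x (A - {y}) = (if y < x then - below_sign x A else below_sign x A)"
  using below_sign_insert[of y "A - {y}" x] by (auto simp: insert_absorb)

lemma below_sign_ne [simp]: "below_sign x A \<noteq> 0" by (simp add: below_sign_def)

lemma creat_cr: "creat x (creat y f) = - creat y (creat x f)"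
proof (rule ext)
  fix A
  have "A - {x} - {y} = A - {y} - {x}" by auto
  then show "creat x (creat y f) A = (- creat y (creat x f)) A"
    by (cases x y rule: linorder_cases) (auto simp: creat_def below_sign_remove)
qed

lemma annih_an: "annih x (annih y f) = - annih y (annih x f)"
  by (rule ext, cases x y rule: linorder_cases) (auto simp: annih_def below_sign_insert insert_commute)

lemma annih_cr: "annih x (creat y f) = (if x = y then f else 0) - creat y (annih x f)"
proof (rule ext)
  fix A
  have "x \<noteq> y \<Longrightarrow> insert x A - {y} = insert x (A - {y})" by auto
  moreover have "x \<notin> A \<Longrightarrow> insert x A - {x} = A" "x \<in> A \<Longrightarrow> insert x (A - {x}) = A" by auto
  ultimately show "annih x (creat y f) A = ((if x = y then f else 0) - creat y (annih x f)) A"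
    by (cases x y rule: linorder_cases) (auto simp: creat_def annih_def below_sign_insert below_sign_remove insert_absorb mult.assoc[symmetric])
qed

lemma creat_lin: "creat x (f + g) = creat x f + creat x g" "creat x (f - g) = creat x f - creat x g" "creat x (- f) = - creat x f" "creat x 0 = 0"
    "creat x (fscale c f) = fscale c (creat x f)"
  and annih_lin: "annih x (f + g) = annih x f + annih x g" "annih x (f - g) = annih x f - annih x g" "annih x (- f) = - annih x f" "annih x 0 = 0"
    "annih x (fscale c f) = fscale c (annih x f)"
  by (auto simp: creat_def annih_def fscale_def fun_eq_iff algebra_simps)

lemma fscale_lin: "fscale c (f + g) = fscale c f + fscale c g" "fscale c (f - g) = fscale c f - fscale c g" "fscale c 0 = 0"
  "fscale c (- f) = - fscale c f" "fscale c (fscale d f) = fscale (c * d) f" "fscale 1 f = f" "fscale 0 f = 0"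
  by (auto simp: fscale_def fun_eq_iff algebra_simps)

lemma evalfun_cr: "(\<And>A. evalfun (\<lambda>f. T f A)) \<Longrightarrow> evalfun (\<lambda>f. creat x (T f) A)"
  and evalfun_an: "(\<And>A. evalfun (\<lambda>f. T f A)) \<Longrightarrow> evalfun (\<lambda>f. annih x (T f) A)"
  by (cases "x \<in> A"; simp add: creat_def annih_def evalfun.zero evalfun.scale)+

lemma evalfun_diff: "evalfun \<phi> \<Longrightarrow> evalfun \<psi> \<Longrightarrow> evalfun (\<lambda>f. \<phi> f - \<psi> f)"
  using evalfun.add[OF _ evalfun.scale[of \<psi> "- 1"], of \<phi>] by simp

lemma supp_cr: "x \<in> N \<Longrightarrow> supp (Pow N) f \<Longrightarrow> supp (Pow N) (creat x f)"
  and supp_an: "x \<in> N \<Longrightarrow> supp (Pow N) f \<Longrightarrow> supp (Pow N) (annih x f)"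
proof -
  assume "x \<in> N"
  then have "\<not> A - {x} \<subseteq> N" "\<not> insert x A \<subseteq> N" if "\<not> A \<subseteq> N" for A using that by auto
  then show "supp (Pow N) f \<Longrightarrow> supp (Pow N) (creat x f)" "supp (Pow N) f \<Longrightarrow> supp (Pow N) (annih x f)"
    by (simp_all add: supp_def creat_def annih_def)
qed

lemma supp_lin: "supp B f \<Longrightarrow> supp B g \<Longrightarrow> supp B (f - g)"
  by (auto simp: supp_def)

lemma ip_cr:
  assumes "finite N" "x \<in> N"
  shows "ip (Pow N) (creat x f) g = ip (Pow N) f (annih x g)"
proof -
  have "ip (Pow N) (creat x f) g = (\<Sum>A\<in>{A \<in> Pow N. x \<in> A}. below_sign x A * cnj (f (A - {x})) * g A)"
    unfolding ip_def using assms(1)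
    by (subst sum.inter_filter) (auto intro!: sum.cong simp: creat_def below_sign_def)
  also have "\<dots> = (\<Sum>A\<in>{A \<in> Pow N. x \<notin> A}. cnj (f A) * (below_sign x A * g (insert x A)))"
    by (rule sum.reindex_bij_witness[where i = "insert x" and j = "\<lambda>A. A - {x}"])
      (use assms(2) in \<open>auto simp: insert_absorb below_sign_remove\<close>)
  also have "\<dots> = ip (Pow N) f (annih x g)"
    unfolding ip_def using assms(1)
    by (subst sum.inter_filter) (auto intro!: sum.cong simp: annih_def)
  finally show ?thesis .
qed

lemma ip_cnj: "ip B g f = cnj (ip B f g)"
  by (simp add: ip_def mult.commute)

lemma ip_an: "finite N \<Longrightarrow> x \<in> N \<Longrightarrow> ip (Pow N) (annih x f) g = ip (Pow N) f (creat x g)"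
  using ip_cr[of N x g f] ip_cnj by metis

text \<open>Signed indices become modes through an injection into the natural numbers, whose order
  fixes the signs. The common type lets exterior and spin models occur as factors of one tensor
  product.\<close>

abbreviation creat_at :: "int \<Rightarrow> (nat set \<Rightarrow> complex) \<Rightarrow> nat set \<Rightarrow> complex" where "creat_at a \<equiv> creat (int_encode a)"
abbreviation annih_at :: "int \<Rightarrow> (nat set \<Rightarrow> complex) \<Rightarrow> nat set \<Rightarrow> complex" where "annih_at a \<equiv> annih (int_encode a)"

definition basis_state :: "int set \<Rightarrow> nat set \<Rightarrow> complex" where
  "basis_state S A = (if A = int_encode ` S then 1 else 0)"

lemma enc_inj: "int_encode ` S = int_encode ` T \<longleftrightarrow> S = T"
  by (simp add: inj_image_eq_iff inj_int_encode)

lemma enc_mem [simp]: "int_encode a \<in> int_encode ` S \<longleftrightarrow> a \<in> S"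
  by (simp add: inj_image_mem_iff inj_int_encode)

lemma c_st_in: "a \<in> S \<Longrightarrow> creat_at a (basis_state S) = 0"
proof (rule ext)
  fix A assume "a \<in> S"
  then have "int_encode a \<in> int_encode ` S" by simp
  then show "creat_at a (basis_state S) A = 0 A" by (auto simp: creat_def basis_state_def)
qed

lemma c_st: "a \<notin> S \<Longrightarrow> \<exists>\<sigma>. \<sigma> \<noteq> 0 \<and> creat_at a (basis_state S) = fscale \<sigma> (basis_state (insert a S))"
proof -
  assume "a \<notin> S"
  then have n: "int_encode a \<notin> int_encode ` S" by simp
  have "creat_at a (basis_state S) = fscale (below_sign (int_encode a) (int_encode ` S)) (basis_state (insert a S))"
  proof (rule ext)
    fix A
    have "A - {int_encode a} = int_encode ` S \<and> int_encode a \<in> A \<longleftrightarrow> A = int_encode ` (insert a S)"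
      unfolding image_insert using n by blast
    moreover have "A = int_encode ` (insert a S) \<Longrightarrow> below_sign (int_encode a) A = below_sign (int_encode a) (int_encode ` S)"
      using n by (simp add: below_sign_insert)
    ultimately show "creat_at a (basis_state S) A = fscale (below_sign (int_encode a) (int_encode ` S)) (basis_state (insert a S)) A"
      by (auto simp: creat_def basis_state_def fscale_def)
  qed
  then show ?thesis using below_sign_ne by blast
qed

lemma d_st_out: "a \<notin> S \<Longrightarrow> annih_at a (basis_state S) = 0"
proof (rule ext)
  fix A assume "a \<notin> S"
  then have "int_encode a \<notin> int_encode ` S" by simp
  then have "insert (int_encode a) A \<noteq> int_encode ` S" by blast
  then show "annih_at a (basis_state S) A = 0 A" by (auto simp: annih_def basis_state_def)
qed

lemma d_st: "a \<in> S \<Longrightarrow> \<exists>\<sigma>. \<sigma> \<noteq> 0 \<and> annih_at a (basis_state S) = fscale \<sigma> (basis_state (S - {a}))"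
proof -
  assume "a \<in> S"
  then have S: "int_encode a \<in> int_encode ` S" by simp
  have e: "int_encode ` (S - {a}) = int_encode ` S - {int_encode a}"
    by (simp add: image_set_diff inj_int_encode)
  have "annih_at a (basis_state S) = fscale (below_sign (int_encode a) (int_encode ` S)) (basis_state (S - {a}))"
  proof (rule ext)
    fix A
    have "insert (int_encode a) A = int_encode ` S \<and> int_encode a \<notin> A \<longleftrightarrow> A = int_encode ` S - {int_encode a}"
      using S by auto
    moreover have "below_sign (int_encode a) (int_encode ` S - {int_encode a}) = below_sign (int_encode a) (int_encode ` S)"
      using S by (simp add: below_sign_remove)
    ultimately show "annih_at a (basis_state S) A = fscale (below_sign (int_encode a) (int_encode ` S)) (basis_state (S - {a})) A"
      by (auto simp: annih_def basis_state_def fscale_def e)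
  qed
  then show ?thesis using below_sign_ne by blast
qed

lemma cd_st: "creat_at a (annih_at a (basis_state S)) = (if a \<in> S then basis_state S else 0)"
proof (cases "a \<in> S")
  case True
  have "annih_at a (creat_at a (basis_state S)) = basis_state S - creat_at a (annih_at a (basis_state S))" by (simp add: annih_cr)
  then show ?thesis using True c_st_in[OF True] by (simp add: annih_lin)
qed (simp add: d_st_out creat_lin)

lemma ip_st:
  assumes "finite N" "int_encode ` S \<subseteq> N"
  shows "ip (Pow N) (basis_state S) (basis_state T) = (if S = T then 1 else 0)"
proof -
  have "ip (Pow N) (basis_state S) (basis_state T) = (\<Sum>A\<in>Pow N. if A = int_encode ` S then (if S = T then 1 else 0) else 0)"
    unfolding ip_def by (intro sum.cong refl) (auto simp: basis_state_def enc_inj)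
  then show ?thesis using assms by simp
qed

text \<open>The second quantisation of the matrix unit E_{a,b}: in an exterior product it replaces
  the basis vector with index b by the one with index a.\<close>

definition ext_elem :: "int \<Rightarrow> int \<Rightarrow> (nat set \<Rightarrow> complex) \<Rightarrow> nat set \<Rightarrow> complex" where
  "ext_elem a b f = creat_at a (annih_at b f)"

definition ext_op :: "int \<Rightarrow> int \<Rightarrow> (nat set \<Rightarrow> complex) \<Rightarrow> nat set \<Rightarrow> complex" where
  "ext_op a b f = ext_elem a b f - ext_elem (- b) (- a) f"

lemma ext_elem_lin: "ext_elem a b (f + g) = ext_elem a b f + ext_elem a b g" "ext_elem a b (f - g) = ext_elem a b f - ext_elem a b g"
    "ext_elem a b (fscale k f) = fscale k (ext_elem a b f)"
  by (simp_all add: ext_elem_def creat_lin annih_lin)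

lemma ext_elem_bracket: "ext_elem a b (ext_elem a' b' f) = ext_elem a' b' (ext_elem a b f)
    + (if b = a' then ext_elem a b' f else 0) - (if a = b' then ext_elem a' b f else 0)"
proof -
  have 1: "creat_at a (annih_at b (creat_at a' (annih_at b' f))) = (if b = a' then creat_at a (annih_at b' f) else 0) - creat_at a (creat_at a' (annih_at b (annih_at b' f)))"
    by (simp add: annih_cr[of _ "int_encode a'"] creat_lin int_encode_eq)
  have 2: "creat_at a' (annih_at b' (creat_at a (annih_at b f))) = (if a = b' then creat_at a' (annih_at b f) else 0) - creat_at a' (creat_at a (annih_at b' (annih_at b f)))"
    by (auto simp: annih_cr[of _ "int_encode a"] creat_lin int_encode_eq)
  have 3: "creat_at a (creat_at a' (annih_at b (annih_at b' f))) = creat_at a' (creat_at a (annih_at b' (annih_at b f)))"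
    by (subst creat_cr, subst annih_an) (simp add: creat_lin)
  show ?thesis unfolding ext_elem_def 1 2 3 by (simp add: algebra_simps)
qed

text \<open>The Clifford generators: \<open>clifford a\<close> and \<open>clifford (-a)\<close> are adjoint to each other.\<close>
definition clifford :: "int \<Rightarrow> (nat set \<Rightarrow> complex) \<Rightarrow> nat set \<Rightarrow> complex" where
  "clifford a = (if a > 0 then creat_at a else annih_at (- a))"

text \<open>The quadratic Clifford element represents E_{a,b} - E_{-b,-a} up to a constant. The
  constant 1/2 is forced by the antisymmetry between \<open>(a, b)\<close> and
  \<open>(-b, -a)\<close> and makes the weights half-integral.\<close>

definition spin_op :: "int \<Rightarrow> int \<Rightarrow> (nat set \<Rightarrow> complex) \<Rightarrow> nat set \<Rightarrow> complex" where
  "spin_op a b f = clifford a (clifford (- b) f) - fscale (if a = b then 1 / 2 else 0) f"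

lemma clifford_lin: "clifford a (f + g) = clifford a f + clifford a g" "clifford a (f - g) = clifford a f - clifford a g" "clifford a (- f) = - clifford a f" "clifford a 0 = 0"
    "clifford a (fscale k f) = fscale k (clifford a f)"
  by (simp_all add: clifford_def creat_lin annih_lin)

lemma clifford_anti:
  assumes "a \<noteq> 0" "b \<noteq> 0"
  shows "clifford a (clifford b f) = (if a = - b then f else 0) - clifford b (clifford a f)"
proof (cases "a > 0"; cases "b > 0")
  assume "a > 0" "b > 0"
  then show ?thesis using creat_cr[of "int_encode a" "int_encode b" f] by (simp add: clifford_def)
next
  assume "a > 0" "\<not> b > 0"
  then show ?thesis using annih_cr[of "int_encode (- b)" "int_encode a" f] by (auto simp: clifford_def int_encode_eq)
next
  assume "\<not> a > 0" "b > 0"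
  then show ?thesis using annih_cr[of "int_encode (- a)" "int_encode b" f] by (auto simp: clifford_def int_encode_eq)
next
  assume "\<not> a > 0" "\<not> b > 0"
  then show ?thesis using assms annih_an[of "int_encode (- a)" "int_encode (- b)" f] by (simp add: clifford_def)
qed

lemma if_fun: "(if P then F else 0) A = (if P then F A else (0::complex))" by simp

lemma spin_bracket:
  assumes "a \<noteq> 0" "b \<noteq> 0" "a' \<noteq> 0" "b' \<noteq> 0"
  shows "spin_op a b (spin_op a' b' f) = spin_op a' b' (spin_op a b f) +
     ((if b = a' then spin_op a b' f else 0) - (if a = b' then spin_op a' b f else 0) -
      (if b = - b' then spin_op a (- a') f else 0) + (if a = - a' then spin_op (- b') b f else 0))"
proof -
  let ?g = clifford
  have lin: "?g x (if P then F else 0) = (if P then ?g x F else 0)" for x P F by (simp add: clifford_lin)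
  have 1: "?g a (?g (- b) (?g a' (?g (- b') f))) = (if b = a' then ?g a (?g (- b') f) else 0) - ?g a (?g a' (?g (- b) (?g (- b') f)))"
    using assms by (subst clifford_anti[of "- b" a']) (auto simp: clifford_lin)
  have 2: "?g a (?g a' (?g (- b) (?g (- b') f))) = (if a = - a' then ?g (- b) (?g (- b') f) else 0) - ?g a' (?g a (?g (- b) (?g (- b') f)))"
    using assms by (subst clifford_anti[of a a']) auto
  have 3: "?g a' (?g a (?g (- b) (?g (- b') f))) = (if b = - b' then ?g a' (?g a f) else 0) - ?g a' (?g a (?g (- b') (?g (- b) f)))"
    using assms by (subst clifford_anti[of "- b" "- b'"]) (auto simp: clifford_lin)
  have 4: "?g a' (?g a (?g (- b') (?g (- b) f))) = (if a = b' then ?g a' (?g (- b) f) else 0) - ?g a' (?g (- b') (?g a (?g (- b) f)))"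
    using assms by (subst clifford_anti[of a "- b'"]) (auto simp: clifford_lin)
  \<comment> \<open>These two relations reorder the products that occur in the wrong order in the
    bracket; their constant terms account for the shifts by 1/2.\<close>
  have 5: "?g a (?g a' f) = (if a = - a' then f else 0) - ?g a' (?g a f)" using assms by (rule_tac clifford_anti) auto
  have 6: "?g (- b') (?g (- b) f) = (if b = - b' then f else 0) - ?g (- b) (?g (- b') f)"
    using assms clifford_anti[of "- b'" "- b" f] by (auto simp: minus_equation_iff equation_minus_iff)
  have main: "?g a (?g (- b) (?g a' (?g (- b') f))) - ?g a' (?g (- b') (?g a (?g (- b) f))) =
      (if b = a' then ?g a (?g (- b') f) else 0) - (if a = - a' then ?g (- b) (?g (- b') f) else 0)
      + (if b = - b' then ?g a' (?g a f) else 0) - (if a = b' then ?g a' (?g (- b) f) else 0)"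
    unfolding 1 2 3 4 by (simp add: algebra_simps)
  have comm: "spin_op a b (spin_op a' b' f) - spin_op a' b' (spin_op a b f) =
     ?g a (?g (- b) (?g a' (?g (- b') f))) - ?g a' (?g (- b') (?g a (?g (- b) f)))"
    by (simp add: spin_op_def clifford_lin fscale_lin algebra_simps mult.commute)
  have "spin_op a b (spin_op a' b' f) - spin_op a' b' (spin_op a b f) = 
     ((if b = a' then spin_op a b' f else 0) - (if a = b' then spin_op a' b f else 0) -
      (if b = - b' then spin_op a (- a') f else 0) + (if a = - a' then spin_op (- b') b f else 0))"
    unfolding comm main
  proof (rule ext)
    fix A
    show "((if b = a' then ?g a (?g (- b') f) else 0) - (if a = - a' then ?g (- b) (?g (- b') f) else 0)
      + (if b = - b' then ?g a' (?g a f) else 0) - (if a = b' then ?g a' (?g (- b) f) else 0)) A =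
     ((if b = a' then spin_op a b' f else 0) - (if a = b' then spin_op a' b f else 0) -
      (if b = - b' then spin_op a (- a') f else 0) + (if a = - a' then spin_op (- b') b f else 0)) A"
      using fun_cong[OF 5, of A] fun_cong[OF 6, of A]
      unfolding plus_fun_apply minus_apply if_fun spin_op_def fscale_def
      by (cases "b = a'"; cases "a = - a'"; cases "b = - b'"; cases "a = b'") (simp_all add: algebra_simps)
  qed
  then show ?thesis by (simp add: algebra_simps)
qed

definition ext_modes :: "nat \<Rightarrow> nat set" where
  "ext_modes M = int_encode ` {a. ix M a}"

definition spin_modes :: "nat \<Rightarrow> nat set" where
  "spin_modes M = int_encode ` int ` {1..M}"

lemma finite_ext_modes: "finite (ext_modes M)"
proof -
  have "{a. ix M a} \<subseteq> {- int M..int M}" by (auto simp: ix_def)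
  then show ?thesis unfolding ext_modes_def using finite_subset by blast
qed

lemma finite_spin_modes: "finite (spin_modes M)"
  by (simp add: spin_modes_def)

lemma model_ext: "model M ext_op (Pow (ext_modes M))"
proof (intro model.intro unitary_module.intro so_module.intro so_module_axioms.intro unitary_module_axioms.intro model_axioms.intro vector_space_fscale)
  have in_modes: "int_encode a \<in> ext_modes M \<longleftrightarrow> ix M a" for a by (simp add: ext_modes_def)
  show "Vector_Spaces.linear fscale fscale (ext_op a b)" for a b
    using vector_space_fscale by (simp add: Vector_Spaces.linear_iff ext_op_def ext_elem_lin fscale_lin)
  show "ext_op (- b) (- a) u = - ext_op a b u" for a b u
    by (simp add: ext_op_def)
  show "ext_op a b (ext_op a' b' f) = ext_op a' b' (ext_op a b f) +
     ((if b = a' then ext_op a b' f else 0) - (if a = b' then ext_op a' b f else 0) -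
      (if b = - b' then ext_op a (- a') f else 0) + (if a = - a' then ext_op (- b') b f else 0))"
    if "ix M a" "ix M b" "ix M a'" "ix M b'" for a b a' b' f
  proof -
    have "ext_op a b (ext_op a' b' f) = ext_op a' b' (ext_op a b f)
      + ((if b = a' then ext_elem a b' f else 0) - (if a = b' then ext_elem a' b f else 0))
      - ((if b = - b' then ext_elem a (- a') f else 0) - (if a = - a' then ext_elem (- b') b f else 0))
      - ((if - a = a' then ext_elem (- b) b' f else 0) - (if - b = b' then ext_elem a' (- a) f else 0))
      + ((if - a = - b' then ext_elem (- b) (- a') f else 0) - (if - b = - a' then ext_elem (- b') (- a) f else 0))"
      unfolding ext_op_def ext_elem_lin
        ext_elem_bracket[of a b a' b' f] ext_elem_bracket[of a b "- b'" "- a'" f]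
        ext_elem_bracket[of "- b" "- a" a' b' f] ext_elem_bracket[of "- b" "- a" "- b'" "- a'" f]
      by (simp only: diff_conv_add_uminus minus_add_distrib minus_minus ac_simps)
    also have "\<dots> = ext_op a' b' (ext_op a b f) +
     ((if b = a' then ext_op a b' f else 0) - (if a = b' then ext_op a' b f else 0) -
      (if b = - b' then ext_op a (- a') f else 0) + (if a = - a' then ext_op (- b') b f else 0))"
      unfolding ext_op_def[of a b'] ext_op_def[of a' b] ext_op_def[of a "- a'"] ext_op_def[of "- b'" b]
      by (cases "b = a'"; cases "a = b'"; cases "b = - b'"; cases "a = - a'") (simp_all, metis minus_minus)
    finally show ?thesis .
  qed
  show "finite (Pow (ext_modes M))" by (simp add: finite_ext_modes)
  show "supp (Pow (ext_modes M)) (ext_op a b f)" if "ix M a" "ix M b" "supp (Pow (ext_modes M)) f" for a b f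
    using that unfolding ext_op_def ext_elem_def by (intro supp_lin supp_cr supp_an) (simp_all add: in_modes)
  show "ip (Pow (ext_modes M)) (ext_op a b f) g = ip (Pow (ext_modes M)) f (ext_op b a g)"
    if "ix M a" "ix M b" for a b f g
  proof -
    have "ip (Pow (ext_modes M)) (h - h') g = ip (Pow (ext_modes M)) h g - ip (Pow (ext_modes M)) h' g" for h h'
      by (simp add: ip_def algebra_simps sum_subtractf)
    then show ?thesis
      using that by (simp add: ext_op_def ext_elem_def ip_cr ip_an finite_ext_modes in_modes)
  qed
  show "evalfun (\<lambda>f. ext_op a b f A)" for a b A
    unfolding ext_op_def ext_elem_def minus_apply
    by (intro evalfun_diff evalfun_cr evalfun_an evalfun.eval)
qed

lemma model_spin: "model M spin_op (Pow (spin_modes M))"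
proof (intro model.intro unitary_module.intro so_module.intro so_module_axioms.intro unitary_module_axioms.intro model_axioms.intro vector_space_fscale)
  have in_modes: "int_encode a \<in> spin_modes M \<longleftrightarrow> 0 < a \<and> ix M a" for a
  proof -
    have "a \<in> int ` {1..M} \<longleftrightarrow> 0 < a \<and> ix M a"
      by (auto simp: ix_def image_iff intro!: bexI[of _ "nat a"])
    then show ?thesis by (simp add: spin_modes_def)
  qed
  have supp_g: "supp (Pow (spin_modes M)) (clifford a f)" if "ix M a" "supp (Pow (spin_modes M)) f" for a f
    using that in_modes[of a] in_modes[of "- a"] by (auto simp: clifford_def ix_def intro!: supp_cr supp_an)
  have adj_g: "ip (Pow (spin_modes M)) (clifford a f) g = ip (Pow (spin_modes M)) f (clifford (- a) g)" if "ix M a" for a f g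
    using that in_modes[of a] in_modes[of "- a"] by (auto simp: clifford_def ix_def ip_cr ip_an finite_spin_modes)
  have eval_g: "evalfun (\<lambda>f. clifford a (T f) A)" if "\<And>A. evalfun (\<lambda>f. T f A)" for a T A
    using that by (auto simp: clifford_def intro: evalfun_cr evalfun_an)
  show "Vector_Spaces.linear fscale fscale (spin_op a b)" for a b
    using vector_space_fscale by (simp add: Vector_Spaces.linear_iff spin_op_def clifford_lin fscale_lin mult.commute)
  show "spin_op (- b) (- a) u = - spin_op a b u" if "ix M a" "ix M b" for a b u
  proof (rule ext)
    fix A
    have "clifford (- b) (clifford a u) = (if a = b then u else 0) - clifford a (clifford (- b) u)"
      using that clifford_anti[of "- b" a u] by (auto simp: ix_def)
    from fun_cong[OF this, of A] show "spin_op (- b) (- a) u A = (- spin_op a b u) A"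
      by (auto simp: spin_op_def fscale_def)
  qed
  show "spin_op a b (spin_op a' b' f) = spin_op a' b' (spin_op a b f) +
     ((if b = a' then spin_op a b' f else 0) - (if a = b' then spin_op a' b f else 0) -
      (if b = - b' then spin_op a (- a') f else 0) + (if a = - a' then spin_op (- b') b f else 0))"
    if "ix M a" "ix M b" "ix M a'" "ix M b'" for a b a' b' f
    using that by (intro spin_bracket) (auto simp: ix_def)
  show "finite (Pow (spin_modes M))" by (simp add: finite_spin_modes)
  show "supp (Pow (spin_modes M)) (spin_op a b f)" if "ix M a" "ix M b" "supp (Pow (spin_modes M)) f" for a b f
    using that unfolding spin_op_def by (intro supp_lin supp_g supp_simps) simp_all
  show "ip (Pow (spin_modes M)) (spin_op a b f) g = ip (Pow (spin_modes M)) f (spin_op b a g)"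
    if "ix M a" "ix M b" for a b f g
  proof -
    have "ip (Pow (spin_modes M)) (h - h') g = ip (Pow (spin_modes M)) h g - ip (Pow (spin_modes M)) h' g" for h h'
      by (simp add: ip_def algebra_simps sum_subtractf)
    then show ?thesis
      using that adj_g[of a "clifford (- b) f" g] adj_g[of "- b" f "clifford (- a) g"] by (simp add: spin_op_def)
  qed
  show "evalfun (\<lambda>f. spin_op a b f A)" for a b A
    unfolding spin_op_def minus_apply fscale_def
    by (intro evalfun_diff eval_g evalfun.scale evalfun.eval)
qed

section \<open>Detection of monomials by weights\<close>

context so_module
begin

lemma cartan_M_X:
  assumes "M \<le> n" "L (int M) (int M) u = l *s u"
  shows "L (int M) (int M) (X M pl mi u) = (l + of_nat (sum mi {1..<M}) - of_nat (sum pl {1..<M})) *s X M pl mi u"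
proof -
  have aux: "L (int M) (int M) (yw M s e x) = (l' + (if s = int M then 1 else - 1) * of_nat (sum e {1..<M})) *s yw M s e x"
    if "lev M s" "L (int M) (int M) x = l' *s x" for s e x l'
  proof (induction e rule: exponent_induct[where M = M])
    case (zero e)
    then have "sum e {1..<M} = 0" by (meson sum.neutral)
    then show ?case using that by (simp only: yw_0[OF zero]) simp
  next
    case (step e i)
    let ?\<sigma> = "(if s = int M then 1 else - 1) :: complex" and ?y = "yw M s e x"
    have "L (int M) (int M) (L s (int i) ?y) = (l' + ?\<sigma> * of_nat (sum e {1..<M})) *s L s (int i) ?y + ?\<sigma> *s L s (int i) ?y"
      using step that by (simp only: cartanM_y y_lin)
    also have "\<dots> = (l' + ?\<sigma> * of_nat (Suc (sum e {1..<M}))) *s L s (int i) ?y"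
      unfolding scale_left_distrib[symmetric] by (simp add: of_nat_Suc algebra_simps)
    finally show ?case using step(1) that(1) by (simp only: yw_Suc sum_fun_upd_Suc)
  qed
  show ?thesis
  proof (cases "M = 0")
    case False
    have "L (int M) (int M) (yw M (- int M) pl u) = (l - of_nat (sum pl {1..<M})) *s yw M (- int M) pl u"
      using aux[of "- int M" u l pl] assms False by simp
    from aux[OF _ this, of "int M" mi] show ?thesis using assms by (simp add: X_def algebra_simps)
  next
    case True
    then show ?thesis using assms by (simp add: X_def yw_def)
  qed
qed

lemma cartan_gl_X:
  assumes "M \<le> n" "i \<in> {1..<M}" "L (int i) (int i) u = l *s u"
  shows "L (int i) (int i) (X M pl mi u) = (l - of_nat (pl i + mi i)) *s X M pl mi u"
proof -
  have same: "of_nat (e i) *s X M pl (shift_exp i i e) u = of_nat (e i) *s X M pl e u"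
    "of_nat (e i) *s X M (shift_exp i i e) mi u = of_nat (e i) *s X M e mi u" for e
    by (cases "e i = 0"; simp add: shift_exp_same)+
  show ?thesis using gl_X[of M i i pl mi u] assms by (simp add: same X_linear scale_left_diff_distrib scale_left_distrib)
qed

end

text \<open>A weight vector \<open>g\<close> pairs to zero with every monomial of another weight.
  The weight of \<open>X p q u\<close> fixes all \<open>p i + q i\<close> and the difference of the
  degrees of \<open>q\<close> and \<open>p\<close>, hence both degrees. So the vanishing below
  \<open>(pl, mi)\<close> reduces to the combinatorial condition \<open>unique\<close>.\<close>

lemma witness_by_weights:
  assumes model: "model M L B" and M: "1 \<le> M" and u: "supp B u" and g: "supp B g"
    and singular: "so_module.singular fscale L M {0} u lam" and dom: "dominant M k lam"
    and kill: "\<And>i j. 1 \<le> i \<Longrightarrow> i < j \<Longrightarrow> j < M \<Longrightarrow> L (int i) (int j) g = 0 \<and> L (int i) (- int j) g = 0"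
    and weight: "\<And>i. i \<in> {1..M} \<Longrightarrow> L (int i) (int i) g = fscale (\<mu> i) g"
    and ne: "ip B g (so_module.X L M pl mi u) \<noteq> 0"
    and unique: "\<And>p q. (\<And>i. i \<in> {1..<M} \<Longrightarrow> p i + q i = pl i + mi i) \<Longrightarrow> sum p {1..<M} = sum pl {1..<M} \<Longrightarrow>
        sum q {1..<M} = sum mi {1..<M} \<Longrightarrow> \<not> block_lt M p q pl mi"
  shows "witness M k pl mi L B u g lam"
proof -
  interpret model M L B by (rule model)
  have cartan: "L (int i) (int i) u = fscale (lam i) u" if "i \<in> {1..M}" for i
    using singular that by (auto simp: singular_def)
  have suppX: "supp B (X M p q u)" for p q
    using X_in[of M "{f. supp B f}" u p q] u by (simp add: supp_L)
  have adj': "cnj (\<mu> i) * ip B g x = ip B g (L (int i) (int i) x)" if "i \<in> {1..M}" "supp B x" for i x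
    using adj[of "int i" "int i" g x] weight[OF that(1)] that g by simp
  have w: "cnj (\<mu> i) = lam i - of_nat (p i + q i)" if "i \<in> {1..<M}" "ip B g (X M p q u) \<noteq> 0" for i p q
    using adj'[of i "X M p q u"] cartan_gl_X[of M i u "lam i" p q] cartan[of i] that suppX by simp
  have wM: "cnj (\<mu> M) = lam M + of_nat (sum q {1..<M}) - of_nat (sum p {1..<M})" if "ip B g (X M p q u) \<noteq> 0" for p q
    using adj'[of M "X M p q u"] cartan_M_X[of M u "lam M" p q] cartan[of M] that suppX M by simp
  have zero: "ip B g (X M p q u) = 0" if "block_lt M p q pl mi" for p q
  proof (rule ccontr)
    assume n0: "ip B g (X M p q u) \<noteq> 0"
    have eq: "p i + q i = pl i + mi i" if "i \<in> {1..<M}" for i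
    proof -
      have "lam i - of_nat (p i + q i) = lam i - of_nat (pl i + mi i)"
        using w[OF that n0] w[OF that ne] by (simp only:)
      then have "of_nat (p i + q i) = (of_nat (pl i + mi i) :: complex)" by (rule diff_left_imp_eq)
      then show ?thesis by (simp only: of_nat_eq_iff)
    qed
    have "complex_of_nat (sum q {1..<M} + sum pl {1..<M}) = of_nat (sum mi {1..<M} + sum p {1..<M})"
      using wM[OF n0] wM[OF ne] by (simp add: algebra_simps)
    then have 1: "sum q {1..<M} + sum pl {1..<M} = sum mi {1..<M} + sum p {1..<M}" by (simp only: of_nat_eq_iff)
    have "(\<Sum>i\<in>{1..<M}. p i + q i) = (\<Sum>i\<in>{1..<M}. pl i + mi i)" using eq by (intro sum.cong) auto
    then have "sum p {1..<M} + sum q {1..<M} = sum pl {1..<M} + sum mi {1..<M}" by (simp add: sum.distrib)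
    with 1 have "sum p {1..<M} = sum pl {1..<M}" "sum q {1..<M} = sum mi {1..<M}" by linarith+
    then show False using unique[of p q] eq that by blast
  qed
  show ?thesis
    unfolding witness_def using model u g singular dom kill ne zero by blast
qed

definition e1 :: "nat \<Rightarrow> nat \<Rightarrow> nat" where "e1 i = (\<lambda>j. if j = i then 1 else 0)"

lemma unique_plus_zero:
  assumes "\<And>i. i \<in> {1..<M} \<Longrightarrow> p i + q i = pl i + mi i" "sum p {1..<M} = sum pl {1..<M}"
    and "\<And>i. i \<in> {1..<M} \<Longrightarrow> pl i = (0::nat)"
  shows "\<not> block_lt M p q pl mi"
proof -
  have "sum p {1..<M} = 0" using assms(2,3) by simp
  then have "p i = 0" if "i \<in> {1..<M}" for i using that by simp
  then have "agree M p pl" "agree M q mi" using assms(1,3) by (force simp: agree_def)+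
  then show ?thesis using deglex_lt_irrefl deglex_lt_eqr agree_sym unfolding block_lt_def by blast
qed

lemma unique_minus_zero:
  assumes "\<And>i. i \<in> {1..<M} \<Longrightarrow> p i + q i = pl i + mi i" "sum q {1..<M} = sum mi {1..<M}"
    and "\<And>i. i \<in> {1..<M} \<Longrightarrow> mi i = (0::nat)"
  shows "\<not> block_lt M p q pl mi"
proof -
  have "sum q {1..<M} = 0" using assms(2,3) by simp
  then have "q i = 0" if "i \<in> {1..<M}" for i using that by simp
  then have "agree M p pl" "agree M q mi" using assms(1,3) by (force simp: agree_def)+
  then show ?thesis using deglex_lt_irrefl deglex_lt_eqr agree_sym unfolding block_lt_def by blast
qed

text \<open>The competing choice of the same degrees has the plus factor at \<open>i - 1\<close> and
  the minus factor at \<open>i\<close>; it is lexicographically larger, since the plus exponents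
  differ first at the index \<open>i - 1\<close>.\<close>

lemma unique_pair:
  assumes eq: "\<And>j. j \<in> {1..<M} \<Longrightarrow> p j + q j = e1 i j + e1 (i - 1) j" and sum: "sum p {1..<M} = sum (e1 i) {1..<M}"
    and i: "2 \<le> i" "i < M"
  shows "\<not> block_lt M p q (e1 i) (e1 (i - 1))"
proof
  assume block_lt: "block_lt M p q (e1 i) (e1 (i - 1))"
  have "\<not> deglex_lt M p (e1 i)"
  proof
    assume "deglex_lt M p (e1 i)"
    then obtain l where l: "l \<in> {1..<M}" "p l < e1 i l" "\<forall>j\<in>{1..<l}. p j = e1 i j" using sum by (auto simp: deglex_lt_def)
    then have li: "l = i" "p i = 0" by (auto simp: e1_def split: if_splits)
    have "p j = 0" if "j \<in> {1..<M}" for j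
    proof -
      consider "j = i" | "j = i - 1" | "j \<noteq> i \<and> j \<noteq> i - 1" by blast
      then show ?thesis
        using li l(3) i eq[OF that] that by cases (auto simp: e1_def)
    qed
    then have "sum p {1..<M} = 0" by simp
    moreover have "sum (e1 i) {1..<M} = 1" using i by (simp add: e1_def)
    ultimately show False using sum by simp
  qed
  then have "agree M p (e1 i)" "deglex_lt M q (e1 (i - 1))" using block_lt by (auto simp: block_lt_def)
  moreover from this(1) have "agree M q (e1 (i - 1))" using eq by (fastforce simp: agree_def)
  ultimately show False using deglex_lt_irrefl deglex_lt_eqr agree_sym by blast
qed

text \<open>Basis states of the exterior algebra that are annihilated by the positive roots of level \<open>m\<close>.\<close>
lemma ext_raise:
  assumes "\<And>j. 1 \<le> j \<Longrightarrow> j \<le> m \<Longrightarrow> - int j \<notin> S" "\<And>j k. 1 \<le> j \<Longrightarrow> j < k \<Longrightarrow> k \<le> m \<Longrightarrow> int k \<in> S \<Longrightarrow> int j \<in> S"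
    and "1 \<le> j" "j < k" "k \<le> m"
  shows "ext_op (int j) (int k) (basis_state S) = 0 \<and> ext_op (int j) (- int k) (basis_state S) = 0"
proof -
  have neg: "- int j \<notin> S" "- int k \<notin> S" using assms by auto
  have "creat_at (int j) (annih_at (int k) (basis_state S)) = 0"
  proof (cases "int k \<in> S")
    case True
    then obtain \<sigma> where "annih_at (int k) (basis_state S) = fscale \<sigma> (basis_state (S - {int k}))" using d_st by blast
    moreover have "int j \<in> S - {int k}" using assms True by auto
    ultimately show ?thesis by (simp add: creat_lin c_st_in fscale_lin)
  qed (simp add: d_st_out creat_lin)
  then show ?thesis using neg by (simp add: ext_op_def ext_elem_def d_st_out creat_lin)
qed

lemma ext_cartan:
  "ext_op (int i) (int i) (basis_state S) = fscale ((if int i \<in> S then 1 else 0) - (if - int i \<in> S then 1 else 0)) (basis_state S)"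
  by (simp add: ext_op_def ext_elem_def cd_st fscale_lin) (auto simp: fscale_def fun_eq_iff)

lemma ext_elem_st:
  assumes "b \<in> S" "a \<notin> S"
  shows "\<exists>\<sigma>. \<sigma> \<noteq> 0 \<and> ext_elem a b (basis_state S) = fscale \<sigma> (basis_state (insert a (S - {b})))"
proof -
  obtain \<sigma> where 1: "\<sigma> \<noteq> 0" "annih_at b (basis_state S) = fscale \<sigma> (basis_state (S - {b}))" using d_st[OF assms(1)] by blast
  obtain \<tau> where 2: "\<tau> \<noteq> 0" "creat_at a (basis_state (S - {b})) = fscale \<tau> (basis_state (insert a (S - {b})))" using c_st[of a "S - {b}"] assms by blast
  show ?thesis using 1 2 by (intro exI[of _ "\<sigma> * \<tau>"]) (simp add: ext_elem_def creat_lin fscale_lin)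
qed

lemma supp_st: "int_encode ` S \<subseteq> N \<Longrightarrow> supp (Pow N) (basis_state S)"
  by (auto simp: supp_def basis_state_def)

lemma ext_st_modes: "(\<And>a. a \<in> S \<Longrightarrow> ix M a) \<Longrightarrow> int_encode ` S \<subseteq> ext_modes M"
  by (auto simp: ext_modes_def)

text \<open>The highest weight of the \<open>i\<close>-th exterior power of the standard representation of \<open>so\<^bsub>2(m+1)\<^esub>\<close>, which for \<open>i = m\<close> is \<open>\<omega>\<^sub>m + \<omega>\<^bsub>m+1\<^esub>\<close>.\<close>
definition kext :: "nat \<Rightarrow> nat \<Rightarrow> nat \<Rightarrow> nat" where
  "kext m i = (\<lambda>j. if j = i \<or> j = Suc m \<and> i = m then 1 else 0)"

lemma int_mem: "int j \<in> int ` A \<longleftrightarrow> j \<in> A"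
  by auto

text \<open>The highest weight vector is e_1 \<and> ... \<and> e_i. A minus factor replaces e_i by
  e_M, a plus factor replaces it by e_(-M), and in the last case e_(i-1) also goes to e_M. The
  resulting basis state consists of an initial segment and some of the modes M and -M. It is killed
  by the raising operators of level \<open>m\<close> and serves as \<open>g\<close>.\<close>

lemma witness_ext:
  assumes i: "1 \<le> i" "i \<le> m" and M: "M = Suc m"
    and cases: "pl = (\<lambda>_. 0) \<and> mi = (\<lambda>_. 0) \<or> pl = (\<lambda>_. 0) \<and> mi = e1 i \<or> pl = e1 i \<and> mi = (\<lambda>_. 0) \<or>
      2 \<le> i \<and> pl = e1 i \<and> mi = e1 (i - 1)"
  shows "\<exists>(L :: int \<Rightarrow> int \<Rightarrow> (nat set \<Rightarrow> complex) \<Rightarrow> nat set \<Rightarrow> complex) B u g lam. witness M (kext m i) pl mi L B u g lam"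
proof -
  interpret R: model M ext_op "Pow (ext_modes M)" by (rule model_ext)
  define S0 where "S0 = int ` {1..i}"
  let ?u = "basis_state S0" and ?B = "Pow (ext_modes M)"
  define lam :: "nat \<Rightarrow> complex" where "lam j = (if j \<le> i then 1 else 0)" for j
  have S0: "int j \<in> S0 \<longleftrightarrow> 1 \<le> j \<and> j \<le> i" "- int j \<in> S0 \<longleftrightarrow> False" if "1 \<le> j" for j
    using that by (auto simp: S0_def)
  have S0': "- int M \<notin> S0" "int M \<notin> S0" using S0[of M] i M by auto
  have singular: "R.singular M {0} ?u lam"
    unfolding R.singular_def
  proof (intro conjI allI impI)
    fix j k assume jk: "1 \<le> j" "j < k" "k \<le> M"
    show "ext_op (int j) (int k) ?u \<in> {0}" "ext_op (int j) (- int k) ?u \<in> {0}"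
      using ext_raise[of M S0 j k] jk S0 by auto
  next
    fix j assume "1 \<le> j" "j \<le> M"
    then show "ext_op (int j) (int j) ?u - fscale (lam j) ?u \<in> {0}"
      using S0[of j] by (simp add: ext_cartan lam_def)
  qed
  have dom: "dominant M (kext m i) lam" using i M by (auto simp: dominant_def lam_def kext_def)
  have suppu: "supp ?B ?u" by (intro supp_st ext_st_modes) (use i M in \<open>auto simp: S0_def\<close>)
  \<comment> \<open>A nonzero remainder \<open>f\<close> arises only with two factors.\<close>
  have main: ?thesis
    if X: "R.X M pl mi ?u = fscale \<sigma> (basis_state S) + f" "\<sigma> \<noteq> 0" "ip ?B (basis_state S) f = 0" and S: "S = int ` {1..r} \<union> T" "T \<subseteq> {int M, - int M}" "r \<le> m"
    for \<sigma> S f r T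
  proof -
    have Smem: "int j \<in> S \<longleftrightarrow> j \<le> r" "- int j \<notin> S" if "1 \<le> j" "j \<le> m" for j
      using that S M by auto
    have modes: "int_encode ` S \<subseteq> ext_modes M" by (intro ext_st_modes) (use S M in auto)
    have "witness M (kext m i) pl mi ext_op ?B ?u (basis_state S) lam"
    proof (rule witness_by_weights[OF model_ext _ suppu supp_st[OF modes] singular dom])
      show "1 \<le> M" using M by simp
      show "ext_op (int j) (int k) (basis_state S) = 0 \<and> ext_op (int j) (- int k) (basis_state S) = 0" if "1 \<le> j" "j < k" "k < M" for j k
        using ext_raise[of m S j k] Smem that M by auto
      show "ip ?B (basis_state S) (R.X M pl mi ?u) \<noteq> 0"
        unfolding X(1) using X(2,3) ip_st[OF finite_ext_modes modes, of S] by simp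
      show "\<not> block_lt M p q pl mi" if "\<And>i. i \<in> {1..<M} \<Longrightarrow> p i + q i = pl i + mi i"
        "sum p {1..<M} = sum pl {1..<M}" "sum q {1..<M} = sum mi {1..<M}" for p q
        using cases unique_plus_zero[OF that(1,2)] unique_minus_zero[OF that(1,3)] unique_pair[of M p q i] that(1,2) i M
        by auto
    qed (rule ext_cartan)
    then show ?thesis by blast
  qed
  have yw1: "R.yw M s (e1 j) x = ext_op s (int j) x" if "s = int M \<or> s = - int M" "1 \<le> j" "j \<le> m" for s j x
  proof -
    have "R.lev M s" using that(1) by (auto simp: R.lev_def)
    then show ?thesis using R.yw_single[of j M s 1 x] that M by (simp add: e1_def One_nat_def)
  qed
  have yw0: "R.yw M s (\<lambda>_. 0) x = x" for s x by (simp add: R.yw_0)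
  have iS: "int i \<in> S0" using S0[of i] i by simp
  from cases consider (a) "pl = (\<lambda>_. 0)" "mi = (\<lambda>_. 0)" | (b) "pl = (\<lambda>_. 0)" "mi = e1 i" | (c) "pl = e1 i" "mi = (\<lambda>_. 0)"
    | (d) "2 \<le> i" "pl = e1 i" "mi = e1 (i - 1)" by blast
  then show ?thesis
  proof cases
    case a
    show ?thesis
      by (rule main[of 1 S0 0 i "{}"]) (use a i in \<open>simp_all add: R.X_def yw0 fscale_lin S0_def\<close>)
  next
    case b
    obtain \<sigma> where \<sigma>: "\<sigma> \<noteq> 0" "ext_elem (int M) (int i) ?u = fscale \<sigma> (basis_state (insert (int M) (S0 - {int i})))"
      using ext_elem_st[OF iS S0'(2)] by blast
    have X: "R.X M pl mi ?u = fscale \<sigma> (basis_state (insert (int M) (S0 - {int i})))"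
      using b i \<sigma> S0' yw1 by (simp add: R.X_def yw0 ext_op_def) (simp add: ext_elem_def d_st_out creat_lin)
    have "{1..i} = insert i {1..i - 1}" using i by auto
    then have "S0 - {int i} = int ` {1..i - 1}" unfolding S0_def by (simp only: image_insert) auto
    then have S: "insert (int M) (S0 - {int i}) = int ` {1..i - 1} \<union> {int M}" by simp
    show ?thesis
      by (rule main[OF _ \<sigma>(1) _ S, where f = 0]) (simp only: X add_0_right, use i in simp_all)
  next
    case c
    obtain \<sigma> where \<sigma>: "\<sigma> \<noteq> 0" "ext_elem (- int M) (int i) ?u = fscale \<sigma> (basis_state (insert (- int M) (S0 - {int i})))"
      using ext_elem_st[OF iS S0'(1)] by blast
    have X: "R.X M pl mi ?u = fscale \<sigma> (basis_state (insert (- int M) (S0 - {int i})))"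
      using c i \<sigma> S0' yw1 by (simp add: R.X_def yw0 ext_op_def) (simp add: ext_elem_def d_st_out creat_lin)
    have "{1..i} = insert i {1..i - 1}" using i by auto
    then have "S0 - {int i} = int ` {1..i - 1}" unfolding S0_def by (simp only: image_insert) auto
    then have S: "insert (- int M) (S0 - {int i}) = int ` {1..i - 1} \<union> {- int M}" by simp
    show ?thesis
      by (rule main[OF _ \<sigma>(1) _ S, where f = 0]) (simp only: X add_0_right, use i in simp_all)
  next
    case d
    obtain \<sigma> where \<sigma>: "\<sigma> \<noteq> 0" "ext_elem (- int M) (int i) ?u = fscale \<sigma> (basis_state (insert (- int M) (S0 - {int i})))"
      using ext_elem_st[OF iS S0'(1)] by blast
    define S1 where "S1 = insert (- int M) (S0 - {int i})"
    have S1: "int (i - 1) \<in> S1" "int M \<notin> S1" "- int M \<in> S1" "- int (i - 1) \<notin> S1"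
      using d i M S0[of "i - 1"] S0' by (auto simp: S1_def)
    obtain \<tau> where \<tau>: "\<tau> \<noteq> 0" "ext_elem (int M) (int (i - 1)) (basis_state S1) = fscale \<tau> (basis_state (insert (int M) (S1 - {int (i - 1)})))"
      using ext_elem_st[OF S1(1,2)] by blast
    \<comment> \<open>The second half of \<open>ext_op\<close> moves the mode -M, just created by
      the plus factor, to -(i-1). The resulting basis state differs from the test vector and is
      orthogonal to it.\<close>
    obtain \<tau>' where \<tau>': "ext_elem (- int (i - 1)) (- int M) (basis_state S1) = fscale \<tau>' (basis_state (insert (- int (i - 1)) (S1 - {- int M})))"
      using ext_elem_st[OF S1(3,4)] by blast
    have y1: "R.yw M (- int M) (e1 i) ?u = fscale \<sigma> (basis_state S1)"
      using yw1[of "- int M" i ?u] i \<sigma> S0' by (simp add: S1_def ext_op_def) (simp add: ext_elem_def d_st_out creat_lin)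
    have ixs: "ix M (int M)" "ix M (int (i - 1))" unfolding ix_of_nat using d i M by auto
    have "ext_op (int M) (int (i - 1)) (basis_state S1) = fscale \<tau> (basis_state (insert (int M) (S1 - {int (i - 1)}))) - fscale \<tau>' (basis_state (insert (- int (i - 1)) (S1 - {- int M})))"
      unfolding ext_op_def \<tau>(2) \<tau>' ..
    then have X: "R.X M pl mi ?u = fscale (\<sigma> * \<tau>) (basis_state (insert (int M) (S1 - {int (i - 1)}))) + fscale (- \<sigma> * \<tau>') (basis_state (insert (- int (i - 1)) (S1 - {- int M})))"
      unfolding R.X_def d(2,3) y1 using yw1[of "int M" "i - 1"] d(1) i R.L_scale[OF ixs, of \<sigma> "basis_state S1"]
      by (simp add: fscale_lin)
    have S2: "insert (int M) (S1 - {int (i - 1)}) = int ` {1..i - 2} \<union> {int M, - int M}"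
    proof -
      have "{1..i} = insert i (insert (i - 1) {1..i - 2})" using d(1) by auto
      then have S0': "S0 = insert (int i) (insert (int (i - 1)) (int ` {1..i - 2}))" unfolding S0_def by (simp only: image_insert)
      have ne: "int i \<notin> int ` {1..i - 2}" "int (i - 1) \<notin> int ` {1..i - 2}" "- int M \<noteq> int (i - 1)" "int i \<noteq> int (i - 1)"
        unfolding int_mem using d(1) M by auto
      have swap: "insert d (insert c (insert a (insert b R) - {a}) - {b}) = R \<union> {d, c}"
        if "a \<notin> R" "b \<notin> R" "c \<noteq> b" "a \<noteq> b" for a b c d :: int and R using that by auto
      show ?thesis unfolding S1_def S0' by (rule swap[OF ne])
    qed
    have ne: "insert (int M) (S1 - {int (i - 1)}) \<noteq> insert (- int (i - 1)) (S1 - {- int M})"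
      using S1 M by auto
    have modes: "int_encode ` insert (int M) (S1 - {int (i - 1)}) \<subseteq> ext_modes M"
      unfolding S2 by (intro ext_st_modes) (use d i M in auto)
    show ?thesis
    proof (rule main[OF X _ _ S2])
      show "\<sigma> * \<tau> \<noteq> 0" using \<sigma>(1) \<tau>(1) by simp
      show "ip ?B (basis_state (insert (int M) (S1 - {int (i - 1)}))) (fscale (- \<sigma> * \<tau>') (basis_state (insert (- int (i - 1)) (S1 - {- int M})))) = 0"
        unfolding ip_simps ip_st[OF finite_ext_modes modes] if_not_P[OF ne] by (rule mult_zero_right)
    qed (use i in auto)
  qed
qed

text \<open>Both operators create the mode \<open>j\<close>, which is already occupied.\<close>

lemma spin_raise:
  assumes "1 \<le> j" "j < k" "int j \<in> S"
  shows "spin_op (int j) (int k) (basis_state S) = 0 \<and> spin_op (int j) (- int k) (basis_state S) = 0"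
proof -
  have "creat_at (int j) (annih_at (int k) (basis_state S)) = 0"
  proof (cases "int k \<in> S")
    case True
    then obtain \<sigma> where "annih_at (int k) (basis_state S) = fscale \<sigma> (basis_state (S - {int k}))" using d_st by blast
    then show ?thesis using assms by (simp add: creat_lin c_st_in fscale_lin)
  qed (simp add: d_st_out creat_lin)
  moreover have "creat_at (int j) (creat_at (int k) (basis_state S)) = 0"
  proof (cases "int k \<in> S")
    case False
    then obtain \<sigma> where "creat_at (int k) (basis_state S) = fscale \<sigma> (basis_state (insert (int k) S))" using c_st by blast
    then show ?thesis using assms by (simp add: creat_lin c_st_in fscale_lin)
  qed (simp add: c_st_in creat_lin)
  ultimately show ?thesis using assms by (simp add: spin_op_def clifford_def fscale_lin)
qed

lemma spin_cartan:
  "1 \<le> i \<Longrightarrow> spin_op (int i) (int i) (basis_state S) = fscale ((if int i \<in> S then 1 else 0) - 1 / 2) (basis_state S)"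
  by (auto simp: spin_op_def clifford_def cd_st fscale_lin) (auto simp: fscale_def fun_eq_iff)

text \<open>The highest weight vectors occupy the modes 1, ..., M for \<omega>_M and 1, ..., m for
  \<omega>_m. The plus factor empties m and M, the minus factor moves m to M. The modes below m stay
  occupied, which by \<open>spin_raise\<close> makes the raising operators of level \<open>m\<close>
  vanish.\<close>

lemma witness_spin:
  assumes "1 \<le> m" and M: "M = Suc m"
    and cases: "k = e1 M \<and> (pl = (\<lambda>_. 0) \<and> mi = (\<lambda>_. 0) \<or> pl = e1 m \<and> mi = (\<lambda>_. 0)) \<or>
      k = e1 m \<and> (pl = (\<lambda>_. 0) \<and> mi = (\<lambda>_. 0) \<or> pl = (\<lambda>_. 0) \<and> mi = e1 m)"
  shows "\<exists>(L :: int \<Rightarrow> int \<Rightarrow> (nat set \<Rightarrow> complex) \<Rightarrow> nat set \<Rightarrow> complex) B u g lam. witness M k pl mi L B u g lam"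
proof -
  interpret R: model M spin_op "Pow (spin_modes M)" by (rule model_spin)
  let ?B = "Pow (spin_modes M)"
  have modes: "int_encode ` S \<subseteq> spin_modes M" if "S \<subseteq> int ` {1..M}" for S
    using that by (auto simp: spin_modes_def)
  have main: ?thesis
    if r: "r = M \<and> k = e1 M \<or> r = m \<and> k = e1 m" and X: "R.X M pl mi (basis_state (int ` {1..r})) = fscale \<sigma> (basis_state S)" "\<sigma> \<noteq> 0"
      and S: "S \<subseteq> int ` {1..M}" "\<And>j. 1 \<le> j \<Longrightarrow> j < m \<Longrightarrow> int j \<in> S"
    for r \<sigma> S
  proof -
    define lam :: "nat \<Rightarrow> complex" where "lam j = (if j \<le> r then 1 else 0) - 1 / 2" for j
    let ?u = "basis_state (int ` {1..r})"
    have mem: "int j \<in> int ` {1..r} \<longleftrightarrow> 1 \<le> j \<and> j \<le> r" for j by auto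
    have singular: "R.singular M {0} ?u lam"
      unfolding R.singular_def
    proof (intro conjI allI impI)
      fix j k assume jk: "1 \<le> j" "j < k" "k \<le> M"
      have "int j \<in> int ` {1..r}" using jk r M by (auto simp: mem)
      then show "spin_op (int j) (int k) ?u \<in> {0}" "spin_op (int j) (- int k) ?u \<in> {0}"
        using spin_raise[OF jk(1,2)] by auto
    next
      fix j assume "1 \<le> j" "j \<le> M"
      then show "spin_op (int j) (int j) ?u - fscale (lam j) ?u \<in> {0}"
        by (simp add: spin_cartan lam_def mem)
    qed
    have dom: "dominant M k lam" using r M assms(1) by (auto simp: dominant_def lam_def e1_def)
    have "r \<le> M" using r M by auto
    then have suppu: "supp ?B ?u" by (intro supp_st modes) auto
    have "witness M k pl mi spin_op ?B ?u (basis_state S) lam"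
    proof (rule witness_by_weights[OF model_spin _ suppu supp_st[OF modes[OF S(1)]] singular dom])
      show "1 \<le> M" using M by simp
      show "spin_op (int i) (int j) (basis_state S) = 0 \<and> spin_op (int i) (- int j) (basis_state S) = 0" if "1 \<le> i" "i < j" "j < M" for i j
        using spin_raise[OF that(1,2), of S] S(2)[of i] that M by auto
      show "ip ?B (basis_state S) (R.X M pl mi ?u) \<noteq> 0"
        unfolding X(1) using X(2) ip_st[OF finite_spin_modes modes[OF S(1)], of S] by simp
      show "\<not> block_lt M p q pl mi" if "\<And>i. i \<in> {1..<M} \<Longrightarrow> p i + q i = pl i + mi i"
        "sum p {1..<M} = sum pl {1..<M}" "sum q {1..<M} = sum mi {1..<M}" for p q
        using cases unique_plus_zero[OF that(1,2)] unique_minus_zero[OF that(1,3)] by auto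
      show "spin_op (int i) (int i) (basis_state S) = fscale ((if int i \<in> S then 1 else 0) - 1 / 2) (basis_state S)" if "i \<in> {1..M}" for i
        using that by (intro spin_cartan) simp
    qed
    then show ?thesis by blast
  qed
  have yw1: "R.yw M s (e1 j) x = spin_op s (int j) x" if "s = int M \<or> s = - int M" "1 \<le> j" "j \<le> m" for s j x
  proof -
    have "R.lev M s" using that(1) by (auto simp: R.lev_def)
    then show ?thesis using R.yw_single[of j M s 1 x] that M by (simp add: e1_def One_nat_def)
  qed
  have yw0: "R.yw M s (\<lambda>_. 0) x = x" for s x by (simp add: R.yw_0)
  have z: "fscale 0 f = 0" for f :: "nat set \<Rightarrow> complex" by (simp add: fscale_lin)
  from cases consider (a) "k = e1 M" "pl = (\<lambda>_. 0)" "mi = (\<lambda>_. 0)" | (b) "k = e1 m" "pl = (\<lambda>_. 0)" "mi = (\<lambda>_. 0)"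
    | (p) "k = e1 M" "pl = e1 m" "mi = (\<lambda>_. 0)" | (q) "k = e1 m" "pl = (\<lambda>_. 0)" "mi = e1 m" by blast
  then show ?thesis
  proof cases
    case a
    show ?thesis
    proof (rule main)
      show "M = M \<and> k = e1 M \<or> M = m \<and> k = e1 m" using a by simp
      show "R.X M pl mi (basis_state (int ` {1..M})) = fscale 1 (basis_state (int ` {1..M}))" by (simp add: a R.X_def yw0 fscale_lin)
      show "int ` {1..M} \<subseteq> int ` {1..M}" by (rule order.refl)
      show "int j \<in> int ` {1..M}" if "1 \<le> j" "j < m" for j using that M by (simp add: int_mem)
    qed simp
  next
    case b
    show ?thesis
    proof (rule main)
      show "m = M \<and> k = e1 M \<or> m = m \<and> k = e1 m" using b by simp
      show "R.X M pl mi (basis_state (int ` {1..m})) = fscale 1 (basis_state (int ` {1..m}))" by (simp add: b R.X_def yw0 fscale_lin)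
      show "int ` {1..m} \<subseteq> int ` {1..M}" using M by (intro image_mono) simp
      show "int j \<in> int ` {1..m}" if "1 \<le> j" "j < m" for j using that by (simp add: int_mem)
    qed simp
  next
    case p
    let ?S = "int ` {1..M}"
    have Sm: "int m \<in> ?S" using assms(1) M by auto
    obtain \<sigma> where \<sigma>: "\<sigma> \<noteq> 0" "annih_at (int m) (basis_state ?S) = fscale \<sigma> (basis_state (?S - {int m}))" using d_st[OF Sm] by blast
    have SM: "int M \<in> ?S - {int m}" using M by auto
    obtain \<tau> where \<tau>: "\<tau> \<noteq> 0" "annih_at (int M) (basis_state (?S - {int m})) = fscale \<tau> (basis_state (?S - {int m} - {int M}))" using d_st[OF SM] by blast
    have "R.X M pl mi (basis_state ?S) = fscale (\<sigma> * \<tau>) (basis_state (?S - {int m} - {int M}))"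
    proof -
      have "spin_op (- int M) (int m) x = annih_at (int M) (annih_at (int m) x)" for x
        using M assms(1) by (simp add: spin_op_def clifford_def fscale_lin)
      moreover have "R.X M pl mi (basis_state ?S) = spin_op (- int M) (int m) (basis_state ?S)"
        unfolding R.X_def p(2,3) yw0 by (rule yw1) (use assms(1) in auto)
      ultimately show ?thesis by (simp only: \<sigma>(2) \<tau>(2) annih_lin fscale_lin)
    qed
    then show ?thesis
    proof (rule main[rotated])
      show "M = M \<and> k = e1 M \<or> M = m \<and> k = e1 m" using p by simp
      show "?S - {int m} - {int M} \<subseteq> int ` {1..M}" by blast
      show "int j \<in> ?S - {int m} - {int M}" if "1 \<le> j" "j < m" for j using that M by (simp add: int_mem)
    qed (use \<sigma>(1) \<tau>(1) in simp)
  next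
    case q
    let ?S = "int ` {1..m}"
    have Sm: "int m \<in> ?S" using assms(1) by auto
    obtain \<sigma> where \<sigma>: "\<sigma> \<noteq> 0" "annih_at (int m) (basis_state ?S) = fscale \<sigma> (basis_state (?S - {int m}))" using d_st[OF Sm] by blast
    have SM: "int M \<notin> ?S - {int m}" using M by auto
    obtain \<tau> where \<tau>: "\<tau> \<noteq> 0" "creat_at (int M) (basis_state (?S - {int m})) = fscale \<tau> (basis_state (insert (int M) (?S - {int m})))" using c_st[OF SM] by blast
    have "R.X M pl mi (basis_state ?S) = fscale (\<sigma> * \<tau>) (basis_state (insert (int M) (?S - {int m})))"
    proof -
      have "spin_op (int M) (int m) x = creat_at (int M) (annih_at (int m) x)" for x
        using M assms(1) by (simp add: spin_op_def clifford_def fscale_lin)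
      moreover have "R.X M pl mi (basis_state ?S) = spin_op (int M) (int m) (basis_state ?S)"
        unfolding R.X_def q(2,3) yw0 by (rule yw1) (use assms(1) in auto)
      ultimately show ?thesis by (simp only: \<sigma>(2) \<tau>(2) creat_lin fscale_lin)
    qed
    then show ?thesis
    proof (rule main[rotated])
      show "m = M \<and> k = e1 M \<or> m = m \<and> k = e1 m" using q by simp
      have "int ` {1..m} \<subseteq> int ` {1..M}" "int M \<in> int ` {1..M}" using M by (auto simp: int_mem)
      then show "insert (int M) (?S - {int m}) \<subseteq> int ` {1..M}" by blast
      show "int j \<in> insert (int M) (?S - {int m})" if "1 \<le> j" "j < m" for j using that by (simp add: int_mem)
    qed (use \<sigma>(1) \<tau>(1) in simp)
  qed
qed

section \<open>Generators of the solutions of one level\<close>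

inductive generator :: "nat \<Rightarrow> (nat \<Rightarrow> nat) \<Rightarrow> (nat \<Rightarrow> nat) \<Rightarrow> (nat \<Rightarrow> nat) \<Rightarrow> bool" for m where
  ext0: "1 \<le> i \<Longrightarrow> i \<le> m \<Longrightarrow> generator m (kext m i) (\<lambda>_. 0) (\<lambda>_. 0)"
| ext_minus: "1 \<le> i \<Longrightarrow> i \<le> m \<Longrightarrow> generator m (kext m i) (\<lambda>_. 0) (e1 i)"
| ext_plus: "1 \<le> i \<Longrightarrow> i \<le> m \<Longrightarrow> generator m (kext m i) (e1 i) (\<lambda>_. 0)"
| ext_pair: "2 \<le> i \<Longrightarrow> i \<le> m \<Longrightarrow> generator m (kext m i) (e1 i) (e1 (i - 1))"
| spinM0: "1 \<le> m \<Longrightarrow> generator m (e1 (Suc m)) (\<lambda>_. 0) (\<lambda>_. 0)"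
| spinM: "1 \<le> m \<Longrightarrow> generator m (e1 (Suc m)) (e1 m) (\<lambda>_. 0)"
| spinm0: "1 \<le> m \<Longrightarrow> generator m (e1 m) (\<lambda>_. 0) (\<lambda>_. 0)"
| spinm: "1 \<le> m \<Longrightarrow> generator m (e1 m) (\<lambda>_. 0) (e1 m)"

lemma witness_generator:
  assumes "generator m k pl mi"
  shows "\<exists>(L :: int \<Rightarrow> int \<Rightarrow> (nat set \<Rightarrow> complex) \<Rightarrow> nat set \<Rightarrow> complex) B u g lam. witness (Suc m) k pl mi L B u g lam"
  using assms
proof cases
  case (ext0 i)
  show ?thesis unfolding ext0(1-3) by (rule witness_ext) (use ext0 in auto)
next
  case (ext_minus i)
  show ?thesis unfolding ext_minus(1-3) by (rule witness_ext) (use ext_minus in auto)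
next
  case (ext_plus i)
  show ?thesis unfolding ext_plus(1-3) by (rule witness_ext) (use ext_plus in auto)
next
  case (ext_pair i)
  show ?thesis unfolding ext_pair(1-3) by (rule witness_ext) (use ext_pair in auto)
next
  case spinM0
  show ?thesis unfolding spinM0(1-3) by (rule witness_spin) (use spinM0 in auto)
next
  case spinM
  show ?thesis unfolding spinM(1-3) by (rule witness_spin) (use spinM in auto)
next
  case spinm0
  show ?thesis unfolding spinm0(1-3) by (rule witness_spin) (use spinm0 in auto)
next
  case spinm
  show ?thesis unfolding spinm(1-3) by (rule witness_spin) (use spinm in auto)
qed

definition sub :: "(nat \<Rightarrow> nat) \<Rightarrow> (nat \<Rightarrow> nat) \<Rightarrow> nat \<Rightarrow> nat" where
  "sub f g = (\<lambda>i. f i - g i)"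

text \<open>A greedy choice at the smallest \<open>i < m\<close> with \<open>k i > 0\<close>. Below
  \<open>i\<close> the labels vanish, hence so do the plus exponents, and
  \<open>mi (i-1) \<le> pl i\<close>. A minus exponent at \<open>i - 1\<close> is therefore taken
  off together with a plus exponent at \<open>i\<close>; without one, a plus factor at
  \<open>i\<close> is preferred, then a minus factor at \<open>i\<close>, then none. If only
  \<open>k m\<close> and \<open>k (Suc m)\<close> remain, the spin weights are used, and their sum
  for a pair.\<close>

lemma block_cond_split_generator:
  assumes "1 \<le> m" and a: "block_cond m k pl mi" and pos: "i0 \<in> {1..Suc m}" "k i0 > 0"
  shows "\<exists>k1 pl1 mi1. generator m k1 pl1 mi1 \<and> (\<forall>i. k1 i \<le> k i \<and> pl1 i \<le> pl i \<and> mi1 i \<le> mi i) \<and>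
    block_cond m (sub k k1) (sub pl pl1) (sub mi mi1) \<and> (\<exists>i\<in>{1..Suc m}. k1 i > 0)"
proof (cases "\<exists>i. i \<in> {1..<m} \<and> k i > 0")
  case True
  define i where "i = (LEAST i. i \<in> {1..<m} \<and> k i > 0)"
  have i: "1 \<le> i" "i < m" "k i > 0" using LeastI_ex[OF True] by (auto simp: i_def)
  have k0: "k j = 0" if "1 \<le> j" "j < i" for j
    using not_less_Least[of j "\<lambda>i. i \<in> {1..<m} \<and> k i > 0"] that i by (auto simp: i_def)
  have A1: "pl j \<le> k j" "pl j + mi j \<le> k j + pl (Suc j)" if "1 \<le> j" "j < m" for j using a that by (auto simp: block_cond_def)
  have A3: "mi m \<le> k m" "pl m \<le> k (Suc m)" using a by (auto simp: block_cond_def)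
  have A4: "mi (m - 1) + pl (m - 1) + mi m \<le> k (m - 1) + k m" using a i by (auto simp: block_cond_def)
  have p0: "pl j = 0" if "1 \<le> j" "j < i" for j using A1[of j] k0[of j] that i by simp
  have ke: "kext m i = e1 i" using i by (auto simp: kext_def e1_def)
  have prev: "pl (i - 1) = 0 \<and> mi (i - 1) \<le> pl i" if "2 \<le> i"
    using A1[of "i - 1"] k0[of "i - 1"] p0[of "i - 1"] that i by simp
  note simps = block_cond_def sub_def e1_def ke
  consider "2 \<le> i" "mi (i - 1) > 0" | "2 \<le> i \<longrightarrow> mi (i - 1) = 0" "pl i > 0" | "2 \<le> i \<longrightarrow> mi (i - 1) = 0" "pl i = 0" "mi i > 0"
    | "pl i = 0" "mi i = 0" by blast
  then show ?thesis
  proof cases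
    case 1
    have "block_cond m (sub k (e1 i)) (sub pl (e1 i)) (sub mi (e1 (i - 1)))"
      unfolding simps
    proof (intro conjI ballI impI)
      fix j assume j: "j \<in> {1..<m}"
      show "pl j - (if j = i then 1 else 0) \<le> k j - (if j = i then 1 else 0)" using A1[of j] j by auto
      consider "j = i" | "Suc j = i" | "j \<noteq> i \<and> Suc j \<noteq> i" by blast
      then show "pl j - (if j = i then 1 else 0) + (mi j - (if j = i - 1 then 1 else 0)) \<le> k j - (if j = i then 1 else 0) + (pl (Suc j) - (if Suc j = i then 1 else 0))"
        by cases (use A1[of j] j 1 prev i in auto)
    qed (use A3 A4 i 1 prev in \<open>auto intro: diff_le_mono\<close>)
    then show ?thesis using ext_pair[of i m] 1 prev i unfolding ke
      by (intro exI[of _ "e1 i"] exI[of _ "e1 (i - 1)"]) (auto simp: e1_def intro!: bexI[of _ i])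
  next
    case 2
    have "block_cond m (sub k (e1 i)) (sub pl (e1 i)) (sub mi (\<lambda>_. 0))"
      unfolding simps
    proof (intro conjI ballI impI)
      fix j assume j: "j \<in> {1..<m}"
      show "pl j - (if j = i then 1 else 0) \<le> k j - (if j = i then 1 else 0)" using A1[of j] j by auto
      consider "j = i" | "Suc j = i" | "j \<noteq> i \<and> Suc j \<noteq> i" by blast
      then show "pl j - (if j = i then 1 else 0) + (mi j - 0) \<le> k j - (if j = i then 1 else 0) + (pl (Suc j) - (if Suc j = i then 1 else 0))"
      proof cases
        case 2
        then show ?thesis using prev j \<open>2 \<le> i \<longrightarrow> mi (i - 1) = 0\<close> by auto
      qed (use A1[of j] j 2 i in auto)
    qed (use A1[of i] A3 A4 i 2 prev in \<open>auto intro: diff_le_mono\<close>)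
    then show ?thesis using ext_plus[of i m] 2 i unfolding ke
      by (intro exI[of _ "e1 i"] exI[of _ "\<lambda>_. 0"]) (auto simp: e1_def intro!: bexI[of _ i])
  next
    case 3
    have "block_cond m (sub k (e1 i)) (sub pl (\<lambda>_. 0)) (sub mi (e1 i))"
      unfolding simps
    proof (intro conjI ballI impI)
      fix j assume j: "j \<in> {1..<m}"
      show "pl j - 0 \<le> k j - (if j = i then 1 else 0)" using A1[of j] j 3 by auto
      show "pl j - 0 + (mi j - (if j = i then 1 else 0)) \<le> k j - (if j = i then 1 else 0) + (pl (Suc j) - 0)"
        using A1[of j] j 3 i by auto
    qed (use A3 A4 i 3 in \<open>auto intro: diff_le_mono\<close>)
    then show ?thesis using ext_minus[of i m] 3 i unfolding ke
      by (intro exI[of _ "e1 i"] exI[of _ "\<lambda>_. 0"] exI[of _ "e1 i"]) (auto simp: e1_def intro!: bexI[of _ i])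
  next
    case 4
    have "block_cond m (sub k (e1 i)) (sub pl (\<lambda>_. 0)) (sub mi (\<lambda>_. 0))"
      unfolding simps
    proof (intro conjI ballI impI)
      fix j assume j: "j \<in> {1..<m}"
      show "pl j - 0 \<le> k j - (if j = i then 1 else 0)" using A1[of j] j 4 by auto
      show "pl j - 0 + (mi j - 0) \<le> k j - (if j = i then 1 else 0) + (pl (Suc j) - 0)"
        using A1[of j] j 4 i by auto
    qed (use A3 A4 i 4 in \<open>auto intro: diff_le_mono\<close>)
    then show ?thesis using ext0[of i m] i unfolding ke
      by (intro exI[of _ "e1 i"] exI[of _ "\<lambda>_. 0"]) (auto simp: e1_def intro!: bexI[of _ i])
  qed
next
  case False
  then have k0: "k j = 0" if "1 \<le> j" "j < m" for j using that by auto
  have A1: "pl j \<le> k j" "pl j + mi j \<le> k j + pl (Suc j)" if "1 \<le> j" "j < m" for j using a that by (auto simp: block_cond_def)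
  have A3: "mi m \<le> k m" "pl m \<le> k (Suc m)" using a by (auto simp: block_cond_def)
  have p0: "pl j = 0" "mi j \<le> pl (Suc j)" if "1 \<le> j" "j < m" for j using A1[of j] k0[of j] that by simp_all
  have A4: "mi (m - 1) + mi m \<le> k m \<and> mi (m - 1) \<le> pl m \<and> pl (m - 1) = 0 \<and> k (m - 1) = 0" if "2 \<le> m"
    using a that k0[of "m - 1"] p0[of "m - 1"] by (auto simp: block_cond_def)
  have m0: "mi j = 0" if "1 \<le> j" "Suc j < m" for j using p0[of j] p0[of "Suc j"] that by simp
  have red: "block_cond m (sub k k1) (sub pl pl1) (sub mi mi1)"
    if "\<And>j. j \<in> {1..<m} \<Longrightarrow> mi j - mi1 j \<le> pl (Suc j) - pl1 (Suc j)" "mi m - mi1 m \<le> k m - k1 m" "pl m - pl1 m \<le> k (Suc m) - k1 (Suc m)"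
      "2 \<le> m \<Longrightarrow> mi (m - 1) - mi1 (m - 1) + (mi m - mi1 m) \<le> k m - k1 m" for k1 pl1 mi1
    unfolding block_cond_def sub_def using that k0 p0 by auto
  consider (pair) "2 \<le> m" "mi (m - 1) > 0" | (km) "2 \<le> m \<longrightarrow> mi (m - 1) = 0" "k m > 0" "mi m > 0"
    | (km0) "2 \<le> m \<longrightarrow> mi (m - 1) = 0" "k m > 0" "mi m = 0"
    | (kM) "2 \<le> m \<longrightarrow> mi (m - 1) = 0" "k m = 0" "pl m > 0" | (kM0) "2 \<le> m \<longrightarrow> mi (m - 1) = 0" "k m = 0" "pl m = 0" by blast
  then show ?thesis
  proof cases
    case pair
    \<comment> \<open>Here \<omega>_m + \<omega>_(m+1) is taken off: the pair uses up one unit of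
      \<open>k m\<close> through its minus factor and one of \<open>k (m+1)\<close> through its plus
      factor.\<close>
    have "block_cond m (sub k (kext m m)) (sub pl (e1 m)) (sub mi (e1 (m - 1)))"
    proof (rule red)
      fix j assume j: "j \<in> {1..<m}"
      show "mi j - e1 (m - 1) j \<le> pl (Suc j) - e1 m (Suc j)"
        using A4 pair m0[of j] j p0[of j] by (cases "Suc j = m") (auto simp: e1_def)
    qed (use A3 A4 pair in \<open>auto simp: e1_def kext_def\<close>)
    then show ?thesis using ext_pair[of m m] pair A3 A4
      by (intro exI[of _ "kext m m"] exI[of _ "e1 m"] exI[of _ "e1 (m - 1)"]) (auto simp: e1_def kext_def intro!: bexI[of _ m])
  next
    case km
    have "block_cond m (sub k (e1 m)) (sub pl (\<lambda>_. 0)) (sub mi (e1 m))"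
      by (rule red) (use p0 A3 A4 km in \<open>auto simp: e1_def\<close>)
    then show ?thesis using spinm[of m] km assms(1)
      by (intro exI[of _ "e1 m"] exI[of _ "\<lambda>_. 0"] exI[of _ "e1 m"]) (auto simp: e1_def intro!: bexI[of _ m])
  next
    case km0
    have "block_cond m (sub k (e1 m)) (sub pl (\<lambda>_. 0)) (sub mi (\<lambda>_. 0))"
      by (rule red) (use p0 A3 A4 km0 in \<open>auto simp: e1_def\<close>)
    then show ?thesis using spinm0[of m] km0 assms(1)
      by (intro exI[of _ "e1 m"] exI[of _ "\<lambda>_. 0"]) (auto simp: e1_def intro!: bexI[of _ m])
  next
    case kM
    have "mi j = 0" if "j \<in> {1..<m}" for j using that m0[of j] kM(1) by (cases "Suc j = m") auto
    then have "block_cond m (sub k (e1 (Suc m))) (sub pl (e1 m)) (sub mi (\<lambda>_. 0))"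
      by (intro red) (use p0 A3 A4 kM in \<open>auto simp: e1_def\<close>)
    then show ?thesis using spinM[of m] kM assms(1) A3
      by (intro exI[of _ "e1 (Suc m)"] exI[of _ "e1 m"] exI[of _ "\<lambda>_. 0"]) (auto simp: e1_def intro!: bexI[of _ "Suc m"])
  next
    case kM0
    have "k (Suc m) > 0" using pos k0[of i0] kM0 by (cases "i0 = Suc m"; cases "i0 = m") auto
    moreover have "block_cond m (sub k (e1 (Suc m))) (sub pl (\<lambda>_. 0)) (sub mi (\<lambda>_. 0))"
      by (rule red) (use p0 A3 A4 kM0 in \<open>auto simp: e1_def\<close>)
    ultimately show ?thesis using spinM0[of m] assms(1)
      by (intro exI[of _ "e1 (Suc m)"] exI[of _ "\<lambda>_. 0"]) (auto simp: e1_def intro!: bexI[of _ "Suc m"])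
  qed
qed

lemma witness_cong:
  assumes "witness M k pl mi L B u g lam" "\<And>i. i \<in> {1..M} \<Longrightarrow> k i = k' i" "agree M pl pl'" "agree M mi mi'"
  shows "witness M k' pl' mi' L B u g lam"
proof -
  interpret model M L B using assms(1) by (simp add: witness_def)
  have "block_lt M p q pl mi" if "block_lt M p q pl' mi'" for p q
    using that assms(3,4) unfolding block_lt_def by (meson agree_dl agree_sym agree_trans)
  moreover have "X M pl mi u = X M pl' mi' u" using assms(3,4) by (rule X_cong)
  moreover have "dominant M k' lam" using assms(1,2) unfolding witness_def dominant_def by auto
  ultimately show ?thesis using assms(1) unfolding witness_def by auto
qed

text \<open>The start of the tensor construction: with the empty list as only basis element the
  supported functions form a line, which carries the trivial module.\<close>

lemma model_trivial: "model M (\<lambda>_ _ _. 0) {[]}"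
  by unfold_locales
    (auto simp: supp_def ip_def fscale_def algebra_simps Vector_Spaces.linear_iff vector_space_fscale evalfun.zero)

theorem witness_exists:
  assumes "1 \<le> m" "block_cond m k pl mi"
  shows "\<exists>(L :: int \<Rightarrow> int \<Rightarrow> (nat set list \<Rightarrow> complex) \<Rightarrow> nat set list \<Rightarrow> complex) B u g lam. witness (Suc m) k pl mi L B u g lam"
  using assms(2)
proof (induction "sum k {1..Suc m}" arbitrary: k pl mi rule: less_induct)
  case less
  show ?case
  proof (cases "\<exists>i\<in>{1..Suc m}. k i > 0")
    case True
    then obtain k1 pl1 mi1 where g: "generator m k1 pl1 mi1" "\<And>i. k1 i \<le> k i \<and> pl1 i \<le> pl i \<and> mi1 i \<le> mi i"
      "block_cond m (sub k k1) (sub pl pl1) (sub mi mi1)" "\<exists>i\<in>{1..Suc m}. k1 i > 0"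
      using block_cond_split_generator[OF assms(1) less.prems] by blast
    have "sum (sub k k1) {1..Suc m} < sum k {1..Suc m}"
    proof (rule sum_strict_mono_ex1)
      show "\<exists>i\<in>{1..Suc m}. sub k k1 i < k i"
        using g(2,4) unfolding sub_def by (metis diff_less less_le_trans)
    qed (auto simp: sub_def)
    from less.hyps[OF this g(3)]
    obtain L2 :: "int \<Rightarrow> int \<Rightarrow> (nat set list \<Rightarrow> complex) \<Rightarrow> nat set list \<Rightarrow> complex" and B2 u2 g2 lam2
      where 2: "witness (Suc m) (sub k k1) (sub pl pl1) (sub mi mi1) L2 B2 u2 g2 lam2" by blast
    obtain L1 :: "int \<Rightarrow> int \<Rightarrow> (nat set \<Rightarrow> complex) \<Rightarrow> nat set \<Rightarrow> complex" and B1 u1 g1 lam1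
      where 1: "witness (Suc m) k1 pl1 mi1 L1 B1 u1 g1 lam1" using witness_generator[OF g(1)] by blast
    have "(\<lambda>i. k1 i + sub k k1 i) = k" "(\<lambda>i. pl1 i + sub pl pl1 i) = pl" "(\<lambda>i. mi1 i + sub mi mi1 i) = mi"
      using g(2) by (auto simp: sub_def)
    with witness_tensor[OF 1 2] show ?thesis by (simp only:) blast
  next
    case False
    then have k0: "k i = 0" if "i \<in> {1..Suc m}" for i using that by auto
    have pl0: "pl i = 0" if "i \<in> {1..m}" for i
    proof (cases "i = m")
      case True
      then show ?thesis using less.prems k0[of "Suc m"] by (auto simp: block_cond_def)
    next
      case False
      then have "pl i \<le> k i" using less.prems that unfolding block_cond_def by fastforce
      then show ?thesis using k0[of i] that by simp
    qed
    have mi0: "mi i = 0" if "i \<in> {1..m}" for i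
    proof (cases "i = m")
      case True
      then show ?thesis using less.prems k0[of m] that by (auto simp: block_cond_def)
    next
      case False
      then have "i \<in> {1..<m}" using that by simp
      then have "pl i + mi i \<le> k i + pl (Suc i)" using less.prems by (simp add: block_cond_def)
      then have "mi i \<le> k i + pl (Suc i)" by simp
      then show ?thesis using k0[of i] pl0[of "Suc i"] that False by simp
    qed
    define u :: "nat set list \<Rightarrow> complex" where "u = (\<lambda>l. if l = [] then 1 else 0)"
    interpret T: model "Suc m" "\<lambda>_ _ _. 0" "{[] :: nat set list}" by (rule model_trivial)
    have "T.X (Suc m) (\<lambda>_. 0) (\<lambda>_. 0) u = u" by (simp add: T.X_def T.yw_0)
    then have "witness (Suc m) (\<lambda>_. 0) (\<lambda>_. 0) (\<lambda>_. 0) (\<lambda>_ _ _. 0) {[]} u u (\<lambda>_. 0)"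
      using model_trivial[of "Suc m"] unique_plus_zero
      by (auto simp: witness_def T.singular_def dominant_def u_def supp_def ip_def block_lt_def deglex_lt_def)
    then have "witness (Suc m) k pl mi (\<lambda>_ _ _. 0) {[]} u u (\<lambda>_. 0)"
      by (rule witness_cong) (use k0 pl0 mi0 in \<open>auto simp: agree_def\<close>)
    then show ?thesis by blast
  qed
qed

section \<open>Induction on the level\<close>

type_synonym exps = "nat \<Rightarrow> nat \<Rightarrow> nat"

primrec exps_lt :: "nat \<Rightarrow> exps \<Rightarrow> exps \<Rightarrow> exps \<Rightarrow> exps \<Rightarrow> bool" where
  "exps_lt 0 p q pl mi = False"
| "exps_lt (Suc m) p q pl mi \<longleftrightarrow> block_lt (Suc m) (p (Suc m)) (q (Suc m)) (pl (Suc m)) (mi (Suc m)) \<or>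
     agree (Suc m) (p (Suc m)) (pl (Suc m)) \<and> agree (Suc m) (q (Suc m)) (mi (Suc m)) \<and> exps_lt m p q pl mi"

text \<open>The highest weight of the level \<open>m\<close> module generated by \<^const>\<open>so_module.X\<close>.\<close>
definition next_weight :: "nat \<Rightarrow> (nat \<Rightarrow> nat) \<Rightarrow> (nat \<Rightarrow> nat) \<Rightarrow> (nat \<Rightarrow> nat) \<Rightarrow> nat \<Rightarrow> nat" where
  "next_weight m k pl mi i =
     (if i < m then k i + (pl (Suc i) + mi (Suc i)) - (pl i + mi i)
      else k (m - 1) + k m + k (Suc m) - (pl (m - 1) + mi (m - 1) + (pl m + mi m)))"

text \<open>At level one there are no positive roots, so \<open>m = 0\<close> imposes nothing; the
  innermost condition comes from D_2.\<close>

primrec conds :: "nat \<Rightarrow> (nat \<Rightarrow> nat) \<Rightarrow> exps \<Rightarrow> exps \<Rightarrow> bool" where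
  "conds 0 k pl mi = True"
| "conds (Suc m) k pl mi \<longleftrightarrow> m = 0 \<or> block_cond m k (pl (Suc m)) (mi (Suc m)) \<and>
     conds m (next_weight m k (pl (Suc m)) (mi (Suc m))) pl mi"

lemma exps_lt_cong:
  "(\<And>j. j \<le> m \<Longrightarrow> p j = p' j \<and> q j = q' j) \<Longrightarrow> exps_lt m p q pl mi = exps_lt m p' q' pl mi"
  by (induction m) auto

text \<open>The last two labels give the difference and the sum of the last two coordinates; the
  others follow downwards. For a single coordinate \<open>dominant\<close> is vacuous, whence
  \<open>2 \<le> M\<close>.\<close>

lemma dominant_unique:
  assumes "dominant M k lam" "dominant M k lam'" "2 \<le> M" "1 \<le> i" "i \<le> M"
  shows "lam i = lam' i"
proof -
  have "lam (M - 1) - lam M = of_nat (k (M - 1))" "lam' (M - 1) - lam' M = of_nat (k (M - 1))"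
    "lam (M - 1) + lam M = of_nat (k M)" "lam' (M - 1) + lam' M = of_nat (k M)"
    using assms unfolding dominant_def by (auto dest!: spec[of _ "M - 1"])
  then have "2 * lam M = of_nat (k M) - of_nat (k (M - 1))" "2 * lam' M = of_nat (k M) - of_nat (k (M - 1))"
    by (metis add_diff_cancel_left' diff_add_eq diff_diff_eq2 mult_2 add.commute)+
  then have "2 * lam M = 2 * lam' M" by (simp only:)
  then have M: "lam M = lam' M" by simp
  show ?thesis
    using assms(5)
  proof (induction i rule: inc_induct)
    case (step i)
    show ?case
    proof (cases "1 \<le> i")
      case True
      then have "lam i - lam (Suc i) = lam' i - lam' (Suc i)" using assms(1,2) step True unfolding dominant_def by metis
      then show ?thesis using step by simp
    qed (use assms step in auto)
  qed (rule M)
qed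

text \<open>The truncated subtractions in \<open>next_weight\<close> are exact under
  \<open>block_cond\<close>: for \<open>i < m\<close> by its bound on \<open>pl i + mi i\<close>,
  and for \<open>i = m\<close> by its bound on three exponents together with
  \<open>pl m \<le> k (m+1)\<close>. The coordinates m - 1 and m of \<open>lam\<close> have sum
  \<open>k (m-1) + k m + k (m+1)\<close>.\<close>

lemma dominant_next:
  assumes "dominant (Suc m) k lam" "block_cond m k pl mi" "1 \<le> m"
  shows "dominant m (next_weight m k pl mi) (\<lambda>i. lam i - of_nat (pl i + mi i))"
  unfolding dominant_def
proof (intro conjI allI impI)
  fix i assume i: "1 \<le> i \<and> i < m"
  have d: "lam i - lam (Suc i) = of_nat (k i)" using assms(1) i by (simp add: dominant_def)
  have "pl i + mi i \<le> k i + pl (Suc i)" using assms(2) i by (simp add: block_cond_def)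
  then have "complex_of_nat (k i + (pl (Suc i) + mi (Suc i)) - (pl i + mi i)) = of_nat (k i) + of_nat (pl (Suc i) + mi (Suc i)) - of_nat (pl i + mi i)"
    by (subst of_nat_diff) auto
  then show "lam i - of_nat (pl i + mi i) - (lam (Suc i) - of_nat (pl (Suc i) + mi (Suc i))) = of_nat (next_weight m k pl mi i)"
    using i d by (simp add: next_weight_def)
next
  assume m: "2 \<le> m"
  have d: "lam (m - 1) - lam m = of_nat (k (m - 1))" "lam m - lam (Suc m) = of_nat (k m)" "lam m + lam (Suc m) = of_nat (k (Suc m))"
    using assms(1) m unfolding dominant_def by (auto dest: spec[of _ "m - 1"])
  have "mi (m - 1) + pl (m - 1) + mi m \<le> k (m - 1) + k m" "pl m \<le> k (Suc m)" using assms(2) m by (auto simp: block_cond_def)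
  then have "complex_of_nat (k (m - 1) + k m + k (Suc m) - (pl (m - 1) + mi (m - 1) + (pl m + mi m)))
    = of_nat (k (m - 1)) + of_nat (k m) + of_nat (k (Suc m)) - of_nat (pl (m - 1) + mi (m - 1)) - of_nat (pl m + mi m)"
    by (subst of_nat_diff) auto
  then have "complex_of_nat (next_weight m k pl mi m) = of_nat (k (m - 1)) + of_nat (k m) + of_nat (k (Suc m)) - of_nat (pl (m - 1) + mi (m - 1)) - of_nat (pl m + mi m)"
    by (simp only: next_weight_def less_irrefl if_False)
  then show "lam (m - 1) - of_nat (pl (m - 1) + mi (m - 1)) + (lam m - of_nat (pl m + mi m)) = of_nat (next_weight m k pl mi m)"
    unfolding d[symmetric] by simp
qed

lemma dominant_diff: "dominant M k lam \<Longrightarrow> 1 \<le> i \<Longrightarrow> i \<le> j \<Longrightarrow> j \<le> M \<Longrightarrow> \<exists>\<kappa>. lam i - lam j = of_nat \<kappa>"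
proof (induction j)
  case (Suc j)
  show ?case
  proof (cases "i = Suc j")
    case False
    then obtain \<kappa> where "lam i - lam j = of_nat \<kappa>" using Suc by auto
    moreover have "lam j - lam (Suc j) = of_nat (k j)" using Suc False by (simp add: dominant_def)
    ultimately have "lam i - lam (Suc j) = of_nat (\<kappa> + k j)" by (simp add: algebra_simps)
    then show ?thesis by blast
  qed (auto intro: exI[of _ 0])
qed simp

lemma dominant_sum:
  assumes "dominant M k lam" "1 \<le> i" "i < j" "j \<le> M"
  shows "\<exists>\<kappa>. lam i + lam j = of_nat \<kappa>"
proof -
  have "i \<le> M - 1" "M - 1 \<le> M" using assms by auto
  then obtain a where a: "lam i - lam (M - 1) = of_nat a" using dominant_diff[OF assms(1,2)] by blast
  obtain b where b: "lam j - lam M = of_nat b" using dominant_diff[OF assms(1), of j M] assms by auto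
  have "lam (M - 1) + lam M = of_nat (k M)" using assms by (simp add: dominant_def)
  then have "lam i + lam j = of_nat (a + b + k M)" using a b by (simp add: algebra_simps)
  then show ?thesis by blast
qed

context so_module
begin

lemma singular_cong:
  assumes "singular M W v lam" "\<And>i. 1 \<le> i \<Longrightarrow> i \<le> M \<Longrightarrow> lam i = lam' i"
  shows "singular M W v lam'"
  using assms by (simp add: singular_def)

definition lower_nilpotent :: bool where
  "lower_nilpotent \<longleftrightarrow> (\<forall>i j w. 1 \<le> i \<longrightarrow> i < j \<longrightarrow> j \<le> n \<longrightarrow>
     (\<exists>N. (L (int j) (int i) ^^ N) w = 0) \<and> (\<exists>N. (L (- int j) (int i) ^^ N) w = 0))"

lemma pairing_witness:
  assumes "M \<le> n" "2 \<le> M" "stable M W" "v \<notin> W" "singular M W v lam" "dominant M k lam"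
    and w: "witness M k pl mi K B u g lam'"
  shows "pairing scale n L M K B W v u lam'"
proof -
  have model: "model M K B" using w by (simp add: witness_def)
  interpret R: model M K B by (rule model)
  have "singular M W v lam'"
    using dominant_unique[OF assms(6) _ assms(2)] w by (intro singular_cong[OF assms(5)]) (auto simp: witness_def)
  moreover have "u \<noteq> 0"
  proof
    assume "u = 0"
    then have "R.X M pl mi u = 0" by (simp only: R.X_linear(4)[OF order.refl])
    then show False using w by (simp add: witness_def)
  qed
  ultimately show ?thesis
    using w assms by (intro pairing.intro so_module_axioms R.unitary_module_axioms pairing_axioms.intro) (auto simp: witness_def)
qed

text \<open>The level drops by one with \<open>v\<close> replaced by \<open>X b v\<close> and
  \<open>W\<close> by the space of smaller blocks: signatures with a smaller top block are absorbed
  by that space, and the others have the same top block. If \<open>block_cond\<close> fails,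
  \<open>X b v\<close> itself is absorbed, whatever the lower exponents are.\<close>

theorem essential_iff_cnd:
  assumes "m \<le> n" "stable m W" "v \<notin> W" "singular m W v lam" "dominant m k lam" "lower_nilpotent"
  shows "sv m pl mi v \<notin> span (W \<union> {sv m p q v | p q. exps_lt m p q pl mi}) \<longleftrightarrow> conds m k pl mi"
  using assms
proof (induction m arbitrary: W v lam k)
  case 0
  then show ?case by (simp add: stable_def span_eq_iff[THEN iffD2])
next
  case (Suc m)
  let ?M = "Suc m"
  show ?case
  proof (cases "m = 0")
    case True
    \<comment> \<open>Level one has no positive roots, so no signature is smaller than
      another.\<close>
    have "\<not> deglex_lt 1 a b" for a b by (simp add: deglex_lt_def)
    then have "{sv ?M p q v | p q. exps_lt ?M p q pl mi} = {}" using True by (simp add: block_lt_def One_nat_def)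
    moreover have "sv ?M pl mi v = v" using True by (simp add: X_def yw_def One_nat_def)
    ultimately show ?thesis using Suc.prems True by (simp add: stable_def span_eq_iff[THEN iffD2])
  next
    case False
    then have m: "1 \<le> m" by simp
    interpret rel_module scale n L m W v lam
      by unfold_locales (use Suc.prems in auto)
    let ?b = "X ?M (pl ?M) (mi ?M)"
    let ?G = "G (\<lambda>p q. block_lt ?M p q (pl ?M) (mi ?M))"
    let ?S = "W \<union> {sv ?M p q v | p q. exps_lt ?M p q pl mi}"
    have Wsv: "sv m p q w \<in> W" if "w \<in> W" for w p q
      using that Suc.prems W_op by (intro sv_in) auto
    have upd: "sv m p q (X ?M a b v) = sv ?M (p(?M := a)) (q(?M := b)) v" for p q a b
      by (simp cong: sv_cong)
    \<comment> \<open>Ordered monomials enter here: lowering words of level \<open>m\<close> in any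
      order become combinations of the vectors \<open>sv m p q s\<close>.\<close>
    have "?G = low m (W \<union> {X ?M p q s | p q s. s \<in> {v} \<and> block_lt ?M p q (pl ?M) (mi ?M)})" by (simp add: gen_def)
    also have "\<dots> = span {sv m p q s | p q s. s \<in> W \<union> {X ?M p q s | p q s. s \<in> {v} \<and> block_lt ?M p q (pl ?M) (mi ?M)}}"
      using Suc.prems by (intro low_eq_span_sv) simp
    also have "\<dots> \<subseteq> span ?S"
    proof (intro span_mono subsetI)
      fix x assume "x \<in> {sv m p q s | p q s. s \<in> W \<union> {X ?M p q s | p q s. s \<in> {v} \<and> block_lt ?M p q (pl ?M) (mi ?M)}}"
      then obtain p q s where x: "x = sv m p q s" "s \<in> W \<or> (\<exists>a b. s = X ?M a b v \<and> block_lt ?M a b (pl ?M) (mi ?M))" by blast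
      from x(2) show "x \<in> ?S"
      proof
        assume "s \<in> W"
        then show ?thesis using Wsv x by simp
      next
        assume "\<exists>a b. s = X ?M a b v \<and> block_lt ?M a b (pl ?M) (mi ?M)"
        then obtain a b where ab: "s = X ?M a b v" "block_lt ?M a b (pl ?M) (mi ?M)" by blast
        have "exps_lt ?M (p(?M := a)) (q(?M := b)) pl mi" using ab by simp
        then show ?thesis unfolding x(1) ab(1) upd by blast
      qed
    qed
    finally have GS: "?G \<subseteq> span ?S" .
    have Gsv: "sv m p q w \<in> ?G" if "w \<in> ?G" for w p q
      using that Suc.prems by (intro sv_in) auto
    have eq: "span ?S = span (?G \<union> {sv m p q (?b v) | p q. exps_lt m p q pl mi})"
    proof (rule subset_antisym)
      show "span ?S \<subseteq> span (?G \<union> {sv m p q (?b v) | p q. exps_lt m p q pl mi})"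
      proof (intro span_mono subsetI)
        fix x assume "x \<in> ?S"
        then consider "x \<in> W" | p q where "x = sv ?M p q v" "exps_lt ?M p q pl mi" by blast
        then show "x \<in> ?G \<union> {sv m p q (?b v) | p q. exps_lt m p q pl mi}"
        proof cases
          case 1
          then show ?thesis by simp
        next
          case 2
          consider "block_lt ?M (p ?M) (q ?M) (pl ?M) (mi ?M)" | "agree ?M (p ?M) (pl ?M)" "agree ?M (q ?M) (mi ?M)" "exps_lt m p q pl mi"
            using 2 by auto
          then show ?thesis
          proof cases
            case 1
            then have "X ?M (p ?M) (q ?M) v \<in> ?G" by simp
            then show ?thesis using Gsv 2(1) by simp
          next
            case 3: 2
            then have "X ?M (p ?M) (q ?M) v = ?b v" by (intro X_cong)
            then have "x = sv m p q (?b v)" using 2(1) by simp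
            then show ?thesis using 3(3) by blast
          qed
        qed
      qed
      have "{sv m p q (?b v) | p q. exps_lt m p q pl mi} \<subseteq> ?S"
      proof
        fix x assume "x \<in> {sv m p q (?b v) | p q. exps_lt m p q pl mi}"
        then obtain p q where x: "x = sv m p q (?b v)" "exps_lt m p q pl mi" by blast
        have "exps_lt m (p(?M := pl ?M)) (q(?M := mi ?M)) pl mi = exps_lt m p q pl mi"
          by (rule exps_lt_cong) simp
        then have "exps_lt ?M (p(?M := pl ?M)) (q(?M := mi ?M)) pl mi" using x(2) by simp
        then have "sv m p q (?b v) \<in> {sv ?M p q v | p q. exps_lt ?M p q pl mi}" unfolding upd by blast
        then show "x \<in> ?S" unfolding x(1) by blast
      qed
      then have "?G \<union> {sv m p q (?b v) | p q. exps_lt m p q pl mi} \<subseteq> span ?S" using GS span_superset by blast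
      then show "span (?G \<union> {sv m p q (?b v) | p q. exps_lt m p q pl mi}) \<subseteq> span ?S" by (rule span_minimal) simp
    qed
    have svM: "sv ?M pl mi v = sv m pl mi (?b v)" by simp
    show ?thesis
    proof (cases "block_cond m k (pl ?M) (mi ?M)")
      case False
      interpret dom_module scale n L m W v lam k
        by unfold_locales (use Suc.prems m in \<open>auto simp: dominant_def lower_nilpotent_def\<close>)
      have "?b v \<in> ?G" by (rule upper_bound[OF m False])
      then have "sv ?M pl mi v \<in> span ?S" unfolding eq svM by (intro span_base) (use Gsv in simp)
      then show ?thesis using False m by simp
    next
      case True
      obtain K :: "int \<Rightarrow> int \<Rightarrow> (nat set list \<Rightarrow> complex) \<Rightarrow> nat set list \<Rightarrow> complex" and B u g lam'
        where w: "witness ?M k (pl ?M) (mi ?M) K B u g lam'" using witness_exists[OF m True] by blast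
      interpret pairing scale n L ?M K B W v u lam'
        using Suc.prems m w by (intro pairing_witness) auto
      have "?b v \<notin> ?G"
        by (rule lower_bound[where g = g]) (use w in \<open>auto simp: witness_def\<close>)
      then have "sv m pl mi (?b v) \<notin> span (?G \<union> {sv m p q (?b v) | p q. exps_lt m p q pl mi}) \<longleftrightarrow>
          conds m (next_weight m k (pl ?M) (mi ?M)) pl mi"
        using Suc.prems filtration[of "pl ?M" "mi ?M"] True m
        by (intro Suc.IH) (auto intro: dominant_next simp del: of_nat_add)
      then show ?thesis unfolding eq svM using True m by simp
    qed
  qed
qed

end

section \<open>From the recursive conditions to the inequalities of the theorem\<close>

definition drop2 :: "exps \<Rightarrow> exps \<Rightarrow> nat \<Rightarrow> nat \<Rightarrow> nat \<Rightarrow> int" where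
  "drop2 pl mi i i' l = int (pl l i) + int (mi l i) - int (pl l i') - int (mi l i')"

definition ineqs :: "nat \<Rightarrow> (nat \<Rightarrow> nat) \<Rightarrow> exps \<Rightarrow> exps \<Rightarrow> bool" where
  "ineqs n k pl mi \<longleftrightarrow>
    (\<forall>i \<in> {1..n - 2}. \<forall>j \<in> {i + 2..n}. int (pl j i) + (\<Sum>l = j + 1..n. drop2 pl mi i (i + 1) l) \<le> int (k i)) \<and>
    (\<forall>i \<in> {1..n - 2}. \<forall>j \<in> {i + 2..n}. int (mi j (i + 1)) + (\<Sum>l = j..n. drop2 pl mi i (i + 1) l) \<le> int (k i)) \<and>
    (\<forall>i \<in> {1..n - 1}. int (mi (i + 1) i) + (\<Sum>l = i + 2..n. drop2 pl mi i (i + 1) l) \<le> int (k i)) \<and>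
    (\<forall>i \<in> {1..n - 2}. int (mi (i + 2) i) + int (pl (i + 2) i) + int (mi (i + 2) (i + 1))
       + (\<Sum>l = i + 3..n. drop2 pl mi i (i + 2) l) \<le> int (k i) + int (k (i + 1))) \<and>
    (\<forall>i \<in> {1..n - 2}. int (pl (i + 1) i)
       + (\<Sum>l = i + 2..n. int (pl l i) + int (mi l i) + int (pl l (i + 1)) + int (mi l (i + 1)))
       \<le> int (k i) + int (k (n - 1)) + int (k n) + 2 * (\<Sum>j = i + 1..n - 2. int (k j))) \<and>
    int (pl n (n - 1)) \<le> int (k n)"

lemma ineqs_acond:
  assumes "ineqs (Suc m) k pl mi" "1 \<le> m"
  shows "block_cond m k (pl (Suc m)) (mi (Suc m))"
proof -
  let ?M = "Suc m"
  have a: "pl ?M i \<le> k i \<and> pl ?M i + mi ?M i \<le> k i + pl ?M (Suc i)" if "i \<in> {1..<m}" for i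
  proof -
    have i: "i \<in> {1..?M - 2}" "?M \<in> {i + 2..?M}" using that by auto
    have "int (pl ?M i) + (\<Sum>l = ?M + 1..?M. drop2 pl mi i (i + 1) l) \<le> int (k i)"
      "int (mi ?M (i + 1)) + (\<Sum>l = ?M..?M. drop2 pl mi i (i + 1) l) \<le> int (k i)"
      using assms(1) i unfolding ineqs_def by blast+
    then show ?thesis by (simp add: drop2_def flip: Suc_eq_plus1)
  qed
  have "int (mi (m + 1) m) + (\<Sum>l = m + 2..?M. drop2 pl mi m (m + 1) l) \<le> int (k m)"
  proof -
    have "m \<in> {1..?M - 1}" using assms by simp
    then show ?thesis using assms(1) unfolding ineqs_def by blast
  qed
  then have b: "mi ?M m \<le> k m" by (simp flip: Suc_eq_plus1)
  have "int (pl ?M (?M - 1)) \<le> int (k ?M)" using assms(1) unfolding ineqs_def by blast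
  then have c: "pl ?M m \<le> k ?M" by simp
  have d: "mi ?M (m - 1) + pl ?M (m - 1) + mi ?M m \<le> k (m - 1) + k m" if "2 \<le> m"
  proof -
    define i where "i = m - 1"
    have i: "i \<in> {1..?M - 2}" "m = i + 1" using that by (auto simp: i_def)
    have "int (mi (i + 2) i) + int (pl (i + 2) i) + int (mi (i + 2) (i + 1)) + (\<Sum>l = i + 3..?M. drop2 pl mi i (i + 2) l) \<le> int (k i) + int (k (i + 1))"
      using assms(1) i(1) unfolding ineqs_def by blast
    moreover have "i + 2 = ?M" "i + 1 = m" "m - 1 = i" "{i + 3..?M} = {}" using i by auto
    ultimately show ?thesis by (simp only: sum.empty)
  qed
  show ?thesis using a b c d by (auto simp: block_cond_def)
qed

lemma ball_insert_iff:
  "A = insert x B \<Longrightarrow> (P x \<longleftrightarrow> R) \<Longrightarrow> (\<And>i. i \<in> B \<Longrightarrow> P i \<longleftrightarrow> Q i) \<Longrightarrow> (\<forall>i\<in>A. P i) \<longleftrightarrow> (\<forall>i\<in>B. Q i) \<and> R"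
  by auto

text \<open>The top level adds \<open>P i - P (i+1)\<close>, or a similar expression, to a sum and
  changes the bound by just the opposite amount when \<open>k\<close> becomes \<open>k'\<close>; so
  an inequality that involves the top level only through the sum keeps its meaning. Those in which
  it occurs otherwise are part of \<open>block_cond\<close>. The bound on \<open>pl m (m-1)\<close>
  at level \<open>m\<close> arises from the fifth family with \<open>i = m - 1\<close>.\<close>

lemma ineqs_step:
  assumes a: "block_cond m k (pl (Suc m)) (mi (Suc m))" and m: "2 \<le> m"
  shows "ineqs (Suc m) k pl mi \<longleftrightarrow> ineqs m (next_weight m k (pl (Suc m)) (mi (Suc m))) pl mi"
proof -
  let ?M = "Suc m"
  define k' where "k' = next_weight m k (pl ?M) (mi ?M)"
  define P where "P i = int (pl ?M i) + int (mi ?M i)" for i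
  have k': "int (k' i) = int (k i) - P i + P (i + 1)" if "i \<in> {1..<m}" for i
  proof -
    have "pl ?M i + mi ?M i \<le> k i + pl ?M (Suc i)" using a that by (simp add: block_cond_def)
    then show ?thesis using that unfolding k'_def next_weight_def P_def by (simp flip: Suc_eq_plus1)
  qed
  have k'm: "int (k' m) = int (k (m - 1)) + int (k m) + int (k ?M) - P (m - 1) - P m"
  proof -
    have "mi ?M (m - 1) + pl ?M (m - 1) + mi ?M m \<le> k (m - 1) + k m" "pl ?M m \<le> k ?M"
      using a m by (auto simp: block_cond_def)
    then show ?thesis unfolding k'_def next_weight_def P_def by simp
  qed
  have sumM: "(\<Sum>l = j..?M. f l) = (\<Sum>l = j..m. f l) + f ?M" if "j \<le> ?M" for j and f :: "nat \<Rightarrow> int"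
    using that by (simp add: sum.cl_ivl_Suc)
  have dM: "drop2 pl mi i i' ?M = P i - P i'" for i i' by (simp add: drop2_def P_def)
  let ?T1 = "\<lambda>n k i j. int (pl j i) + (\<Sum>l = j + 1..n. drop2 pl mi i (i + 1) l) \<le> int (k i)"
  let ?T2 = "\<lambda>n k i j. int (mi j (i + 1)) + (\<Sum>l = j..n. drop2 pl mi i (i + 1) l) \<le> int (k i)"
  let ?T3 = "\<lambda>n k i. int (mi (i + 1) i) + (\<Sum>l = i + 2..n. drop2 pl mi i (i + 1) l) \<le> int (k i)"
  let ?T4 = "\<lambda>n k i. int (mi (i + 2) i) + int (pl (i + 2) i) + int (mi (i + 2) (i + 1))
       + (\<Sum>l = i + 3..n. drop2 pl mi i (i + 2) l) \<le> int (k i) + int (k (i + 1))"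
  let ?T5 = "\<lambda>n k i. int (pl (i + 1) i)
       + (\<Sum>l = i + 2..n. int (pl l i) + int (mi l i) + int (pl l (i + 1)) + int (mi l (i + 1)))
       \<le> int (k i) + int (k (n - 1)) + int (k n) + 2 * (\<Sum>j = i + 1..n - 2. int (k j))"
  have A1: "pl ?M i \<le> k i" "pl ?M i + mi ?M i \<le> k i + pl ?M (Suc i)" if "i \<in> {1..<m}" for i
    using a that by (auto simp: block_cond_def)
  have e1: "(\<forall>i \<in> {1..?M - 2}. \<forall>j \<in> {i + 2..?M}. ?T1 ?M k i j) \<longleftrightarrow> (\<forall>i \<in> {1..m - 2}. \<forall>j \<in> {i + 2..m}. ?T1 m k' i j)"
  proof -
    have eq: "?T1 ?M k i j \<longleftrightarrow> ?T1 m k' i j" if "1 \<le> i" "i + 2 \<le> j" "j \<le> m" for i j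
    proof -
      have "int (k' i) = int (k i) - P i + P (i + 1)" using that k' by simp
      moreover have "(\<Sum>l = j + 1..?M. drop2 pl mi i (i + 1) l) = (\<Sum>l = j + 1..m. drop2 pl mi i (i + 1) l) + (P i - P (i + 1))"
        using that sumM[of "j + 1"] dM by simp
      ultimately show ?thesis by (intro iffI; linarith)
    qed
    have last: "?T1 ?M k i ?M" if "1 \<le> i" "i < m" for i using A1[of i] that by simp
    show ?thesis
    proof (intro iffI ballI)
      fix i j assume *: "\<forall>i \<in> {1..?M - 2}. \<forall>j \<in> {i + 2..?M}. ?T1 ?M k i j" "i \<in> {1..m - 2}" "j \<in> {i + 2..m}"
      then have "i \<in> {1..?M - 2}" "j \<in> {i + 2..?M}" "1 \<le> i" "i + 2 \<le> j" "j \<le> m" by auto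
      then show "?T1 m k' i j" using *(1) eq by blast
    next
      fix i j assume *: "\<forall>i \<in> {1..m - 2}. \<forall>j \<in> {i + 2..m}. ?T1 m k' i j" "i \<in> {1..?M - 2}" "j \<in> {i + 2..?M}"
      show "?T1 ?M k i j"
      proof (cases "j = ?M")
        case True
        have "1 \<le> i" "i < m" using * by auto
        then show ?thesis unfolding True by (rule last)
      next
        case False
        then have "i \<in> {1..m - 2}" "j \<in> {i + 2..m}" "1 \<le> i" "i + 2 \<le> j" "j \<le> m" using *(2,3) by auto
        then show ?thesis using *(1) eq by blast
      qed
    qed
  qed
  have e2: "(\<forall>i \<in> {1..?M - 2}. \<forall>j \<in> {i + 2..?M}. ?T2 ?M k i j) \<longleftrightarrow> (\<forall>i \<in> {1..m - 2}. \<forall>j \<in> {i + 2..m}. ?T2 m k' i j)"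
  proof -
    have eq: "?T2 ?M k i j \<longleftrightarrow> ?T2 m k' i j" if "1 \<le> i" "i + 2 \<le> j" "j \<le> m" for i j
    proof -
      have "int (k' i) = int (k i) - P i + P (i + 1)" using that k' by simp
      moreover have "(\<Sum>l = j..?M. drop2 pl mi i (i + 1) l) = (\<Sum>l = j..m. drop2 pl mi i (i + 1) l) + (P i - P (i + 1))"
        using that sumM[of j] dM by simp
      ultimately show ?thesis by (intro iffI; linarith)
    qed
    have last: "?T2 ?M k i ?M" if "1 \<le> i" "i < m" for i using A1[of i] that by (simp add: dM P_def flip: Suc_eq_plus1)
    show ?thesis
    proof (intro iffI ballI)
      fix i j assume *: "\<forall>i \<in> {1..?M - 2}. \<forall>j \<in> {i + 2..?M}. ?T2 ?M k i j" "i \<in> {1..m - 2}" "j \<in> {i + 2..m}"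
      then have "i \<in> {1..?M - 2}" "j \<in> {i + 2..?M}" "1 \<le> i" "i + 2 \<le> j" "j \<le> m" by auto
      then show "?T2 m k' i j" using *(1) eq by blast
    next
      fix i j assume *: "\<forall>i \<in> {1..m - 2}. \<forall>j \<in> {i + 2..m}. ?T2 m k' i j" "i \<in> {1..?M - 2}" "j \<in> {i + 2..?M}"
      show "?T2 ?M k i j"
      proof (cases "j = ?M")
        case True
        have "1 \<le> i" "i < m" using * by auto
        then show ?thesis unfolding True by (rule last)
      next
        case False
        then have "i \<in> {1..m - 2}" "j \<in> {i + 2..m}" "1 \<le> i" "i + 2 \<le> j" "j \<le> m" using *(2,3) by auto
        then show ?thesis using *(1) eq by blast
      qed
    qed
  qed
  have e3: "(\<forall>i \<in> {1..?M - 1}. ?T3 ?M k i) \<longleftrightarrow> (\<forall>i \<in> {1..m - 1}. ?T3 m k' i)"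
  proof -
    have eq: "?T3 ?M k i \<longleftrightarrow> ?T3 m k' i" if "1 \<le> i" "i < m" for i
    proof -
      have "int (k' i) = int (k i) - P i + P (i + 1)" using that k' by simp
      moreover have "(\<Sum>l = i + 2..?M. drop2 pl mi i (i + 1) l) = (\<Sum>l = i + 2..m. drop2 pl mi i (i + 1) l) + (P i - P (i + 1))"
        using that sumM[of "i + 2"] dM by simp
      ultimately show ?thesis by (intro iffI; linarith)
    qed
    have last: "?T3 ?M k m" using a by (simp add: block_cond_def flip: Suc_eq_plus1)
    have ins: "{1..?M - 1} = insert m {1..m - 1}" using m by auto
    have "?T3 ?M k m \<longleftrightarrow> True" using last by blast
    note ball_insert_iff[of _ _ _ "?T3 ?M k", OF ins this, of "?T3 m k'"]
    moreover have "?T3 ?M k i \<longleftrightarrow> ?T3 m k' i" if "i \<in> {1..m - 1}" for i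
      using that m by (intro eq) auto
    ultimately show ?thesis by blast
  qed
  have e4: "(\<forall>i \<in> {1..?M - 2}. ?T4 ?M k i) \<longleftrightarrow> (\<forall>i \<in> {1..m - 2}. ?T4 m k' i)"
  proof -
    have eq: "?T4 ?M k i \<longleftrightarrow> ?T4 m k' i" if "1 \<le> i" "i + 2 \<le> m" for i
    proof -
      have "int (k' i) = int (k i) - P i + P (i + 1)" using that k' by simp
      moreover have "int (k' (i + 1)) = int (k (i + 1)) - P (i + 1) + P (i + 2)" using that k'[of "i + 1"] by (simp flip: Suc_eq_plus1)
      moreover have "(\<Sum>l = i + 3..?M. drop2 pl mi i (i + 2) l) = (\<Sum>l = i + 3..m. drop2 pl mi i (i + 2) l) + (P i - P (i + 2))"
        using that sumM[of "i + 3"] dM by simp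
      ultimately show ?thesis by (intro iffI; linarith)
    qed
    have last: "?T4 ?M k (m - 1)"
    proof -
      define i where "i = m - 1"
      have i: "i + 1 = m" "i + 2 = ?M" "{i + 3..?M} = {}" using m by (auto simp: i_def)
      have "mi ?M i + pl ?M i + mi ?M m \<le> k i + k m" using a m by (simp add: block_cond_def i_def)
      then show ?thesis unfolding i_def[symmetric] i sum.empty by linarith
    qed
    have ins: "{1..?M - 2} = insert (m - 1) {1..m - 2}" using m by auto
    have "?T4 ?M k (m - 1) \<longleftrightarrow> True" using last by blast
    note ball_insert_iff[of _ _ _ "?T4 ?M k", OF ins this, of "?T4 m k'"]
    moreover have "?T4 ?M k i \<longleftrightarrow> ?T4 m k' i" if "i \<in> {1..m - 2}" for i
      using that m by (intro eq) auto
    ultimately show ?thesis by blast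
  qed
  have e5: "(\<forall>i \<in> {1..?M - 2}. ?T5 ?M k i) \<longleftrightarrow> (\<forall>i \<in> {1..m - 2}. ?T5 m k' i) \<and> int (pl m (m - 1)) \<le> int (k' m)"
  proof -
    have eq: "?T5 ?M k i \<longleftrightarrow> ?T5 m k' i" if i: "1 \<le> i" "i + 2 \<le> m" for i
    proof -
      \<comment> \<open>The changes \<open>P (j+1) - P j\<close> of the labels telescope over the
        range.\<close>
      have tele: "(\<Sum>j = i + 1..<N. int (k' j)) = (\<Sum>j = i + 1..<N. int (k j)) - P (i + 1) + P N" if "i + 1 \<le> N" "N < m" for N
        using that
      proof (induction N rule: dec_induct)
        case (step N)
        then show ?case using k'[of N] i by (simp add: sum.op_ivl_Suc flip: Suc_eq_plus1)
      qed simp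
      have s: "{i + 1..m - 2} = {i + 1..<m - 1}" "{i + 1..?M - 2} = {i + 1..<m}" using i by auto
      have "(\<Sum>j = i + 1..<m. int (k j)) = (\<Sum>j = i + 1..<m - 1. int (k j)) + int (k (m - 1))"
        using i sum.op_ivl_Suc[of "\<lambda>j. int (k j)" "i + 1" "m - 1"] by (auto split: if_splits)
      moreover have "(\<Sum>j = i + 1..<m - 1. int (k' j)) = (\<Sum>j = i + 1..<m - 1. int (k j)) - P (i + 1) + P (m - 1)"
        using i by (intro tele) auto
      moreover have "int (k' i) = int (k i) - P i + P (i + 1)" using i k' by simp
      moreover have "int (k' (m - 1)) = int (k (m - 1)) - P (m - 1) + P m" using i k'[of "m - 1"] by (simp flip: Suc_eq_plus1)
      moreover have "(\<Sum>l = i + 2..?M. int (pl l i) + int (mi l i) + int (pl l (i + 1)) + int (mi l (i + 1)))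
          = (\<Sum>l = i + 2..m. int (pl l i) + int (mi l i) + int (pl l (i + 1)) + int (mi l (i + 1))) + (P i + P (i + 1))"
        using i by (subst sumM) (auto simp: P_def)
      ultimately show ?thesis
        unfolding s k'm diff_Suc_1 by (intro iffI; linarith)
    qed
    have last: "?T5 ?M k (m - 1) \<longleftrightarrow> int (pl m (m - 1)) \<le> int (k' m)"
    proof -
      have "m - 1 + 1 = m" "m - 1 + 2 = ?M" "{m - 1 + 1..?M - 2} = {}" using m by auto
      then show ?thesis using k'm by (simp add: P_def, intro iffI; linarith)
    qed
    have ins: "{1..?M - 2} = insert (m - 1) {1..m - 2}" using m by auto
    have "?T5 ?M k (m - 1) \<longleftrightarrow> int (pl m (m - 1)) \<le> int (k' m)" using last by blast
    note ball_insert_iff[of _ _ _ "?T5 ?M k", OF ins this, of "?T5 m k'"]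
    moreover have "?T5 ?M k i \<longleftrightarrow> ?T5 m k' i" if "i \<in> {1..m - 2}" for i
      using that m by (intro eq) auto
    ultimately show ?thesis by blast
  qed
  have e6: "int (pl ?M (?M - 1)) \<le> int (k ?M)" using a by (simp add: block_cond_def)
  show ?thesis
    unfolding ineqs_def k'_def[symmetric] e1 e2 e3 e4 e5 using e6 by blast
qed

lemma ineqs_iff_cnd: "2 \<le> n \<Longrightarrow> ineqs n k pl mi \<longleftrightarrow> conds n k pl mi"
proof (induction n arbitrary: k rule: nat_induct_at_least)
  case base
  have "ineqs 2 k pl mi \<longleftrightarrow> block_cond 1 k (pl 2) (mi 2)"
    by (auto simp: ineqs_def block_cond_def numeral_2_eq_2 One_nat_def)
  then show ?case by (simp add: numeral_2_eq_2 One_nat_def)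
next
  case (Suc m)
  have "ineqs (Suc m) k pl mi \<longleftrightarrow> block_cond m k (pl (Suc m)) (mi (Suc m)) \<and>
     ineqs m (next_weight m k (pl (Suc m)) (mi (Suc m))) pl mi"
    using ineqs_acond[of m k pl mi] ineqs_step[of m k pl mi] Suc by auto
  then show ?case using Suc by simp
qed

section \<open>The matrices of the even orthogonal Lie algebra\<close>

text \<open>The row of a \<open>2n \<times> 2n\<close> matrix that belongs to the basis vector with signed index \<open>a\<close>.\<close>
definition pos :: "nat \<Rightarrow> int \<Rightarrow> nat" where
  "pos n a = (if 0 < a then nat a - 1 else n + nat (- a) - 1)"

text \<open>The position paired with \<open>i\<close> by the form, that is, the position of the
  signed index with opposite sign.\<close>

definition mirror :: "nat \<Rightarrow> nat \<Rightarrow> nat" where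
  "mirror n i = (if i < n then i + n else i - n)"

lemma mirror_lt [simp]: "i < 2 * n \<Longrightarrow> mirror n i < 2 * n"
  and mirror_mirror [simp]: "i < 2 * n \<Longrightarrow> mirror n (mirror n i) = i"
  by (auto simp: mirror_def)

lemma mirror_eq_iff: "i < 2 * n \<Longrightarrow> j < 2 * n \<Longrightarrow> mirror n i = mirror n j \<longleftrightarrow> i = j"
  and mirror_swap: "i < 2 * n \<Longrightarrow> j < 2 * n \<Longrightarrow> mirror n i = j \<longleftrightarrow> i = mirror n j"
  by (auto simp: mirror_def)

lemma mirror_neq: "i < 2 * n \<Longrightarrow> mirror n i \<noteq> i"
  by (auto simp: mirror_def)

lemma pos_of_nat: "1 \<le> i \<Longrightarrow> pos n (int i) = i - 1" "1 \<le> i \<Longrightarrow> pos n (- int i) = n + i - 1"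
  by (auto simp: pos_def)

lemma pos_lt: "ix n a \<Longrightarrow> pos n a < 2 * n"
  by (erule ix_cases) (auto simp: pos_of_nat)

lemma pos_minus: "ix n a \<Longrightarrow> pos n (- a) = mirror n (pos n a)"
  by (erule ix_cases) (auto simp: pos_of_nat mirror_def)

lemma pos_inj:
  assumes "ix n a" "ix n b"
  shows "pos n a = pos n b \<longleftrightarrow> a = b"
  by (rule ix_cases[OF assms(1)]; rule ix_cases[OF assms(2)]) (auto simp: pos_of_nat)

lemma pos_surj:
  assumes "r < 2 * n"
  obtains a where "ix n a" "r = pos n a"
proof (cases "r < n")
  case True
  then show ?thesis using that[of "int (Suc r)"] pos_of_nat(1)[of "Suc r" n] by simp
next
  case False
  then show ?thesis using that[of "- int (Suc (r - n))"] assms pos_of_nat(2)[of "Suc (r - n)" n] by simp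
qed

lemma so_form_entry:
  "i < 2 * n \<Longrightarrow> j < 2 * n \<Longrightarrow> so_form n $$ (i, j) = of_bool (j = mirror n i)"
  by (auto simp: so_form_def mirror_def)

lemma so_form_carrier [simp]: "so_form n \<in> carrier_mat (2 * n) (2 * n)"
  by (auto simp: so_form_def)

lemma sum_of_bool: "(s :: nat) < N \<Longrightarrow> (\<Sum>k = 0..<N. of_bool (k = s) * g k) = (g s :: complex)"
proof -
  assume "s < N"
  have "(\<Sum>k = 0..<N. of_bool (k = s) * g k) = (\<Sum>k = 0..<N. if k = s then g k else 0)"
    by (intro sum.cong) auto
  then show ?thesis using \<open>s < N\<close> sum.delta[of "{0..<N}" s g] by simp
qed

lemma times_entry:
  assumes "A \<in> carrier_mat N N" "B \<in> carrier_mat N N" "i < N" "j < N"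
  shows "(A * B) $$ (i, j) = (\<Sum>k = 0..<N. A $$ (i, k) * B $$ (k, j))"
  using assms by (auto simp: scalar_prod_def)

lemma so_even_iff:
  "X \<in> so_even n \<longleftrightarrow> X \<in> carrier_mat (2 * n) (2 * n) \<and>
     (\<forall>i < 2 * n. \<forall>j < 2 * n. X $$ (mirror n j, i) + X $$ (mirror n i, j) = 0)"
proof (cases "X \<in> carrier_mat (2 * n) (2 * n)")
  case True
  have "(transpose_mat X * so_form n + so_form n * X) $$ (i, j) = X $$ (mirror n j, i) + X $$ (mirror n i, j)"
    if ij: "i < 2 * n" "j < 2 * n" for i j
  proof -
    have "(transpose_mat X * so_form n) $$ (i, j) = (\<Sum>k = 0..<2 * n. of_bool (k = mirror n j) * X $$ (k, i))"
      by (rule trans[OF times_entry sum.cong[OF refl]]) (use True ij in \<open>auto simp: so_form_entry mirror_swap\<close>)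
    moreover have "(so_form n * X) $$ (i, j) = (\<Sum>k = 0..<2 * n. of_bool (k = mirror n i) * X $$ (k, j))"
      by (rule trans[OF times_entry sum.cong[OF refl]]) (use True ij in \<open>auto simp: so_form_entry\<close>)
    ultimately show ?thesis using True ij by (simp add: sum_of_bool so_form_def)
  qed
  then have "transpose_mat X * so_form n + so_form n * X = 0\<^sub>m (2 * n) (2 * n) \<longleftrightarrow>
      (\<forall>i < 2 * n. \<forall>j < 2 * n. X $$ (mirror n j, i) + X $$ (mirror n i, j) = 0)"
    using True by (auto simp: mat_eq_iff so_form_def)
  then show ?thesis by (simp add: so_even_def True)
qed (simp add: so_even_def)

lemma so_even_carrier: "X \<in> so_even n \<Longrightarrow> X \<in> carrier_mat (2 * n) (2 * n)"
  by (simp add: so_even_iff)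

lemma so_even_entry:
  "X \<in> so_even n \<Longrightarrow> i < 2 * n \<Longrightarrow> j < 2 * n \<Longrightarrow> X $$ (mirror n j, mirror n i) = - X $$ (i, j)"
proof -
  assume "X \<in> so_even n" "i < 2 * n" "j < 2 * n"
  then have "X $$ (mirror n j, mirror n i) + X $$ (mirror n (mirror n i), j) = 0"
    unfolding so_even_iff using mirror_lt by blast
  then show ?thesis using \<open>i < 2 * n\<close> by (simp add: eq_neg_iff_add_eq_0)
qed

lemma so_even_closed:
  shows so_even_zero: "0\<^sub>m (2 * n) (2 * n) \<in> so_even n"
    and so_even_add: "X \<in> so_even n \<Longrightarrow> Y \<in> so_even n \<Longrightarrow> X + Y \<in> so_even n"
    and so_even_smult: "X \<in> so_even n \<Longrightarrow> x \<cdot>\<^sub>m X \<in> so_even n"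
proof -
  show "0\<^sub>m (2 * n) (2 * n) \<in> so_even n" by (simp add: so_even_iff)
  show "X \<in> so_even n \<Longrightarrow> Y \<in> so_even n \<Longrightarrow> X + Y \<in> so_even n"
  proof -
    assume *: "X \<in> so_even n" "Y \<in> so_even n"
    have "(X + Y) $$ (mirror n j, i) + (X + Y) $$ (mirror n i, j) =
      (X $$ (mirror n j, i) + X $$ (mirror n i, j)) + (Y $$ (mirror n j, i) + Y $$ (mirror n i, j))"
      if "i < 2 * n" "j < 2 * n" for i j using that *[THEN so_even_carrier] by simp
    then show ?thesis using * unfolding so_even_iff by simp
  qed
  show "X \<in> so_even n \<Longrightarrow> x \<cdot>\<^sub>m X \<in> so_even n"
  proof -
    assume *: "X \<in> so_even n"
    have "(x \<cdot>\<^sub>m X) $$ (mirror n j, i) + (x \<cdot>\<^sub>m X) $$ (mirror n i, j) = x * (X $$ (mirror n j, i) + X $$ (mirror n i, j))"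
      if "i < 2 * n" "j < 2 * n" for i j using that *[THEN so_even_carrier] by (simp add: distrib_left)
    then show ?thesis using * unfolding so_even_iff by simp
  qed
qed

lemma so_even_times:
  assumes X: "X \<in> so_even n" and Y: "Y \<in> so_even n" and ij: "i < 2 * n" "j < 2 * n"
  shows "(X * Y) $$ (mirror n j, i) = (Y * X) $$ (mirror n i, j)"
proof -
  note c = X[THEN so_even_carrier] Y[THEN so_even_carrier]
  have "(X * Y) $$ (mirror n j, i) = (\<Sum>k = 0..<2 * n. X $$ (mirror n j, k) * Y $$ (k, i))"
    using c ij by (intro times_entry) auto
  also have "\<dots> = (\<Sum>k = 0..<2 * n. Y $$ (mirror n i, mirror n k) * X $$ (mirror n k, j))"
  proof (intro sum.cong refl)
    fix k assume "k \<in> {0..<2 * n}"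
    then have "X $$ (mirror n j, k) = - X $$ (mirror n k, j)" "Y $$ (mirror n i, mirror n k) = - Y $$ (k, i)"
      using so_even_entry[OF X, of "mirror n k" j] so_even_entry[OF Y, of k i] ij by simp_all
    then show "X $$ (mirror n j, k) * Y $$ (k, i) = Y $$ (mirror n i, mirror n k) * X $$ (mirror n k, j)"
      by (simp only: minus_mult_minus mult.commute minus_mult_commute)
  qed
  also have "\<dots> = (\<Sum>k = 0..<2 * n. Y $$ (mirror n i, k) * X $$ (k, j))"
    by (rule sum.reindex_bij_witness[of _ "mirror n" "mirror n"]) auto
  also have "\<dots> = (Y * X) $$ (mirror n i, j)"
    using c ij by (intro times_entry[symmetric]) auto
  finally show ?thesis .
qed

lemma so_even_bracket:
  assumes "X \<in> so_even n" "Y \<in> so_even n"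
  shows "X * Y - Y * X \<in> so_even n"
proof -
  have "(X * Y - Y * X) $$ (mirror n j, i) + (X * Y - Y * X) $$ (mirror n i, j) = 0" if "i < 2 * n" "j < 2 * n" for i j
    using that assms[THEN so_even_carrier] so_even_times[OF assms that] so_even_times[OF assms(2,1) that]
    by (simp del: index_mult_mat(1))
  then show ?thesis unfolding so_even_iff using assms[THEN so_even_carrier] by auto
qed

text \<open>The matrix E_{a,b} - E_{-b,-a} of signed indices, expressed through positions.\<close>

definition F_entry :: "nat \<Rightarrow> nat \<Rightarrow> nat \<Rightarrow> nat \<Rightarrow> nat \<Rightarrow> complex" where
  "F_entry n r s i j = of_bool (i = r) * of_bool (j = s) - of_bool (i = mirror n s) * of_bool (j = mirror n r)"

definition F_mat :: "nat \<Rightarrow> nat \<Rightarrow> nat \<Rightarrow> complex mat" where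
  "F_mat n r s = mat (2 * n) (2 * n) (\<lambda>(i, j). F_entry n r s i j)"

lemma F_mat_carrier [simp]: "F_mat n r s \<in> carrier_mat (2 * n) (2 * n)"
  "dim_row (F_mat n r s) = 2 * n" "dim_col (F_mat n r s) = 2 * n"
  by (auto simp: F_mat_def)

lemma F_mat_entry [simp]: "i < 2 * n \<Longrightarrow> j < 2 * n \<Longrightarrow> F_mat n r s $$ (i, j) = F_entry n r s i j"
  by (simp add: F_mat_def)

lemma F_mat_so_even:
  assumes "r < 2 * n" "s < 2 * n"
  shows "F_mat n r s \<in> so_even n"
  unfolding so_even_iff using assms by (auto simp: F_entry_def mirror_eq_iff mirror_swap)

lemma F_mat_times:
  assumes "r < 2 * n" "s < 2 * n" "i < 2 * n" "j < 2 * n"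
  shows "(F_mat n r s * F_mat n t u) $$ (i, j) =
    of_bool (i = r) * F_entry n t u s j - of_bool (i = mirror n s) * F_entry n t u (mirror n r) j"
proof -
  have "(F_mat n r s * F_mat n t u) $$ (i, j) = (\<Sum>k = 0..<2 * n. F_entry n r s i k * F_entry n t u k j)"
    using assms by (subst times_entry[where N = "2 * n"]) auto
  also have "\<dots> = (\<Sum>k = 0..<2 * n. of_bool (i = r) * (of_bool (k = s) * F_entry n t u k j)
      - of_bool (i = mirror n s) * (of_bool (k = mirror n r) * F_entry n t u k j))"
    by (intro sum.cong refl) (simp add: F_entry_def[of n r s] left_diff_distrib mult.assoc)
  also have "\<dots> = of_bool (i = r) * F_entry n t u s j - of_bool (i = mirror n s) * F_entry n t u (mirror n r) j"
    using assms by (simp only: sum_subtractf sum_distrib_left[symmetric] sum_of_bool mirror_lt)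
  finally show ?thesis .
qed

lemma F_mat_skew:
  assumes "r < 2 * n" "s < 2 * n"
  shows "F_mat n (mirror n s) (mirror n r) = (- 1) \<cdot>\<^sub>m F_mat n r s"
  by (rule eq_matI) (use assms in \<open>auto simp: F_entry_def\<close>)

text \<open>The commutator of two such matrices as a polynomial identity in the indicators. Treating
  them as ring elements avoids a case distinction over all coincidences of indices; equal indicators
  only have to be written alike beforehand.\<close>

lemma bracket_identity:
  fixes ir :: complex
  shows "ir * (st1 * ju - su * jt') - is' * (rt * ju - ru * jt') - (it * (ru * js - su * jr') - iu' * (rt * js - st1 * jr')) =
    st1 * (ir * ju - iu' * jr') - ru * (it * js - is' * jt') + (rt * (iu' * js - is' * ju) - su * (ir * jt' - it * jr'))"
  by (simp add: algebra_simps)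

lemma F_mat_bracket:
  assumes "r < 2 * n" "s < 2 * n" "t < 2 * n" "u < 2 * n"
  shows "F_mat n r s * F_mat n t u - F_mat n t u * F_mat n r s =
    (of_bool (s = t) \<cdot>\<^sub>m F_mat n r u + (- of_bool (r = u)) \<cdot>\<^sub>m F_mat n t s)
    + ((- of_bool (s = mirror n u)) \<cdot>\<^sub>m F_mat n r (mirror n t) + of_bool (r = mirror n t) \<cdot>\<^sub>m F_mat n (mirror n u) s)"
    (is "?A = ?B")
proof (rule eq_matI)
  fix i j assume "i < dim_row ?B" "j < dim_col ?B"
  then have ij: "i < 2 * n" "j < 2 * n" by auto
  have m: "mirror n r = t \<longleftrightarrow> r = mirror n t" "u = mirror n s \<longleftrightarrow> s = mirror n u"
    "mirror n r = mirror n u \<longleftrightarrow> r = u" "mirror n t = mirror n s \<longleftrightarrow> s = t" "mirror n t = r \<longleftrightarrow> r = mirror n t"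
    "u = r \<longleftrightarrow> r = u"
    using assms by (auto simp: mirror_eq_iff mirror_swap)
  have "?A $$ (i, j) = (F_mat n r s * F_mat n t u) $$ (i, j) - (F_mat n t u * F_mat n r s) $$ (i, j)"
    using ij by simp
  also have "\<dots> = (of_bool (s = t) * F_entry n r u i j - of_bool (r = u) * F_entry n t s i j)
    + (of_bool (r = mirror n t) * F_entry n (mirror n u) s i j - of_bool (s = mirror n u) * F_entry n r (mirror n t) i j)"
    unfolding F_mat_times[OF assms(1,2) ij] F_mat_times[OF assms(3,4) ij] F_entry_def
    unfolding m mirror_mirror[OF assms(1)] mirror_mirror[OF assms(2)] mirror_mirror[OF assms(3)] mirror_mirror[OF assms(4)]
    by (rule bracket_identity)
  also have "\<dots> = ?B $$ (i, j)" using ij by simp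
  finally show "?A $$ (i, j) = ?B $$ (i, j)" .
qed auto

lemma F_mat_square:
  assumes "r < 2 * n" "s < 2 * n" "r \<noteq> s" "r \<noteq> mirror n s"
  shows "F_mat n r s * F_mat n r s = 0\<^sub>m (2 * n) (2 * n)"
proof (rule eq_matI)
  fix i j assume "i < dim_row (0\<^sub>m (2 * n) (2 * n) :: complex mat)" "j < dim_col (0\<^sub>m (2 * n) (2 * n) :: complex mat)"
  then have ij: "i < 2 * n" "j < 2 * n" by auto
  have "mirror n r \<noteq> s" "s \<noteq> mirror n s" "r \<noteq> mirror n r" "mirror n r \<noteq> mirror n s"
    using assms mirror_neq[of r n] mirror_neq[of s n] by (auto simp: mirror_eq_iff mirror_swap)
  then show "(F_mat n r s * F_mat n r s) $$ (i, j) = 0\<^sub>m (2 * n) (2 * n) $$ (i, j)"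
    unfolding F_mat_times[OF assms(1,2) ij] using ij assms by (auto simp: F_entry_def)
qed auto

text \<open>With F F = 0 the double commutator of Y is -2 F Y F, and F annihilates this from both
  sides.\<close>

lemma square_zero_ad3:
  assumes F: "F \<in> carrier_mat N N" and Y: "Y \<in> carrier_mat N N" and sq: "F * F = 0\<^sub>m N N"
  defines "ad \<equiv> (\<lambda>Y. F * Y - Y * F)"
  shows "ad (ad (ad Y)) = (0\<^sub>m N N :: complex mat)"
proof -
  define P where "P = F * Y * F"
  have FY: "F * Y \<in> carrier_mat N N" "Y * F \<in> carrier_mat N N" and P: "P \<in> carrier_mat N N"
    using F Y by (auto simp: P_def)
  have z: "F * (F * Y) = 0\<^sub>m N N" "Y * F * F = 0\<^sub>m N N" "F * P = 0\<^sub>m N N" "P * F = 0\<^sub>m N N"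
  proof -
    show 1: "F * (F * Y) = 0\<^sub>m N N" using F Y sq by (simp flip: assoc_mult_mat[OF F F Y])
    show "Y * F * F = 0\<^sub>m N N" using F Y sq by (simp add: assoc_mult_mat[OF Y F F])
    show "F * P = 0\<^sub>m N N" unfolding P_def using F by (simp flip: assoc_mult_mat[OF F FY(1) F] add: 1)
    show "P * F = 0\<^sub>m N N" unfolding P_def by (simp add: assoc_mult_mat[OF FY(1) F F] sq right_mult_zero_mat[OF FY(1)])
  qed
  have "ad (ad Y) = (0\<^sub>m N N - P) - (P - 0\<^sub>m N N)"
    unfolding ad_def mult_minus_distrib_mat[OF F FY] minus_mult_distrib_mat[OF FY F] z P_def
    by (subst assoc_mult_mat[OF F Y F, symmetric]) simp
  also have "\<dots> = - P + - P" using P by (intro eq_matI) auto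
  finally have ad2: "ad (ad Y) = - P + - P" .
  have z': "F * (- P) = 0\<^sub>m N N" "(- P) * F = 0\<^sub>m N N" using F P z by auto
  have P': "- P \<in> carrier_mat N N" using P by simp
  have "F * (- P + - P) = 0\<^sub>m N N" "(- P + - P) * F = 0\<^sub>m N N"
    unfolding mult_add_distrib_mat[OF F P' P'] add_mult_distrib_mat[OF P' P' F] z' by simp_all
  moreover have "ad (ad (ad Y)) = F * ad (ad Y) - ad (ad Y) * F" by (simp only: ad_def)
  ultimately show ?thesis unfolding ad2 by simp
qed

section \<open>Weights and root vectors\<close>

lemma cartan_so_even: "H \<in> cartan n \<Longrightarrow> H \<in> so_even n"
  by (simp add: cartan_def)

lemma cartan_bracket_entry:
  assumes H: "H \<in> cartan n" and X: "X \<in> carrier_mat (2 * n) (2 * n)" and rs: "r < 2 * n" "s < 2 * n"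
  shows "(H * X - X * H) $$ (r, s) = (H $$ (r, r) - H $$ (s, s)) * X $$ (r, s)"
proof -
  have c: "H \<in> carrier_mat (2 * n) (2 * n)" using H by (simp add: cartan_def so_even_carrier)
  have d: "H $$ (i, j) = 0" if "i < 2 * n" "j < 2 * n" "i \<noteq> j" for i j
    using that H c by (auto simp: cartan_def diagonal_mat_def)
  have "(H * X) $$ (r, s) = (\<Sum>k = 0..<2 * n. of_bool (k = r) * (H $$ (r, k) * X $$ (k, s)))"
    by (rule trans[OF times_entry sum.cong[OF refl]]) (use c X rs d in auto)
  moreover have "(X * H) $$ (r, s) = (\<Sum>k = 0..<2 * n. of_bool (k = s) * (X $$ (r, k) * H $$ (k, s)))"
    by (rule trans[OF times_entry sum.cong[OF refl]]) (use c X rs d in auto)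
  ultimately have "(H * X) $$ (r, s) = H $$ (r, r) * X $$ (r, s)" "(X * H) $$ (r, s) = X $$ (r, s) * H $$ (s, s)"
    using rs by (simp_all only: sum_of_bool)
  then show ?thesis using c X rs by (simp add: algebra_simps del: index_mult_mat(1))
qed

lemma F_mat_diag:
  assumes "ix n c"
  shows "F_mat n (pos n c) (pos n c) \<in> cartan n"
    and "ix n a \<Longrightarrow> F_mat n (pos n c) (pos n c) $$ (pos n a, pos n a) = of_bool (a = c) - of_bool (a = - c)"
proof -
  show "F_mat n (pos n c) (pos n c) \<in> cartan n"
    using F_mat_so_even[OF pos_lt[OF assms] pos_lt[OF assms]]
    by (auto simp: cartan_def diagonal_mat_def F_entry_def)
  show "F_mat n (pos n c) (pos n c) $$ (pos n a, pos n a) = of_bool (a = c) - of_bool (a = - c)" if "ix n a"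
    using that assms pos_inj[of n a "- c"] by (simp add: pos_lt F_entry_def pos_inj flip: pos_minus)
qed

lemma cartan_mirror:
  "H \<in> cartan n \<Longrightarrow> ix n a \<Longrightarrow> H $$ (pos n (- a), pos n (- a)) = - H $$ (pos n a, pos n a)"
  by (simp add: pos_minus so_even_entry cartan_so_even pos_lt)

lemma F_mat_weight:
  assumes H: "H \<in> cartan n" and cd: "ix n c" "ix n d"
  shows "H * F_mat n (pos n c) (pos n d) - F_mat n (pos n c) (pos n d) * H =
    (H $$ (pos n c, pos n c) - H $$ (pos n d, pos n d)) \<cdot>\<^sub>m F_mat n (pos n c) (pos n d)"
    (is "?A = ?B")
proof (rule eq_matI)
  fix r s assume "r < dim_row ?B" "s < dim_col ?B"
  then have rs: "r < 2 * n" "s < 2 * n" by auto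
  have "(H $$ (r, r) - H $$ (s, s)) * F_entry n (pos n c) (pos n d) r s =
      (H $$ (pos n c, pos n c) - H $$ (pos n d, pos n d)) * F_entry n (pos n c) (pos n d) r s"
    using cartan_mirror[OF H cd(1)] cartan_mirror[OF H cd(2)]
    by (auto simp: F_entry_def algebra_simps simp flip: pos_minus[OF cd(1)] pos_minus[OF cd(2)])
  then show "?A $$ (r, s) = ?B $$ (r, s)"
    using rs cartan_bracket_entry[OF H F_mat_carrier(1) rs, of "pos n c" "pos n d"] by simp
qed (use cartan_so_even[OF H, THEN so_even_carrier] in auto)

lemma F_mat_nonzero:
  assumes "ix n c" "ix n d" "c \<noteq> - d"
  shows "F_entry n (pos n c) (pos n d) (pos n c) (pos n d) = 1"
  using assms pos_inj[of n c "- d"] by (simp add: F_entry_def flip: pos_minus)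

text \<open>Root spaces are one-dimensional. Testing the weight on the two Cartan matrices belonging
  to \<open>c\<close> and \<open>d\<close> leaves only the entries at \<open>(c, d)\<close> and
  \<open>(-d, -c)\<close>, and these are negatives of each other in \<open>so_even\<close>.\<close>

lemma weight_vector:
  assumes X: "X \<in> so_even n" "X \<noteq> 0\<^sub>m (2 * n) (2 * n)" and cd: "ix n c" "ix n d" "c \<noteq> d" "c \<noteq> - d"
    and H: "\<And>H. H \<in> cartan n \<Longrightarrow> H * X - X * H = (H $$ (pos n c, pos n c) - H $$ (pos n d, pos n d)) \<cdot>\<^sub>m X"
  obtains x where "x \<noteq> 0" "X = x \<cdot>\<^sub>m F_mat n (pos n c) (pos n d)"
proof -
  note Xc = so_even_carrier[OF X(1)]
  have supp: "a = c \<and> b = d \<or> a = - d \<and> b = - c"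
    if ab: "ix n a" "ix n b" "X $$ (pos n a, pos n b) \<noteq> 0" for a b
  proof -
    have *: "H $$ (pos n a, pos n a) - H $$ (pos n b, pos n b) = H $$ (pos n c, pos n c) - H $$ (pos n d, pos n d)"
      if h: "H \<in> cartan n" for H
    proof -
      have "((H $$ (pos n c, pos n c) - H $$ (pos n d, pos n d)) \<cdot>\<^sub>m X) $$ (pos n a, pos n b) =
          (H $$ (pos n a, pos n a) - H $$ (pos n b, pos n b)) * X $$ (pos n a, pos n b)"
        using cartan_bracket_entry[OF h Xc pos_lt[OF ab(1)] pos_lt[OF ab(2)]] unfolding H[OF h] .
      then show ?thesis using ab Xc pos_lt[OF ab(1)] pos_lt[OF ab(2)] by simp
    qed
    have n0: "c \<noteq> - c" "d \<noteq> - d" "d \<noteq> c" "d \<noteq> - c" using cd by (auto simp: ix_def)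
    have "of_bool (a = c) - of_bool (a = - c) - (of_bool (b = c) - of_bool (b = - c)) =
        (of_bool (c = c) - of_bool (c = - c) - (of_bool (d = c) - of_bool (d = - c)) :: complex)"
      using *[OF F_mat_diag(1)[OF cd(1)]]
      unfolding F_mat_diag(2)[OF cd(1) ab(1)] F_mat_diag(2)[OF cd(1) ab(2)] F_mat_diag(2)[OF cd(1) cd(1)] F_mat_diag(2)[OF cd(1) cd(2)] .
    \<comment> \<open>The right side of the preceding equation equals one, since \<open>d\<close>
      differs from \<open>c\<close> and from \<open>-c\<close>.\<close>
    then have 1: "a = c \<or> b = - c" using n0 by (cases "a = c"; cases "b = - c"; cases "a = - c"; cases "b = c") simp_all
    have "of_bool (a = d) - of_bool (a = - d) - (of_bool (b = d) - of_bool (b = - d)) =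
        (of_bool (c = d) - of_bool (c = - d) - (of_bool (d = d) - of_bool (d = - d)) :: complex)"
      using *[OF F_mat_diag(1)[OF cd(2)]]
      unfolding F_mat_diag(2)[OF cd(2) ab(1)] F_mat_diag(2)[OF cd(2) ab(2)] F_mat_diag(2)[OF cd(2) cd(1)] F_mat_diag(2)[OF cd(2) cd(2)] .
    then have 2: "b = d \<or> a = - d" using n0 cd(3,4) by (cases "b = d"; cases "a = - d"; cases "b = - d"; cases "a = d") simp_all
    show ?thesis using 1 2 cd by auto
  qed
  let ?x = "X $$ (pos n c, pos n d)"
  have eq: "X = ?x \<cdot>\<^sub>m F_mat n (pos n c) (pos n d)" (is "_ = ?B")
  proof (rule eq_matI)
    fix r s assume "r < dim_row ?B" "s < dim_col ?B"
    then have rs: "r < 2 * n" "s < 2 * n" by auto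
    obtain a where a: "ix n a" "r = pos n a" by (rule pos_surj[OF rs(1)])
    obtain b where b: "ix n b" "s = pos n b" by (rule pos_surj[OF rs(2)])
    note ab = a b
    have F: "F_entry n (pos n c) (pos n d) r s = of_bool (a = c \<and> b = d) - of_bool (a = - d \<and> b = - c)"
      using ab cd pos_inj[of n a "- d"] pos_inj[of n b "- c"] by (simp add: F_entry_def pos_inj flip: pos_minus)
    have "X $$ (r, s) = ?x * F_entry n (pos n c) (pos n d) r s"
    proof (cases "a = - d \<and> b = - c")
      case True
      then have "X $$ (r, s) = - ?x"
        using so_even_entry[OF X(1) pos_lt[OF cd(1)] pos_lt[OF cd(2)]] ab cd by (simp only: pos_minus)
      moreover have "\<not> (a = c \<and> b = d)" using True cd by blast
      ultimately show ?thesis using True unfolding F by simp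
    next
      case False
      then have F': "F_entry n (pos n c) (pos n d) r s = of_bool (a = c \<and> b = d)" unfolding F by simp
      have "a = c \<and> b = d \<or> X $$ (r, s) = 0" using False supp ab by blast
      then show ?thesis
      proof
        assume "a = c \<and> b = d"
        then show ?thesis unfolding F' by (simp add: ab)
      next
        assume *: "X $$ (r, s) = 0"
        show ?thesis
        proof (cases "a = c \<and> b = d")
          case True
          then have "?x = 0" using * ab by simp
          then show ?thesis using * by simp
        next
          case False
          then show ?thesis unfolding F' * by simp
        qed
      qed
    qed
    then show "X $$ (r, s) = ?B $$ (r, s)" using rs by simp
  qed (use Xc in auto)
  moreover have "?x \<noteq> 0"
  proof
    assume "?x = 0"
    then have "X = 0 \<cdot>\<^sub>m F_mat n (pos n c) (pos n d)" using eq by simp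
    moreover have "0 \<cdot>\<^sub>m F_mat n (pos n c) (pos n d) = 0\<^sub>m (2 * n) (2 * n)" by (intro eq_matI) auto
    ultimately show False using X(2) by simp
  qed
  ultimately show ?thesis using that by blast
qed

text \<open>Row and column of the positive root vector in signed indices; exchanging them gives the
  negative root vector.\<close>

fun high_ix :: "root \<Rightarrow> int" where
  "high_ix (Minus i j) = int i"
| "high_ix (Plus i j) = int i"

fun low_ix :: "root \<Rightarrow> int" where
  "low_ix (Minus i j) = int j"
| "low_ix (Plus i j) = - int j"

lemma set_positive_roots:
  "\<alpha> \<in> set (positive_roots n) \<longleftrightarrow> (\<exists>i j. 1 \<le> i \<and> i < j \<and> j \<le> n \<and> (\<alpha> = Minus i j \<or> \<alpha> = Plus i j))"
  by (fastforce simp: positive_roots_def)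

lemma root_ix:
  assumes "\<alpha> \<in> set (positive_roots n)"
  shows "ix n (high_ix \<alpha>)" "ix n (low_ix \<alpha>)" "low_ix \<alpha> \<noteq> high_ix \<alpha>" "low_ix \<alpha> \<noteq> - high_ix \<alpha>"
  using assms by (auto simp: set_positive_roots)

lemma root_weight_eq:
  assumes "\<alpha> \<in> set (positive_roots n)" "H \<in> cartan n"
  shows "root_weight \<alpha> H = H $$ (pos n (high_ix \<alpha>), pos n (high_ix \<alpha>)) - H $$ (pos n (low_ix \<alpha>), pos n (low_ix \<alpha>))"
proof -
  obtain i j where ij: "1 \<le> i" "i < j" "j \<le> n" "\<alpha> = Minus i j \<or> \<alpha> = Plus i j"
    using assms(1) by (auto simp: set_positive_roots)
  then show ?thesis
    using cartan_mirror[OF assms(2), of "int j"] by (auto simp: epsilon_def pos_of_nat(1))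
qed

lemma root_vector_positive:
  assumes "\<alpha> \<in> set (positive_roots n)"
  shows "root_vector n (root_weight \<alpha>) (F_mat n (pos n (high_ix \<alpha>)) (pos n (low_ix \<alpha>)))"
proof -
  note ix = root_ix[OF assms]
  have "F_mat n (pos n (high_ix \<alpha>)) (pos n (low_ix \<alpha>)) \<noteq> 0\<^sub>m (2 * n) (2 * n)"
  proof
    assume "F_mat n (pos n (high_ix \<alpha>)) (pos n (low_ix \<alpha>)) = 0\<^sub>m (2 * n) (2 * n)"
    moreover have "F_mat n (pos n (high_ix \<alpha>)) (pos n (low_ix \<alpha>)) $$ (pos n (high_ix \<alpha>), pos n (low_ix \<alpha>)) = 1"
      using ix F_mat_nonzero[OF ix(1,2)] by (auto simp: pos_lt)
    ultimately show False using ix by (simp add: pos_lt)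
  qed
  then show ?thesis
    using ix F_mat_weight[of _ n "high_ix \<alpha>" "low_ix \<alpha>"] root_weight_eq[OF assms]
    by (simp add: root_vector_def F_mat_so_even pos_lt)
qed

lemma root_vector_negative:
  assumes "\<alpha> \<in> set (positive_roots n)" "root_vector n (\<lambda>H. - root_weight \<alpha> H) X"
  obtains x where "x \<noteq> 0" "X = x \<cdot>\<^sub>m F_mat n (pos n (low_ix \<alpha>)) (pos n (high_ix \<alpha>))"
proof (rule weight_vector[OF _ _ root_ix(2)[OF assms(1)] root_ix(1)[OF assms(1)] root_ix(3)[OF assms(1)] root_ix(4)[OF assms(1)]])
  show "X \<in> so_even n" "X \<noteq> 0\<^sub>m (2 * n) (2 * n)" using assms(2) by (simp_all add: root_vector_def)
  show "H * X - X * H = (H $$ (pos n (low_ix \<alpha>), pos n (low_ix \<alpha>)) - H $$ (pos n (high_ix \<alpha>), pos n (high_ix \<alpha>))) \<cdot>\<^sub>m X"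
    if "H \<in> cartan n" for H
    using assms(2) that root_weight_eq[OF assms(1) that] by (simp add: root_vector_def)
qed (rule that)

lemma dominant_weight_domw:
  assumes "2 \<le> n"
  shows "dominant n k (\<lambda>i. dominant_weight n k (F_mat n (pos n (int i)) (pos n (int i))))"
proof -
  define \<omega> where "\<omega> l i = fundamental_weight n l (F_mat n (pos n (int i)) (pos n (int i)))" for l i
  have eps: "epsilon j (F_mat n (pos n (int i)) (pos n (int i))) = of_bool (j = i)" if "j \<in> {1..n}" "i \<in> {1..n}" for i j
    using that F_mat_diag(2)[of n "int i" "int j"] by (simp add: epsilon_def pos_of_nat)
  have sums: "(\<Sum>j = 1..l. epsilon j (F_mat n (pos n (int i)) (pos n (int i)))) = of_bool (i \<le> l)"
    if "l \<le> n" "i \<in> {1..n}" for l i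
  proof -
    have "(\<Sum>j = 1..l. epsilon j (F_mat n (pos n (int i)) (pos n (int i)))) = (\<Sum>j = 1..l. if j = i then 1 else 0)"
      using that by (intro sum.cong) (auto simp: eps)
    then show ?thesis using that by simp
  qed
  have \<omega>: "\<omega> l i = (if l + 2 \<le> n then of_bool (i \<le> l)
      else if l + 1 = n then (of_bool (i \<le> n - 1) - of_bool (i = n)) / 2 else 1 / 2)"
    if "l \<in> {1..n}" "i \<in> {1..n}" for l i
    using that assms by (auto simp: \<omega>_def fundamental_weight_def sums eps)
  have diff: "\<omega> l i - \<omega> l (Suc i) = of_bool (l = i)" if "l \<in> {1..n}" "1 \<le> i" "i < n" for l i
    using that assms by (auto simp: \<omega> not_le)
  have last: "\<omega> l (n - 1) + \<omega> l n = of_bool (l = n)" if "l \<in> {1..n}" for l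
    using that assms by (auto simp: \<omega>)
  have sum: "(\<Sum>l = 1..n. of_nat (k l) * of_bool (l = i)) = (of_nat (k i) :: complex)" if "i \<in> {1..n}" for i
  proof -
    have "(\<Sum>l = 1..n. of_nat (k l) * of_bool (l = i)) = (\<Sum>l = 1..n. if l = i then of_nat (k l) else (0 :: complex))"
      by (intro sum.cong) auto
    then show ?thesis using that by simp
  qed
  have lam: "dominant_weight n k (F_mat n (pos n (int i)) (pos n (int i))) = (\<Sum>l = 1..n. of_nat (k l) * \<omega> l i)" for i
    by (simp add: dominant_weight_def \<omega>_def)
  show ?thesis
    unfolding dominant_def lam
  proof (intro conjI allI impI)
    fix i assume i: "1 \<le> i \<and> i < n"
    have "(\<Sum>l = 1..n. of_nat (k l) * \<omega> l i) - (\<Sum>l = 1..n. of_nat (k l) * \<omega> l (Suc i)) =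
        (\<Sum>l = 1..n. of_nat (k l) * of_bool (l = i))"
      unfolding sum_subtractf[symmetric] right_diff_distrib[symmetric] using i by (intro sum.cong) (auto simp: diff)
    then show "(\<Sum>l = 1..n. of_nat (k l) * \<omega> l i) - (\<Sum>l = 1..n. of_nat (k l) * \<omega> l (Suc i)) = of_nat (k i)"
      using sum[of i] i by simp
  next
    have "(\<Sum>l = 1..n. of_nat (k l) * \<omega> l (n - 1)) + (\<Sum>l = 1..n. of_nat (k l) * \<omega> l n) =
        (\<Sum>l = 1..n. of_nat (k l) * of_bool (l = n))"
      unfolding sum.distrib[symmetric] distrib_left[symmetric] by (intro sum.cong) (auto simp: last)
    then show "(\<Sum>l = 1..n. of_nat (k l) * \<omega> l (n - 1)) + (\<Sum>l = 1..n. of_nat (k l) * \<omega> l n) = of_nat (k n)"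
      using sum[of n] assms by simp
  qed
qed

section \<open>Essential signatures\<close>

lemma positive_roots_Suc:
  "positive_roots (Suc m) = positive_roots m @ map (\<lambda>i. Minus i (Suc m)) [1..<Suc m] @ map (\<lambda>i. Plus i (Suc m)) [1..<Suc m]"
proof (cases "m = 0")
  case False
  then have "[2..<Suc m + 1] = [2..<m + 1] @ [Suc m]" by (simp flip: Suc_eq_plus1)
  then show ?thesis by (simp add: positive_roots_def)
qed (simp add: positive_roots_def flip: Suc_eq_plus1)

lemma exponent_blocks_Suc:
  "1 \<le> m \<Longrightarrow> exponent_blocks (Suc m) p =
    map (\<lambda>i. p (Plus i (Suc m))) [1..<Suc m] # map (\<lambda>i. p (Minus i (Suc m))) [1..<Suc m] # exponent_blocks m p"
  by (simp add: exponent_blocks_def flip: Suc_eq_plus1)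

lemma map_lex_iff:
  "(map a xs, map b xs) \<in> lex r \<longleftrightarrow> (\<exists>i < length xs. (a (xs ! i), b (xs ! i)) \<in> r \<and> (\<forall>j < i. a (xs ! j) = b (xs ! j)))"
proof (induction xs)
  case (Cons x xs)
  show ?case
    unfolding list.map Cons_in_lex Cons.IH length_Cons Ex_less_Suc2 All_less_Suc2 by auto
qed simp

lemma map_deglex_iff:
  "(map a [1..<M], map b [1..<M]) \<in> deglex \<longleftrightarrow> deglex_lt M a b"
proof -
  have "(\<exists>i<length [1..<M]. (a ([1..<M] ! i), b ([1..<M] ! i)) \<in> {(a, b). a < b} \<and> (\<forall>j<i. a ([1..<M] ! j) = b ([1..<M] ! j)))
      \<longleftrightarrow> (\<exists>i\<in>{1..<M}. a i < b i \<and> (\<forall>j\<in>{1..<i}. a j = b j))" (is "?l \<longleftrightarrow> ?r")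
  proof
    assume ?l
    then obtain i where i: "i < M - 1" "a (1 + i) < b (1 + i)" "\<And>j. j < i \<Longrightarrow> a (1 + j) = b (1 + j)"
      by (auto simp: nth_upt)
    have "a j = b j" if "j \<in> {1..<1 + i}" for j using i(3)[of "j - 1"] that by auto
    then show ?r using i by (intro bexI[of _ "1 + i"]) auto
  next
    assume ?r
    then obtain i where i: "i \<in> {1..<M}" "a i < b i" "\<And>j. j \<in> {1..<i} \<Longrightarrow> a j = b j" by blast
    then show ?l by (intro exI[of _ "i - 1"]) (auto simp: nth_upt)
  qed
  then show ?thesis
    by (simp only: deglex_def map_lex_iff deglex_lt_def mem_Collect_eq prod.case interv_sum_list_conv_sum_set_nat set_upt)
qed

lemma map_eqr_iff: "map a [1..<M] = map b [1..<M] \<longleftrightarrow> agree M a b"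
  by (auto simp: agree_def)

abbreviation (input) plus_exp :: "exponents \<Rightarrow> exps" where "plus_exp p j i \<equiv> p (Plus i j)"
abbreviation (input) minus_exp :: "exponents \<Rightarrow> exps" where "minus_exp p j i \<equiv> p (Minus i j)"

lemma exponents_less_iff:
  "exponents_less n q p \<longleftrightarrow> exps_lt n (plus_exp q) (minus_exp q) (plus_exp p) (minus_exp p)"
proof (induction n)
  case 0
  then show ?case by (simp add: exponents_less_def exponent_blocks_def)
next
  case (Suc m)
  show ?case
  proof (cases "m = 0")
    case True
    then show ?thesis by (simp add: exponents_less_def exponent_blocks_def block_lt_def deglex_lt_def flip: Suc_eq_plus1)
  next
    case False
    then have m: "1 \<le> m" by simp
    have len: "length (exponent_blocks m q) = length (exponent_blocks m p)"
      by (simp add: exponent_blocks_def length_concat comp_def)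
    show ?thesis
      using Suc unfolding exponents_less_def exponent_blocks_Suc[OF m] Cons_in_lex map_deglex_iff list.inject map_eqr_iff
      by (auto simp: len block_lt_def)
  qed
qed

lemma foldr_scale:
  assumes "vector_space scale" "\<And>\<alpha> w c. \<alpha> \<in> set xs \<Longrightarrow> T \<alpha> (scale c w) = scale c (T \<alpha> w)"
  shows "foldr (\<lambda>\<alpha> w. scale (y \<alpha>) (T \<alpha> w)) xs u = scale (\<Prod>\<alpha>\<leftarrow>xs. y \<alpha>) (foldr T xs u)"
proof -
  interpret vector_space scale by (rule assms(1))
  show ?thesis using assms(2) by (induction xs) auto
qed

section \<open>Passage from representations to modules of operators\<close>

locale so_representation = vector_space scale
  for scale :: "complex \<Rightarrow> 'v::ab_group_add \<Rightarrow> 'v" (infixr "*s" 75) +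
  fixes n :: nat and \<rho> :: "complex mat \<Rightarrow> 'v \<Rightarrow> 'v"
  assumes rep: "lie_representation (so_even n) scale \<rho>"
begin

lemma rep_linear: "X \<in> so_even n \<Longrightarrow> Vector_Spaces.linear scale scale (\<rho> X)"
  and rep_add: "X \<in> so_even n \<Longrightarrow> Y \<in> so_even n \<Longrightarrow> \<rho> (X + Y) w = \<rho> X w + \<rho> Y w"
  and rep_scale: "X \<in> so_even n \<Longrightarrow> \<rho> (x \<cdot>\<^sub>m X) w = x *s \<rho> X w"
  and rep_bracket: "X \<in> so_even n \<Longrightarrow> Y \<in> so_even n \<Longrightarrow> \<rho> (X * Y - Y * X) w = \<rho> X (\<rho> Y w) - \<rho> Y (\<rho> X w)"
  using rep unfolding lie_representation_def by blast+

lemma rep_vec: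
  assumes "X \<in> so_even n"
  shows rep_vec_add: "\<rho> X (u + w) = \<rho> X u + \<rho> X w" and rep_vec_scale: "\<rho> X (c *s w) = c *s \<rho> X w"
    and rep_vec_zero: "\<rho> X 0 = 0"
proof -
  show "\<rho> X (u + w) = \<rho> X u + \<rho> X w" and sc: "\<rho> X (c *s w) = c *s \<rho> X w" for u w c
    using rep_linear[OF assms] by (auto simp: Vector_Spaces.linear_iff)
  show "\<rho> X 0 = 0" using sc[of 0 0] by simp
qed

lemma rep_zero: "\<rho> (0\<^sub>m (2 * n) (2 * n)) w = 0"
proof -
  have "0 \<cdot>\<^sub>m (0\<^sub>m (2 * n) (2 * n)) = (0\<^sub>m (2 * n) (2 * n) :: complex mat)" by (intro eq_matI) auto
  then show ?thesis using rep_scale[OF so_even_zero, of 0 w] by simp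
qed

definition Lop :: "int \<Rightarrow> int \<Rightarrow> 'v \<Rightarrow> 'v" where
  "Lop a b = \<rho> (F_mat n (pos n a) (pos n b))"

sublocale so_module scale n Lop
proof unfold_locales
  fix a b assume ab: "ix n a" "ix n b"
  then have F: "F_mat n (pos n a) (pos n b) \<in> so_even n" by (simp add: F_mat_so_even pos_lt)
  show "Lop a b (u + w) = Lop a b u + Lop a b w" "Lop a b (x *s u) = x *s Lop a b u" for u w x
    unfolding Lop_def using F by (simp_all add: rep_vec_add rep_vec_scale)
  show "Lop (- b) (- a) u = - Lop a b u" for u
    unfolding Lop_def pos_minus[OF ab(1)] pos_minus[OF ab(2)] F_mat_skew[OF pos_lt[OF ab(1)] pos_lt[OF ab(2)]] rep_scale[OF F]
    by simp
  fix c d assume cd: "ix n c" "ix n d"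
  note lt = pos_lt[OF ab(1)] pos_lt[OF ab(2)] pos_lt[OF cd(1)] pos_lt[OF cd(2)]
  have F': "F_mat n (pos n c) (pos n d) \<in> so_even n" by (simp add: F_mat_so_even lt)
  note neg = pos_minus[OF cd(1), symmetric] pos_minus[OF cd(2), symmetric]
  have eqs: "pos n b = pos n c \<longleftrightarrow> b = c" "pos n a = pos n d \<longleftrightarrow> a = d"
    "pos n b = pos n (- d) \<longleftrightarrow> b = - d" "pos n a = pos n (- c) \<longleftrightarrow> a = - c"
    using ab cd by (simp_all add: pos_inj)
  have so: "F_mat n (pos n x) (pos n y) \<in> so_even n" if "ix n x" "ix n y" for x y
    using that by (simp add: F_mat_so_even pos_lt)
  have ob: "of_bool P *s x = (if P then x else 0)" "(- of_bool P) *s x = - (if P then x else 0)" for P x by auto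
  have eq: "Lop a b (Lop c d u) - Lop c d (Lop a b u) =
    (of_bool (b = c) *s Lop a d u + (- of_bool (a = d)) *s Lop c b u)
    + ((- of_bool (b = - d)) *s Lop a (- c) u + of_bool (a = - c) *s Lop (- d) b u)" for u
    unfolding Lop_def rep_bracket[OF F F', symmetric] F_mat_bracket[OF lt] neg eqs
    using ab cd by (simp add: rep_add rep_scale so so_even_add so_even_smult)
  show "Lop a b (Lop c d u) = Lop c d (Lop a b u)
        + ((if b = c then Lop a d u else 0) - (if a = d then Lop c b u else 0)
        - (if b = - d then Lop a (- c) u else 0) + (if a = - c then Lop (- d) b u else 0))" for u
    using eq[of u] unfolding ob diff_eq_eq by (simp add: algebra_simps split del: if_split)
qed

text \<open>The matrices \<open>F_mat\<close> span the Lie algebra: the sum of all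
  \<open>F_mat n r s\<close> weighted by the entries of \<open>Y\<close> is twice \<open>Y\<close>,
  since a position and its mirror image contribute equally; hence the factor 1/2. The partial sums
  \<open>part A\<close> allow an induction over finite sets.\<close>

lemma rep_in_stable:
  assumes W: "stable n W" and Y: "Y \<in> so_even n" and w: "w \<in> W"
  shows "\<rho> Y w \<in> W"
proof -
  note Yc = so_even_carrier[OF Y]
  have sub: "subspace W" using W by (simp add: stable_def)
  define part where "part A = mat (2 * n) (2 * n) (\<lambda>(i, j). \<Sum>q\<in>A. Y $$ q / 2 * F_entry n (fst q) (snd q) i j)" for A
  have "part A \<in> so_even n \<and> \<rho> (part A) w \<in> W" if "finite A" "A \<subseteq> {0..<2 * n} \<times> {0..<2 * n}" for A
    using that
  proof (induction A rule: finite_induct)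
    case empty
    have "part {} = 0\<^sub>m (2 * n) (2 * n)" unfolding part_def by (intro eq_matI) auto
    then show ?case using sub by (simp add: so_even_zero rep_zero subspace_0)
  next
    case (insert q A)
    obtain r s where q: "q = (r, s)" by (cases q)
    have rs: "r < 2 * n" "s < 2 * n" using insert q by auto
    obtain a b where ab: "ix n a" "r = pos n a" "ix n b" "s = pos n b"
      by (rule pos_surj[OF rs(1)], rule pos_surj[OF rs(2)]) blast
    have F: "F_mat n r s \<in> so_even n" using rs by (rule F_mat_so_even)
    have "part (insert q A) = (Y $$ q / 2) \<cdot>\<^sub>m F_mat n r s + part A"
      unfolding part_def using insert by (intro eq_matI) (auto simp: q)
    moreover have "\<rho> (F_mat n r s) w \<in> W" using W w ab by (auto simp: stable_def Lop_def)
    ultimately show ?case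
      using insert F sub by (simp add: so_even_add so_even_smult rep_add rep_scale subspace_add subspace_scale)
  qed
  from this[of "{0..<2 * n} \<times> {0..<2 * n}"] have "\<rho> (part ({0..<2 * n} \<times> {0..<2 * n})) w \<in> W" by simp
  moreover have "part ({0..<2 * n} \<times> {0..<2 * n}) = Y"
  proof (rule eq_matI)
    fix i j assume "i < dim_row Y" "j < dim_col Y"
    then have ij: "i < 2 * n" "j < 2 * n" using Yc by auto
    have "part ({0..<2 * n} \<times> {0..<2 * n}) $$ (i, j) = (\<Sum>r = 0..<2 * n. \<Sum>s = 0..<2 * n. Y $$ (r, s) / 2 * F_entry n r s i j)"
      using ij unfolding part_def by (simp add: sum.cartesian_product case_prod_unfold)
    also have "\<dots> = (\<Sum>r = 0..<2 * n. of_bool (r = i) * (\<Sum>s = 0..<2 * n. of_bool (s = j) * (Y $$ (r, s) / 2))) -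
        (\<Sum>r = 0..<2 * n. of_bool (r = mirror n j) * (\<Sum>s = 0..<2 * n. of_bool (s = mirror n i) * (Y $$ (r, s) / 2)))"
      unfolding sum_distrib_left sum_subtractf[symmetric]
    proof (intro sum.cong refl)
      fix r s assume rs: "r \<in> {0..<2 * n}" "s \<in> {0..<2 * n}"
      have "i = mirror n s \<longleftrightarrow> s = mirror n i" "j = mirror n r \<longleftrightarrow> r = mirror n j" "i = r \<longleftrightarrow> r = i" "j = s \<longleftrightarrow> s = j"
        using rs ij mirror_swap[of s n i] mirror_swap[of r n j] by auto
      then show "Y $$ (r, s) / 2 * F_entry n r s i j = of_bool (r = i) * (of_bool (s = j) * (Y $$ (r, s) / 2)) -
          of_bool (r = mirror n j) * (of_bool (s = mirror n i) * (Y $$ (r, s) / 2))"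
        by (simp only: F_entry_def) (simp only: algebra_simps)
    qed
    also have "\<dots> = Y $$ (i, j) / 2 - Y $$ (mirror n j, mirror n i) / 2"
      using ij by (simp only: sum_of_bool mirror_lt)
    also have "\<dots> = Y $$ (i, j)" using so_even_entry[OF Y ij] by simp
    finally show "part ({0..<2 * n} \<times> {0..<2 * n}) $$ (i, j) = Y $$ (i, j)" .
  qed (use Yc in \<open>auto simp: part_def\<close>)
  ultimately show ?thesis by simp
qed

section \<open>Local nilpotency of root vectors\<close>

definition nilset :: "('v \<Rightarrow> 'v) \<Rightarrow> 'v set" where
  "nilset f = {w. \<exists>N. (f ^^ N) w = 0}"

lemma nilset_add:
  assumes f: "\<And>x y. f (x + y) = f x + f y" "f 0 = 0" and "x \<in> nilset f" "y \<in> nilset f"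
  shows "x + y \<in> nilset f"
proof -
  have zero: "(f ^^ N) 0 = 0" for N by (induction N) (auto simp: f)
  have add: "(f ^^ N) (x + y) = (f ^^ N) x + (f ^^ N) y" for N x y by (induction N) (auto simp: f)
  have mono: "(f ^^ (N + M)) x = 0" if "(f ^^ M) x = 0" for N M x using that zero by (simp add: funpow_add)
  obtain N M where "(f ^^ N) x = 0" "(f ^^ M) y = 0" using assms(3,4) unfolding nilset_def by blast
  then have "(f ^^ (N + M)) (x + y) = 0" using mono[of M y N] mono[of N x M] by (simp add: add add.commute)
  then show ?thesis unfolding nilset_def by blast
qed

text \<open>f (B x) = B (f x) + C x, and f x vanishes under a smaller power of f than x. With
  \<open>B\<close> the action of Y and f that of F, the operator \<open>C\<close> is the action of
  their commutator, so the question passes from Y to ad Y.\<close>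

lemma nilset_step:
  assumes B: "\<And>y. f (B y) = B (f y) + C y" "B 0 = 0" and C: "\<And>x. x \<in> nilset f \<Longrightarrow> C x \<in> nilset f"
    and f: "\<And>x y. f (x + y) = f x + f y" "f 0 = 0" and x: "x \<in> nilset f"
  shows "B x \<in> nilset f"
proof -
  obtain N where "(f ^^ N) x = 0" using x unfolding nilset_def by blast
  then show ?thesis
  proof (induction N arbitrary: x)
    case 0
    then show ?case using B(2) by (auto simp: nilset_def intro: exI[of _ 0])
  next
    case (Suc N)
    then have "(f ^^ N) (f x) = 0" by (simp add: funpow_swap1)
    then have "B (f x) \<in> nilset f" by (rule Suc.IH)
    moreover have "C x \<in> nilset f" using Suc.prems C unfolding nilset_def by blast
    ultimately have "f (B x) \<in> nilset f" unfolding B(1) by (rule nilset_add[OF f])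
    then obtain M where "(f ^^ M) (f (B x)) = 0" by (auto simp: nilset_def)
    then have "(f ^^ Suc M) (B x) = 0" by (simp add: funpow_swap1)
    then show ?case unfolding nilset_def by blast
  qed
qed

text \<open>A root vector squares to zero in the standard representation, so its adjoint action has cube zero.\<close>
lemma nilset_stable:
  assumes cd: "ix n c" "ix n d" "c \<noteq> d" "c \<noteq> - d"
  shows "stable n (nilset (Lop c d))"
proof -
  define F where "F = F_mat n (pos n c) (pos n d)"
  define ad where "ad Y = F * Y - Y * F" for Y
  have F: "F \<in> so_even n" unfolding F_def by (simp add: F_mat_so_even pos_lt cd)
  have f: "Lop c d = \<rho> F" by (simp add: Lop_def F_def)
  have sq: "F * F = 0\<^sub>m (2 * n) (2 * n)"
    unfolding F_def using cd pos_inj[of n c "- d"]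
    by (intro F_mat_square) (simp_all add: pos_lt pos_inj flip: pos_minus)
  have ad_so: "ad Y \<in> so_even n" if "Y \<in> so_even n" for Y
    unfolding ad_def by (rule so_even_bracket[OF F that])
  have ad3: "ad (ad (ad Y)) = 0\<^sub>m (2 * n) (2 * n)" if "Y \<in> so_even n" for Y
    unfolding ad_def by (rule square_zero_ad3[OF so_even_carrier[OF F] so_even_carrier[OF that] sq])
  have step: "\<rho> Y w \<in> nilset (\<rho> F)"
    if Y: "Y \<in> so_even n" and ad: "\<And>w. w \<in> nilset (\<rho> F) \<Longrightarrow> \<rho> (ad Y) w \<in> nilset (\<rho> F)" and w: "w \<in> nilset (\<rho> F)" for Y w
  proof (rule nilset_step[OF _ _ ad _ _ w])
    show "\<rho> F (\<rho> Y y) = \<rho> Y (\<rho> F y) + \<rho> (ad Y) y" for y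
      unfolding ad_def using rep_bracket[OF F Y, of y] by simp
  qed (use Y F in \<open>simp_all add: rep_vec_zero rep_vec_add\<close>)
  have nil0: "0 \<in> nilset (\<rho> F)" by (auto simp: nilset_def intro: exI[of _ 0])
  have op: "\<rho> Y w \<in> nilset (\<rho> F)" if Y: "Y \<in> so_even n" and w: "w \<in> nilset (\<rho> F)" for Y w
  proof (rule step[OF Y _ w], rule step[OF ad_so[OF Y]], rule step[OF ad_so[OF ad_so[OF Y]]])
    show "\<rho> (ad (ad (ad Y))) x \<in> nilset (\<rho> F)" for x unfolding ad3[OF Y] rep_zero by (rule nil0)
  qed
  have pow: "(\<rho> F ^^ N) (t *s x) = t *s (\<rho> F ^^ N) x" for N x t
    by (induction N) (simp_all add: rep_vec_scale[OF F])
  have "x + y \<in> nilset (\<rho> F)" if "x \<in> nilset (\<rho> F)" "y \<in> nilset (\<rho> F)" for x y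
    by (rule nilset_add[OF rep_vec_add[OF F] rep_vec_zero[OF F] that])
  moreover have "t *s x \<in> nilset (\<rho> F)" if x: "x \<in> nilset (\<rho> F)" for t x
  proof -
    obtain N where "(\<rho> F ^^ N) x = 0" using x unfolding nilset_def by blast
    then have "(\<rho> F ^^ N) (t *s x) = 0" by (simp add: pow)
    then show ?thesis unfolding nilset_def by blast
  qed
  ultimately have "subspace (nilset (\<rho> F))" using nil0 by (simp add: subspace_def)
  then show ?thesis
    unfolding stable_def f using op by (simp add: Lop_def F_mat_so_even pos_lt)
qed

lemma foldr_lowering:
  "foldr (\<lambda>\<alpha>. Lop (low_ix \<alpha>) (high_ix \<alpha>) ^^ p \<alpha>) (positive_roots m) u = sv m (plus_exp p) (minus_exp p) u"
proof (induction m arbitrary: u)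
  case 0
  then show ?case by (simp add: positive_roots_def)
next
  case (Suc m)
  then show ?case by (simp add: positive_roots_Suc foldr_map comp_def X_def yw_def)
qed

text \<open>The constant collects the inverse factorials and the powers of the scalars by which the
  chosen root vectors differ from \<open>F_mat\<close>.\<close>

lemma signature_vector_eq:
  assumes f: "\<And>\<alpha>. \<alpha> \<in> set (positive_roots n) \<Longrightarrow> x \<alpha> \<noteq> 0 \<and> f \<alpha> = x \<alpha> \<cdot>\<^sub>m F_mat n (pos n (low_ix \<alpha>)) (pos n (high_ix \<alpha>))"
  shows "\<exists>C. C \<noteq> 0 \<and> signature_vector n scale \<rho> v f p = C *s sv n (plus_exp p) (minus_exp p) v"
proof -
  have L: "(\<rho> (f \<alpha>) ^^ N) w = x \<alpha> ^ N *s (Lop (low_ix \<alpha>) (high_ix \<alpha>) ^^ N) w"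
    "(Lop (low_ix \<alpha>) (high_ix \<alpha>) ^^ N) (c *s w) = c *s (Lop (low_ix \<alpha>) (high_ix \<alpha>) ^^ N) w"
    if "\<alpha> \<in> set (positive_roots n)" for \<alpha> N w c
  proof -
    note ix = root_ix(1,2)[OF that]
    have F: "F_mat n (pos n (low_ix \<alpha>)) (pos n (high_ix \<alpha>)) \<in> so_even n" by (simp add: F_mat_so_even pos_lt ix)
    have "\<rho> (f \<alpha>) w = x \<alpha> *s Lop (low_ix \<alpha>) (high_ix \<alpha>) w" for w
      using f[OF that] by (simp add: rep_scale[OF F] Lop_def)
    then show "(\<rho> (f \<alpha>) ^^ N) w = x \<alpha> ^ N *s (Lop (low_ix \<alpha>) (high_ix \<alpha>) ^^ N) w"
      by (induction N) (simp_all add: L_scale ix mult.commute)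
    show "(Lop (low_ix \<alpha>) (high_ix \<alpha>) ^^ N) (c *s w) = c *s (Lop (low_ix \<alpha>) (high_ix \<alpha>) ^^ N) w"
      by (induction N) (simp_all add: L_scale ix)
  qed
  define y where "y \<alpha> = 1 / fact (p \<alpha>) * x \<alpha> ^ p \<alpha>" for \<alpha>
  have "signature_vector n scale \<rho> v f p =
      foldr (\<lambda>\<alpha> w. y \<alpha> *s (Lop (low_ix \<alpha>) (high_ix \<alpha>) ^^ p \<alpha>) w) (positive_roots n) v"
    unfolding signature_vector_def by (intro foldr_cong refl) (simp add: L y_def)
  also have "\<dots> = (\<Prod>\<alpha>\<leftarrow>positive_roots n. y \<alpha>) *s sv n (plus_exp p) (minus_exp p) v"
    unfolding foldr_lowering[symmetric] by (rule foldr_scale) (use L vector_space_axioms in auto)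
  finally show ?thesis
    using f by (intro exI[of _ "\<Prod>\<alpha>\<leftarrow>positive_roots n. y \<alpha>"]) (auto simp: y_def prod_list_zero_iff)
qed

lemma essential_iff_sv:
  assumes f: "\<And>\<alpha>. \<alpha> \<in> set (positive_roots n) \<Longrightarrow> x \<alpha> \<noteq> 0 \<and> f \<alpha> = x \<alpha> \<cdot>\<^sub>m F_mat n (pos n (low_ix \<alpha>)) (pos n (high_ix \<alpha>))"
  shows "essential n scale \<rho> v f p \<longleftrightarrow>
    sv n (plus_exp p) (minus_exp p) v \<notin> span {sv n a b v | a b. exps_lt n a b (plus_exp p) (minus_exp p)}"
proof -
  let ?sig = "signature_vector n scale \<rho> v f"
  let ?sv = "\<lambda>p. sv n (plus_exp p) (minus_exp p) v"
  have rel: "?sig q \<in> span S \<longleftrightarrow> ?sv q \<in> span S" for q S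
  proof -
    obtain C where C: "C \<noteq> 0" "?sig q = C *s ?sv q" using signature_vector_eq[OF f] by blast
    then have "?sv q = inverse C *s ?sig q" by simp
    then show ?thesis using C span_scale by metis
  qed
  have set: "{sv n a b v | a b. exps_lt n a b (plus_exp p) (minus_exp p)} = {?sv q | q. exponents_less n q p}" (is "?A = ?B")
  proof
    show "?A \<subseteq> ?B"
    proof
      fix z assume "z \<in> ?A"
      then obtain a b where ab: "z = sv n a b v" "exps_lt n a b (plus_exp p) (minus_exp p)" by blast
      define q where "q \<alpha> = (case \<alpha> of Plus i j \<Rightarrow> a j i | Minus i j \<Rightarrow> b j i)" for \<alpha>
      have q: "plus_exp q = a" "minus_exp q = b" by (auto simp: q_def)
      have "z = ?sv q \<and> exponents_less n q p" unfolding exponents_less_iff q using ab by simp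
      then show "z \<in> ?B" by blast
    qed
    show "?B \<subseteq> ?A" unfolding exponents_less_iff by blast
  qed
  define A where "A = {?sig q | q. exponents_less n q p}"
  define B where "B = {?sv q | q. exponents_less n q p}"
  have "?sig q \<in> span B" if "exponents_less n q p" for q
    unfolding rel by (rule span_base) (use that in \<open>auto simp: B_def\<close>)
  then have AB: "span A \<subseteq> span B" by (intro span_minimal) (auto simp: A_def)
  have "?sv q \<in> span A" if "exponents_less n q p" for q
    unfolding rel[symmetric] by (rule span_base) (use that in \<open>auto simp: A_def\<close>)
  then have BA: "span B \<subseteq> span A" by (intro span_minimal) (auto simp: B_def)
  have "span A = span B" using AB BA by (rule subset_antisym)
  then show ?thesis unfolding essential_def set rel A_def B_def by simp
qed

end

section \<open>Irreducible highest weight representations\<close>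

locale highest_weight_representation = so_representation scale n \<rho>
  for scale :: "complex \<Rightarrow> 'v::ab_group_add \<Rightarrow> 'v" (infixr "*s" 75) and n \<rho> +
  fixes k :: "nat \<Rightarrow> nat" and v :: 'v
  assumes two: "2 \<le> n"
    and irr: "irreducible_representation (so_even n) scale \<rho>"
    and hw: "highest_weight_vector n scale \<rho> (dominant_weight n k) v"
begin

lemma stable_trivial: "stable n W \<Longrightarrow> W = {0} \<or> W = UNIV"
  using irr rep_in_stable[of W] unfolding irreducible_representation_def stable_def by blast

lemma v_nonzero: "v \<noteq> 0"
  using hw by (simp add: highest_weight_vector_def)

definition lam :: "nat \<Rightarrow> complex" where
  "lam i = dominant_weight n k (F_mat n (pos n (int i)) (pos n (int i)))"

lemma lam_domw: "dominant n k lam"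
  unfolding lam_def using dominant_weight_domw[OF two, of k] .

lemma v_sing: "singular n {0} v lam"
  unfolding singular_def
proof (intro conjI allI impI)
  fix i j assume ij: "1 \<le> i" "i < j" "j \<le> n"
  have e: "\<rho> (F_mat n (pos n (high_ix \<alpha>)) (pos n (low_ix \<alpha>))) v = 0" if "\<alpha> \<in> set (positive_roots n)" for \<alpha>
    using hw root_vector_positive[OF that] that by (auto simp: highest_weight_vector_def)
  show "Lop (int i) (int j) v \<in> {0}" using e[of "Minus i j"] ij by (simp add: set_positive_roots Lop_def)
  show "Lop (int i) (- int j) v \<in> {0}" using e[of "Plus i j"] ij by (simp add: set_positive_roots Lop_def)
next
  fix i assume "1 \<le> i" "i \<le> n"
  then have "\<rho> (F_mat n (pos n (int i)) (pos n (int i))) v = lam i *s v"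
    using hw F_mat_diag(1)[of n "int i"] by (simp add: highest_weight_vector_def lam_def)
  then show "Lop (int i) (int i) v - lam i *s v \<in> {0}" by (simp add: Lop_def)
qed

text \<open>A witness for zero exponents supplies a unitary module with the same highest weight.
  There the powers vanish on \<open>u\<close> by positivity, and by irreducibility \<open>v\<close>
  inherits this.\<close>

lemma v_nilpotent:
  assumes "1 \<le> i" "i < j" "j \<le> n"
  shows "v \<in> nilset (Lop (int j) (int i))" "v \<in> nilset (Lop (- int j) (int i))"
proof -
  obtain m where m: "n = Suc m" "1 \<le> m" using two by (cases n) auto
  have "block_cond m k (\<lambda>_. 0) (\<lambda>_. 0)" by (simp add: block_cond_def)
  from witness_exists[OF m(2) this]
  obtain K :: "int \<Rightarrow> int \<Rightarrow> (nat set list \<Rightarrow> complex) \<Rightarrow> nat set list \<Rightarrow> complex" and B u g lam'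
    where w: "witness n k (\<lambda>_. 0) (\<lambda>_. 0) K B u g lam'" unfolding m(1) by blast
  interpret P: pairing scale n Lop n K B "{0}" v u lam'
    by (rule pairing_witness[OF order.refl two _ _ v_sing lam_domw w])
       (auto simp: stable_def v_nonzero L_zero)
  have ker: "{x. (x, 0) \<in> P.N} = {0}"
    using stable_trivial[OF P.kernel_inv] P.v_kernel by blast
  have dominant: "dominant n k lam'" and u: "supp B u" and singular: "P.R.singular n {0} u lam'"
    using w by (auto simp: witness_def)
  have diag: "K (int l) (int l) u = fscale (lam' l) u" if "1 \<le> l" "l \<le> n" for l
    using singular that by (simp add: P.R.singular_def)
  have fs: "fscale a u - fscale b u = fscale (a - b) u" "fscale a u + fscale b u = fscale (a + b) u" for a b
    by (simp_all add: P.R.scale_left_diff_distrib P.R.scale_left_distrib)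
  have nil: "v \<in> nilset (Lop b (int i))"
    if b: "ix n b" "int i \<noteq> b" "int i \<noteq> - b" "K (int i) b u = 0" "K (int i) (int i) u - K b b u = fscale (of_nat \<kappa>) u" for b \<kappa>
  proof -
    have "ix n (int i)" using assms by simp
    then have "(K b (int i) ^^ Suc \<kappa>) u = 0" using b u by (intro P.R.unitary_vanish)
    then have "((Lop b (int i) ^^ Suc \<kappa>) v, 0) \<in> P.N"
      using P.pow_N[OF b(1) \<open>ix n (int i)\<close>, of "Suc \<kappa>"] by simp
    then have "(Lop b (int i) ^^ Suc \<kappa>) v = 0" using ker by blast
    then show ?thesis unfolding nilset_def by blast
  qed
  obtain \<kappa> where "lam' i - lam' j = of_nat \<kappa>" using dominant_diff[OF dominant, of i j] assms by auto
  then show "v \<in> nilset (Lop (int j) (int i))"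
    using assms singular diag[of i] diag[of j] by (intro nil[of "int j" \<kappa>]) (auto simp: P.R.singular_def fs)
  obtain \<kappa>' where "lam' i + lam' j = of_nat \<kappa>'" using dominant_sum[OF dominant, of i j] assms by auto
  moreover have "K (- int j) (- int j) u = - K (int j) (int j) u"
    using P.R.L_skew[of "int j" "int j" u] assms by simp
  ultimately show "v \<in> nilset (Lop (- int j) (int i))"
    using assms singular diag[of i] diag[of j] by (intro nil[of "- int j" \<kappa>']) (auto simp: P.R.singular_def fs)
qed

text \<open>The vectors on which a root vector acts nilpotently form an invariant subspace that
  contains \<open>v\<close>, hence the whole module.\<close>

lemma nilpotent: lower_nilpotent
proof -
  have "w \<in> nilset (Lop b (int i))" if "v \<in> nilset (Lop b (int i))" "ix n b" "ix n (int i)" "b \<noteq> int i" "b \<noteq> - int i" for w b i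
    using stable_trivial[OF nilset_stable[OF that(2-5)]] that(1) v_nonzero by blast
  then show ?thesis
    using v_nilpotent unfolding lower_nilpotent_def nilset_def by (auto simp: nilset_def)
qed

lemma sv_notin_iff:
  "sv n pl mi v \<notin> span {sv n a b v | a b. exps_lt n a b pl mi} \<longleftrightarrow> ineqs n k pl mi"
proof -
  have "stable n {0}" by (simp add: stable_def L_zero)
  then have "sv n pl mi v \<notin> span ({0} \<union> {sv n a b v | a b. exps_lt n a b pl mi}) \<longleftrightarrow> conds n k pl mi"
    using v_nonzero by (intro essential_iff_cnd[OF _ _ _ v_sing lam_domw nilpotent]) auto
  then show ?thesis using ineqs_iff_cnd[OF two] span_insert_0 by (simp only: insert_is_Un[symmetric])
qed

end

theorem theorem3:
  fixes n :: nat
    and k :: "nat \<Rightarrow> nat"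
    and scale :: "complex \<Rightarrow> 'v::ab_group_add \<Rightarrow> 'v"
    and \<rho> :: "complex mat \<Rightarrow> 'v \<Rightarrow> 'v"
    and v :: 'v
    and f :: "root \<Rightarrow> complex mat"
    and p :: exponents
  assumes "2 \<le> n"
    and "irreducible_representation (so_even n) scale \<rho>"
    and "highest_weight_vector n scale \<rho> (dominant_weight n k) v"
    and "\<And>\<alpha>. \<alpha> \<in> set (positive_roots n) \<Longrightarrow> root_vector n (\<lambda>H. - root_weight \<alpha> H) (f \<alpha>)"
  shows "essential n scale \<rho> v f p \<longleftrightarrow>
    (\<forall>i \<in> {1..n - 2}. \<forall>j \<in> {i + 2..n}.
       int (p (Plus i j))
       + (\<Sum>l = j + 1..n. int (p (Plus i l)) + int (p (Minus i l))
                          - int (p (Plus (i + 1) l)) - int (p (Minus (i + 1) l)))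
       \<le> int (k i)) \<and>
    (\<forall>i \<in> {1..n - 2}. \<forall>j \<in> {i + 2..n}.
       int (p (Minus (i + 1) j))
       + (\<Sum>l = j..n. int (p (Plus i l)) + int (p (Minus i l))
                      - int (p (Plus (i + 1) l)) - int (p (Minus (i + 1) l)))
       \<le> int (k i)) \<and>
    (\<forall>i \<in> {1..n - 1}.
       int (p (Minus i (i + 1)))
       + (\<Sum>l = i + 2..n. int (p (Plus i l)) + int (p (Minus i l))
                          - int (p (Plus (i + 1) l)) - int (p (Minus (i + 1) l)))
       \<le> int (k i)) \<and>
    (\<forall>i \<in> {1..n - 2}.
       int (p (Minus i (i + 2))) + int (p (Plus i (i + 2))) + int (p (Minus (i + 1) (i + 2)))
       + (\<Sum>l = i + 3..n. int (p (Plus i l)) + int (p (Minus i l))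
                          - int (p (Plus (i + 2) l)) - int (p (Minus (i + 2) l)))
       \<le> int (k i) + int (k (i + 1))) \<and>
    (\<forall>i \<in> {1..n - 2}.
       int (p (Plus i (i + 1)))
       + (\<Sum>l = i + 2..n. int (p (Plus i l)) + int (p (Minus i l))
                          + int (p (Plus (i + 1) l)) + int (p (Minus (i + 1) l)))
       \<le> int (k i) + int (k (n - 1)) + int (k n) + 2 * (\<Sum>j = i + 1..n - 2. int (k j))) \<and>
    int (p (Plus (n - 1) n)) \<le> int (k n)"
proof -
  interpret highest_weight_representation scale n \<rho> k v
    using assms(1-3)
    by (auto simp: highest_weight_representation_def highest_weight_representation_axioms_def so_representation_def
      so_representation_axioms_def irreducible_representation_def lie_representation_def)
  \<comment> \<open>The vectors \<open>f \<alpha>\<close> are known only as nonzero elements of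
    one-dimensional root spaces.\<close>
  have "\<exists>x. x \<noteq> 0 \<and> f \<alpha> = x \<cdot>\<^sub>m F_mat n (pos n (low_ix \<alpha>)) (pos n (high_ix \<alpha>))" if "\<alpha> \<in> set (positive_roots n)" for \<alpha>
    by (rule root_vector_negative[OF that assms(4)[OF that]]) blast
  then obtain x where "\<And>\<alpha>. \<alpha> \<in> set (positive_roots n) \<Longrightarrow>
      x \<alpha> \<noteq> 0 \<and> f \<alpha> = x \<alpha> \<cdot>\<^sub>m F_mat n (pos n (low_ix \<alpha>)) (pos n (high_ix \<alpha>))"
    by metis
  from essential_iff_sv[OF this, of v p] show ?thesis
    unfolding sv_notin_iff ineqs_def drop2_def .
qed

end
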